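(* Let $(\mathbb{R}^d,\cdot,X,K)$ be a sub-Finsler nilpotent group. Any isoperimetric region $E$ (normalized so that $E=E_1$) is bounded.
   Context: Setting. A nilpotent group is a connected, simply connected Lie group $G$ whose Lie algebra $\mathfrak{g}$ is nilpotent. With $\mathfrak{g}_0=\mathfrak{g}$, $\mathfrak{g}_{i+1}=[\mathfrak{g},\mathfrak{g}_i]$ and $r$ the step ($\mathfrak{g}_r=0\ne\mathfrak{g}_{r-1}$), fix a Malcev basis $\{Y_1,\dots,Y_d\}$ of $\mathfrak{g}$, i.e. a basis such that each $\mathrm{span}\{Y_{d-n+1},\dots,Y_d\}$, $1\le n\le d$, is an ideal and each $\mathfrak{g}_i$, $0\le i\le r-1$, is one of these ideals. Identify $G$ with $(\mathbb{R}^d,\cdot)$ via $(x_1,\dots,x_d)\mapsto\exp(x_1Y_1+\dots+x_dY_d)$; the identity is $0$. The Lebesgue measure $|\cdot|$ of $\mathbb{R}^d$ is then a Haar measure of the group. $X=\{X_1,\dots,X_k\}$ is a system of linearly independent left-invariant vector fields. Put $\mathcal{H}^0=\mathrm{span}(X)$ and $\mathcal{H}^n=\mathcal{H}^{n-1}+[\mathcal{H}^{n-1},\mathcal{H}^0]$; $X$ is assumed to be Lie bracket generating, i.e. $\mathcal{H}^s(0)=\mathfrak{g}$ for some $s$. Vector fields tangent to $\mathcal{H}^0$ at every point are called horizontal. Fix a left-invariant Riemannian metric $g=\langle\cdot,\cdot\rangle$ for which $X$ is an orthonormal basis of $\mathcal{H}^0$ and $\mathcal{H}^0$ is orthogonal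 to a chosen complementary subbundle $V$; $\operatorname{div}$ is the divergence with respect to $g$. $B(x,r)$ denotes the sub-Riemannian ball, i.e. the ball of center $x$ and radius $r$ for the left-invariant Carnot–Carathéodory distance $d_X$ associated to $X$ (with $X$ orthonormal). $K\subset\mathcal{H}^0_0$ is a convex body (compact convex set) with $0$ in its interior (relative to $\mathcal{H}^0_0$), not necessarily symmetric. It defines the asymmetric norm $\|u\|_K=\inf\{\lambda\ge0:u\in\lambda K\}$ on $\mathcal{H}^0_0$, extended to $\mathcal{H}^0$ by left-invariance: $\|\sum_i a_iX_i(p)\|_K=\|\sum_i a_iX_i(0)\|_K$. The data $(\mathbb{R}^d,\cdot,X,K)$ is called a sub-Finsler nilpotent group. Perimeter. For a measurable set $E\subseteq\mathbb{R}^d$, $P_K(E)=\sup\{\int_E\operatorname{div}(U)\,dx\}$, the supremum being over compactly supported $C^1$ horizontal vector fields $U$ on $\mathbb{R}^d$ with $\sup_p\|U_p\|_K\le1$. $E$ is a finite perimeter set if $P_K(E)<+\infty$. Isoperimetric regions. For $v>0$, $I_K(v)=\inf\{P_K(E): E\subseteq\mathbb{R}^d \text{ is a finite perimeter set and } |E|=v\}$. An isoperimetric region (of volume $v>0$) is a finite perimeter set $E$ with $|E|=v$ and $P_K(E)=I_K(v)$. Convention: an isoperimetric region $E$ coincides almost everywhere with the open set $E_1=\{x\in\mathbb{R}^d:\exists r>0 \text{ such that } |B(x,r)\setminus E|=0\}$, and it is always assumed that $E$ is exactly $E_1$ (in particular $E$ is open). *)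

theory Defs
  imports "HOL-Analysis.Analysis"
begin

section \<open>Functions of class \<open>C\<^sup>k\<close>\<close>

primrec Ck :: "nat \<Rightarrow> ('a::euclidean_space \<Rightarrow> 'b::real_normed_vector) \<Rightarrow> bool" where
  "Ck 0 f \<longleftrightarrow> continuous_on UNIV f"
| "Ck (Suc k) f \<longleftrightarrow> f differentiable_on UNIV \<and> (\<forall>v. Ck k (\<lambda>x. frechet_derivative f (at x) v))"

definition smooth :: "('a::euclidean_space \<Rightarrow> 'b::real_normed_vector) \<Rightarrow> bool" where
  "smooth f \<longleftrightarrow> (\<forall>k. Ck k f)"

section \<open>Lie group structures on \<open>real ^ 'n\<close> and their Lie algebras\<close>

text \<open>
  The group law \<open>gmul\<close> on \<open>real ^ 'n\<close> has identity \<open>0\<close> and inverse \<open>ginv\<close>. A left-invariant vector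
  field is represented by its value at \<open>0\<close>, so that the Lie algebra is \<open>real ^ 'n\<close> (the tangent space
  at \<open>0\<close>), with the bracket transported from the Lie bracket of vector fields.
\<close>

type_synonym 'n group_law = "real ^ 'n \<Rightarrow> real ^ 'n \<Rightarrow> real ^ 'n"
type_synonym 'n vector_field = "real ^ 'n \<Rightarrow> real ^ 'n"

definition left_field :: "'n::finite group_law \<Rightarrow> real ^ 'n \<Rightarrow> 'n vector_field" where
  "left_field gmul v p = frechet_derivative (gmul p) (at 0) v"

definition pull_back :: "'n::finite group_law \<Rightarrow> 'n vector_field \<Rightarrow> real ^ 'n \<Rightarrow> real ^ 'n \<Rightarrow> real ^ 'n" where
  \<comment> \<open>the differential at \<open>p\<close> of the left translation taking \<open>p\<close> to \<open>0\<close>\<close>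
  "pull_back gmul ginv p u = frechet_derivative (gmul (ginv p)) (at p) u"

definition field_bracket :: "'n::finite vector_field \<Rightarrow> 'n vector_field \<Rightarrow> 'n vector_field" where
  "field_bracket V W p =
     frechet_derivative W (at p) (V p) - frechet_derivative V (at p) (W p)"

definition bracket :: "'n::finite group_law \<Rightarrow> real ^ 'n \<Rightarrow> real ^ 'n \<Rightarrow> real ^ 'n" where
  "bracket gmul v w = field_bracket (left_field gmul v) (left_field gmul w) 0"

definition set_bracket :: "'n::finite group_law \<Rightarrow> (real ^ 'n) set \<Rightarrow> (real ^ 'n) set \<Rightarrow> (real ^ 'n) set" where
  "set_bracket gmul A B = span {bracket gmul a b | a b. a \<in> A \<and> b \<in> B}"

primrec lower_central :: "'n::finite group_law \<Rightarrow> nat \<Rightarrow> (real ^ 'n) set" where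
  "lower_central gmul 0 = UNIV"
| "lower_central gmul (Suc i) = set_bracket gmul UNIV (lower_central gmul i)"

definition lie_ideal :: "'n::finite group_law \<Rightarrow> (real ^ 'n) set \<Rightarrow> bool" where
  "lie_ideal gmul I \<longleftrightarrow> subspace I \<and> (\<forall>v. \<forall>w\<in>I. bracket gmul v w \<in> I)"

definition tail_span :: "'n::{finite,linorder} \<Rightarrow> (real ^ 'n::{finite,linorder}) set" where
  "tail_span j = span {axis i 1 | i. j \<le> i}"

text \<open>
  A nilpotent group of step \<open>r\<close> in the exponential coordinates of a Malcev basis \<open>Y\<close>. In these
  coordinates \<open>Y i = axis i 1\<close>, the index type \<open>'n\<close> playing the role of \<open>{1..d}\<close> with its order, and
  the point \<open>v\<close> is \<open>exp v\<close>: the curve \<open>t \<mapsto> t *\<^sub>R v\<close> is the one-parameter subgroup with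
  velocity \<open>v\<close> at \<open>0\<close>.
\<close>

locale nilpotent_lie_group =
  fixes gmul :: "'n::{finite,linorder} group_law"
    and ginv :: "'n vector_field"
    and r :: nat
  assumes group: "Groups.group gmul 0 ginv"
    and smooth_mult: "smooth (\<lambda>z. gmul (fst z) (snd z))"
    and smooth_inv: "smooth ginv"
    and exponential_coordinates: "gmul (s *\<^sub>R v) (t *\<^sub>R v) = (s + t) *\<^sub>R v"
    and nilpotent: "0 < r" "lower_central gmul r = {0}" "lower_central gmul (r - 1) \<noteq> {0}"
    and malcev_ideal: "lie_ideal gmul (tail_span j)"
    and malcev_central: "i < r \<Longrightarrow> \<exists>j. lower_central gmul i = tail_span j"

section \<open>Sub-Finsler structures\<close>

text \<open>\<open>X\<close> is the set of the values at \<open>0\<close> of the fields \<open>X\<^sub>1, \<dots>, X\<^sub>k\<close>.\<close>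

primrec bracket_layer :: "'n::finite group_law \<Rightarrow> (real ^ 'n) set \<Rightarrow> nat \<Rightarrow> (real ^ 'n) set" where
  "bracket_layer gmul X 0 = span X"
| "bracket_layer gmul X (Suc m) =
     {a + b | a b. a \<in> bracket_layer gmul X m \<and> b \<in> set_bracket gmul (bracket_layer gmul X m) (span X)}"

definition horizontal_at :: "'n::finite group_law \<Rightarrow> (real ^ 'n) set \<Rightarrow> real ^ 'n \<Rightarrow> (real ^ 'n) set" where
  "horizontal_at gmul X p = (\<lambda>v. left_field gmul v p) ` span X"

text \<open>
  \<open>g\<close> is the value at \<open>0\<close> of the left-invariant Riemannian metric and \<open>V\<close> the fibre at \<open>0\<close> of the
  complement of the horizontal bundle.
\<close>

locale sub_finsler_nilpotent_group = nilpotent_lie_group gmul ginv r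
  for gmul :: "'n::{finite,linorder} group_law" and ginv :: "'n vector_field" and r :: nat +
  fixes X :: "(real ^ 'n::{finite,linorder}) set"
    and g :: "real ^ 'n::{finite,linorder} \<Rightarrow> real ^ 'n::{finite,linorder} \<Rightarrow> real"
    and V :: "(real ^ 'n::{finite,linorder}) set"
    and K :: "(real ^ 'n::{finite,linorder}) set"
  assumes independent_X: "independent X"
    and bracket_generating: "\<exists>s. bracket_layer gmul X s = UNIV"
    and g_bilinear: "bilinear g"
    and g_sym: "g u w = g w u"
    and g_pos: "u \<noteq> 0 \<Longrightarrow> 0 < g u u"
    and g_orthonormal: "x \<in> X \<Longrightarrow> y \<in> X \<Longrightarrow> g x y = (if x = y then 1 else 0)"
    and V_complement: "subspace V" "span X \<inter> V = {0}" "{a + b | a b. a \<in> span X \<and> b \<in> V} = UNIV"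
    and V_orthogonal: "a \<in> span X \<Longrightarrow> b \<in> V \<Longrightarrow> g a b = 0"
    and K_body: "K \<subseteq> span X" "compact K" "convex K"
    and K_zero: "0 \<in> (top_of_set (span X)) interior_of K"

definition asym_norm :: "(real ^ 'n::finite) set \<Rightarrow> real ^ 'n \<Rightarrow> real" where
  "asym_norm K u = Inf {l. 0 \<le> l \<and> u \<in> (*\<^sub>R) l ` K}"

definition asym_norm_at ::
  "'n::finite group_law \<Rightarrow> 'n vector_field \<Rightarrow> (real ^ 'n) set \<Rightarrow> real ^ 'n \<Rightarrow> real ^ 'n \<Rightarrow> real" where
  "asym_norm_at gmul ginv K p u = asym_norm K (pull_back gmul ginv p u)"

section \<open>Carnot--Caratheodory distance\<close>

text \<open>
  Curves are piecewise \<open>C\<^sup>1\<close> on \<open>{0..1}\<close>. The speed may be unbounded near the finitely many exceptional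
  points, so the length is a nonnegative integral, infinite if the speed is not integrable.
\<close>

definition horizontal_path :: "'n::finite group_law \<Rightarrow> (real ^ 'n) set \<Rightarrow> (real \<Rightarrow> real ^ 'n) \<Rightarrow> bool" where
  "horizontal_path gmul X \<gamma> \<longleftrightarrow> valid_path \<gamma> \<and>
     (\<exists>S. finite S \<and> (\<forall>t\<in>{0..1} - S. \<gamma> differentiable (at t) \<and>
        vector_derivative \<gamma> (at t) \<in> horizontal_at gmul X (\<gamma> t)))"

definition sr_norm_at ::
  "'n::finite group_law \<Rightarrow> 'n vector_field \<Rightarrow> (real ^ 'n) set \<Rightarrow> real ^ 'n \<Rightarrow> real ^ 'n \<Rightarrow> real" where
  \<comment> \<open>the norm of the horizontal vector \<open>u\<close> at \<open>p\<close> for which \<open>X\<close> is orthonormal\<close>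
  "sr_norm_at gmul ginv X p u = sqrt (\<Sum>x\<in>X. (representation X (pull_back gmul ginv p u) x)\<^sup>2)"

definition cc_length ::
  "'n::finite group_law \<Rightarrow> 'n vector_field \<Rightarrow> (real ^ 'n) set \<Rightarrow> (real \<Rightarrow> real ^ 'n) \<Rightarrow> ennreal" where
  "cc_length gmul ginv X \<gamma> =
     (\<integral>\<^sup>+t\<in>{0..1}. ennreal (sr_norm_at gmul ginv X (\<gamma> t) (vector_derivative \<gamma> (at t))) \<partial>lborel)"

definition cc_dist ::
  "'n::finite group_law \<Rightarrow> 'n vector_field \<Rightarrow> (real ^ 'n) set \<Rightarrow> real ^ 'n \<Rightarrow> real ^ 'n \<Rightarrow> ennreal" where
  "cc_dist gmul ginv X p q =
     Inf {cc_length gmul ginv X \<gamma> | \<gamma>. horizontal_path gmul X \<gamma> \<and> pathstart \<gamma> = p \<and> pathfinish \<gamma> = q}"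

definition cc_ball ::
  "'n::finite group_law \<Rightarrow> 'n vector_field \<Rightarrow> (real ^ 'n) set \<Rightarrow> real ^ 'n \<Rightarrow> real \<Rightarrow> (real ^ 'n) set" where
  "cc_ball gmul ginv X x \<rho> = {y. cc_dist gmul ginv X x y < ennreal \<rho>}"

section \<open>Divergence and perimeter\<close>

definition metric_at ::
  "'n::finite group_law \<Rightarrow> 'n vector_field \<Rightarrow> (real ^ 'n \<Rightarrow> real ^ 'n \<Rightarrow> real) \<Rightarrow>
    real ^ 'n \<Rightarrow> real ^ 'n \<Rightarrow> real ^ 'n \<Rightarrow> real" where
  "metric_at gmul ginv g p u w = g (pull_back gmul ginv p u) (pull_back gmul ginv p w)"

definition riemannian_density ::
  "'n::finite group_law \<Rightarrow> 'n vector_field \<Rightarrow> (real ^ 'n \<Rightarrow> real ^ 'n \<Rightarrow> real) \<Rightarrow> real ^ 'n \<Rightarrow> real" where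
  "riemannian_density gmul ginv g p =
     sqrt (det (\<chi> i j. metric_at gmul ginv g p (axis i 1) (axis j 1)))"

definition divergence ::
  "'n::finite group_law \<Rightarrow> 'n vector_field \<Rightarrow> (real ^ 'n \<Rightarrow> real ^ 'n \<Rightarrow> real) \<Rightarrow>
    'n vector_field \<Rightarrow> real ^ 'n \<Rightarrow> real" where
  \<comment> \<open>\<open>(1 / \<surd>det g) \<Sum>\<^sub>i \<partial>\<^sub>i (\<surd>det g U\<^sub>i)\<close>\<close>
  "divergence gmul ginv g U p =
     (\<Sum>i\<in>UNIV. frechet_derivative (\<lambda>q. riemannian_density gmul ginv g q * U q $ i) (at p) (axis i 1))
       / riemannian_density gmul ginv g p"

definition test_fields ::
  "'n::finite group_law \<Rightarrow> 'n vector_field \<Rightarrow> (real ^ 'n) set \<Rightarrow> (real ^ 'n) set \<Rightarrow> 'n vector_field set" where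
  "test_fields gmul ginv X K =
     {U. Ck 1 U \<and> compact (closure {p. U p \<noteq> 0}) \<and>
         (\<forall>p. U p \<in> horizontal_at gmul X p) \<and> (\<forall>p. asym_norm_at gmul ginv K p (U p) \<le> 1)}"

definition perimeter ::
  "'n::finite group_law \<Rightarrow> 'n vector_field \<Rightarrow> (real ^ 'n) set \<Rightarrow> (real ^ 'n \<Rightarrow> real ^ 'n \<Rightarrow> real) \<Rightarrow>
    (real ^ 'n) set \<Rightarrow> (real ^ 'n) set \<Rightarrow> ereal" where
  "perimeter gmul ginv X g K E =
     (SUP U\<in>test_fields gmul ginv X K. ereal (LINT p:E|lebesgue. divergence gmul ginv g U p))"

definition finite_perimeter ::
  "'n::finite group_law \<Rightarrow> 'n vector_field \<Rightarrow> (real ^ 'n) set \<Rightarrow> (real ^ 'n \<Rightarrow> real ^ 'n \<Rightarrow> real) \<Rightarrow>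
    (real ^ 'n) set \<Rightarrow> (real ^ 'n) set \<Rightarrow> bool" where
  "finite_perimeter gmul ginv X g K E \<longleftrightarrow> E \<in> sets lebesgue \<and> perimeter gmul ginv X g K E < \<infinity>"

section \<open>Isoperimetric regions\<close>

definition isoperimetric_profile ::
  "'n::finite group_law \<Rightarrow> 'n vector_field \<Rightarrow> (real ^ 'n) set \<Rightarrow> (real ^ 'n \<Rightarrow> real ^ 'n \<Rightarrow> real) \<Rightarrow>
    (real ^ 'n) set \<Rightarrow> real \<Rightarrow> ereal" where
  "isoperimetric_profile gmul ginv X g K v =
     Inf {perimeter gmul ginv X g K E | E.
            finite_perimeter gmul ginv X g K E \<and> emeasure lebesgue E = ennreal v}"

definition isoperimetric_region ::
  "'n::finite group_law \<Rightarrow> 'n vector_field \<Rightarrow> (real ^ 'n) set \<Rightarrow> (real ^ 'n \<Rightarrow> real ^ 'n \<Rightarrow> real) \<Rightarrow>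
    (real ^ 'n) set \<Rightarrow> real \<Rightarrow> (real ^ 'n) set \<Rightarrow> bool" where
  "isoperimetric_region gmul ginv X g K v E \<longleftrightarrow>
     finite_perimeter gmul ginv X g K E \<and> emeasure lebesgue E = ennreal v \<and>
     perimeter gmul ginv X g K E = isoperimetric_profile gmul ginv X g K v"

definition measure_interior ::
  "'n::finite group_law \<Rightarrow> 'n vector_field \<Rightarrow> (real ^ 'n) set \<Rightarrow> (real ^ 'n) set \<Rightarrow> (real ^ 'n) set" where
  "measure_interior gmul ginv X E = {x. \<exists>\<rho>>0. cc_ball gmul ginv X x \<rho> - E \<in> null_sets lebesgue}"

end

theory Submission
  imports Defs
begin

text \<open>
  The strategy is the classical one: an isoperimetric region has a uniform lower volume density at
  each of its points, and a set of finite volume with this property is bounded. All estimates are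
  made for a Borel representative \<open>B\<close> of the region, and upper perimeter bounds are expressed by the
  predicate \<open>perim_le B c\<close>: the pairing of the indicator of \<open>B\<close> with the horizontal divergence of
  every admissible \<open>K\<close>-valued test function is at most \<open>c\<close>.

  The density estimate rests on comparing \<open>B\<close> with \<open>B\<close> minus a small ball. The competitor has a
  smaller volume \<open>v - m\<close>, so one needs to know how much perimeter the missing volume costs. A general
  nilpotent group has no dilations that could restore the volume, so this cost is estimated through
  translations. For a set \<open>B\<close> and a left translate \<open>F\<close> of it, the perimeters of \<open>B \<union> F\<close> and
  \<open>B \<inter> F\<close> add up to at most twice the perimeter of \<open>B\<close> (\<open>perimeter_union_inter\<close>). Since the overlap of \<open>B\<close>
  and \<open>F\<close> takes every intermediate value as the translation varies, the isoperimetric profile \<open>I\<close> is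
  midpoint concave in the strong sense \<open>I (u + w) + I (u - w) \<le> 2 I u\<close> for \<open>0 \<le> w < u\<close>
  (\<open>midpoint_concavity\<close>). As \<open>I\<close> is nonnegative, this forces
  \<open>I v \<le> I (v - m) + 2 m I v / v\<close> for \<open>2 m \<le> v\<close> (\<open>profile_increment\<close>): the price of the volume \<open>m\<close> is
  linear in \<open>m\<close>.

  Submodularity holds for a nonsymmetric \<open>K\<close> because it only uses the convexity of \<open>K\<close>. For
  \<open>C\<^sup>1\<close> functions \<open>m\<close> and \<open>n\<close> the gradients of a smoothed maximum and minimum are pointwise
  the convex combinations \<open>\<theta> \<nabla>m + (1 - \<theta>) \<nabla>n\<close> and
  \<open>(1 - \<theta>) \<nabla>m + \<theta> \<nabla>n\<close>, and the weights can be moved onto the test fields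
  (\<open>smooth_max_min_pair_le\<close>). Sets are reduced to functions by convolution on the left
  (\<open>mollification\<close>), an average of left translates, which does not increase the perimeter.

  The second ingredient is an isoperimetric inequality \<open>m \<le> C c m\<^sup>\<sigma>\<close> with some
  \<open>\<sigma> > 0\<close> for a set of small volume \<open>m\<close> and perimeter at most \<open>c\<close> (\<open>isoperimetric_inequality\<close>).
  Moving a set on the right by \<open>exp (t x)\<close> with \<open>x \<in> X\<close> displaces a volume of at most a constant times \<open>c \<bar>t\<bar>\<close>, so
  moving it by a product of such elements displaces at most a constant times \<open>c\<close> times their total
  length. By a
  quantitative form of Chow's theorem (\<open>chow\<close>) every \<open>h\<close> near \<open>0\<close> is a product of total length
  at most a constant times a positive power of \<open>\<bar>h\<bar>\<close>. Averaging over \<open>h\<close> in a Euclidean ball of volume \<open>2 m\<close> gives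
  the inequality, because a set of volume \<open>m\<close> can overlap with its translates by at most
  half of its volume on average. The proof of \<open>chow\<close> goes down the lower central series, producing iterated
  brackets by group commutators.

  Now let \<open>x\<close> be a point for which the volume of \<open>B\<close> in a ball around \<open>x\<close> is small. Cutting \<open>B\<close> along
  suitable shrinking concentric balls (\<open>cut_by_ball\<close>), comparing the outer piece with \<open>B\<close> by
  \<open>profile_increment\<close> and applying the isoperimetric inequality to the inner piece gives a
  superlinear recursion for the volumes of the inner pieces, which therefore tend to \<open>0\<close>
  (\<open>density_estimate\<close>). So \<open>B\<close> has no volume in a smaller ball around \<open>x\<close>, which is impossible at
  a point of \<open>E = measure_interior E\<close>, since \<open>cc\<close>-balls contain Euclidean neighbourhoods. If \<open>E\<close> were unbounded,
  it would contain arbitrarily many points with disjoint balls around them, each containing a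
  fixed amount of its finite volume.

  Two structural facts about the group are used throughout: Lebesgue measure is invariant under left and
  right translations, and the Riemannian divergence of the horizontal field with coefficients \<open>u\<close>
  is the sum of the left-invariant derivatives of the coefficients. Both follow from one observation: in
  Malcev coordinates the differentials of translations are unitriangular. This is derived from the
  nilpotency of the bracket by differential calculus (\<open>pull_back_minus_in\<close>).
\<close>

section \<open>Maps of class \<open>C\<^sup>1\<close>\<close>

abbreviation FD :: "('a::real_normed_vector \<Rightarrow> 'b::real_normed_vector) \<Rightarrow> 'a \<Rightarrow> 'a \<Rightarrow> 'b" where
  "FD f x \<equiv> frechet_derivative f (at x)"

lemma FD_eq: "(f has_derivative f') (at x) \<Longrightarrow> FD f x = f'"
  using frechet_derivative_at by metis

lemma Ck_1_iff:
  "Ck 1 f \<longleftrightarrow> (\<forall>x. (f has_derivative FD f x) (at x)) \<and> (\<forall>v. continuous_on UNIV (\<lambda>x. FD f x v))"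
  by (auto simp: differentiable_on_def frechet_derivative_works)

lemma Ck_1_I:
  assumes "\<And>x. (f has_derivative f' x) (at x)" "\<And>v. continuous_on UNIV (\<lambda>x. f' x v)"
  shows "Ck 1 f"
proof -
  have "FD f x = f' x" for x using assms(1) FD_eq by blast
  thus ?thesis using assms by (simp only: Ck_1_iff) auto
qed

lemma Ck_1_deriv: "Ck 1 f \<Longrightarrow> (f has_derivative FD f x) (at x)"
  by (simp only: Ck_1_iff)

lemma Ck_1_FD_linear: "Ck 1 f \<Longrightarrow> linear (FD f x)"
  using Ck_1_deriv has_derivative_linear by blast

lemma Ck_1_continuous: "Ck 1 f \<Longrightarrow> continuous_on S f"
  by (meson Ck_1_deriv has_derivative_continuous_on has_derivative_at_withinI)

lemma Ck_1_measurable: "Ck 1 f \<Longrightarrow> f \<in> borel_measurable borel"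
  using Ck_1_continuous borel_measurable_continuous_onI by blast

lemma linear_basis_expansion:
  fixes L :: "'a::euclidean_space \<Rightarrow> 'b::real_vector"
  assumes "linear L" shows "L w = (\<Sum>b\<in>Basis. (w \<bullet> b) *\<^sub>R L b)"
proof -
  have "L w = L (\<Sum>b\<in>Basis. (w \<bullet> b) *\<^sub>R b)" by (simp add: euclidean_representation)
  thus ?thesis using assms by (simp add: linear_sum linear_scale)
qed

lemma Ck_1_FD_continuous:
  fixes f :: "'a::euclidean_space \<Rightarrow> 'b::real_normed_vector"
  assumes "Ck 1 f" "continuous_on S p" "continuous_on S w"
  shows "continuous_on S (\<lambda>t. FD f (p t) (w t))"
proof -
  have *: "FD f (p t) (w t) = (\<Sum>b\<in>Basis. (w t \<bullet> b) *\<^sub>R FD f (p t) b)" for t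
    by (rule linear_basis_expansion[OF Ck_1_FD_linear[OF assms(1)]])
  have "continuous_on S (\<lambda>t. FD f (p t) b)" for b
    using assms(1,2) continuous_on_compose2[of UNIV "\<lambda>x. FD f x b" S p] by (simp only: Ck_1_iff) auto
  thus ?thesis unfolding * using assms(3) by (intro continuous_intros)
qed

lemma Ck_1_const [simp]: "Ck 1 (\<lambda>x. c)"
  by (rule Ck_1_I[of _ "\<lambda>_ _. 0"]) auto

lemma Ck_1_bounded_linear:
  assumes "bounded_linear L" shows "Ck 1 L"
  using assms by (intro Ck_1_I[of _ "\<lambda>_. L"] bounded_linear_imp_has_derivative) auto

lemma Ck_1_id: "Ck 1 (\<lambda>x. x)"
  by (rule Ck_1_bounded_linear) (rule bounded_linear_ident)

lemma Ck_1_add: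
  assumes "Ck 1 f" "Ck 1 g" shows "Ck 1 (\<lambda>x. f x + g x)"
  by (rule Ck_1_I[of _ "\<lambda>x v. FD f x v + FD g x v"])
     (use assms in \<open>auto intro!: derivative_eq_intros Ck_1_deriv continuous_intros Ck_1_FD_continuous simp del: One_nat_def\<close>)

lemma Ck_1_uminus:
  assumes "Ck 1 f" shows "Ck 1 (\<lambda>x. - f x)"
  by (rule Ck_1_I[of _ "\<lambda>x v. - FD f x v"])
     (use assms in \<open>auto intro!: derivative_eq_intros Ck_1_deriv continuous_intros Ck_1_FD_continuous simp del: One_nat_def\<close>)

lemma Ck_1_diff:
  assumes "Ck 1 f" "Ck 1 g" shows "Ck 1 (\<lambda>x. f x - g x)"
  using Ck_1_add[OF assms(1) Ck_1_uminus[OF assms(2)]] by simp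

lemma Ck_1_scaleR:
  fixes f :: "'a::euclidean_space \<Rightarrow> real"
  assumes f: "Ck 1 f" and g: "Ck 1 g" shows "Ck 1 (\<lambda>x. f x *\<^sub>R g x)"
proof (rule Ck_1_I[of _ "\<lambda>x v. f x *\<^sub>R FD g x v + FD f x v *\<^sub>R g x"])
  show "((\<lambda>x. f x *\<^sub>R g x) has_derivative (\<lambda>v. f x *\<^sub>R FD g x v + FD f x v *\<^sub>R g x)) (at x)" for x
    by (rule has_derivative_scaleR[OF Ck_1_deriv[OF f] Ck_1_deriv[OF g]])
  show "continuous_on UNIV (\<lambda>x. f x *\<^sub>R FD g x v + FD f x v *\<^sub>R g x)" for v
    by (intro continuous_on_add continuous_on_scaleR Ck_1_continuous Ck_1_FD_continuous f g continuous_on_const continuous_on_id)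
qed

lemma Ck_1_mult:
  fixes f g :: "'a::euclidean_space \<Rightarrow> real"
  assumes "Ck 1 f" "Ck 1 g" shows "Ck 1 (\<lambda>x. f x * g x)"
  using Ck_1_scaleR[OF assms] by simp

lemma Ck_1_sum:
  assumes "\<And>i. i \<in> I \<Longrightarrow> Ck 1 (f i)" shows "Ck 1 (\<lambda>x. \<Sum>i\<in>I. f i x)"
  by (rule Ck_1_I[of _ "\<lambda>x v. \<Sum>i\<in>I. FD (f i) x v"])
     (use assms in \<open>auto intro!: derivative_eq_intros Ck_1_deriv continuous_intros Ck_1_FD_continuous simp del: One_nat_def\<close>)

lemma Ck_1_Pair:
  assumes "Ck 1 f" "Ck 1 g" shows "Ck 1 (\<lambda>x. (f x, g x))"
  by (rule Ck_1_I[of _ "\<lambda>x v. (FD f x v, FD g x v)"])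
     (use assms in \<open>auto intro!: derivative_eq_intros Ck_1_deriv continuous_intros Ck_1_FD_continuous simp del: One_nat_def\<close>)

lemma Ck_1_compose:
  fixes f :: "'b::euclidean_space \<Rightarrow> 'c::real_normed_vector"
  assumes "Ck 1 f" "Ck 1 g" shows "Ck 1 (\<lambda>x. f (g x))"
proof (rule Ck_1_I[of _ "\<lambda>x v. FD f (g x) (FD g x v)"])
  show "((\<lambda>x. f (g x)) has_derivative (\<lambda>v. FD f (g x) (FD g x v))) (at x)" for x
    by (rule has_derivative_compose[OF Ck_1_deriv[OF assms(2)] Ck_1_deriv[OF assms(1)]])
  show "continuous_on UNIV (\<lambda>x. FD f (g x) (FD g x v))" for v
    by (intro Ck_1_FD_continuous assms Ck_1_continuous continuous_on_const continuous_on_id)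
qed

lemma Ck_1_nth:
  fixes f :: "'a::euclidean_space \<Rightarrow> real ^ 'n"
  shows "Ck 1 f \<Longrightarrow> Ck 1 (\<lambda>x. f x $ i)"
  using Ck_1_compose[OF Ck_1_bounded_linear[OF bounded_linear_vec_nth[of i]], of f] by simp

lemma FD_nth:
  fixes f :: "'a::euclidean_space \<Rightarrow> real ^ 'n"
  shows "Ck 1 f \<Longrightarrow> FD (\<lambda>x. f x $ i) x v = FD f x v $ i"
  using FD_eq[OF bounded_linear.has_derivative[OF bounded_linear_vec_nth Ck_1_deriv]] by metis

lemma smooth_Ck_1: "smooth f \<Longrightarrow> Ck 1 f"
  by (simp add: smooth_def del: One_nat_def)

lemma smooth_FD: "smooth f \<Longrightarrow> smooth (\<lambda>x. FD f x v)"
  unfolding smooth_def by (metis Ck.simps(2))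

section \<open>Symmetry of the second derivative\<close>

text \<open>
  The second difference is evaluated by two applications of the mean value theorem, one in each
  direction. Reading the same symmetric expression in both orders gives Schwarz's theorem.
\<close>

lemma second_difference_mean_value:
  fixes f :: "'a::euclidean_space \<Rightarrow> real"
  assumes f: "Ck 1 f" and fv: "Ck 1 (\<lambda>x. FD f x v)" and h: "0 < h"
  obtains s t where "0 < s" "s < h" "0 < t" "t < h"
    "f (x + h *\<^sub>R v + h *\<^sub>R w) - f (x + h *\<^sub>R v) - f (x + h *\<^sub>R w) + f x
       = h * h * FD (\<lambda>x. FD f x v) (x + s *\<^sub>R v + t *\<^sub>R w) w"
proof -
  define G where "G s = f (x + s *\<^sub>R v + h *\<^sub>R w) - f (x + s *\<^sub>R v)" for s
  have d1: "((\<lambda>s. f (c + s *\<^sub>R v)) has_real_derivative FD f (c + s *\<^sub>R v) v) (at s)" for c s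
  proof -
    have "((\<lambda>s. f (c + s *\<^sub>R v)) has_derivative (\<lambda>y. FD f (c + s *\<^sub>R v) (y *\<^sub>R v))) (at s)"
      by (rule has_derivative_compose[OF _ Ck_1_deriv[OF f]]) (auto intro!: derivative_eq_intros)
    thus ?thesis using linear_scale[OF Ck_1_FD_linear[OF f]]
      by (simp add: has_field_derivative_def mult_commute_abs)
  qed
  have G: "(G has_real_derivative (FD f (x + s *\<^sub>R v + h *\<^sub>R w) v - FD f (x + s *\<^sub>R v) v)) (at s)" for s
    unfolding G_def using DERIV_diff[OF d1[of "x + h *\<^sub>R w" s] d1[of x s]] by (simp add: add_ac)
  obtain s where s: "0 < s" "s < h"
    "G h - G 0 = h * (FD f (x + s *\<^sub>R v + h *\<^sub>R w) v - FD f (x + s *\<^sub>R v) v)"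
    using MVT2[OF h, of G "\<lambda>s. FD f (x + s *\<^sub>R v + h *\<^sub>R w) v - FD f (x + s *\<^sub>R v) v"] G by auto
  have d2: "((\<lambda>t. FD f (x + s *\<^sub>R v + t *\<^sub>R w) v) has_real_derivative
      FD (\<lambda>x. FD f x v) (x + s *\<^sub>R v + t *\<^sub>R w) w) (at t)" for t
  proof -
    have "((\<lambda>t. FD f (x + s *\<^sub>R v + t *\<^sub>R w) v) has_derivative
      (\<lambda>y. FD (\<lambda>x. FD f x v) (x + s *\<^sub>R v + t *\<^sub>R w) (y *\<^sub>R w))) (at t)"
      by (rule has_derivative_compose[OF _ Ck_1_deriv[OF fv]]) (auto intro!: derivative_eq_intros)
    thus ?thesis using linear_scale[OF Ck_1_FD_linear[OF fv]]
      by (simp add: has_field_derivative_def mult_commute_abs)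
  qed
  obtain t where t: "0 < t" "t < h"
    "FD f (x + s *\<^sub>R v + h *\<^sub>R w) v - FD f (x + s *\<^sub>R v) v = h * FD (\<lambda>x. FD f x v) (x + s *\<^sub>R v + t *\<^sub>R w) w"
    using MVT2[OF h, of "\<lambda>t. FD f (x + s *\<^sub>R v + t *\<^sub>R w) v" "\<lambda>t. FD (\<lambda>x. FD f x v) (x + s *\<^sub>R v + t *\<^sub>R w) w"] d2 by auto
  show ?thesis by (rule that[OF s(1,2) t(1,2)]) (use s(3) t(3) in \<open>simp add: G_def algebra_simps\<close>)
qed

lemma second_derivative_symmetric_real:
  fixes f :: "'a::euclidean_space \<Rightarrow> real"
  assumes f: "Ck 1 f" and fv: "\<And>v. Ck 1 (\<lambda>x. FD f x v)"
  shows "FD (\<lambda>x. FD f x v) x w = FD (\<lambda>x. FD f x w) x v"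
proof (rule ccontr)
  assume neq: "\<not> ?thesis"
  define A where "A y = FD (\<lambda>x. FD f x v) y w" for y
  define B where "B y = FD (\<lambda>x. FD f x w) y v" for y
  define e where "e = \<bar>A x - B x\<bar> / 2"
  have e: "e > 0" using neq by (simp add: e_def A_def B_def)
  have "continuous_on UNIV A" "continuous_on UNIV B" unfolding A_def B_def
    by (rule Ck_1_FD_continuous[OF fv continuous_on_id continuous_on_const])+
  hence "isCont A x" "isCont B x" using continuous_on_eq_continuous_at open_UNIV by blast+
  then obtain d1 d2 where d: "d1 > 0" "\<And>y. dist y x < d1 \<Longrightarrow> dist (A y) (A x) < e"
     "d2 > 0" "\<And>y. dist y x < d2 \<Longrightarrow> dist (B y) (B x) < e"
    using e unfolding continuous_at_eps_delta by metis
  define d where "d = min d1 d2"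
  have d0: "d > 0" using d by (simp add: d_def)
  \<comment> \<open>small enough for the whole parallelogram to lie in the ball of radius \<open>d\<close>\<close>
  define h where "h = d / (1 + norm v + norm w)"
  have pos: "1 + norm v + norm w > 0" by (simp add: add_nonneg_pos add_pos_nonneg)
  have h: "h > 0" using d0 pos by (simp add: h_def)
  have close: "dist (x + s *\<^sub>R v + t *\<^sub>R w) x < d" if "0 < s" "s < h" "0 < t" "t < h" for s t
  proof -
    have "dist (x + s *\<^sub>R v + t *\<^sub>R w) x = norm (s *\<^sub>R v + t *\<^sub>R w)" by (simp add: dist_norm algebra_simps)
    also have "\<dots> \<le> s * norm v + t * norm w" using norm_triangle_ineq[of "s *\<^sub>R v" "t *\<^sub>R w"] that by simp
    also have "\<dots> \<le> h * norm v + h * norm w" using that by (intro add_mono mult_right_mono) auto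
    also have "\<dots> < h * (1 + norm v + norm w)" using h by (simp add: algebra_simps)
    also have "\<dots> = d" using pos by (simp add: h_def)
    finally show ?thesis .
  qed
  obtain s t where 1: "0 < s" "s < h" "0 < t" "t < h"
    "f (x + h *\<^sub>R v + h *\<^sub>R w) - f (x + h *\<^sub>R v) - f (x + h *\<^sub>R w) + f x = h * h * A (x + s *\<^sub>R v + t *\<^sub>R w)"
    unfolding A_def by (rule second_difference_mean_value[OF f fv h])
  obtain s' t' where 2: "0 < s'" "s' < h" "0 < t'" "t' < h"
    "f (x + h *\<^sub>R w + h *\<^sub>R v) - f (x + h *\<^sub>R w) - f (x + h *\<^sub>R v) + f x = h * h * B (x + s' *\<^sub>R w + t' *\<^sub>R v)"
    unfolding B_def by (rule second_difference_mean_value[OF f fv h])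
  have "h * h * A (x + s *\<^sub>R v + t *\<^sub>R w) = h * h * B (x + t' *\<^sub>R v + s' *\<^sub>R w)"
    using 1(5) 2(5) by (simp add: algebra_simps)
  hence "A (x + s *\<^sub>R v + t *\<^sub>R w) = B (x + t' *\<^sub>R v + s' *\<^sub>R w)" using h by simp
  moreover have "dist (A (x + s *\<^sub>R v + t *\<^sub>R w)) (A x) < e" using close[OF 1(1-4)] d(2) by (simp add: d_def)
  moreover have "dist (B (x + t' *\<^sub>R v + s' *\<^sub>R w)) (B x) < e" using close[OF 2(3,4,1,2)] d(4) by (simp add: d_def)
  ultimately have "\<bar>A x - B x\<bar> < 2 * e" unfolding dist_real_def by arith
  thus False by (simp add: e_def)
qed

lemma second_derivative_symmetric:
  fixes f :: "'a::euclidean_space \<Rightarrow> 'b::euclidean_space"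
  assumes f: "Ck 1 f" and fv: "\<And>v. Ck 1 (\<lambda>x. FD f x v)"
  shows "FD (\<lambda>x. FD f x v) x w = FD (\<lambda>x. FD f x w) x v"
proof (rule euclidean_eqI)
  fix b :: 'b
  have FDi: "FD (\<lambda>x. g x \<bullet> b) y u = FD g y u \<bullet> b" if "Ck 1 g" for g :: "'a \<Rightarrow> 'b" and y u
    using FD_eq[OF bounded_linear.has_derivative[OF bounded_linear_inner_left Ck_1_deriv[OF that]]] by metis
  have Ci: "Ck 1 (\<lambda>x. g x \<bullet> b)" if "Ck 1 g" for g :: "'a \<Rightarrow> 'b"
    by (rule Ck_1_compose[OF Ck_1_bounded_linear[OF bounded_linear_inner_left] that])
  show "FD (\<lambda>x. FD f x v) x w \<bullet> b = FD (\<lambda>x. FD f x w) x v \<bullet> b"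
    using second_derivative_symmetric_real[of "\<lambda>x. f x \<bullet> b" v x w]
    by (simp only: Ci[OF f] Ci[OF fv] FDi[OF f] FDi[OF fv] simp_thms)
qed

section \<open>Curves in a subspace and linear maps\<close>

text \<open>
  Integrating a derivative that stays in \<open>W\<close> cannot leave \<open>W\<close>: the pairing
  with every vector orthogonal to \<open>W\<close> is constant. This is the device by which
  infinitesimal statements about the bracket become statements about the group.
\<close>

lemma increment_in_subspace:
  fixes f :: "real \<Rightarrow> 'a::euclidean_space"
  assumes W: "subspace W" and d: "\<And>t. (f has_vector_derivative f' t) (at t)" and f': "\<And>t. f' t \<in> W"
  shows "f b - f a \<in> W"
proof -
  have "(f b - f a) \<in> orthogonal_comp (orthogonal_comp W)"
    unfolding orthogonal_comp_def orthogonal_def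
  proof (intro CollectI ballI)
    fix y assume y: "y \<in> {x. \<forall>y\<in>W. y \<bullet> x = 0}"
    have "((\<lambda>t. y \<bullet> f t) has_real_derivative 0) (at t)" for t
    proof -
      have "((\<lambda>t. y \<bullet> f t) has_vector_derivative (y \<bullet> f' t)) (at t)"
        by (rule bounded_linear.has_vector_derivative[OF bounded_linear_inner_right d])
      moreover have "y \<bullet> f' t = 0" using y f'[of t] by (auto simp: inner_commute)
      ultimately show ?thesis by (simp add: has_real_derivative_iff_has_vector_derivative)
    qed
    hence "y \<bullet> f b = y \<bullet> f a" using DERIV_const_ratio_const DERIV_isconst_all by blast
    thus "y \<bullet> (f b - f a) = 0" by (simp add: inner_diff_right)
  qed
  thus ?thesis using orthogonal_comp_self[OF W] by simp
qed

text \<open>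
  Homogeneity under integers suffices: \<open>f x = n f (x / n)\<close> for all \<open>n\<close>,
  and the right-hand side tends to the derivative at \<open>0\<close> in direction \<open>x\<close>.
\<close>

lemma homogeneous_differentiable_imp_linear:
  fixes f :: "'a::real_normed_vector \<Rightarrow> 'b::real_normed_vector"
  assumes d: "(f has_derivative f') (at 0)" and hom: "\<And>(n::nat) x. f (real n *\<^sub>R x) = real n *\<^sub>R f x"
  shows "f = f'"
proof
  fix x
  have f0: "f 0 = 0" using hom[of 0 0] by simp
  have "((\<lambda>t. f (t *\<^sub>R x)) has_derivative (\<lambda>t. f' (t *\<^sub>R x))) (at 0)"
    by (rule has_derivative_compose[of "\<lambda>t. t *\<^sub>R x"]) (auto intro!: derivative_eq_intros d)
  hence "((\<lambda>t. f (t *\<^sub>R x)) has_vector_derivative f' x) (at 0)"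
    using linear_scale[OF has_derivative_linear[OF d]] by (simp add: has_vector_derivative_def)
  hence "((\<lambda>t. norm (f (t *\<^sub>R x) - t *\<^sub>R f' x) / norm t) \<longlongrightarrow> 0) (at 0)"
    by (simp add: has_vector_derivative_def has_derivative_at f0)
  moreover have "\<forall>\<^sub>F t in at 0. norm (f (t *\<^sub>R x) - t *\<^sub>R f' x) / norm t = norm ((1 / t) *\<^sub>R f (t *\<^sub>R x) - f' x)"
    unfolding eventually_at
  proof (intro exI[of _ 1] conjI ballI impI)
    fix t :: real assume "t \<noteq> 0 \<and> dist t 0 < 1"
    hence "(1 / t) *\<^sub>R f (t *\<^sub>R x) - f' x = (1 / t) *\<^sub>R (f (t *\<^sub>R x) - t *\<^sub>R f' x)" by (simp add: algebra_simps)
    thus "norm (f (t *\<^sub>R x) - t *\<^sub>R f' x) / norm t = norm ((1 / t) *\<^sub>R f (t *\<^sub>R x) - f' x)" by simp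
  qed simp
  ultimately have "((\<lambda>t. norm ((1 / t) *\<^sub>R f (t *\<^sub>R x) - f' x)) \<longlongrightarrow> 0) (at 0)"
    by (rule Lim_transform_eventually)
  hence "((\<lambda>t. (1 / t) *\<^sub>R f (t *\<^sub>R x)) \<longlongrightarrow> f' x) (at 0)"
    using Lim_null tendsto_norm_zero_iff by blast
  moreover have "filterlim (\<lambda>n. 1 / real (Suc n)) (at 0) sequentially"
    unfolding filterlim_at by (auto simp: LIMSEQ_inverse_real_of_nat inverse_eq_divide[symmetric] simp del: of_nat_Suc)
  ultimately have "(\<lambda>n. (1 / (1 / real (Suc n))) *\<^sub>R f ((1 / real (Suc n)) *\<^sub>R x)) \<longlonglongrightarrow> f' x"
    by (rule filterlim_compose)
  moreover have "(1 / (1 / real (Suc n))) *\<^sub>R f ((1 / real (Suc n)) *\<^sub>R x) = f x" for n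
    using hom[of "Suc n" "(1 / real (Suc n)) *\<^sub>R x"] by (simp del: of_nat_Suc)
  ultimately have "(\<lambda>n. f x) \<longlonglongrightarrow> f' x" by (simp only:)
  thus "f x = f' x" using LIMSEQ_const_iff by blast
qed

lemma linear_family_bounded:
  fixes L :: "'a::topological_space \<Rightarrow> 'b::euclidean_space \<Rightarrow> 'c::real_normed_vector"
  assumes "compact S" "\<And>p. p \<in> S \<Longrightarrow> linear (L p)" "\<And>b. continuous_on S (\<lambda>p. L p b)"
  obtains C where "C > 0" "\<And>p w. p \<in> S \<Longrightarrow> norm (L p w) \<le> C * norm w"
proof -
  have "\<exists>c. \<forall>p\<in>S. norm (L p b) \<le> c" for b
    using compact_imp_bounded[OF compact_continuous_image[OF assms(3) assms(1)]]
    by (force simp: bounded_iff)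
  then obtain c where c: "\<And>b p. p \<in> S \<Longrightarrow> norm (L p b) \<le> c b" by metis
  have "norm (L p w) \<le> (1 + (\<Sum>b\<in>Basis. \<bar>c b\<bar>)) * norm w" if p: "p \<in> S" for p w
  proof -
    have "L p w = (\<Sum>b\<in>Basis. (w \<bullet> b) *\<^sub>R L p b)" by (rule linear_basis_expansion[OF assms(2)[OF p]])
    also have "norm \<dots> \<le> (\<Sum>b\<in>Basis. norm ((w \<bullet> b) *\<^sub>R L p b))" by (rule norm_sum)
    also have "\<dots> \<le> (\<Sum>b\<in>Basis. norm w * \<bar>c b\<bar>)"
      using c[OF p] Basis_le_norm by (intro sum_mono) (auto intro!: mult_mono intro: order_trans[OF _ abs_ge_self])
    also have "\<dots> \<le> (1 + (\<Sum>b\<in>Basis. \<bar>c b\<bar>)) * norm w" by (simp add: algebra_simps sum_distrib_left)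
    finally show ?thesis .
  qed
  moreover have "1 + (\<Sum>b\<in>(Basis::'b set). \<bar>c b\<bar>) > 0" by (intro add_pos_nonneg sum_nonneg) auto
  ultimately show ?thesis using that by blast
qed

section \<open>The group law and its partial differentials\<close>

context nilpotent_lie_group
begin

notation gmul (infixl "\<odot>" 70)

interpretation G: Groups.group gmul 0 ginv by (rule group)

lemma gmul_assoc: "(x \<odot> y) \<odot> z = x \<odot> (y \<odot> z)" by (rule G.assoc)
lemma gmul_0_left [simp]: "0 \<odot> x = x" by (rule G.group_left_neutral)
lemma gmul_0_right [simp]: "x \<odot> 0 = x" by simp

lemma gmul_minus_right [simp]: "x \<odot> - x = 0"
  using exponential_coordinates[of 1 x "-1"] by simp

lemma gmul_minus_left [simp]: "- x \<odot> x = 0"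
  using exponential_coordinates[of "-1" x 1] by simp

lemma ginv_eq [simp]: "ginv x = - x"
  by (metis G.right_inverse G.assoc gmul_minus_left gmul_0_left gmul_0_right)

lemma gmul_cancel [simp]: "- x \<odot> (x \<odot> y) = y" "x \<odot> (- x \<odot> y) = y" "y \<odot> x \<odot> - x = y" "y \<odot> - x \<odot> x = y"
  by (simp_all add: gmul_assoc[symmetric]) (simp_all add: gmul_assoc)

lemma gmul_right_cancel [simp]: "y \<odot> x = z \<odot> x \<longleftrightarrow> y = z"
  by (metis gmul_cancel(3))

lemma minus_gmul: "- (x \<odot> y) = - y \<odot> - x"
  by (metis gmul_assoc gmul_cancel(3) gmul_minus_right gmul_right_cancel)

lemma Ck_1_mult_pair: "Ck 1 (\<lambda>z. fst z \<odot> snd z)"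
  using smooth_mult by (rule smooth_Ck_1)

lemma Ck_1_gmul:
  assumes "Ck 1 f" "Ck 1 g" shows "Ck 1 (\<lambda>x. f x \<odot> g x)"
  using Ck_1_compose[OF Ck_1_mult_pair Ck_1_Pair[OF assms]] by simp

text \<open>
  \<open>LD q x\<close> is the differential at \<open>x\<close> of the left translation by
  \<open>q\<close>, and \<open>RD q x\<close> that of the right translation by \<open>q\<close>.
  They are defined as the two partial differentials of the multiplication so that joint smoothness
  in \<open>q\<close> and \<open>x\<close> is immediate.
\<close>

definition LD :: "(real, 'n) vec \<Rightarrow> (real, 'n) vec \<Rightarrow> (real, 'n) vec \<Rightarrow> (real, 'n) vec" where
  "LD q x v = FD (\<lambda>z. fst z \<odot> snd z) (q, x) (0, v)"

definition RD :: "(real, 'n) vec \<Rightarrow> (real, 'n) vec \<Rightarrow> (real, 'n) vec \<Rightarrow> (real, 'n) vec" where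
  "RD q x v = FD (\<lambda>z. fst z \<odot> snd z) (x, q) (v, 0)"

lemma FD_mult_pair: "FD (\<lambda>z. fst z \<odot> snd z) (x, y) (u, v) = LD x y v + RD y x u"
  unfolding LD_def RD_def using linear_add[OF Ck_1_FD_linear[OF Ck_1_mult_pair], of _ "(0,v)" "(u,0)"] by simp

lemma linear_LD: "linear (LD q x)"
  unfolding LD_def using linear_compose[OF _ Ck_1_FD_linear[OF Ck_1_mult_pair], of "\<lambda>v. (0, v)"]
  by (simp add: o_def linear_iff)

lemma linear_RD: "linear (RD q x)"
  unfolding RD_def using linear_compose[OF _ Ck_1_FD_linear[OF Ck_1_mult_pair], of "\<lambda>v. (v, 0)"]
  by (simp add: o_def linear_iff)

lemmas LD_simps = linear_0[OF linear_LD] linear_add[OF linear_LD] linear_diff[OF linear_LD] linear_scale[OF linear_LD] linear_neg[OF linear_LD] linear_sum[OF linear_LD]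
lemmas RD_simps = linear_0[OF linear_RD] linear_add[OF linear_RD] linear_diff[OF linear_RD] linear_scale[OF linear_RD] linear_neg[OF linear_RD]

lemma has_derivative_gmul:
  assumes "(f has_derivative f') (at x within S)" "(g has_derivative g') (at x within S)"
  shows "((\<lambda>x. f x \<odot> g x) has_derivative (\<lambda>v. LD (f x) (g x) (g' v) + RD (g x) (f x) (f' v))) (at x within S)"
  using has_derivative_compose[OF has_derivative_Pair[OF assms] Ck_1_deriv[OF Ck_1_mult_pair]]
  by (simp add: FD_mult_pair)

lemma has_vector_derivative_gmul:
  assumes "(f has_vector_derivative f') (at x within S)" "(g has_vector_derivative g') (at x within S)"
  shows "((\<lambda>x. f x \<odot> g x) has_vector_derivative (LD (f x) (g x) g' + RD (g x) (f x) f')) (at x within S)"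
  using has_derivative_gmul[OF assms[unfolded has_vector_derivative_def]]
  by (simp add: has_vector_derivative_def LD_simps RD_simps scaleR_add_right)

lemma has_derivative_gmul_left: "(gmul q has_derivative LD q x) (at x within S)"
  using has_derivative_gmul[OF has_derivative_const[of q] has_derivative_ident] by (simp add: RD_simps)

lemma has_derivative_gmul_right: "((\<lambda>x. x \<odot> q) has_derivative RD q x) (at x within S)"
  using has_derivative_gmul[OF has_derivative_ident has_derivative_const[of q]] by (simp add: LD_simps)

lemma left_field_eq: "left_field gmul v p = LD p 0 v"
  unfolding left_field_def using FD_eq[OF has_derivative_gmul_left] by metis

lemma pull_back_eq: "pull_back gmul ginv p u = LD (- p) p u"
  unfolding pull_back_def ginv_eq using FD_eq[OF has_derivative_gmul_left] by metis

lemma LD_0 [simp]: "LD 0 x v = v"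
proof -
  have "((\<lambda>x. x) has_derivative LD 0 x) (at x)"
    using has_derivative_gmul_left[of 0 x UNIV] by (rule back_subst[of "\<lambda>f. (f has_derivative _) _"]) auto
  thus ?thesis using has_derivative_unique[OF _ has_derivative_ident] by metis
qed

lemma RD_0 [simp]: "RD 0 x v = v"
proof -
  have "((\<lambda>x. x) has_derivative RD 0 x) (at x)"
    using has_derivative_gmul_right[of 0 x UNIV] by simp
  thus ?thesis using has_derivative_unique[OF _ has_derivative_ident] by metis
qed

text \<open>
  Chain rule for left translations composed by associativity. All manipulations of left-invariant
  fields below are instances of it.
\<close>

lemma LD_LD: "LD q (p \<odot> x) (LD p x v) = LD (q \<odot> p) x v"
proof -
  have "((\<lambda>x. q \<odot> (p \<odot> x)) has_derivative (\<lambda>v. LD q (p \<odot> x) (LD p x v))) (at x)"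
    by (rule has_derivative_compose[OF has_derivative_gmul_left has_derivative_gmul_left])
  moreover have "((\<lambda>x. q \<odot> (p \<odot> x)) has_derivative LD (q \<odot> p) x) (at x)"
    using has_derivative_gmul_left[of "q \<odot> p" x UNIV] by (rule back_subst[of "\<lambda>f. (f has_derivative _) _"]) (auto simp: gmul_assoc)
  ultimately show ?thesis using has_derivative_unique by metis
qed

lemma pull_back_left_field [simp]: "LD (- p) p (LD p 0 v) = v"
  using LD_LD[of "- p" p 0 v] by simp

lemma left_field_pull_back [simp]: "LD p 0 (LD (- p) p v) = v"
  using LD_LD[of p "- p" p v] by simp

lemma LD_factor: "LD q x v = LD (q \<odot> x) 0 (LD (- x) x v)"
  using LD_LD[of "q \<odot> x" "- x" x v] by simp

lemma Ck_1_LD: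
  assumes "Ck 1 f" "Ck 1 g" "Ck 1 h"
  shows "Ck 1 (\<lambda>x. LD (f x) (g x) (h x))"
proof -
  have "Ck 1 (\<lambda>x. LD (f x) (g x) b)" for b
    unfolding LD_def by (rule Ck_1_compose[OF smooth_Ck_1[OF smooth_FD[OF smooth_mult]] Ck_1_Pair[OF assms(1,2)]])
  moreover have "LD (f x) (g x) (h x) = (\<Sum>b\<in>Basis. (h x \<bullet> b) *\<^sub>R LD (f x) (g x) b)" for x
    by (rule linear_basis_expansion[OF linear_LD])
  moreover have "Ck 1 (\<lambda>x. h x \<bullet> b)" for b
    by (rule Ck_1_compose[OF Ck_1_bounded_linear[OF bounded_linear_inner_left] assms(3)])
  ultimately show ?thesis by (simp only:) (intro Ck_1_sum Ck_1_scaleR)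
qed

lemma continuous_on_gmul: "continuous_on S f \<Longrightarrow> continuous_on S g \<Longrightarrow> continuous_on S (\<lambda>x. f x \<odot> g x)"
  using continuous_on_compose2[OF Ck_1_continuous[OF Ck_1_mult_pair, of UNIV] continuous_on_Pair] by auto

lemma continuous_on_LD:
  assumes "continuous_on S f" "continuous_on S g" "continuous_on S h"
  shows "continuous_on S (\<lambda>x. LD (f x) (g x) (h x))"
  unfolding LD_def by (rule Ck_1_FD_continuous[OF Ck_1_mult_pair])
    (intro continuous_on_Pair assms continuous_on_const)+

section \<open>The adjoint action\<close>

definition Ad :: "(real, 'n) vec \<Rightarrow> (real, 'n) vec \<Rightarrow> (real, 'n) vec" where
  "Ad p x = p \<odot> x \<odot> - p"

lemma Ad_gmul: "Ad p (x \<odot> y) = Ad p x \<odot> Ad p y"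
  unfolding Ad_def by (simp add: gmul_assoc)

lemma Ad_Ad: "Ad p (Ad q x) = Ad (p \<odot> q) x"
  unfolding Ad_def by (simp add: gmul_assoc minus_gmul)

lemma Ad_0 [simp]: "Ad 0 x = x" by (simp add: Ad_def)

lemma Ad_0_right [simp]: "Ad p 0 = 0" by (simp add: Ad_def)

lemma Ad_swap: "Ad p x \<odot> p = p \<odot> x" by (simp add: Ad_def)

lemma Ad_neg_Ad [simp]: "Ad (- p) (Ad p x) = x" "Ad p (Ad (- p) x) = x" by (simp_all add: Ad_Ad)

lemma Ad_nat_scale: "Ad p (real n *\<^sub>R x) = real n *\<^sub>R Ad p x"
proof (induction n)
  case (Suc n)
  have "Ad p (real (Suc n) *\<^sub>R x) = Ad p (real n *\<^sub>R x \<odot> 1 *\<^sub>R x)"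
    unfolding exponential_coordinates by (simp add: add.commute)
  also have "\<dots> = real n *\<^sub>R Ad p x \<odot> 1 *\<^sub>R Ad p x" by (simp add: Ad_gmul Suc.IH)
  also have "\<dots> = real (Suc n) *\<^sub>R Ad p x" unfolding exponential_coordinates by (simp add: add.commute)
  finally show ?case .
qed simp

lemma Ck_1_Ad: "Ck 1 f \<Longrightarrow> Ck 1 g \<Longrightarrow> Ck 1 (\<lambda>x. Ad (f x) (g x))"
  unfolding Ad_def by (intro Ck_1_gmul Ck_1_uminus)

text \<open>
  In exponential coordinates conjugation is linear: it is a homomorphism, and one-parameter
  subgroups are lines, so it commutes with multiplication by integers; being differentiable at
  \<open>0\<close>, it agrees with its derivative there. Hence \<open>Ad\<close> is the adjoint
  representation itself.
\<close>

lemma linear_Ad: "linear (Ad p)"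
proof -
  have "Ck 1 (Ad p)" using Ck_1_Ad[OF Ck_1_const Ck_1_id, of p] .
  hence "(Ad p has_derivative FD (Ad p) 0) (at 0)" by (rule Ck_1_deriv)
  thus ?thesis using homogeneous_differentiable_imp_linear[of "Ad p", OF _ Ad_nat_scale] has_derivative_linear by metis
qed

lemmas Ad_simps = linear_0[OF linear_Ad] linear_add[OF linear_Ad] linear_diff[OF linear_Ad] linear_scale[OF linear_Ad] linear_neg[OF linear_Ad] linear_sum[OF linear_Ad]

end

context nilpotent_lie_group
begin

section \<open>The infinitesimal adjoint action is the bracket\<close>

lemma Ck_1_left_field: "Ck 1 (\<lambda>p. LD p 0 v)"
  by (intro Ck_1_LD Ck_1_id Ck_1_const)

lemma bracket_eq: "bracket gmul v w = FD (\<lambda>p. LD p 0 w) 0 v - FD (\<lambda>p. LD p 0 v) 0 w"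
proof -
  have "left_field gmul v = (\<lambda>p. LD p 0 v)" for v by (rule ext) (rule left_field_eq)
  thus ?thesis by (simp add: bracket_def field_bracket_def)
qed

lemma bracket_antisym: "bracket gmul v w = - bracket gmul w v"
  by (simp add: bracket_eq)

lemma linear_bracket_right: "linear (bracket gmul v)"
proof (rule linearI)
  show "bracket gmul v (a + b) = bracket gmul v a + bracket gmul v b" for a b
  proof -
    have "((\<lambda>p. LD p 0 (a + b)) has_derivative (\<lambda>v. FD (\<lambda>p. LD p 0 a) 0 v + FD (\<lambda>p. LD p 0 b) 0 v)) (at 0)"
      unfolding LD_simps by (intro has_derivative_add Ck_1_deriv Ck_1_left_field)
    hence "FD (\<lambda>p. LD p 0 (a + b)) 0 = (\<lambda>v. FD (\<lambda>p. LD p 0 a) 0 v + FD (\<lambda>p. LD p 0 b) 0 v)" by (rule FD_eq)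
    thus ?thesis by (simp add: bracket_eq linear_add[OF Ck_1_FD_linear[OF Ck_1_left_field]])
  qed
  show "bracket gmul v (c *\<^sub>R a) = c *\<^sub>R bracket gmul v a" for c a
  proof -
    have "((\<lambda>p. LD p 0 (c *\<^sub>R a)) has_derivative (\<lambda>v. c *\<^sub>R FD (\<lambda>p. LD p 0 a) 0 v)) (at 0)"
      unfolding LD_simps by (intro has_derivative_scaleR_right Ck_1_deriv Ck_1_left_field)
    hence "FD (\<lambda>p. LD p 0 (c *\<^sub>R a)) 0 = (\<lambda>v. c *\<^sub>R FD (\<lambda>p. LD p 0 a) 0 v)" by (rule FD_eq)
    thus ?thesis by (simp add: bracket_eq linear_scale[OF Ck_1_FD_linear[OF Ck_1_left_field]] algebra_simps)
  qed
qed

lemma linear_bracket_left: "linear (\<lambda>v. bracket gmul v w)"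
  unfolding bracket_antisym[of _ w] by (intro linear_compose_neg linear_bracket_right)

lemmas bracket_simps = linear_0[OF linear_bracket_right] linear_add[OF linear_bracket_right] linear_diff[OF linear_bracket_right]
  linear_scale[OF linear_bracket_right] linear_0[OF linear_bracket_left] linear_add[OF linear_bracket_left]
  linear_diff[OF linear_bracket_left] linear_scale[OF linear_bracket_left]

text \<open>
  The identity \<open>Ad (t p) z \<odot> t p = t p \<odot> z\<close> differentiated along
  \<open>z\<close> gives an equation between a right and a left differential. Differentiating it
  once more in \<open>t\<close> expresses the derivative of \<open>Ad (t p) z\<close> by mixed
  second derivatives of the multiplication at the identity, and the symmetry of these turns the
  expression into the bracket of the left-invariant fields.
\<close>

lemma Ad_has_vector_derivative_0:
  "((\<lambda>t. Ad (t *\<^sub>R p) z) has_vector_derivative bracket gmul p z) (at 0)"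
proof -
  define m :: "(real, 'n) vec \<times> (real, 'n) vec \<Rightarrow> (real, 'n) vec" where "m = (\<lambda>z. fst z \<odot> snd z)"
  have sm: "smooth m" using smooth_mult by (simp add: m_def)
  have m1: "Ck 1 (\<lambda>z. FD m z w)" for w using smooth_Ck_1[OF smooth_FD[OF sm]] .
  define A where "A t = Ad (t *\<^sub>R p) z" for t :: real
  have "Ck 1 A" unfolding A_def
    by (intro Ck_1_Ad Ck_1_const Ck_1_bounded_linear bounded_linear_scaleR_left)
  hence "(A has_derivative FD A 0) (at 0)" by (rule Ck_1_deriv)
  moreover have "FD A 0 = (\<lambda>t. t *\<^sub>R FD A 0 1)"
  proof
    show "FD A 0 t = t *\<^sub>R FD A 0 1" for t
      using linear_scale[OF Ck_1_FD_linear[OF \<open>Ck 1 A\<close>], of 0 t 1] by simp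
  qed
  ultimately have A': "(A has_vector_derivative FD A 0 1) (at 0)"
    unfolding has_vector_derivative_def by metis
  define A' where "A' = FD A 0 1"
  note A' = A'[folded A'_def]
  \<comment> \<open>both sides are the derivative at \<open>0\<close> of \<open>s \<mapsto> t p \<odot> s z\<close>\<close>
  have key: "RD (t *\<^sub>R p) 0 (A t) = LD (t *\<^sub>R p) 0 z" for t
  proof -
    have eq: "(\<lambda>s. s *\<^sub>R A t \<odot> t *\<^sub>R p) = (\<lambda>s. t *\<^sub>R p \<odot> s *\<^sub>R z)"
      unfolding A_def Ad_simps(4)[symmetric] Ad_swap ..
    have "((\<lambda>s. s *\<^sub>R A t \<odot> t *\<^sub>R p) has_vector_derivative RD (t *\<^sub>R p) (0 *\<^sub>R A t) (A t)) (at 0)"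
      by (rule has_vector_derivative_eq_rhs[OF has_vector_derivative_gmul])
         (auto intro!: derivative_eq_intros simp: LD_simps)
    moreover have "((\<lambda>s. t *\<^sub>R p \<odot> s *\<^sub>R z) has_vector_derivative LD (t *\<^sub>R p) (0 *\<^sub>R z) z) (at 0)"
      by (rule has_vector_derivative_eq_rhs[OF has_vector_derivative_gmul])
         (auto intro!: derivative_eq_intros simp: RD_simps)
    ultimately show ?thesis unfolding eq using vector_derivative_unique_at scaleR_zero_left by metis
  qed
  have exp: "RD (t *\<^sub>R p) 0 (A t) = (\<Sum>b\<in>Basis. (A t \<bullet> b) *\<^sub>R FD m (0, t *\<^sub>R p) (b, 0))" for t
    unfolding linear_basis_expansion[OF linear_RD, of _ _ "A t"] by (simp add: RD_def m_def)
  have d1: "((\<lambda>t. FD m (0, t *\<^sub>R p) (b, 0)) has_vector_derivative FD (\<lambda>z. FD m z (b, 0)) (0, 0) (0, p)) (at 0)" for b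
  proof -
    have "((\<lambda>t. (0, t *\<^sub>R p)) has_derivative (\<lambda>t. (0, t *\<^sub>R p))) (at 0)"
      by (auto intro!: derivative_eq_intros)
    from has_derivative_compose[OF this, of "\<lambda>z. FD m z (b, 0)"] Ck_1_deriv[OF m1, of "(b, 0)" "(0, 0 *\<^sub>R p)"]
    have "((\<lambda>t. FD m (0, t *\<^sub>R p) (b, 0)) has_derivative (\<lambda>t. FD (\<lambda>z. FD m z (b, 0)) (0, 0) (0, t *\<^sub>R p))) (at 0)"
      by simp
    moreover have "FD (\<lambda>z. FD m z (b, 0)) (0, 0) (0, t *\<^sub>R p) = t *\<^sub>R FD (\<lambda>z. FD m z (b, 0)) (0, 0) (0, p)" for t
      using linear_scale[OF Ck_1_FD_linear[OF m1], of "(b, 0)" "(0, 0)" t "(0, p)"] by simp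
    ultimately show ?thesis by (simp add: has_vector_derivative_def)
  qed
  have "((\<lambda>t. RD (t *\<^sub>R p) 0 (A t)) has_vector_derivative
     (\<Sum>b\<in>Basis. (A 0 \<bullet> b) *\<^sub>R FD (\<lambda>z. FD m z (b, 0)) (0, 0) (0, p) + (A' \<bullet> b) *\<^sub>R FD m (0, 0 *\<^sub>R p) (b, 0))) (at 0)"
    unfolding exp
    by (intro has_vector_derivative_sum has_vector_derivative_scaleR d1)
       (rule bounded_linear.has_vector_derivative[OF bounded_linear_inner_left A', unfolded has_real_derivative_iff_has_vector_derivative[symmetric]])
  also have "(\<Sum>b\<in>Basis. (A 0 \<bullet> b) *\<^sub>R FD (\<lambda>z. FD m z (b, 0)) (0, 0) (0, p) + (A' \<bullet> b) *\<^sub>R FD m (0, 0 *\<^sub>R p) (b, 0))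
     = (\<Sum>b\<in>Basis. (z \<bullet> b) *\<^sub>R FD (\<lambda>z. FD m z (0, p)) (0, 0) (b, 0)) + (\<Sum>b\<in>Basis. (A' \<bullet> b) *\<^sub>R b)"
    unfolding sum.distrib second_derivative_symmetric[OF smooth_Ck_1[OF sm] m1, of "(_, 0)" _ "(0, p)"]
    using RD_0[unfolded RD_def, of 0] by (simp add: A_def m_def)
  also have "\<dots> = FD (\<lambda>z. FD m z (0, p)) (0, 0) (z, 0) + A'"
  proof -
    have "linear (\<lambda>u. FD (\<lambda>z. FD m z (0, p)) (0, 0) (u, 0))"
      using linear_compose[OF _ Ck_1_FD_linear[OF m1], of "\<lambda>v. (v, 0)"] by (simp add: o_def linear_iff)
    from linear_basis_expansion[OF this, of z] show ?thesis by (simp add: euclidean_representation)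
  qed
  also have "FD (\<lambda>z. FD m z (0, p)) (0, 0) (z, 0) = FD (\<lambda>q. LD q 0 p) 0 z"
  proof -
    have "((\<lambda>q. (q, 0)) has_derivative (\<lambda>q. (q, 0))) (at 0)" by (auto intro!: derivative_eq_intros)
    from has_derivative_compose[OF this Ck_1_deriv[OF m1, of "(0, p)"]]
    have "((\<lambda>q. LD q 0 p) has_derivative (\<lambda>q. FD (\<lambda>z. FD m z (0, p)) (0, 0) (q, 0))) (at 0)"
      by (simp add: LD_def m_def)
    from FD_eq[OF this] show ?thesis by simp
  qed
  finally have 1: "((\<lambda>t. LD (t *\<^sub>R p) 0 z) has_vector_derivative FD (\<lambda>q. LD q 0 p) 0 z + A') (at 0)"
    unfolding key .
  \<comment> \<open>the same curve differentiated directly\<close>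
  have 2: "((\<lambda>t. LD (t *\<^sub>R p) 0 z) has_vector_derivative FD (\<lambda>q. LD q 0 z) 0 p) (at 0)"
  proof -
    have "((\<lambda>t. t *\<^sub>R p) has_derivative (\<lambda>t. t *\<^sub>R p)) (at 0)" by (auto intro!: derivative_eq_intros)
    from has_derivative_compose[OF this Ck_1_deriv[OF Ck_1_left_field, of z "0 *\<^sub>R p"]]
    show ?thesis by (simp add: has_vector_derivative_def linear_scale[OF Ck_1_FD_linear[OF Ck_1_left_field]])
  qed
  have "FD (\<lambda>q. LD q 0 p) 0 z + A' = FD (\<lambda>q. LD q 0 z) 0 p"
    by (rule vector_derivative_unique_at[OF 1 2])
  hence "A' = bracket gmul p z" by (simp add: bracket_eq algebra_simps)
  thus ?thesis using A' unfolding A_def by simp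
qed

lemma Ad_has_vector_derivative:
  "((\<lambda>t. Ad (t *\<^sub>R p) z) has_vector_derivative bracket gmul p (Ad (s *\<^sub>R p) z)) (at s)"
proof -
  have "((\<lambda>t. Ad (t *\<^sub>R p) (Ad (s *\<^sub>R p) z)) \<circ> (\<lambda>t. t - s) has_vector_derivative 1 *\<^sub>R bracket gmul p (Ad (s *\<^sub>R p) z)) (at s)"
  proof (rule vector_diff_chain_at)
    show "((\<lambda>t. t - s) has_vector_derivative 1) (at s)" by (auto intro!: derivative_eq_intros)
    show "((\<lambda>t. Ad (t *\<^sub>R p) (Ad (s *\<^sub>R p) z)) has_vector_derivative bracket gmul p (Ad (s *\<^sub>R p) z)) (at (s - s))"
      using Ad_has_vector_derivative_0 by simp
  qed
  moreover have "(\<lambda>t. Ad (t *\<^sub>R p) (Ad (s *\<^sub>R p) z)) \<circ> (\<lambda>t. t - s) = (\<lambda>t. Ad (t *\<^sub>R p) z)"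
    by (auto simp: Ad_Ad exponential_coordinates)
  ultimately show ?thesis by simp
qed

text \<open>
  Conjugation preserves the bracket because the bracket is the derivative of conjugation. The
  derivative of this invariance along a one-parameter group is the Jacobi identity.
\<close>

lemma jacobi: "bracket gmul (bracket gmul x y) z = bracket gmul x (bracket gmul y z) - bracket gmul y (bracket gmul x z)"
proof -
  \<comment> \<open>invariance of the bracket under conjugation\<close>
  have conj: "bracket gmul (Ad p y) z = Ad p (bracket gmul y (Ad (- p) z))" for p y z
  proof -
    have "((\<lambda>t. Ad p (Ad (t *\<^sub>R y) (Ad (- p) z))) has_vector_derivative Ad p (bracket gmul y (Ad (- p) z))) (at 0)"
      by (rule bounded_linear.has_vector_derivative[OF linear_conv_bounded_linear[THEN iffD1, OF linear_Ad] Ad_has_vector_derivative_0])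
    moreover have "Ad p (Ad (t *\<^sub>R y) (Ad (- p) z)) = Ad (t *\<^sub>R Ad p y) z" for t
      by (simp only: Ad_Ad Ad_simps(4)[symmetric]) (simp add: Ad_def gmul_assoc)
    ultimately show ?thesis
      using vector_derivative_unique_at[OF Ad_has_vector_derivative_0[of "Ad p y" z]] by simp
  qed
  define f where "f t = bracket gmul y (Ad (- (t *\<^sub>R x)) z)" for t
  have "((\<lambda>t. bracket gmul (Ad (t *\<^sub>R x) y) z) has_vector_derivative bracket gmul (bracket gmul x y) z) (at 0)"
    by (rule bounded_linear.has_vector_derivative[OF linear_conv_bounded_linear[THEN iffD1, OF linear_bracket_left] Ad_has_vector_derivative_0])
  hence "((\<lambda>t. bracket gmul (Ad (t *\<^sub>R x) y) (Ad (t *\<^sub>R x) (Ad (- (t *\<^sub>R x)) z))) has_vector_derivative bracket gmul (bracket gmul x y) z) (at 0)"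
    by simp
  hence 1: "((\<lambda>t. Ad (t *\<^sub>R x) (f t)) has_vector_derivative bracket gmul (bracket gmul x y) z) (at 0)"
    by (simp add: conj f_def)
  have f': "(f has_vector_derivative bracket gmul y (- bracket gmul x z)) (at 0)"
  proof -
    have "((\<lambda>t. Ad (t *\<^sub>R (- x)) z) has_vector_derivative bracket gmul (- x) z) (at 0)"
      by (rule Ad_has_vector_derivative_0)
    from bounded_linear.has_vector_derivative[OF linear_conv_bounded_linear[THEN iffD1, OF linear_bracket_right] this, of y]
    show ?thesis by (simp add: f_def[abs_def] linear_neg[OF linear_bracket_left])
  qed
  have f0: "f 0 = bracket gmul y z" by (simp add: f_def)
  have expand: "Ad (t *\<^sub>R x) (f t) = (\<Sum>b\<in>Basis. (f t \<bullet> b) *\<^sub>R Ad (t *\<^sub>R x) b)" for t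
    by (rule linear_basis_expansion[OF linear_Ad])
  have "((\<lambda>t. Ad (t *\<^sub>R x) (f t)) has_vector_derivative
     (\<Sum>b\<in>Basis. (f 0 \<bullet> b) *\<^sub>R bracket gmul x b + (bracket gmul y (- bracket gmul x z) \<bullet> b) *\<^sub>R Ad (0 *\<^sub>R x) b)) (at 0)"
    unfolding expand
    by (intro has_vector_derivative_sum has_vector_derivative_scaleR Ad_has_vector_derivative_0)
       (rule bounded_linear.has_vector_derivative[OF bounded_linear_inner_left f', unfolded has_real_derivative_iff_has_vector_derivative[symmetric]])
  also have "(\<Sum>b\<in>Basis. (f 0 \<bullet> b) *\<^sub>R bracket gmul x b + (bracket gmul y (- bracket gmul x z) \<bullet> b) *\<^sub>R Ad (0 *\<^sub>R x) b)
     = bracket gmul x (f 0) + bracket gmul y (- bracket gmul x z)"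
    unfolding sum.distrib linear_basis_expansion[OF linear_bracket_right, of x "f 0"] by (simp add: euclidean_representation)
  finally show ?thesis using vector_derivative_unique_at[OF 1] by (simp add: f0 linear_neg[OF linear_bracket_right])
qed

section \<open>Nilpotency\<close>

lemma subspace_lower_central: "subspace (lower_central gmul i)"
  by (cases i) (auto simp: set_bracket_def)

lemma bracket_lower_central: "z \<in> lower_central gmul i \<Longrightarrow> bracket gmul p z \<in> lower_central gmul (Suc i)"
  by (auto simp: set_bracket_def intro!: span_base)

lemma lower_central_decreasing: "lower_central gmul (Suc i) \<subseteq> lower_central gmul i"
proof (induction i)
  case (Suc i)
  show ?case unfolding lower_central.simps(2)[of gmul "Suc i"] set_bracket_def
  proof (rule span_minimal)
    show "{bracket gmul a b |a b. a \<in> UNIV \<and> b \<in> lower_central gmul (Suc i)} \<subseteq> lower_central gmul (Suc i)"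
      using Suc.IH bracket_lower_central by blast
  qed (rule subspace_lower_central)
qed auto

lemma iterated_bracket_lower_central: "(bracket gmul p ^^ k) z \<in> lower_central gmul k"
  by (induction k) (auto simp del: lower_central.simps(2) simp: bracket_lower_central)

lemma iterated_bracket_0: "(bracket gmul p ^^ r) z = 0"
  using iterated_bracket_lower_central[of r p z] nilpotent(2) by simp

text \<open>
  \<open>W\<close> and \<open>W'\<close> are subspaces such that bracketing takes \<open>W\<close>
  into \<open>W'\<close>. Modulo \<open>W'\<close> the group law is additive in directions of
  \<open>W\<close>, which is what this part and the next one establish. Two chains of such pairs
  matter: consecutive terms of the lower central series, and consecutive ideals of the Malcev flag.
\<close>

definition ideal_pair :: "(real, 'n) vec set \<Rightarrow> (real, 'n) vec set \<Rightarrow> bool" where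
  "ideal_pair W W' \<longleftrightarrow> subspace W \<and> subspace W' \<and> W' \<subseteq> W \<and> (\<forall>p. \<forall>z\<in>W. bracket gmul p z \<in> W')"

lemma ideal_pair_self: "ideal_pair W W' \<Longrightarrow> ideal_pair W' W'"
  unfolding ideal_pair_def by blast

lemma ideal_pair_lower_central: "ideal_pair (lower_central gmul i) (lower_central gmul (Suc i))"
  unfolding ideal_pair_def
  using subspace_lower_central lower_central_decreasing bracket_lower_central by blast

lemma linear_iterated_bracket: "linear (bracket gmul p ^^ k)"
  by (induction k) (auto simp: linear_iff bracket_simps)

lemma iterated_bracket_Ad_derivative:
  "((\<lambda>t. (bracket gmul p ^^ k) (Ad (t *\<^sub>R p) z)) has_vector_derivative (bracket gmul p ^^ Suc k) (Ad (s *\<^sub>R p) z)) (at s)"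
  using bounded_linear.has_vector_derivative[OF linear_conv_bounded_linear[THEN iffD1, OF linear_iterated_bracket] Ad_has_vector_derivative]
  by (simp only: funpow_Suc_right o_def)

text \<open>
  The \<open>k\<close>-th iterated bracket with \<open>p\<close> along \<open>t \<mapsto> Ad (t p)
  z\<close> has the next one as its derivative, and the \<open>r\<close>-th one vanishes. Downward
  induction on \<open>k\<close> with \<open>increment_in_subspace\<close> replaces the exponential
  series of the adjoint representation.
\<close>

lemma Ad_minus_in:
  assumes W: "ideal_pair W W'" and z: "z \<in> W"
  shows "Ad p z - z \<in> W'"
proof -
  have W': "subspace W'" and br: "\<And>z. z \<in> W \<Longrightarrow> bracket gmul p z \<in> W'" and sub: "W' \<subseteq> W"
    using W by (auto simp: ideal_pair_def)
  have it: "(bracket gmul p ^^ Suc k) z \<in> W'" for k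
    by (induction k) (use br z sub in auto)
  have "\<forall>t. (bracket gmul p ^^ Suc k) (Ad (t *\<^sub>R p) z) \<in> W'" if "k \<le> r" for k
    using that
  proof (induction k rule: inc_induct)
    case base
    show ?case using iterated_bracket_0 subspace_0[OF W'] by (simp add: bracket_simps)
  next
    case (step k)
    show ?case
    proof
      fix t :: real
      have "(bracket gmul p ^^ Suc k) (Ad (t *\<^sub>R p) z) - (bracket gmul p ^^ Suc k) (Ad (0 *\<^sub>R p) z) \<in> W'"
        by (rule increment_in_subspace[OF W' iterated_bracket_Ad_derivative]) (use step.IH in blast)
      from subspace_add[OF W' this it[of k]]
      show "(bracket gmul p ^^ Suc k) (Ad (t *\<^sub>R p) z) \<in> W'" by simp
    qed
  qed
  from this[of 0] have d: "bracket gmul p (Ad (t *\<^sub>R p) z) \<in> W'" for t by simp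
  have "Ad (1 *\<^sub>R p) z - Ad (0 *\<^sub>R p) z \<in> W'"
    by (rule increment_in_subspace[OF W' Ad_has_vector_derivative d])
  thus ?thesis by simp
qed

text \<open>
  The second order expansion: the difference between \<open>Ad (t p) z\<close> and \<open>z + t [p,
  z]\<close> has the derivative \<open>[p, Ad (t p) z - z]\<close>, which lies one step deeper.
\<close>

lemma Ad_minus_bracket_in:
  assumes W: "ideal_pair W W'" and W2: "ideal_pair W' W''" and z: "z \<in> W"
  shows "Ad p z - z - bracket gmul p z \<in> W''"
proof -
  have W'': "subspace W''" using W2 by (auto simp: ideal_pair_def)
  have "(Ad (1 *\<^sub>R p) z - 1 *\<^sub>R bracket gmul p z) - (Ad (0 *\<^sub>R p) z - 0 *\<^sub>R bracket gmul p z) \<in> W''"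
  proof (rule increment_in_subspace[OF W''])
    show "((\<lambda>t. Ad (t *\<^sub>R p) z - t *\<^sub>R bracket gmul p z) has_vector_derivative
       (bracket gmul p (Ad (t *\<^sub>R p) z - z))) (at t)" for t
      unfolding bracket_simps by (rule has_vector_derivative_diff[OF Ad_has_vector_derivative]) (auto intro!: derivative_eq_intros)
    show "bracket gmul p (Ad (t *\<^sub>R p) z - z) \<in> W''" for t
      using Ad_minus_in[OF W z] W2 by (auto simp: ideal_pair_def)
  qed
  thus ?thesis by (simp add: algebra_simps)
qed

section \<open>The differential of the group law modulo ideals\<close>

text \<open>
  This is the derivative at \<open>e = 0\<close> of the factorization
  \<open>(p\<^sup>n\<^sup>+\<^sup>1)\<inverse> q\<^sup>n\<^sup>+\<^sup>1 = p\<inverse>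
  ((p\<^sup>n)\<inverse> q\<^sup>n) p \<odot> p\<inverse> q\<close> for \<open>q = p + e z\<close>,
  powers of an element being its multiples.
\<close>

lemma pull_back_power_step:
  "LD (- (real (Suc n) *\<^sub>R p)) (real (Suc n) *\<^sub>R p) (real (Suc n) *\<^sub>R z)
     = Ad (- p) (LD (- (real n *\<^sub>R p)) (real n *\<^sub>R p) (real n *\<^sub>R z)) + LD (- p) p z"
proof -
  define a where "a n e = - (real n *\<^sub>R p) \<odot> (real n *\<^sub>R (p + e *\<^sub>R z))" for n :: nat and e :: real
  have d: "(a n has_vector_derivative LD (- (real n *\<^sub>R p)) (real n *\<^sub>R p) (real n *\<^sub>R z)) (at 0)" for n
    unfolding a_def
    by (rule has_vector_derivative_eq_rhs[OF has_vector_derivative_gmul]) (auto intro!: derivative_eq_intros simp: RD_simps)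
  have a0: "a n 0 = 0" for n by (simp add: a_def)
  have rec: "a (Suc n) e = Ad (- p) (a n e) \<odot> a 1 e" for e
  proof -
    define q where "q = p + e *\<^sub>R z"
    have "real (Suc n) *\<^sub>R q = real n *\<^sub>R q \<odot> q" for q
      using exponential_coordinates[of "real n" q 1] by (simp add: add.commute)
    moreover have "- (real (Suc n) *\<^sub>R p) = - p \<odot> - (real n *\<^sub>R p)"
      using exponential_coordinates[of "-1" p "- real n"] by (simp add: algebra_simps)
    ultimately have "a (Suc n) e = - p \<odot> - (real n *\<^sub>R p) \<odot> (real n *\<^sub>R q \<odot> q)"
      by (simp only: a_def q_def[symmetric])
    thus ?thesis by (simp add: Ad_def a_def q_def[symmetric] gmul_assoc)
  qed
  have "((\<lambda>e. Ad (- p) (a n e) \<odot> a 1 e) has_vector_derivative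
     LD (Ad (- p) (a n 0)) (a 1 0) (LD (- (real 1 *\<^sub>R p)) (real 1 *\<^sub>R p) (real 1 *\<^sub>R z))
     + RD (a 1 0) (Ad (- p) (a n 0)) (Ad (- p) (LD (- (real n *\<^sub>R p)) (real n *\<^sub>R p) (real n *\<^sub>R z)))) (at 0)"
    by (intro has_vector_derivative_gmul d bounded_linear.has_vector_derivative[OF linear_conv_bounded_linear[THEN iffD1, OF linear_Ad]])
  hence "(a (Suc n) has_vector_derivative
     LD (- p) p z + Ad (- p) (LD (- (real n *\<^sub>R p)) (real n *\<^sub>R p) (real n *\<^sub>R z))) (at 0)"
    by (simp add: a0 rec[abs_def])
  from vector_derivative_unique_at[OF d this] show ?thesis by (simp add: add.commute)
qed

text \<open>
  A discrete form of the formula for the differential of the exponential map,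
  \<open>\<integral>\<^sub>0\<^sup>1 Ad (- s p) z ds\<close>, in which no integral has to be
  defined.
\<close>

lemma pull_back_power:
  "LD (- (real n *\<^sub>R p)) (real n *\<^sub>R p) (real n *\<^sub>R z) = (\<Sum>k<n. Ad (- (real k *\<^sub>R p)) (LD (- p) p z))"
proof (induction n)
  case (Suc n)
  have "Ad (- p) (Ad (- (real k *\<^sub>R p)) y) = Ad (- (real (Suc k) *\<^sub>R p)) y" for k y
  proof -
    have "- p \<odot> - (real k *\<^sub>R p) = - (real (Suc k) *\<^sub>R p)"
      using exponential_coordinates[of "-1" p "- real k"] by (simp add: algebra_simps)
    thus ?thesis by (simp add: Ad_Ad)
  qed
  thus ?case unfolding pull_back_power_step Suc.IH sum.lessThan_Suc_shift
    by (simp add: Ad_simps add.commute)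
qed (simp add: LD_simps)

lemma Ad_bounded_segment:
  obtains C where "C > 0" "\<And>s w. s \<in> {-1..1} \<Longrightarrow> norm (Ad (s *\<^sub>R p) w) \<le> C * norm w"
proof (rule linear_family_bounded[of "{-1..1::real}" "\<lambda>s. Ad (s *\<^sub>R p)"])
  show "continuous_on {-1..1} (\<lambda>s::real. Ad (s *\<^sub>R p) b)" for b
    by (intro Ck_1_continuous Ck_1_Ad Ck_1_const Ck_1_bounded_linear bounded_linear_scaleR_left)
qed (auto intro: linear_Ad)

text \<open>
  Subdividing \<open>p\<close> into \<open>n\<close> equal parts writes the left-hand side, up to an
  error that vanishes as \<open>n\<close> grows, as the mean of \<open>Ad (- k p / n) z\<close> over
  \<open>k < n\<close>. Each of these differs from \<open>z\<close> by an element of the closed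
  subspace \<open>W'\<close>.
\<close>

lemma pull_back_minus_in:
  assumes W: "ideal_pair W W'" and z: "z \<in> W"
  shows "LD (- p) p z - z \<in> W'"
proof -
  have W': "subspace W'" using W by (auto simp: ideal_pair_def)
  obtain C where C: "C > 0" "\<And>s w. s \<in> {-1..1} \<Longrightarrow> norm (Ad (s *\<^sub>R p) w) \<le> C * norm w"
    using Ad_bounded_segment[of p] by blast
  define q where "q n = (1 / real (Suc n)) *\<^sub>R p" for n
  define y where "y n = LD (- q n) (q n) z" for n
  \<comment> \<open>the mean in which the differential \<open>y n\<close> at \<open>q n\<close> is replaced by its limit \<open>z\<close>\<close>
  define u where "u n = (1 / real (Suc n)) *\<^sub>R (\<Sum>k<Suc n. Ad (- (real k *\<^sub>R q n)) z)" for n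
  have eq: "LD (- p) p z = (1 / real (Suc n)) *\<^sub>R (\<Sum>k<Suc n. Ad (- (real k *\<^sub>R q n)) (y n))" for n
  proof -
    have "real (Suc n) *\<^sub>R q n = p" by (simp add: q_def del: of_nat_Suc)
    hence "real (Suc n) *\<^sub>R LD (- p) p z = (\<Sum>k<Suc n. Ad (- (real k *\<^sub>R q n)) (y n))"
      using pull_back_power[of "Suc n" "q n" z] by (simp only: y_def LD_simps)
    hence "(1 / real (Suc n)) *\<^sub>R real (Suc n) *\<^sub>R LD (- p) p z = (1 / real (Suc n)) *\<^sub>R (\<Sum>k<Suc n. Ad (- (real k *\<^sub>R q n)) (y n))"
      by (simp only:)
    thus ?thesis by (simp del: of_nat_Suc sum.lessThan_Suc)
  qed
  have y_lim: "y \<longlonglongrightarrow> z"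
  proof -
    have "continuous_on UNIV (\<lambda>q. LD (- q) q z)" by (intro continuous_on_LD continuous_intros)
    hence "isCont (\<lambda>q. LD (- q) q z) 0" by (simp add: continuous_on_eq_continuous_at)
    moreover have "q \<longlonglongrightarrow> 0" unfolding q_def
      using tendsto_scaleR[OF LIMSEQ_inverse_real_of_nat tendsto_const[of p]] by (simp add: inverse_eq_divide)
    ultimately have "(\<lambda>n. LD (- q n) (q n) z) \<longlonglongrightarrow> LD (- 0) 0 z" by (rule isCont_tendsto_compose)
    thus ?thesis by (simp add: y_def[abs_def])
  qed
  have bound: "norm (LD (- p) p z - u n) \<le> C * norm (y n - z)" for n
  proof -
    have "LD (- p) p z - u n = (1 / real (Suc n)) *\<^sub>R (\<Sum>k<Suc n. Ad (- (real k *\<^sub>R q n)) (y n - z))"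
      unfolding eq[of n] u_def Ad_simps sum_subtractf scaleR_diff_right ..
    also have "norm \<dots> \<le> (1 / real (Suc n)) * (\<Sum>k<Suc n. C * norm (y n - z))"
    proof -
      have "norm (Ad (- (real k *\<^sub>R q n)) (y n - z)) \<le> C * norm (y n - z)" if "k < Suc n" for k
        using C(2)[of "- (real k / real (Suc n))" "y n - z"] that by (simp add: q_def divide_simps)
      hence "norm (\<Sum>k<Suc n. Ad (- (real k *\<^sub>R q n)) (y n - z)) \<le> (\<Sum>k<Suc n. C * norm (y n - z))"
        by (intro sum_norm_le) auto
      thus ?thesis unfolding norm_scaleR by (intro mult_mono) auto
    qed
    also have "\<dots> = C * norm (y n - z)" by (simp del: sum.lessThan_Suc)
    finally show ?thesis .
  qed
  have "(\<lambda>n. C * norm (y n - z)) \<longlonglongrightarrow> C * norm (z - z)" by (intro tendsto_intros y_lim)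
  hence lim0: "(\<lambda>n. C * norm (y n - z)) \<longlonglongrightarrow> 0" by simp
  have "\<forall>\<^sub>F n in sequentially. norm (LD (- p) p z - u n) \<le> C * norm (y n - z)"
    using bound by (intro always_eventually) blast
  hence "(\<lambda>n. LD (- p) p z - u n) \<longlonglongrightarrow> 0" using lim0 by (rule Lim_null_comparison)
  from tendsto_diff[OF tendsto_const[of "LD (- p) p z - z"] this]
  have "(\<lambda>n. u n - z) \<longlonglongrightarrow> LD (- p) p z - z" by simp
  note lim = this
  have "u n - z \<in> W'" for n
  proof -
    have "u n - z = (1 / real (Suc n)) *\<^sub>R (\<Sum>k<Suc n. Ad (- (real k *\<^sub>R q n)) z - z)"
      unfolding sum_subtractf u_def by (simp add: scaleR_diff_right sum_constant_scaleR del: sum_constant sum.lessThan_Suc of_nat_Suc)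
    thus ?thesis using Ad_minus_in[OF W z] by (auto intro!: subspace_scale[OF W'] subspace_sum[OF W'] simp del: sum.lessThan_Suc)
  qed
  thus ?thesis using closed_sequentially[OF closed_subspace[OF W'] _ lim] by simp
qed

text \<open>
  The inverse map takes \<open>W'\<close> into itself injectively, hence onto itself by finite
  dimension.
\<close>

lemma left_field_in_ideal:
  assumes W': "ideal_pair W' W'" and w: "w \<in> W'"
  shows "LD p 0 w \<in> W'"
proof -
  have s: "subspace W'" using W' by (auto simp: ideal_pair_def)
  let ?y = "LD (- p) p"
  have sub: "?y ` W' \<subseteq> W'"
    using pull_back_minus_in[OF W'] subspace_add[OF s] by (metis diff_add_cancel image_subsetI)
  have "inj_on ?y W'" by (rule inj_on_inverseI[of _ "LD p 0"]) simp
  hence "dim (?y ` W') = dim W'" using dim_image_eq[OF linear_LD] span_eq_iff[of W'] s by metis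
  hence "?y ` W' = W'" using subspace_dim_equal[of "?y ` W'" W'] sub s linear_subspace_image[OF linear_LD s] by simp
  then obtain w' where "w' \<in> W'" "w = ?y w'" using w by blast
  thus ?thesis by simp
qed

lemma left_field_minus_in:
  assumes W: "ideal_pair W W'" and z: "z \<in> W"
  shows "LD p 0 z - z \<in> W'"
proof -
  have "LD p 0 (LD (- p) p z - z) \<in> W'"
    by (rule left_field_in_ideal[OF ideal_pair_self[OF W] pull_back_minus_in[OF W z]])
  hence "z - LD p 0 z \<in> W'" by (simp add: LD_simps(3))
  thus ?thesis using subspace_neg W by (fastforce simp: ideal_pair_def)
qed

lemma LD_minus_in:
  assumes W: "ideal_pair W W'" and z: "z \<in> W"
  shows "LD q x z - z \<in> W'"
proof -
  have s: "subspace W'" and sub: "W' \<subseteq> W" using W by (auto simp: ideal_pair_def)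
  let ?y = "LD (- x) x z"
  have y: "?y - z \<in> W'" by (rule pull_back_minus_in[OF W z])
  hence "?y \<in> W" using W z sub by (metis diff_add_cancel ideal_pair_def subsetD subspace_add)
  hence "LD (q \<odot> x) 0 ?y - ?y \<in> W'" by (rule left_field_minus_in[OF W])
  from subspace_add[OF s this y] show ?thesis by (simp add: LD_factor[of q x])
qed

text \<open>
  A right translation is a left translation after a conjugation, so the previous estimates combine.
\<close>

lemma RD_minus_in:
  assumes W: "ideal_pair W W'" and z: "z \<in> W"
  shows "RD q x z - z \<in> W'"
proof -
  have s: "subspace W'" and sub: "W' \<subseteq> W" using W by (auto simp: ideal_pair_def)
  let ?y = "LD (- x) x z"
  have y: "?y - z \<in> W'" by (rule pull_back_minus_in[OF W z])
  hence yW: "?y \<in> W" using W z sub by (metis diff_add_cancel ideal_pair_def subsetD subspace_add)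
  have a: "Ad (- q) ?y - ?y \<in> W'" by (rule Ad_minus_in[OF W yW])
  hence aW: "Ad (- q) ?y \<in> W" using W yW sub by (metis diff_add_cancel ideal_pair_def subsetD subspace_add)
  have b: "LD (x \<odot> q) 0 (Ad (- q) ?y) - Ad (- q) ?y \<in> W'" by (rule left_field_minus_in[OF W aW])
  have "RD q x (LD x 0 w) = LD (x \<odot> q) 0 (Ad (- q) w)" for w
  proof -
    have 1: "((\<lambda>e. x \<odot> (e *\<^sub>R w) \<odot> q) has_vector_derivative RD q (x \<odot> 0 *\<^sub>R w) (LD x (0 *\<^sub>R w) w)) (at 0)"
      by (rule has_vector_derivative_eq_rhs[OF has_vector_derivative_gmul[OF has_vector_derivative_gmul]])
         (auto intro!: derivative_eq_intros simp: RD_simps LD_simps)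
    have 2: "((\<lambda>e. x \<odot> q \<odot> (e *\<^sub>R Ad (- q) w)) has_vector_derivative LD (x \<odot> q) (0 *\<^sub>R Ad (- q) w) (Ad (- q) w)) (at 0)"
      by (rule has_vector_derivative_eq_rhs[OF has_vector_derivative_gmul])
         (auto intro!: derivative_eq_intros simp: RD_simps LD_simps)
    have eq: "(\<lambda>e. x \<odot> (e *\<^sub>R w) \<odot> q) = (\<lambda>e. x \<odot> q \<odot> (e *\<^sub>R Ad (- q) w))"
      by (simp only: Ad_simps(4)[symmetric]) (simp add: Ad_def gmul_assoc)
    show ?thesis using vector_derivative_unique_at[OF 1[unfolded eq] 2] by simp
  qed
  from this[of ?y] have "RD q x z - z = (LD (x \<odot> q) 0 (Ad (- q) ?y) - Ad (- q) ?y) + (Ad (- q) ?y - ?y) + (?y - z)" by simp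
  thus ?thesis using a b y subspace_add[OF s] by metis
qed

lemma gmul_add_left_in:
  assumes W: "ideal_pair W W'" and z: "z \<in> W"
  shows "(x + z) \<odot> q - (x \<odot> q + z) \<in> W'"
proof -
  have s: "subspace W'" using W by (auto simp: ideal_pair_def)
  have "((x + 1 *\<^sub>R z) \<odot> q - 1 *\<^sub>R z) - ((x + 0 *\<^sub>R z) \<odot> q - 0 *\<^sub>R z) \<in> W'"
  proof (rule increment_in_subspace[OF s])
    show "((\<lambda>t. (x + t *\<^sub>R z) \<odot> q - t *\<^sub>R z) has_vector_derivative RD q (x + t *\<^sub>R z) z - z) (at t)" for t
      by (rule has_vector_derivative_eq_rhs[OF has_vector_derivative_diff[OF has_vector_derivative_gmul]])
         (auto intro!: derivative_eq_intros simp: LD_simps)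
  qed (rule RD_minus_in[OF W z])
  thus ?thesis by (simp add: algebra_simps)
qed

end

section \<open>Unitriangular maps preserve Lebesgue measure\<close>

text \<open>
  A copy of the index type on which the order is declared to be a well-order. The change of
  variables formula is applied to vectors indexed by a well-ordered type; a finite linear order is
  one.
\<close>

typedef 'a wo = "UNIV :: 'a set" by auto

instantiation wo :: (linorder) linorder
begin
definition "less_eq_wo x y \<longleftrightarrow> Rep_wo x \<le> Rep_wo y"
definition "less_wo x y \<longleftrightarrow> Rep_wo x < Rep_wo y"
instance by standard (auto simp: less_eq_wo_def less_wo_def Rep_wo_inject less_le)
end

instance wo :: (finite) finite
proof
  have "(UNIV :: 'a wo set) = Abs_wo ` UNIV" by (metis Rep_wo_inverse UNIV_I surjI surj_def)
  thus "finite (UNIV :: 'a wo set)" by (metis finite finite_imageI)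
qed

instance wo :: ("{finite, linorder}") wellorder
proof
  fix P :: "'a wo \<Rightarrow> bool" and a
  assume IH: "\<And>x. (\<And>y. y < x \<Longrightarrow> P y) \<Longrightarrow> P x"
  show "P a"
  proof (induction a rule: measure_induct_rule[of "\<lambda>x. card {y. y < x}"])
    case (less x)
    have "card {z. z < y} < card {z. z < x}" if "y < x" for y
      using that by (intro psubset_card_mono) (auto intro: less_trans)
    thus ?case using less IH by blast
  qed
qed

definition to_wo :: "real ^ 'n::finite \<Rightarrow> real ^ 'n wo" where "to_wo x = (\<chi> i. x $ Rep_wo i)"
definition of_wo :: "real ^ 'n wo \<Rightarrow> real ^ 'n::finite" where "of_wo y = (\<chi> i. y $ Abs_wo i)"

lemma to_of_wo [simp]: "to_wo (of_wo y) = y" "of_wo (to_wo x) = x"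
  by (simp_all add: to_wo_def of_wo_def vec_eq_iff Abs_wo_inverse Rep_wo_inverse)

lemma linear_to_wo: "linear to_wo" and linear_of_wo: "linear of_wo"
  by (auto simp: linear_iff to_wo_def of_wo_def vec_eq_iff)

lemma axis_of_wo: "of_wo (axis k c) = axis (Rep_wo k) c"
  by (auto simp: of_wo_def axis_def vec_eq_iff Abs_wo_inverse Rep_wo_inverse)

lemma measurable_of_wo [measurable]: "of_wo \<in> borel_measurable borel"
  by (auto intro!: borel_measurable_continuous_onI linear_continuous_on simp: linear_conv_bounded_linear[symmetric] linear_of_wo)

lemma emeasure_lborel_box_vec:
  "emeasure lborel (box l (u :: real ^ 'm::finite)) = (if \<forall>i. l $ i \<le> u $ i then ennreal (\<Prod>i\<in>UNIV. u $ i - l $ i) else 0)"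
proof -
  have "(\<Prod>b\<in>Basis. (u - l) \<bullet> b) = (\<Prod>i\<in>UNIV. u $ i - l $ i)"
  proof -
    have B: "(Basis :: (real ^ 'm) set) = (\<lambda>i. axis i 1) ` UNIV" by (auto simp: Basis_vec_def)
    show ?thesis unfolding B by (subst prod.reindex) (auto simp: inj_on_def axis_eq_axis inner_axis)
  qed
  moreover have "(\<forall>b\<in>Basis. l \<bullet> b \<le> u \<bullet> b) \<longleftrightarrow> (\<forall>i. l $ i \<le> u $ i)"
    by (auto simp: Basis_vec_def inner_axis)
  ultimately show ?thesis by (simp add: emeasure_lborel_box_eq)
qed

lemma mem_box_vec: "x \<in> box l (u :: real ^ 'm::finite) \<longleftrightarrow> (\<forall>i. l $ i < x $ i \<and> x $ i < u $ i)"
  by (auto simp: mem_box Basis_vec_def inner_axis)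

lemma distr_of_wo: "distr lborel borel (of_wo :: real ^ 'n wo \<Rightarrow> real ^ 'n::finite) = lborel"
proof (rule lborel_eqI[symmetric])
  fix l u :: "real ^ 'n" assume le: "\<And>b. b \<in> Basis \<Longrightarrow> l \<bullet> b \<le> u \<bullet> b"
  have "of_wo -` box l u = box (to_wo l) (to_wo u)"
  proof -
    have "(\<forall>i. P (Abs_wo i)) \<longleftrightarrow> (\<forall>k. P k)" for P :: "'n wo \<Rightarrow> bool" by (metis Rep_wo_inverse)
    from this[of "\<lambda>k. l $ Rep_wo k < _ $ k \<and> _ $ k < u $ Rep_wo k"] show ?thesis
      by (auto simp: mem_box_vec of_wo_def to_wo_def Abs_wo_inverse)
  qed
  hence "emeasure (distr lborel borel (of_wo :: real ^ 'n wo \<Rightarrow> _)) (box l u) = emeasure lborel (box (to_wo l) (to_wo u))"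
    by (simp add: emeasure_distr)
  also have "\<dots> = emeasure lborel (box l u)"
  proof -
    have 1: "(\<forall>k. to_wo l $ k \<le> to_wo u $ k) \<longleftrightarrow> (\<forall>i. l $ i \<le> u $ i)"
      by (simp add: to_wo_def) (metis Abs_wo_inverse UNIV_I)
    have "bij Rep_wo" by (metis Abs_wo_inverse Rep_wo_inverse UNIV_I bij_def inj_on_inverseI surj_def)
    hence "(\<Prod>k\<in>UNIV. to_wo u $ k - to_wo l $ k) = (\<Prod>i\<in>UNIV. u $ i - l $ i)"
      unfolding to_wo_def vec_lambda_beta by (rule prod.reindex_bij_betw)
    thus ?thesis using 1 by (simp add: emeasure_lborel_box_vec)
  qed
  also have "\<dots> = (\<Prod>b\<in>Basis. (u - l) \<bullet> b)" using le by (simp add: emeasure_lborel_box_eq)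
  finally show "emeasure (distr lborel borel (of_wo :: real ^ 'n wo \<Rightarrow> _)) (box l u) = (\<Prod>b\<in>Basis. (u - l) \<bullet> b)" .
qed simp

lemma emeasure_to_wo_image:
  assumes A: "(A :: (real ^ 'n::finite) set) \<in> sets borel"
  shows "to_wo ` A \<in> sets borel" "emeasure lborel (to_wo ` A) = emeasure lborel A"
proof -
  have eq: "to_wo ` A = of_wo -` A \<inter> space borel" by (auto simp: image_iff) (metis to_of_wo(1))
  show "to_wo ` A \<in> sets borel" unfolding eq by (rule measurable_sets[OF measurable_of_wo A])
  have "emeasure lborel A = emeasure (distr lborel borel of_wo) A" by (simp only: distr_of_wo)
  also have "\<dots> = emeasure lborel (to_wo ` A)" unfolding eq by (subst emeasure_distr) (use A in auto)
  finally show "emeasure lborel (to_wo ` A) = emeasure lborel A" ..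
qed

text \<open>
  The inverse map has Jacobian determinant \<open>1\<close>, so the change of variables formula
  gives the preimage of a box under \<open>f\<close> the measure of the box. Boxes determine
  Lebesgue measure.
\<close>

lemma unitriangular_measure_preserving:
  fixes f g :: "(real, 'n::{finite,linorder}) vec \<Rightarrow> (real, 'n) vec"
  assumes inv: "\<And>x. f (g x) = x" "\<And>x. g (f x) = x" and cont: "continuous_on UNIV f"
    and g': "\<And>x. (g has_derivative g' x) (at x)"
    and tri: "\<And>x i j. i \<le> j \<Longrightarrow> g' x (axis j 1) $ i = (if i = j then 1 else 0)"
  shows "distr lborel borel f = lborel"
proof (rule lborel_eqI[symmetric])
  fix l u :: "(real, 'n) vec" assume le: "\<And>b. b \<in> Basis \<Longrightarrow> l \<bullet> b \<le> u \<bullet> b"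
  define G where "G = to_wo \<circ> g \<circ> of_wo"
  define G' where "G' y = to_wo \<circ> g' (of_wo y) \<circ> of_wo" for y
  have G': "(G has_derivative G' y) (at y)" for y
    unfolding G_def G'_def
    by (intro diff_chain_at linear_imp_has_derivative[OF linear_of_wo] linear_imp_has_derivative[OF linear_to_wo] g')
  have det: "det (matrix (G' y)) = 1" for y
  proof -
    have M: "matrix (G' y) $ k $ m = g' (of_wo y) (axis (Rep_wo m) 1) $ Rep_wo k" for k m
      by (simp add: matrix_def G'_def axis_of_wo) (simp add: to_wo_def)
    have "matrix (G' y) $ k $ m = 0" if "k < m" for k m
      using tri[of "Rep_wo k" "Rep_wo m"] that by (auto simp: M less_wo_def)
    hence "det (matrix (G' y)) = (\<Prod>k\<in>UNIV. matrix (G' y) $ k $ k)" by (rule det_lowerdiagonal)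
    also have "\<dots> = 1" by (simp add: M tri)
    finally show ?thesis .
  qed
  let ?B = "box l u" and ?S = "to_wo ` box l u"
  have S: "?S \<in> sets borel" "emeasure lborel ?S = emeasure lborel ?B" using emeasure_to_wo_image[of ?B] by auto
  have fin: "emeasure lborel ?B < \<infinity>" using emeasure_lborel_box_finite by blast
  have Slm: "?S \<in> lmeasurable" using S fin by (auto simp: fmeasurable_def)
  have SL: "?S \<in> sets lebesgue" using S(1) by simp
  have inj: "inj_on G ?S" unfolding G_def o_def
    by (intro inj_onI) (metis inv(1) to_of_wo)
  have "((\<lambda>x. \<bar>det (matrix (G' x))\<bar>) has_integral measure lebesgue ?S) ?S"
    using has_integral_measure_lborel[OF S(1)] S fin by (simp add: det measure_completion)
  hence img: "G ` ?S \<in> lmeasurable" "measure lebesgue (G ` ?S) = measure lebesgue ?S"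
    using has_measure_differentiable_image[OF SL has_derivative_at_withinI[OF G'] inj] by blast+
  have eqB: "f -` ?B = g ` ?B" by (auto simp: inv image_iff) (metis inv(2))
  have fm: "f \<in> borel_measurable borel" using cont by (rule borel_measurable_continuous_onI)
  have gB: "g ` ?B \<in> sets borel" unfolding eqB[symmetric]
    using measurable_sets[OF fm, of ?B] by simp
  have GS: "G ` ?S = to_wo ` (g ` ?B)" by (auto simp: G_def image_image)
  have "emeasure (distr lborel borel f) ?B = emeasure lborel (g ` ?B)"
    using fm by (simp add: emeasure_distr eqB)
  also have "\<dots> = emeasure lborel (G ` ?S)" unfolding GS using emeasure_to_wo_image[OF gB] by simp
  also have "\<dots> = emeasure lebesgue (G ` ?S)" using emeasure_to_wo_image[OF gB] by (simp add: GS)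
  also have "\<dots> = emeasure lebesgue ?S"
    using img Slm by (simp add: emeasure_eq_measure2 del: emeasure_completion)
  also have "\<dots> = emeasure lborel ?B" using S by simp
  also have "\<dots> = (\<Prod>b\<in>Basis. (u - l) \<bullet> b)" using le by (simp add: emeasure_lborel_box_eq)
  finally show "emeasure (distr lborel borel f) ?B = (\<Prod>b\<in>Basis. (u - l) \<bullet> b)" .
qed simp

section \<open>Invariance of Lebesgue measure\<close>

text \<open>
  Every permutation other than the identity moves some index upwards, and the corresponding factor
  of its term in the Leibniz formula vanishes.
\<close>

lemma det_unitriangular:
  fixes A :: "real ^ 'n::{finite,linorder} ^ 'n::{finite,linorder}"
  assumes tri: "\<And>i j. i \<le> j \<Longrightarrow> A $ i $ j = (if i = j then 1 else 0)"
  shows "det A = 1"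
proof -
  have p0: "(\<Prod>i\<in>UNIV. A $ i $ p i) = 0" if p: "p permutes UNIV" "p \<noteq> id" for p
  proof -
    have "\<exists>i. i < p i"
    proof (rule ccontr)
      assume "\<not> ?thesis"
      hence le: "p i \<le> i" for i by (simp add: not_less)
      have ne: "{i. p i \<noteq> i} \<noteq> {}" using p(2) by (auto simp: fun_eq_iff)
      define i where "i = Min {i. p i \<noteq> i}"
      have "p i \<noteq> i" using Min_in[OF _ ne] by (simp add: i_def)
      hence "p i < i" using le[of i] by simp
      have "p (p i) = p i"
      proof (rule ccontr)
        assume "p (p i) \<noteq> p i"
        hence "i \<le> p i" unfolding i_def by (intro Min_le) auto
        thus False using \<open>p i < i\<close> by simp
      qed
      thus False using \<open>p i \<noteq> i\<close> permutes_inj[OF p(1)] by (simp add: inj_eq)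
    qed
    then obtain i where "i < p i" by blast
    hence "A $ i $ p i = 0" using tri[of i "p i"] by simp
    thus ?thesis by (auto intro: prod_zero)
  qed
  have "det A = (\<Sum>p\<in>{id}. of_int (sign p) * (\<Prod>i\<in>UNIV. A $ i $ p i))"
    unfolding det_def
    by (rule sum.mono_neutral_right) (auto simp: permutes_id p0 finite_permutations)
  also have "\<dots> = 1" by (simp add: tri sign_id)
  finally show ?thesis .
qed

context nilpotent_lie_group
begin

lemma tail_span_iff:
  fixes x :: "(real, 'n) vec" shows "x \<in> tail_span j \<longleftrightarrow> (\<forall>i<j. x $ i = 0)"
proof
  assume "x \<in> tail_span j"
  moreover have "subspace {x :: (real, 'n) vec. \<forall>i<j. x $ i = 0}" by (auto simp: subspace_def)
  ultimately show "\<forall>i<j. x $ i = 0"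
    unfolding tail_span_def using span_minimal[of "{axis i 1 |i. j \<le> i}" "{x :: (real, 'n) vec. \<forall>i<j. x $ i = 0}"]
    by (force simp: axis_def)
next
  assume x: "\<forall>i<j. x $ i = 0"
  have "x = (\<Sum>i\<in>UNIV. x $ i *\<^sub>R axis i 1)"
    using basis_expansion[of x] by (simp add: scalar_mult_eq_scaleR)
  moreover have "x $ i *\<^sub>R axis i 1 \<in> tail_span j" for i
  proof (cases "i < j")
    case False
    hence "axis i 1 \<in> {axis i (1::real) |i. j \<le> i}" by auto
    thus ?thesis unfolding tail_span_def by (intro span_scale span_base)
  qed (use x in \<open>simp add: tail_span_def span_zero\<close>)
  ultimately show "x \<in> tail_span j"
    using span_sum unfolding tail_span_def by (metis (no_types, lifting))
qed

definition above :: "'n \<Rightarrow> (real, 'n) vec set" where "above j = {x. \<forall>i\<le>j. x $ i = 0}"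

lemma subspace_above: "subspace (above j)" and subspace_tail_span: "subspace (tail_span j)"
  by (auto simp: subspace_def above_def tail_span_def) (auto intro: span_add span_scale span_zero)

lemma bracket_tail: "z \<in> tail_span j \<Longrightarrow> bracket gmul p z \<in> tail_span j"
  using malcev_ideal[of j] by (auto simp: lie_ideal_def)

lemma bracket_above:
  assumes "z \<in> above j" shows "bracket gmul p z \<in> above j"
proof -
  have "bracket gmul p z = (\<Sum>i\<in>UNIV. z $ i *\<^sub>R bracket gmul p (axis i 1))"
    using basis_expansion[of z] linear_sum[OF linear_bracket_right, of p "\<lambda>i. z $ i *\<^sub>R axis i 1" UNIV]
    by (simp add: scalar_mult_eq_scaleR bracket_simps)
  moreover have "z $ i *\<^sub>R bracket gmul p (axis i 1) \<in> above j" for i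
  proof (cases "i \<le> j")
    case True
    thus ?thesis using assms subspace_0[OF subspace_above] by (simp add: above_def)
  next
    case False
    have "bracket gmul p (axis i 1) \<in> tail_span i" by (rule bracket_tail) (auto simp: tail_span_iff axis_def)
    thus ?thesis using False by (auto simp: tail_span_iff above_def)
  qed
  ultimately show ?thesis by (simp add: subspace_sum[OF subspace_above])
qed

text \<open>
  The diagonal entry \<open>l\<close> is an eigenvalue of a nilpotent map: the \<open>r\<close>-th
  iterate multiplies \<open>axis j 1\<close> by \<open>l\<^sup>r\<close> modulo the next ideal and
  vanishes. So brackets take each ideal of the Malcev flag into the next smaller one.
\<close>

lemma bracket_diagonal: "bracket gmul p (axis j 1) $ j = 0"
proof -
  define l where "l = bracket gmul p (axis j 1) $ j"
  have e: "axis j 1 \<in> tail_span j" by (auto simp: tail_span_iff axis_def)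
  have 1: "bracket gmul p (axis j 1) - l *\<^sub>R axis j 1 \<in> above j"
    using bracket_tail[OF e, of p] by (auto simp: above_def tail_span_iff l_def axis_def le_less)
  have "(bracket gmul p ^^ k) (axis j 1) - l ^ k *\<^sub>R axis j 1 \<in> above j" for k
  proof (induction k)
    case (Suc k)
    have "(bracket gmul p ^^ Suc k) (axis j 1) - l ^ Suc k *\<^sub>R axis j 1
      = bracket gmul p ((bracket gmul p ^^ k) (axis j 1) - l ^ k *\<^sub>R axis j 1) + l ^ k *\<^sub>R (bracket gmul p (axis j 1) - l *\<^sub>R axis j 1)"
      by (simp add: bracket_simps algebra_simps)
    thus ?case using subspace_add[OF subspace_above bracket_above[OF Suc.IH] subspace_scale[OF subspace_above 1]] by metis
  qed (use subspace_0[OF subspace_above] in simp)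
  from this[of r] have "l ^ r *\<^sub>R axis j 1 \<in> above j"
    using subspace_neg[OF subspace_above] by (fastforce simp: iterated_bracket_0)
  hence "l ^ r = 0" by (auto simp: above_def axis_def)
  thus ?thesis by (simp add: l_def)
qed

lemma ideal_pair_tail: "ideal_pair (tail_span j) (above j)"
  unfolding ideal_pair_def
proof (intro conjI subspace_above subspace_tail_span allI ballI)
  show "above j \<subseteq> tail_span j" by (auto simp: above_def tail_span_iff)
  fix p z assume z: "z \<in> tail_span j"
  have "z - z $ j *\<^sub>R axis j 1 \<in> above j" using z by (auto simp: above_def tail_span_iff axis_def le_less)
  from bracket_above[OF this, of p] bracket_tail[OF z, of p] show "bracket gmul p z \<in> above j"
    by (auto simp: above_def tail_span_iff bracket_simps bracket_diagonal le_less)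
qed

lemma axis_in_tail_span: "axis (j :: 'n) c \<in> tail_span j"
  by (auto simp: tail_span_iff axis_def)

lemma LD_triangular: "i \<le> j \<Longrightarrow> LD q x (axis j 1) $ i = (if i = j then 1 else 0)"
  using LD_minus_in[OF ideal_pair_tail axis_in_tail_span, of q x j 1] by (auto simp: above_def axis_def)

lemma RD_triangular: "i \<le> j \<Longrightarrow> RD q x (axis j 1) $ i = (if i = j then 1 else 0)"
  using RD_minus_in[OF ideal_pair_tail axis_in_tail_span, of q x j 1] by (auto simp: above_def axis_def)

lemma distr_lborel_left: "distr lborel borel (\<lambda>x. q \<odot> x) = lborel"
  by (rule unitriangular_measure_preserving[where g = "\<lambda>x. - q \<odot> x" and g' = "LD (- q)"])
     (auto intro!: has_derivative_gmul_left continuous_on_gmul continuous_intros simp: LD_triangular)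

lemma distr_lborel_right: "distr lborel borel (\<lambda>x. x \<odot> q) = lborel"
  by (rule unitriangular_measure_preserving[where g = "\<lambda>x. x \<odot> - q" and g' = "RD (- q)"])
     (auto intro!: has_derivative_gmul_right continuous_on_gmul continuous_intros simp: RD_triangular)

text \<open>
  Translating the base point along \<open>axis i 1\<close> changes the \<open>i\<close>-th
  coordinate of every product \<open>x \<odot> q\<close> by the same amount, so the
  \<open>i\<close>-th coefficient of a left-invariant field is constant in this direction.
\<close>

lemma left_field_divergence_free: "FD (\<lambda>p. LD p 0 v) x (axis i 1) $ i = 0"
proof -
  have c: "((x + e *\<^sub>R axis i 1) \<odot> q) $ i = (x \<odot> q) $ i + e" for e :: real and x q
    using gmul_add_left_in[OF ideal_pair_tail axis_in_tail_span, of x i e q] 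
    by (auto simp: above_def axis_def scaleR_vec_def if_distrib cong: if_cong)
  have d: "((\<lambda>t. (x \<odot> t *\<^sub>R v) $ i) has_vector_derivative LD x 0 v $ i) (at 0)" for x
  proof -
    have "((\<lambda>t. x \<odot> t *\<^sub>R v) has_vector_derivative LD x (0 *\<^sub>R v) v) (at 0)"
      by (rule has_vector_derivative_eq_rhs[OF has_vector_derivative_gmul]) (auto intro!: derivative_eq_intros simp: RD_simps)
    from bounded_linear.has_vector_derivative[OF bounded_linear_vec_nth this, of i] show ?thesis by simp
  qed
  have "((\<lambda>t. (x \<odot> t *\<^sub>R v) $ i + e) has_vector_derivative LD x 0 v $ i) (at 0)" for e
    using has_vector_derivative_add[OF d[of x] has_vector_derivative_const[of e]] by simp
  hence "LD (x + e *\<^sub>R axis i 1) 0 v $ i = LD x 0 v $ i" for e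
    using vector_derivative_unique_at[OF d[of "x + e *\<^sub>R axis i 1", unfolded c]] by blast
  moreover have "((\<lambda>e. LD (x + e *\<^sub>R axis i 1) 0 v $ i) has_vector_derivative FD (\<lambda>p. LD p 0 v) x (axis i 1) $ i) (at 0)"
  proof -
    have "((\<lambda>e. x + e *\<^sub>R axis i 1) has_derivative (\<lambda>e. e *\<^sub>R axis i 1)) (at 0)" by (auto intro!: derivative_eq_intros)
    from bounded_linear.has_derivative[OF bounded_linear_vec_nth[of i] has_derivative_compose[OF this Ck_1_deriv[OF Ck_1_left_field[of v]]]]
    show ?thesis by (simp add: has_vector_derivative_def linear_scale[OF Ck_1_FD_linear[OF Ck_1_left_field]])
  qed
  ultimately have "((\<lambda>e. LD x 0 v $ i) has_vector_derivative FD (\<lambda>p. LD p 0 v) x (axis i 1) $ i) (at 0)" by simp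
  thus ?thesis using vector_derivative_unique_at[OF _ has_vector_derivative_const] by blast
qed

section \<open>The horizontal divergence\<close>

text \<open>
  The divergence of the vector field with coefficients \<open>u\<close> in the left-invariant frame:
  the sum of the derivatives of the coefficients along the corresponding fields of the frame.
\<close>

definition hdiv :: "((real, 'n) vec \<Rightarrow> (real, 'n) vec) \<Rightarrow> (real, 'n) vec \<Rightarrow> real" where
  "hdiv u p = (\<Sum>i\<in>UNIV. FD u p (LD p 0 (axis i 1)) $ i)"

lemma vec_sum_axis: "(x :: (real, 'n) vec) = (\<Sum>i\<in>UNIV. x $ i *\<^sub>R axis i 1)"
  using basis_expansion[of x] by (simp add: scalar_mult_eq_scaleR)

text \<open>
  The product rule leaves only the derivatives of the coefficients, since the left-invariant fields
  themselves are divergence free.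
\<close>

lemma hdiv_eq_euclidean_divergence:
  assumes u: "Ck 1 u"
  shows "(\<Sum>i\<in>UNIV. FD (\<lambda>p. LD p 0 (u p)) p (axis i 1) $ i) = hdiv u p"
proof -
  have U: "LD q 0 (u q) = (\<Sum>j\<in>UNIV. u q $ j *\<^sub>R LD q 0 (axis j 1))" for q
    using arg_cong[OF vec_sum_axis[of "u q"], of "LD q 0"] by (simp add: LD_simps)
  have "((\<lambda>q. LD q 0 (u q)) has_derivative
     (\<lambda>w. \<Sum>j\<in>UNIV. u p $ j *\<^sub>R FD (\<lambda>q. LD q 0 (axis j 1)) p w + FD u p w $ j *\<^sub>R LD p 0 (axis j 1))) (at p)"
    unfolding U
    by (intro has_derivative_sum has_derivative_scaleR Ck_1_deriv[OF Ck_1_left_field]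
         bounded_linear.has_derivative[OF bounded_linear_vec_nth Ck_1_deriv[OF u]])
  from FD_eq[OF this]
  have "(\<Sum>i\<in>UNIV. FD (\<lambda>p. LD p 0 (u p)) p (axis i 1) $ i)
     = (\<Sum>i\<in>UNIV. \<Sum>j\<in>UNIV. FD u p (axis i 1) $ j * LD p 0 (axis j 1) $ i)"
    by (simp add: left_field_divergence_free)
  also have "\<dots> = (\<Sum>j\<in>UNIV. (\<Sum>i\<in>UNIV. LD p 0 (axis j 1) $ i *\<^sub>R FD u p (axis i 1)) $ j)"
    by (subst sum.swap) (simp add: mult.commute)
  also have "\<dots> = (\<Sum>j\<in>UNIV. FD u p (LD p 0 (axis j 1)) $ j)"
  proof -
    have "(\<Sum>i\<in>UNIV. w $ i *\<^sub>R FD u p (axis i 1)) = FD u p w" for w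
      using arg_cong[OF vec_sum_axis[of w], of "FD u p"] 
      by (simp add: linear_sum[OF Ck_1_FD_linear[OF u]] linear_scale[OF Ck_1_FD_linear[OF u]])
    thus ?thesis by simp
  qed
  finally show ?thesis by (simp add: hdiv_def)
qed

end

context sub_finsler_nilpotent_group
begin

lemma linear_g_left: "linear (\<lambda>u. g u w)" and linear_g_right: "linear (g u)"
  using g_bilinear by (auto simp: bilinear_def)

text \<open>
  Left translations have unitriangular differentials, so they preserve the volume density of a
  left-invariant metric with respect to coordinates.
\<close>

lemma riemannian_density_constant:
  "riemannian_density gmul ginv g p = sqrt (det (\<chi> i j. g (axis i 1) (axis j 1)))"
proof -
  define Y where "Y = matrix (LD (- p) p)"
  define G where "G = (\<chi> i j. g (axis i 1) (axis j 1))"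
  have col: "LD (- p) p (axis i 1) = (\<Sum>k\<in>UNIV. Y $ k $ i *\<^sub>R axis k 1)" for i
    using vec_sum_axis[of "LD (- p) p (axis i 1)"] by (simp add: Y_def matrix_def)
  have "metric_at gmul ginv g p (axis i 1) (axis j 1) = (transpose Y ** (G ** Y)) $ i $ j" for i j
  proof -
    have "metric_at gmul ginv g p (axis i 1) (axis j 1)
       = (\<Sum>k\<in>UNIV. Y $ k $ i * (\<Sum>m\<in>UNIV. Y $ m $ j * g (axis k 1) (axis m 1)))"
      unfolding metric_at_def pull_back_eq col
      by (simp add: linear_sum[OF linear_g_left] linear_scale[OF linear_g_left] linear_sum[OF linear_g_right] linear_scale[OF linear_g_right] sum_distrib_left)
         (subst sum.swap, simp add: mult.left_commute)
    also have "\<dots> = (transpose Y ** (G ** Y)) $ i $ j"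
      by (simp add: matrix_matrix_mult_def transpose_def G_def mult.commute)
    finally show ?thesis .
  qed
  hence "(\<chi> i j. metric_at gmul ginv g p (axis i 1) (axis j 1)) = transpose Y ** (G ** Y)"
    by (simp add: vec_eq_iff)
  moreover have "det Y = 1"
    by (rule det_unitriangular) (simp add: Y_def matrix_def LD_triangular)
  ultimately show ?thesis by (simp add: riemannian_density_def det_mul G_def)
qed

text \<open>
  A vector in the kernel of the Gram matrix would have length \<open>0\<close>.
\<close>

lemma riemannian_density_nonzero: "riemannian_density gmul ginv g p \<noteq> 0"
proof -
  define G where "G = (\<chi> i j. g (axis i 1) (axis j 1))"
  have "det G \<noteq> 0"
  proof
    assume "det G = 0"
    hence "\<not> inj ((*v) G)" by (simp add: det_nz_iff_inj[symmetric])
    then obtain x where x: "G *v x = 0" "x \<noteq> 0"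
      using linear_injective_0[OF matrix_vector_mul_linear[of G]] by auto
    have "g x x = (\<Sum>i\<in>UNIV. x $ i * (\<Sum>j\<in>UNIV. x $ j * g (axis i 1) (axis j 1)))"
      by (subst (1 2) vec_sum_axis[of x]) 
         (simp add: linear_sum[OF linear_g_left] linear_scale[OF linear_g_left] linear_sum[OF linear_g_right] linear_scale[OF linear_g_right] sum_distrib_left,
          subst sum.swap, simp add: mult.left_commute)
    also have "\<dots> = (\<Sum>i\<in>UNIV. x $ i * (G *v x) $ i)"
      by (simp add: matrix_vector_mult_def G_def mult.commute)
    finally show False using x g_pos[of x] by simp
  qed
  thus ?thesis by (simp add: riemannian_density_constant G_def)
qed

lemma divergence_eq:
  assumes U: "Ck 1 U"
  shows "divergence gmul ginv g U p = (\<Sum>i\<in>UNIV. FD U p (axis i 1) $ i)"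
proof -
  define c where "c = riemannian_density gmul ginv g p"
  have c: "riemannian_density gmul ginv g q = c" for q unfolding c_def riemannian_density_constant ..
  have "FD (\<lambda>q. c * U q $ i) p w = c * FD U p w $ i" for i w
  proof -
    have "((\<lambda>q. c * U q $ i) has_derivative (\<lambda>w. c * FD U p w $ i)) (at p)"
      by (intro has_derivative_mult_right bounded_linear.has_derivative[OF bounded_linear_vec_nth Ck_1_deriv[OF U]])
    thus ?thesis using FD_eq by metis
  qed
  thus ?thesis using riemannian_density_nonzero[of p]
    by (simp add: divergence_def c sum_distrib_left[symmetric])
qed

section \<open>Test functions\<close>

text \<open>
  Horizontal test fields are written in the left-invariant frame, where the constraint on the
  asymmetric norm becomes the pointwise condition of being \<open>K\<close>-valued.
\<close>

definition T :: "((real, 'n) vec \<Rightarrow> (real, 'n) vec) set" where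
  "T = {u. Ck 1 u \<and> bounded {p. u p \<noteq> 0} \<and> range u \<subseteq> K}"

lemma zero_in_K: "0 \<in> K"
  using K_zero interior_of_subset[of "top_of_set (span X)" K] by (rule rev_subsetD)

lemma K_absorbing: obtains \<epsilon> where "\<epsilon> > 0" "\<And>w. w \<in> span X \<Longrightarrow> norm w \<le> \<epsilon> \<Longrightarrow> w \<in> K"
proof -
  obtain S where S: "openin (top_of_set (span X)) S" "0 \<in> S" "S \<subseteq> K"
    using K_zero by (auto simp: interior_of_def)
  then obtain e where e: "e > 0" "ball 0 e \<inter> span X \<subseteq> S"
    by (auto simp: openin_contains_ball)
  show ?thesis
  proof (rule that[of "e/2"])
    fix w assume "w \<in> span X" "norm w \<le> e/2"
    hence "w \<in> ball 0 e \<inter> span X" using e by auto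
    thus "w \<in> K" using e S by blast
  qed (use e in simp)
qed

text \<open>
  That \<open>w\<close> belongs to every dilate of \<open>K\<close> by a factor larger than
  \<open>1\<close> follows from convexity and \<open>0 \<in> K\<close>; the dilation factor is then
  sent to \<open>1\<close>, \<open>K\<close> being closed.
\<close>

lemma asym_norm_le_1_iff:
  assumes w: "w \<in> span X" shows "asym_norm K w \<le> 1 \<longleftrightarrow> w \<in> K"
proof
  assume "w \<in> K"
  hence "1 \<in> {l. 0 \<le> l \<and> w \<in> (*\<^sub>R) l ` K}" by (auto simp: image_iff)
  thus "asym_norm K w \<le> 1" unfolding asym_norm_def by (intro cInf_lower) auto
next
  assume le: "asym_norm K w \<le> 1"
  let ?S = "{l. 0 \<le> l \<and> w \<in> (*\<^sub>R) l ` K}"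
  obtain e where e: "e > 0" "\<And>w. w \<in> span X \<Longrightarrow> norm w \<le> e \<Longrightarrow> w \<in> K" using K_absorbing by blast
  have ne: "?S \<noteq> {}"
  proof (cases "w = 0")
    case True thus ?thesis using zero_in_K by (auto intro!: exI[of _ 0])
  next
    case False
    have "(e / norm w) *\<^sub>R w \<in> K" using e False span_scale[OF w] by (intro e(2)) auto
    moreover have "w = (norm w / e) *\<^sub>R ((e / norm w) *\<^sub>R w)" using e False by simp
    ultimately have "norm w / e \<in> ?S" using e by (auto intro!: image_eqI)
    thus ?thesis by blast
  qed
  have inK: "(1 / (1 + 1 / real (Suc n))) *\<^sub>R w \<in> K" for n
  proof -
    have "0 < 1 / real (Suc n)" by simp
    hence "Inf ?S < 1 + 1 / real (Suc n)" using le unfolding asym_norm_def by linarith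
    then obtain l k where l: "0 \<le> l" "l < 1 + 1 / real (Suc n)" "w = l *\<^sub>R k" "k \<in> K"
      using cInf_lessD[OF ne] by blast
    have pos: "1 + 1 / real (Suc n) > 0" by (simp add: add_pos_pos)
    have "(l / (1 + 1 / real (Suc n))) *\<^sub>R k + (1 - l / (1 + 1 / real (Suc n))) *\<^sub>R 0 \<in> K"
      using l pos K_body(3) zero_in_K by (intro convexD) (auto simp: divide_simps simp del: of_nat_Suc)
    thus ?thesis using l by simp
  qed
  have "(\<lambda>n. (1 / (1 + 1 / real (Suc n))) *\<^sub>R w) \<longlonglongrightarrow> (1 / (1 + 0)) *\<^sub>R w"
    using LIMSEQ_inverse_real_of_nat by (intro tendsto_intros) (auto simp: inverse_eq_divide)
  from closed_sequentially[OF compact_imp_closed[OF K_body(2)] inK this] show "w \<in> K" by simp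
qed

lemma compact_closure_iff_bounded: "compact (closure S) \<longleftrightarrow> bounded (S :: (real, 'n) vec set)"
  by (metis bounded_subset closure_subset compact_closure)

lemma test_fields_eq: "test_fields gmul ginv X K = (\<lambda>u p. LD p 0 (u p)) ` T"
proof (intro equalityI subsetI)
  fix U assume U: "U \<in> test_fields gmul ginv X K"
  define u where "u p = LD (- p) p (U p)" for p
  have C: "Ck 1 U" using U by (simp add: test_fields_def)
  have eq: "U = (\<lambda>p. LD p 0 (u p))" by (simp add: u_def)
  have "u p \<in> K" for p
  proof -
    obtain v where v: "v \<in> span X" "U p = LD p 0 v"
      using U unfolding test_fields_def horizontal_at_def left_field_eq by blast
    hence "u p = v" by (simp add: u_def)
    moreover have "asym_norm K (u p) \<le> 1"
      using U by (auto simp: test_fields_def asym_norm_at_def pull_back_eq u_def)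
    ultimately show ?thesis using asym_norm_le_1_iff v by simp
  qed
  moreover have "Ck 1 u" unfolding u_def by (intro Ck_1_LD Ck_1_uminus Ck_1_id C)
  moreover have "{p. u p \<noteq> 0} \<subseteq> {p. U p \<noteq> 0}" by (auto simp: u_def LD_simps)
  hence "bounded {p. u p \<noteq> 0}" using U compact_closure_iff_bounded bounded_subset
    unfolding test_fields_def by (metis (no_types, lifting) mem_Collect_eq)
  ultimately show "U \<in> (\<lambda>u p. LD p 0 (u p)) ` T" using eq by (auto simp: T_def)
next
  fix U assume "U \<in> (\<lambda>u p. LD p 0 (u p)) ` T"
  then obtain u where u: "u \<in> T" and U: "U = (\<lambda>p. LD p 0 (u p))" by blast
  have "Ck 1 U" unfolding U using u by (intro Ck_1_LD Ck_1_id Ck_1_const) (auto simp: T_def)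
  moreover have "{p. U p \<noteq> 0} \<subseteq> {p. u p \<noteq> 0}" by (auto simp: U LD_simps)
  hence "compact (closure {p. U p \<noteq> 0})" unfolding compact_closure_iff_bounded using u
    by (auto simp: T_def intro: bounded_subset)
  moreover have uK: "u p \<in> K" for p using u by (auto simp: T_def)
  moreover have "u p \<in> span X" for p using uK K_body(1) by blast
  ultimately show "U \<in> test_fields gmul ginv X K"
    by (auto simp: test_fields_def horizontal_at_def left_field_eq asym_norm_at_def pull_back_eq U asym_norm_le_1_iff)
qed

lemma perimeter_eq_hdiv:
  "perimeter gmul ginv X g K E = (SUP u\<in>T. ereal (LINT p:E|lebesgue. hdiv u p))"
proof -
  have "divergence gmul ginv g (\<lambda>p. LD p 0 (u p)) = hdiv u" if "u \<in> T" for u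
  proof
    fix p
    have u: "Ck 1 u" using that by (simp add: T_def)
    have "Ck 1 (\<lambda>p. LD p 0 (u p))" by (intro Ck_1_LD Ck_1_id Ck_1_const u)
    thus "divergence gmul ginv g (\<lambda>p. LD p 0 (u p)) p = hdiv u p"
      by (simp only: divergence_eq hdiv_eq_euclidean_divergence[OF u])
  qed
  thus ?thesis unfolding perimeter_def test_fields_eq image_image by (intro SUP_cong) auto
qed

end

section \<open>Integrals depending on a parameter\<close>

text \<open>
  If \<open>g x\<close> is supported in a ball that is uniform for \<open>x\<close> in bounded sets,
  continuity of \<open>g x\<close> in \<open>x\<close> is uniform in \<open>y\<close>. This replaces
  dominated convergence for the integrals below.
\<close>

lemma compact_support_uniform:
  fixes g :: "'a::euclidean_space \<Rightarrow> 'b::euclidean_space \<Rightarrow> real"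
  assumes g: "continuous_on UNIV (\<lambda>z. g (fst z) (snd z))"
    and supp: "\<And>R. \<exists>S. \<forall>x y. norm x \<le> R \<longrightarrow> S < norm y \<longrightarrow> g x y = 0"
  obtains S where "\<And>e. e > 0 \<Longrightarrow> \<exists>d>0. \<forall>x y. dist x x0 < d \<longrightarrow> \<bar>g x y - g x0 y\<bar> \<le> e * indicator (cball 0 S) y"
proof -
  obtain S where S: "\<And>x y. norm x \<le> norm x0 + 1 \<Longrightarrow> S < norm y \<Longrightarrow> g x y = 0"
    using supp[of "norm x0 + 1"] by blast
  show ?thesis
  proof (rule that[of S])
    fix e :: real assume e: "e > 0"
    have "uniformly_continuous_on (cball x0 1 \<times> cball 0 S) (\<lambda>z. g (fst z) (snd z))"
      by (intro compact_uniformly_continuous continuous_on_subset[OF g] compact_Times) auto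
    then obtain d where d: "d > 0" "\<And>z z'. z \<in> cball x0 1 \<times> cball 0 S \<Longrightarrow> z' \<in> cball x0 1 \<times> cball 0 S \<Longrightarrow>
        dist z' z < d \<Longrightarrow> dist (g (fst z') (snd z')) (g (fst z) (snd z)) < e"
      using e unfolding uniformly_continuous_on_def by blast
    have "\<bar>g x y - g x0 y\<bar> \<le> e * indicator (cball 0 S) y" if x: "dist x x0 < min d 1" for x y
    proof (cases "norm y \<le> S")
      case True
      have "(x, y) \<in> cball x0 1 \<times> cball 0 S" "(x0, y) \<in> cball x0 1 \<times> cball 0 S"
        using True x by (auto simp: dist_commute)
      moreover have "dist (x, y) (x0, y) < d" using x by (simp add: dist_Pair_Pair)
      ultimately show ?thesis using d(2)[of "(x0, y)" "(x, y)"] True by (simp add: dist_real_def)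
    next
      case False
      have "norm x \<le> norm x0 + 1"
        using x norm_triangle_sub[of x x0] by (simp add: dist_norm)
      thus ?thesis using False S[of x y] S[of x0 y] by simp
    qed
    thus "\<exists>d>0. \<forall>x y. dist x x0 < d \<longrightarrow> \<bar>g x y - g x0 y\<bar> \<le> e * indicator (cball 0 S) y"
      using d(1) by (intro exI[of _ "min d 1"]) auto
  qed
qed

lemma integrable_bounded_support:
  fixes h :: "'b::euclidean_space \<Rightarrow> real"
  assumes "h \<in> borel_measurable borel" "\<And>y. \<bar>h y\<bar> \<le> e * indicator (cball 0 S) y"
  shows "integrable lborel h" "\<bar>\<integral>y. h y \<partial>lborel\<bar> \<le> e * measure lborel (cball 0 S :: 'b set)"
proof -
  have fin: "emeasure lborel (cball 0 S :: 'b set) < \<infinity>" using emeasure_lborel_cball_finite by blast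
  have i: "integrable lborel (\<lambda>y :: 'b. e * indicator (cball 0 S) y)"
    using fin by (intro integrable_mult_right integrable_real_indicator) auto
  show h: "integrable lborel h"
    by (rule Bochner_Integration.integrable_bound[OF i]) (use assms in \<open>auto intro: order_trans[OF _ abs_ge_self]\<close>)
  have "\<bar>\<integral>y. h y \<partial>lborel\<bar> \<le> (\<integral>y. \<bar>h y\<bar> \<partial>lborel)" by (rule integral_abs_bound)
  also have "\<dots> \<le> (\<integral>y. e * indicator (cball (0::'b) S) y \<partial>lborel)"
    by (rule integral_mono[OF integrable_abs[OF h] i]) (rule assms(2))
  also have "\<dots> = e * measure lborel (cball 0 S :: 'b set)" by simp
  finally show "\<bar>\<integral>y. h y \<partial>lborel\<bar> \<le> e * measure lborel (cball 0 S :: 'b set)" .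
qed

lemma continuous_bounded_support:
  fixes h :: "'b::euclidean_space \<Rightarrow> real"
  assumes "continuous_on UNIV h" "bounded {y. h y \<noteq> 0}"
  obtains M S where "M > 0" "\<And>y. \<bar>h y\<bar> \<le> M * indicator (cball 0 S) y"
proof -
  obtain S where S: "\<And>y. h y \<noteq> 0 \<Longrightarrow> norm y \<le> S" using assms(2) by (auto simp: bounded_iff)
  have "bounded (h ` cball 0 S)"
    by (intro compact_imp_bounded compact_continuous_image continuous_on_subset[OF assms(1)]) auto
  then obtain M where "\<forall>z\<in>h ` cball 0 S. norm z \<le> M" by (auto simp only: bounded_iff)
  hence M: "\<And>y. norm y \<le> S \<Longrightarrow> \<bar>h y\<bar> \<le> M" by auto
  have "\<bar>h y\<bar> \<le> (\<bar>M\<bar> + 1) * indicator (cball 0 S) y" for y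
    using S[of y] M[of y] by (cases "norm y \<le> S") auto
  thus ?thesis using that[of "\<bar>M\<bar> + 1" S] by auto
qed

lemma integrable_mult_bounded_support:
  fixes h :: "'b::euclidean_space \<Rightarrow> real"
  assumes f: "f \<in> borel_measurable borel" "\<And>y. \<bar>f y\<bar> \<le> 1"
    and h: "continuous_on UNIV h" "bounded {y. h y \<noteq> 0}"
  shows "integrable lborel (\<lambda>y. f y * h y)"
proof -
  obtain M S where "M > 0" and M: "\<And>y. \<bar>h y\<bar> \<le> M * indicator (cball 0 S) y"
    using continuous_bounded_support[OF h] by blast
  have "\<bar>f y * h y\<bar> \<le> M * indicator (cball 0 S) y" for y
    using mult_mono[OF f(2)[of y] M[of y]] by (simp add: abs_mult)
  thus ?thesis
    by (intro integrable_bounded_support) (use f borel_measurable_continuous_onI[OF h(1)] in auto)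
qed

lemma support_bounded:
  fixes g :: "'a::real_normed_vector \<Rightarrow> 'b::real_normed_vector \<Rightarrow> real"
  assumes "\<And>R. \<exists>S. \<forall>x y. norm x \<le> R \<longrightarrow> S < norm y \<longrightarrow> g x y = 0"
  shows "bounded {y. g x y \<noteq> 0}"
proof -
  obtain S where "\<And>x' y. norm x' \<le> norm x \<Longrightarrow> S < norm y \<Longrightarrow> g x' y = 0" using assms[of "norm x"] by blast
  hence "norm y \<le> S" if "g x y \<noteq> 0" for y using that by (meson not_le order_refl)
  thus ?thesis by (auto simp: bounded_iff)
qed

lemma continuous_param_integral:
  fixes g :: "'a::euclidean_space \<Rightarrow> 'b::euclidean_space \<Rightarrow> real"
  assumes g: "continuous_on UNIV (\<lambda>z. g (fst z) (snd z))"
    and supp: "\<And>R. \<exists>S. \<forall>x y. norm x \<le> R \<longrightarrow> S < norm y \<longrightarrow> g x y = 0"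
    and f: "f \<in> borel_measurable borel" "\<And>y. \<bar>f y\<bar> \<le> 1"
  shows "integrable lborel (\<lambda>y. f y * g x y)"
    and "continuous_on UNIV (\<lambda>x. \<integral>y. f y * g x y \<partial>lborel)"
proof -
  have cx: "continuous_on UNIV (g x)" for x
    using continuous_on_compose2[OF g continuous_on_Pair[OF continuous_on_const[of UNIV x] continuous_on_id]] by simp
  show int: "integrable lborel (\<lambda>y. f y * g x y)" for x
    by (rule integrable_mult_bounded_support[OF f cx support_bounded[OF supp]])
  show "continuous_on UNIV (\<lambda>x. \<integral>y. f y * g x y \<partial>lborel)"
    unfolding continuous_on_eq_continuous_at[OF open_UNIV]
  proof (intro ballI)
    fix x0 :: 'a
    obtain S where S: "\<And>e. e > 0 \<Longrightarrow> \<exists>d>0. \<forall>x y. dist x x0 < d \<longrightarrow> \<bar>g x y - g x0 y\<bar> \<le> e * indicator (cball 0 S) y"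
      using compact_support_uniform[OF g supp, of x0] by blast
    define m where "m = measure lborel (cball 0 S :: 'b set) + 1"
    have m: "m > 0" by (simp add: m_def add_nonneg_pos)
    show "isCont (\<lambda>x. \<integral>y. f y * g x y \<partial>lborel) x0"
      unfolding continuous_at_eps_delta
    proof (intro allI impI)
      fix e :: real assume e: "e > 0"
      obtain d where d: "d > 0" "\<And>x y. dist x x0 < d \<Longrightarrow> \<bar>g x y - g x0 y\<bar> \<le> (e / m) * indicator (cball 0 S) y"
        using S[of "e / m"] e m by auto
      have "dist (\<integral>y. f y * g x y \<partial>lborel) (\<integral>y. f y * g x0 y \<partial>lborel) < e" if x: "dist x x0 < d" for x
      proof -
        have "\<bar>f y * (g x y - g x0 y)\<bar> \<le> (e / m) * indicator (cball 0 S) y" for y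
          using mult_mono[OF f(2)[of y] d(2)[OF x, of y]] by (simp add: abs_mult)
        hence "\<bar>\<integral>y. f y * (g x y - g x0 y) \<partial>lborel\<bar> \<le> (e / m) * measure lborel (cball 0 S :: 'b set)"
          using f(1) borel_measurable_continuous_onI[OF cx] by (intro integrable_bounded_support) auto
        also have "\<dots> < (e / m) * m" using e m by (intro mult_strict_left_mono) (auto simp: m_def)
        also have "\<dots> = e" using m by simp
        finally have "\<bar>\<integral>y. f y * (g x y - g x0 y) \<partial>lborel\<bar> < e" .
        thus ?thesis by (simp add: dist_real_def right_diff_distrib Bochner_Integration.integral_diff[OF int int])
      qed
      thus "\<exists>d>0. \<forall>x. dist x x0 < d \<longrightarrow> dist (\<integral>y. f y * g x y \<partial>lborel) (\<integral>y. f y * g x0 y \<partial>lborel) < e"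
        using d(1) by blast
    qed
  qed
qed

text \<open>
  Differentiation under the integral sign against a bounded measurable weight. The difference
  quotient is compared with the derivative by the mean value theorem in every point
  \<open>y\<close>; uniform continuity of the partial derivatives gives an error that is uniform on
  the common support.
\<close>

lemma Ck_1_param_integral:
  fixes k :: "'a::euclidean_space \<Rightarrow> 'b::euclidean_space \<Rightarrow> real"
  assumes k: "Ck 1 (\<lambda>z. k (fst z) (snd z))"
    and supp: "\<And>R. \<exists>S. \<forall>x y. norm x \<le> R \<longrightarrow> S < norm y \<longrightarrow> k x y = 0"
    and f: "f \<in> borel_measurable borel" "\<And>y. \<bar>f y\<bar> \<le> 1"
  shows "((\<lambda>x. \<integral>y. f y * k x y \<partial>lborel) has_derivative
           (\<lambda>w. \<integral>y. f y * FD (\<lambda>x. k x y) x0 w \<partial>lborel)) (at x0)"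
    and "Ck 1 (\<lambda>x. \<integral>y. f y * k x y \<partial>lborel)"
proof -
  let ?k = "\<lambda>z. k (fst z) (snd z)"
  have kx: "Ck 1 (\<lambda>x. k x y)" for y
    using Ck_1_compose[OF k Ck_1_Pair[OF Ck_1_id Ck_1_const, of y]] by simp
  have FDk: "FD (\<lambda>x. k x y) x w = FD ?k (x, y) (w, 0)" for x y w
  proof -
    have "((\<lambda>x. (x, y)) has_derivative (\<lambda>w. (w, 0))) (at x)" by (auto intro!: derivative_eq_intros)
    from FD_eq[OF has_derivative_compose[OF this Ck_1_deriv[OF k]]] show ?thesis by simp
  qed
  define g where "g w x y = FD (\<lambda>x. k x y) x w" for w x y
  have g: "continuous_on UNIV (\<lambda>z. g w (fst z) (snd z))" for w
    unfolding g_def FDk by (simp add: Ck_1_FD_continuous[OF k continuous_on_id continuous_on_const])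
  have gsupp: "\<exists>S. \<forall>x y. norm x \<le> R \<longrightarrow> S < norm y \<longrightarrow> g w x y = 0" for w R
  proof -
    obtain S where S: "\<And>x y. norm x \<le> R + 1 \<Longrightarrow> S < norm y \<Longrightarrow> k x y = 0" using supp[of "R + 1"] by blast
    have "g w x y = 0" if x: "norm x \<le> R" and y: "S < norm y" for x y
    proof -
      have "((\<lambda>x. k x y) has_derivative (\<lambda>_. 0)) (at x)"
      proof (rule has_derivative_transform_within_open[of "\<lambda>_. 0" _ _ _ "ball x 1"])
        show "0 = k x' y" if "x' \<in> ball x 1" for x'
          using that x y norm_triangle_sub[of x' x] by (intro S[symmetric]) (auto simp: dist_norm norm_minus_commute)
      qed auto
      from FD_eq[OF this] show ?thesis by (simp add: g_def)
    qed
    thus ?thesis by blast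
  qed
  have intk: "integrable lborel (\<lambda>y. f y * k x y)" for x
    by (rule continuous_param_integral[OF Ck_1_continuous[OF k] supp f])
  have intg: "integrable lborel (\<lambda>y. f y * g w x y)" for w x
    by (rule continuous_param_integral[OF g gsupp f])
  have glin: "g w x y = (\<Sum>b\<in>Basis. (w \<bullet> b) * g b x y)" for w x y
    unfolding g_def using linear_basis_expansion[OF Ck_1_FD_linear[OF kx], where w = w] by simp
  show der: "((\<lambda>x. \<integral>y. f y * k x y \<partial>lborel) has_derivative
           (\<lambda>w. \<integral>y. f y * FD (\<lambda>x. k x y) x0 w \<partial>lborel)) (at x0)" for x0
  proof -
    define L where "L w = (\<integral>y. f y * g w x0 y \<partial>lborel)" for w
    have gadd: "g (v + w) x y = g v x y + g w x y" "g (c *\<^sub>R v) x y = c * g v x y" for v w x y c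
      unfolding g_def using linear_add[OF Ck_1_FD_linear[OF kx]] linear_scale[OF Ck_1_FD_linear[OF kx]] by auto
    have "linear L"
    proof (rule linearI)
      show "L (v + w) = L v + L w" for v w
        unfolding L_def gadd distrib_left by (rule Bochner_Integration.integral_add[OF intg intg])
      show "L (c *\<^sub>R v) = c *\<^sub>R L v" for c v
        unfolding L_def gadd by (simp add: mult.left_commute)
    qed
    obtain S where S: "\<And>b e. e > 0 \<Longrightarrow> \<exists>d>0. \<forall>x y. dist x x0 < d \<longrightarrow> \<bar>g b x y - g b x0 y\<bar> \<le> e * indicator (cball 0 (S b)) y"
    proof -
      have "\<forall>b. \<exists>S. \<forall>e>0. \<exists>d>0. \<forall>x y. dist x x0 < d \<longrightarrow> \<bar>g b x y - g b x0 y\<bar> \<le> e * indicator (cball 0 S) y"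
        using compact_support_uniform[OF g gsupp] by metis
      thus ?thesis using that by metis
    qed
    define S0 where "S0 = Max (S ` Basis)"
    have S0: "S b \<le> S0" if "b \<in> Basis" for b using that by (simp add: S0_def)
    define m where "m = real (DIM('a)) * measure lborel (cball 0 S0 :: 'b set) + 1"
    have m: "m > 0" by (simp add: m_def add_nonneg_pos)
    have est: "\<exists>d>0. \<forall>w. norm w < d \<longrightarrow> \<bar>(\<integral>y. f y * k (x0 + w) y \<partial>lborel) - (\<integral>y. f y * k x0 y \<partial>lborel) - L w\<bar> \<le> e * norm w"
      if e: "e > 0" for e
    proof -
      have "\<forall>b\<in>Basis. \<exists>d>0. \<forall>x y. dist x x0 < d \<longrightarrow> \<bar>g b x y - g b x0 y\<bar> \<le> (e / m) * indicator (cball 0 (S b)) y"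
        using S[of "e / m"] e m by auto
      then obtain d where d: "\<And>b. b \<in> Basis \<Longrightarrow> d b > 0"
        "\<And>b x y. b \<in> Basis \<Longrightarrow> dist x x0 < d b \<Longrightarrow> \<bar>g b x y - g b x0 y\<bar> \<le> (e / m) * indicator (cball 0 (S b)) y" by metis
      define d0 where "d0 = Min (d ` Basis)"
      have d0: "d0 > 0" using d(1) by (simp add: d0_def)
      have d0': "d0 \<le> d b" if "b \<in> Basis" for b using that by (simp add: d0_def)
      have "\<bar>(\<integral>y. f y * k (x0 + w) y \<partial>lborel) - (\<integral>y. f y * k x0 y \<partial>lborel) - L w\<bar> \<le> e * norm w" if w: "norm w < d0" for w
      proof -
        \<comment> \<open>the remainder is linear in \<open>w\<close> with a coefficient controlled on each basis vector\<close>
        have pt: "\<bar>f y * (k (x0 + w) y - k x0 y - g w x0 y)\<bar> \<le> (real (DIM('a)) * (e / m) * norm w) * indicator (cball 0 S0) y" for y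
        proof -
          have "((\<lambda>s. k (x0 + s *\<^sub>R w) y) has_real_derivative g w (x0 + s *\<^sub>R w) y) (at s)" for s
          proof -
            have "((\<lambda>s. k (x0 + s *\<^sub>R w) y) has_derivative (\<lambda>s'. FD (\<lambda>x. k x y) (x0 + s *\<^sub>R w) (s' *\<^sub>R w))) (at s)"
              by (rule has_derivative_compose[OF _ Ck_1_deriv[OF kx]]) (auto intro!: derivative_eq_intros)
            thus ?thesis using linear_scale[OF Ck_1_FD_linear[OF kx]]
              by (simp add: has_field_derivative_def g_def mult_commute_abs)
          qed
          then obtain s where s: "0 < s" "s < 1" "k (x0 + 1 *\<^sub>R w) y - k (x0 + 0 *\<^sub>R w) y = (1 - 0) * g w (x0 + s *\<^sub>R w) y"
            using MVT2[of 0 1 "\<lambda>s. k (x0 + s *\<^sub>R w) y" "\<lambda>s. g w (x0 + s *\<^sub>R w) y"] by auto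
          have dist: "dist (x0 + s *\<^sub>R w) x0 < d0"
          proof -
            have "s * norm w \<le> norm w" using s by (simp add: mult_left_le_one_le)
            thus ?thesis using w s by (simp add: dist_norm)
          qed
          have "\<bar>k (x0 + w) y - k x0 y - g w x0 y\<bar> = \<bar>\<Sum>b\<in>Basis. (w \<bullet> b) * (g b (x0 + s *\<^sub>R w) y - g b x0 y)\<bar>"
            using s(3) unfolding glin[of w] by (simp add: right_diff_distrib sum_subtractf)
          also have "\<dots> \<le> (\<Sum>b\<in>(Basis::'a set). norm w * ((e / m) * indicator (cball 0 S0) y))"
          proof (rule order_trans[OF sum_abs sum_mono])
            fix b :: 'a assume b: "b \<in> Basis"
            have "\<bar>g b (x0 + s *\<^sub>R w) y - g b x0 y\<bar> \<le> (e / m) * indicator (cball 0 (S b)) y"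
              using d(2)[OF b] dist d0'[OF b] by (meson less_le_trans)
            also have "\<dots> \<le> (e / m) * indicator (cball 0 S0) y"
              using S0[OF b] e m by (intro mult_left_mono) (auto simp: indicator_def)
            finally show "\<bar>(w \<bullet> b) * (g b (x0 + s *\<^sub>R w) y - g b x0 y)\<bar> \<le> norm w * ((e / m) * indicator (cball 0 S0) y)"
              unfolding abs_mult using Basis_le_norm[OF b] by (intro mult_mono) auto
          qed
          also have "\<dots> = (real (DIM('a)) * (e / m) * norm w) * indicator (cball 0 S0) y" by simp
          finally have "\<bar>k (x0 + w) y - k x0 y - g w x0 y\<bar> \<le> (real (DIM('a)) * (e / m) * norm w) * indicator (cball 0 S0) y" .
          from mult_mono[OF f(2)[of y] this] show ?thesis by (simp add: abs_mult)
        qed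
        have "(\<integral>y. f y * k (x0 + w) y \<partial>lborel) - (\<integral>y. f y * k x0 y \<partial>lborel) - L w
            = (\<integral>y. f y * (k (x0 + w) y - k x0 y - g w x0 y) \<partial>lborel)"
          by (simp add: L_def right_diff_distrib intk intg)
        also have "\<bar>\<dots>\<bar> \<le> (real (DIM('a)) * (e / m) * norm w) * measure lborel (cball 0 S0 :: 'b set)"
        proof (rule integrable_bounded_support(2)[OF _ pt])
          have "(\<lambda>y. k (x0 + w) y - k x0 y - g w x0 y) \<in> borel_measurable borel"
          proof -
            have "continuous_on UNIV (\<lambda>y. k x y)" for x
              using continuous_on_compose2[OF Ck_1_continuous[OF k, of UNIV] continuous_on_Pair[OF continuous_on_const[of UNIV x] continuous_on_id]] by simp
            moreover have "continuous_on UNIV (\<lambda>y. g w x0 y)"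
              using continuous_on_compose2[OF g continuous_on_Pair[OF continuous_on_const[of UNIV x0] continuous_on_id]] by simp
            ultimately show ?thesis by (intro borel_measurable_continuous_onI continuous_on_diff)
          qed
          thus "(\<lambda>y. f y * (k (x0 + w) y - k x0 y - g w x0 y)) \<in> borel_measurable borel" using f(1) by simp
        qed
        also have "\<dots> = (e * norm w) * ((real (DIM('a)) * measure lborel (cball 0 S0 :: 'b set)) / m)" by simp
        also have "\<dots> \<le> (e * norm w) * 1" using e m by (intro mult_left_mono) (auto simp: m_def)
        finally show ?thesis by simp
      qed
      thus ?thesis using d0 by blast
    qed
    have "((\<lambda>x. \<integral>y. f y * k x y \<partial>lborel) has_derivative L) (at x0)"
      unfolding has_derivative_at_alt
    proof (intro conjI allI impI)
      show "bounded_linear L" using \<open>linear L\<close> by (simp add: linear_conv_bounded_linear)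
      fix e :: real assume "e > 0"
      then obtain d where d: "d > 0" "\<And>w. norm w < d \<Longrightarrow> \<bar>(\<integral>y. f y * k (x0 + w) y \<partial>lborel) - (\<integral>y. f y * k x0 y \<partial>lborel) - L w\<bar> \<le> e * norm w"
        using est by blast
      show "\<exists>d>0. \<forall>y. norm (y - x0) < d \<longrightarrow> norm ((\<integral>y'. f y' * k y y' \<partial>lborel) - (\<integral>y. f y * k x0 y \<partial>lborel) - L (y - x0)) \<le> e * norm (y - x0)"
        using d(1) d(2)[of "_ - x0"] by (intro exI[of _ d]) auto
    qed
    thus ?thesis by (simp add: L_def[abs_def] g_def)
  qed
  show "Ck 1 (\<lambda>x. \<integral>y. f y * k x y \<partial>lborel)"
  proof (rule Ck_1_I[OF der])
    show "continuous_on UNIV (\<lambda>x. \<integral>y. f y * FD (\<lambda>x. k x y) x v \<partial>lborel)" for v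
      using continuous_param_integral(2)[OF g gsupp f, of v] by (simp add: g_def)
  qed
qed

section \<open>Elementary functions of class \<open>C\<^sup>1\<close>\<close>

lemma Ck_1_real:
  fixes h :: "real \<Rightarrow> real"
  assumes "\<And>s. (h has_real_derivative h' s) (at s)" "continuous_on UNIV h'"
  shows "Ck 1 h"
  by (rule Ck_1_I[of _ "\<lambda>s v. h' s * v"]) (use assms in \<open>auto simp: has_field_derivative_def intro!: continuous_intros\<close>)

text \<open>
  The simplest \<open>C\<^sup>1\<close> function that vanishes exactly on the nonpositive half-line.
  All cutoff functions below are built from it.
\<close>

definition square_plus :: "real \<Rightarrow> real" where "square_plus s = (max 0 s)\<^sup>2"

lemma square_plus_deriv: "(square_plus has_real_derivative 2 * max 0 s) (at s)"
proof -
  consider "s < 0" | "s = 0" | "s > 0" by linarith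
  thus ?thesis
  proof cases
    case 1
    have "((\<lambda>_. 0) has_real_derivative 0) (at s)" by simp
    hence "(square_plus has_real_derivative 0) (at s)"
      by (rule has_field_derivative_transform_within_open[where S = "{..<0}"]) (use 1 in \<open>auto simp: square_plus_def\<close>)
    thus ?thesis using 1 by simp
  next
    case 3
    have "((\<lambda>s. s\<^sup>2) has_real_derivative 2 * s) (at s)" by (auto intro!: derivative_eq_intros)
    hence "(square_plus has_real_derivative 2 * s) (at s)"
      by (rule has_field_derivative_transform_within_open[where S = "{0<..}"]) (use 3 in \<open>auto simp: square_plus_def\<close>)
    thus ?thesis using 3 by simp
  next
    case 2
    have "(\<lambda>h. (square_plus (0 + h) - square_plus 0) / h) \<midarrow>0\<rightarrow> 0"
    proof (rule Lim_null_comparison[of _ "\<lambda>h. \<bar>h\<bar>"])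
      show "\<forall>\<^sub>F h in at 0. norm ((square_plus (0 + h) - square_plus 0) / h) \<le> \<bar>h\<bar>"
        by (rule always_eventually) (auto simp: square_plus_def max_def power2_eq_square)
      show "(\<lambda>h. \<bar>h\<bar>) \<midarrow>0\<rightarrow> (0::real)" by (rule tendsto_rabs_zero) (rule tendsto_ident_at)
    qed
    thus ?thesis using 2 by (simp add: DERIV_def)
  qed
qed

lemma Ck_1_square_plus: "Ck 1 square_plus"
  by (rule Ck_1_real[OF square_plus_deriv]) (intro continuous_intros)

lemma square_plus_nonneg: "square_plus s \<ge> 0" by (simp add: square_plus_def)

text \<open>
  A \<open>C\<^sup>1\<close> step that decreases from \<open>1\<close> at \<open>0\<close> to
  \<open>0\<close> at \<open>1\<close>; the two summands of the denominator do not vanish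
  simultaneously.
\<close>

definition ramp :: "real \<Rightarrow> real" where
  "ramp s = square_plus (1 - s) / (square_plus s + square_plus (1 - s))"

lemma ramp_denominator: "square_plus s + square_plus (1 - s) > 0"
proof -
  have "square_plus s > 0 \<or> square_plus (1 - s) > 0" by (auto simp: square_plus_def max_def)
  thus ?thesis using square_plus_nonneg[of s] square_plus_nonneg[of "1 - s"] by linarith
qed

lemma ramp_bounds: "0 \<le> ramp s" "ramp s \<le> 1"
  using ramp_denominator[of s] square_plus_nonneg[of s] square_plus_nonneg[of "1 - s"] by (auto simp: ramp_def)

lemma ramp_eq_1: "s \<le> 0 \<Longrightarrow> ramp s = 1"
  using ramp_denominator[of s] by (simp add: ramp_def square_plus_def max_def)

lemma ramp_eq_0: "s \<ge> 1 \<Longrightarrow> ramp s = 0"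
  by (simp add: ramp_def square_plus_def max_def)

definition ramp' :: "real \<Rightarrow> real" where
  "ramp' s = (- (2 * max 0 (1 - s)) * (square_plus s + square_plus (1 - s))
      - square_plus (1 - s) * (2 * max 0 s - 2 * max 0 (1 - s))) / (square_plus s + square_plus (1 - s))\<^sup>2"

lemma ramp_deriv: "(ramp has_real_derivative ramp' s) (at s)"
proof -
  have d: "((\<lambda>s. square_plus (1 - s)) has_real_derivative - (2 * max 0 (1 - s))) (at s)"
  proof -
    have "((\<lambda>s. 1 - s) has_real_derivative - 1) (at s)" by (auto intro!: derivative_eq_intros)
    from DERIV_chain2[where f = square_plus, OF square_plus_deriv this] show ?thesis by simp
  qed
  show ?thesis unfolding ramp_def[abs_def] ramp'_def
    by (rule derivative_eq_intros d square_plus_deriv refl | use ramp_denominator[of s] in \<open>simp add: power2_eq_square\<close>)+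
qed

lemma continuous_ramp': "continuous_on UNIV ramp'"
  unfolding ramp'_def[abs_def]
  using Ck_1_continuous[OF Ck_1_square_plus, of UNIV] Ck_1_continuous[OF Ck_1_compose[OF Ck_1_square_plus Ck_1_diff[OF Ck_1_const Ck_1_id]], of UNIV 1]
  by (intro continuous_intros) (use ramp_denominator in \<open>auto simp: less_le\<close>)

lemma Ck_1_ramp: "Ck 1 ramp"
  by (rule Ck_1_real[OF ramp_deriv continuous_ramp'])

lemma ramp'_bound: obtains M where "M > 0" "\<And>s. \<bar>ramp' s\<bar> \<le> M * indicator {0..1} s"
proof -
  have "bounded (ramp' ` {0..1})"
    by (intro compact_imp_bounded compact_continuous_image continuous_on_subset[OF continuous_ramp']) auto
  then obtain M where "\<forall>z\<in>ramp' ` {0..1}. norm z \<le> M" by (auto simp only: bounded_iff)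
  hence M: "\<And>s. s \<in> {0..1} \<Longrightarrow> \<bar>ramp' s\<bar> \<le> M" by auto
  have "ramp' s = 0" if out: "s \<notin> {0..1}" for s
  proof -
    consider "s < 0" | "s > 1" using out by (cases "s < 0") auto
    thus ?thesis
    proof cases
      case 1
      have "((\<lambda>_. 1) has_real_derivative 0) (at s)" by simp
      hence "(ramp has_real_derivative 0) (at s)"
        by (rule has_field_derivative_transform_within_open[where S = "{..<0}"]) (use 1 in \<open>auto simp: ramp_eq_1\<close>)
      thus ?thesis using DERIV_unique ramp_deriv by blast
    next
      case 2
      have "((\<lambda>_. 0) has_real_derivative 0) (at s)" by simp
      hence "(ramp has_real_derivative 0) (at s)"
        by (rule has_field_derivative_transform_within_open[where S = "{1<..}"]) (use 2 in \<open>auto simp: ramp_eq_0\<close>)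
      thus ?thesis using DERIV_unique ramp_deriv by blast
    qed
  qed
  hence "\<bar>ramp' s\<bar> \<le> (\<bar>M\<bar> + 1) * indicator {0..1} s" for s
    using M[of s] by (cases "s \<in> {0..1}") auto
  thus ?thesis using that[of "\<bar>M\<bar> + 1"] by auto
qed

lemma Ck_1_norm_square: "Ck 1 (\<lambda>x :: 'a::euclidean_space. x \<bullet> x)"
  by (rule Ck_1_I[of _ "\<lambda>x v. x \<bullet> v + v \<bullet> x"]) (auto intro!: derivative_eq_intros continuous_intros)

lemma bump_exists:
  fixes \<epsilon> :: real
  assumes "\<epsilon> > 0"
  obtains \<rho> :: "'a::euclidean_space \<Rightarrow> real" where "Ck 1 \<rho>" "\<And>x. 0 \<le> \<rho> x" "\<And>x. \<epsilon> \<le> norm x \<Longrightarrow> \<rho> x = 0"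
    "integrable lborel \<rho>" "(\<integral>x. \<rho> x \<partial>lborel) = 1"
proof -
  define b :: "'a \<Rightarrow> real" where "b x = square_plus (\<epsilon>\<^sup>2 - x \<bullet> x)" for x
  have C: "Ck 1 b" unfolding b_def
    by (intro Ck_1_compose[OF Ck_1_square_plus] Ck_1_diff Ck_1_const Ck_1_norm_square)
  have nn: "b x \<ge> 0" for x by (simp add: b_def square_plus_nonneg)
  have z: "b x = 0" if "\<epsilon> \<le> norm x" for x
  proof -
    have "\<epsilon>\<^sup>2 \<le> x \<bullet> x" using that assms by (simp add: power2_norm_eq_inner[symmetric] power_mono)
    thus ?thesis by (simp add: b_def square_plus_def)
  qed
  have int: "integrable lborel b"
  proof -
    have "norm x \<le> \<epsilon>" if "b x \<noteq> 0" for x using z[of x] that by linarith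
    hence "bounded {x. b x \<noteq> 0}" by (auto simp: bounded_iff)
    from integrable_mult_bounded_support[of "\<lambda>_. 1", OF _ _ Ck_1_continuous[OF C] this] show ?thesis by simp
  qed
  have pos: "b x > 0" if "x \<in> ball 0 \<epsilon>" for x
  proof -
    have "x \<bullet> x < \<epsilon>\<^sup>2" using that assms by (simp add: power2_norm_eq_inner[symmetric] power_strict_mono)
    thus ?thesis by (simp add: b_def square_plus_def)
  qed
  have "(\<integral>x. b x \<partial>lborel) \<noteq> 0"
  proof
    assume "(\<integral>x. b x \<partial>lborel) = 0"
    hence "AE x in lborel. b x = 0" using integral_nonneg_eq_0_iff_AE[OF int] nn by simp
    hence "AE x in lborel. x \<notin> ball (0::'a) \<epsilon>" by eventually_elim (use pos in force)
    hence "ball (0::'a) \<epsilon> \<in> null_sets lborel"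
      using AE_iff_null_sets[of "ball (0::'a) \<epsilon>" lborel] by simp
    hence "emeasure lborel (ball (0::'a) \<epsilon>) = 0" by blast
    thus False using content_ball_pos[OF assms, of "0::'a"] by (simp add: measure_def)
  qed
  moreover have "(\<integral>x. b x \<partial>lborel) \<ge> 0" using nn by (intro integral_nonneg_AE) simp
  ultimately have p: "(\<integral>x. b x \<partial>lborel) > 0" by linarith
  show ?thesis
  proof (rule that[of "\<lambda>x. b x / (\<integral>x. b x \<partial>lborel)"])
    show "Ck 1 (\<lambda>x. b x / (\<integral>x. b x \<partial>lborel))"
      using Ck_1_mult[OF C Ck_1_const[of "inverse (\<integral>x. b x \<partial>lborel)"]] by (simp add: divide_inverse)
  qed (use nn z p int in auto)
qed

context nilpotent_lie_group
begin

section \<open>Calculus of the horizontal divergence\<close>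

lemma bounded_gmul:
  assumes "bounded A" "bounded B"
  obtains S where "\<And>a b. a \<in> A \<Longrightarrow> b \<in> B \<Longrightarrow> norm (a \<odot> b) \<le> S"
proof -
  have "compact ((\<lambda>z. fst z \<odot> snd z) ` (closure A \<times> closure B))"
    by (intro compact_continuous_image continuous_on_gmul continuous_intros compact_Times)
       (use assms in \<open>auto simp: compact_closure\<close>)
  then obtain S where S: "\<forall>z\<in>(\<lambda>z. fst z \<odot> snd z) ` (closure A \<times> closure B). norm z \<le> S"
    by (auto simp only: bounded_iff dest!: compact_imp_bounded)
  have "norm (a \<odot> b) \<le> S" if "a \<in> A" "b \<in> B" for a b
  proof -
    have "(a, b) \<in> closure A \<times> closure B" using that closure_subset[of A] closure_subset[of B] by blast
    hence "fst (a, b) \<odot> snd (a, b) \<in> (\<lambda>z. fst z \<odot> snd z) ` (closure A \<times> closure B)" by (rule imageI)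
    from bspec[OF S this] show ?thesis by simp
  qed
  thus ?thesis using that by blast
qed

lemma measurable_gmul [measurable]:
  "(\<lambda>x. q \<odot> x) \<in> borel_measurable borel" "(\<lambda>x. x \<odot> q) \<in> borel_measurable borel"
  by (intro borel_measurable_continuous_onI continuous_on_gmul continuous_intros)+

lemma measurable_gmul_pair [measurable]:
  assumes [measurable]: "f \<in> borel_measurable M" "g \<in> borel_measurable M"
  shows "(\<lambda>x. f x \<odot> g x) \<in> borel_measurable M"
proof -
  have "(\<lambda>z. fst z \<odot> snd z) \<in> borel_measurable (borel :: ((real,'n) vec \<times> (real,'n) vec) measure)"
    by (intro borel_measurable_continuous_onI continuous_on_gmul continuous_intros)
  hence "(\<lambda>z. fst z \<odot> snd z) \<in> (borel \<Otimes>\<^sub>M borel) \<rightarrow>\<^sub>M borel" by (simp add: borel_prod)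
  from measurable_compose[OF _ this, of "\<lambda>x. (f x, g x)" M] show ?thesis by simp
qed

lemma integral_left: "f \<in> borel_measurable borel \<Longrightarrow> (\<integral>x. f (q \<odot> x) \<partial>lborel) = (\<integral>x. f x \<partial>lborel :: real)"
  using integral_distr[of "\<lambda>x. q \<odot> x" lborel borel f] by (simp add: distr_lborel_left)

lemma integral_right: "f \<in> borel_measurable borel \<Longrightarrow> (\<integral>x. f (x \<odot> q) \<partial>lborel) = (\<integral>x. f x \<partial>lborel :: real)"
  using integral_distr[of "\<lambda>x. x \<odot> q" lborel borel f] by (simp add: distr_lborel_right)

lemma nn_integral_left: "f \<in> borel_measurable borel \<Longrightarrow> (\<integral>\<^sup>+x. f (q \<odot> x) \<partial>lborel) = (\<integral>\<^sup>+x. f x \<partial>lborel)"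
  using nn_integral_distr[of "\<lambda>x. q \<odot> x" lborel borel f] by (simp add: distr_lborel_left)

lemma distr_lborel_minus: "distr lborel borel (\<lambda>x :: (real, 'n) vec. - x) = lborel"
proof -
  have "(\<lambda>x :: (real, 'n) vec. 0 + (\<Sum>j\<in>Basis. ((-1) * (x \<bullet> j)) *\<^sub>R j)) = (\<lambda>x. - x)"
    by (simp add: sum_negf euclidean_representation)
  with lborel_affine_euclidean[of "\<lambda>_. -1" "0 :: (real, 'n) vec"]
  show ?thesis by (simp add: density_1)
qed

lemma integral_minus: "f \<in> borel_measurable borel \<Longrightarrow> (\<integral>x. f (- x) \<partial>lborel) = (\<integral>x. f (x :: (real, 'n) vec) \<partial>lborel :: real)"
  using integral_distr[of "uminus" lborel borel f] by (simp add: distr_lborel_minus)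

lemma emeasure_left: "B \<in> sets borel \<Longrightarrow> emeasure lborel {x. q \<odot> x \<in> B} = emeasure lborel B"
  using emeasure_distr[of "\<lambda>x. q \<odot> x" lborel borel B] by (simp add: distr_lborel_left vimage_def)

lemma emeasure_right: "B \<in> sets borel \<Longrightarrow> emeasure lborel {x. x \<odot> q \<in> B} = emeasure lborel B"
  using emeasure_distr[of "\<lambda>x. x \<odot> q" lborel borel B] by (simp add: distr_lborel_right vimage_def)

lemma continuous_hdiv:
  assumes "Ck 1 u" shows "continuous_on UNIV (hdiv u)"
  unfolding hdiv_def[abs_def]
  by (intro continuous_on_sum continuous_on_component Ck_1_FD_continuous[OF assms] continuous_on_LD continuous_intros)

lemma FD_zero_outside:
  fixes u :: "'a::euclidean_space \<Rightarrow> 'b::real_normed_vector"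
  assumes "p \<notin> closure {p. u p \<noteq> 0}" shows "FD u p = (\<lambda>_. 0)"
proof -
  have "(u has_derivative (\<lambda>_. 0)) (at p)"
    by (rule has_derivative_transform_within_open[of "\<lambda>_. 0" _ _ _ "- closure {p. u p \<noteq> 0}"])
       (use assms closure_subset[of "{p. u p \<noteq> 0}"] in auto)
  thus ?thesis by (rule FD_eq)
qed

lemma bounded_support_hdiv:
  assumes "bounded {p. u p \<noteq> 0}" shows "bounded {p. hdiv u p \<noteq> 0}"
proof (rule bounded_subset[OF bounded_closure[OF assms]])
  show "{p. hdiv u p \<noteq> 0} \<subseteq> closure {p. u p \<noteq> 0}"
  proof (rule subsetI, rule ccontr)
    fix p assume "p \<in> {p. hdiv u p \<noteq> 0}" "p \<notin> closure {p. u p \<noteq> 0}"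
    thus False by (simp add: hdiv_def FD_zero_outside)
  qed
qed

lemma hdiv_scaleR:
  assumes f: "Ck 1 f" and u: "Ck 1 u"
  shows "hdiv (\<lambda>p. f p *\<^sub>R u p) p = f p * hdiv u p + FD f p (LD p 0 (u p))"
proof -
  have FD: "FD (\<lambda>p. f p *\<^sub>R u p) p = (\<lambda>w. f p *\<^sub>R FD u p w + FD f p w *\<^sub>R u p)"
    by (rule FD_eq[OF has_derivative_scaleR[OF Ck_1_deriv[OF f] Ck_1_deriv[OF u]]])
  have "FD f p (LD p 0 (u p)) = (\<Sum>i\<in>UNIV. u p $ i * FD f p (LD p 0 (axis i 1)))"
    using arg_cong[OF vec_sum_axis[of "u p"], of "\<lambda>w. FD f p (LD p 0 w)"]
    by (simp add: LD_simps linear_sum[OF Ck_1_FD_linear[OF f]] linear_scale[OF Ck_1_FD_linear[OF f]])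
  thus ?thesis by (simp add: hdiv_def FD sum.distrib sum_distrib_left mult.commute)
qed

lemma hdiv_add:
  assumes u: "Ck 1 u" and w: "Ck 1 w"
  shows "hdiv (\<lambda>p. u p + w p) p = hdiv u p + hdiv w p"
proof -
  have "FD (\<lambda>p. u p + w p) p = (\<lambda>v. FD u p v + FD w p v)"
    by (rule FD_eq[OF has_derivative_add[OF Ck_1_deriv[OF u] Ck_1_deriv[OF w]]])
  thus ?thesis by (simp add: hdiv_def sum.distrib)
qed

lemma hdiv_const: "hdiv (\<lambda>p. v) p = 0"
  using FD_eq[OF has_derivative_const[of v "at p"]] by (simp add: hdiv_def)

lemma hdiv_left:
  assumes u: "Ck 1 u"
  shows "hdiv (\<lambda>p. u (h \<odot> p)) p = hdiv u (h \<odot> p)"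
proof -
  have "FD (\<lambda>p. u (h \<odot> p)) p = (\<lambda>w. FD u (h \<odot> p) (LD h p w))"
    by (rule FD_eq[OF has_derivative_compose[OF has_derivative_gmul_left Ck_1_deriv[OF u]]])
  thus ?thesis using LD_LD[of h p 0] by (simp add: hdiv_def)
qed

lemma Ck_1_left: "Ck 1 u \<Longrightarrow> Ck 1 (\<lambda>p. u (h \<odot> p))" and Ck_1_right: "Ck 1 u \<Longrightarrow> Ck 1 (\<lambda>p. u (p \<odot> h))"
  by (rule Ck_1_compose, assumption, intro Ck_1_gmul Ck_1_const Ck_1_id)+

lemma bounded_support_left:
  assumes "bounded {p. u p \<noteq> 0}" shows "bounded {p. u (h \<odot> p) \<noteq> 0}"
proof -
  obtain S where S: "\<And>a b. a \<in> {- h} \<Longrightarrow> b \<in> {p. u p \<noteq> 0} \<Longrightarrow> norm (a \<odot> b) \<le> S"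
    using bounded_gmul[of "{- h}", OF _ assms] by auto
  have "norm p \<le> S" if "u (h \<odot> p) \<noteq> 0" for p using S[of "- h" "h \<odot> p"] that by simp
  thus ?thesis by (auto simp: bounded_iff)
qed

lemma right_flow_support:
  assumes "bounded {p. \<phi> p \<noteq> (0::real)}"
  shows "\<exists>S. \<forall>t p. norm (t::real) \<le> R \<longrightarrow> S < norm p \<longrightarrow> \<phi> (p \<odot> t *\<^sub>R v) = 0"
proof -
  have "bounded ((\<lambda>t. - (t *\<^sub>R v)) ` cball 0 R)"
    by (intro compact_imp_bounded compact_continuous_image continuous_intros) auto
  then obtain S where S: "\<And>a b. a \<in> {p. \<phi> p \<noteq> 0} \<Longrightarrow> b \<in> (\<lambda>t. - (t *\<^sub>R v)) ` cball 0 R \<Longrightarrow> norm (a \<odot> b) \<le> S"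
    using bounded_gmul[OF assms] by blast
  have "norm p \<le> S" if "norm t \<le> R" "\<phi> (p \<odot> t *\<^sub>R v) \<noteq> 0" for t p
  proof -
    have "- (t *\<^sub>R v) \<in> (\<lambda>t. - (t *\<^sub>R v)) ` cball 0 R" using that by (intro imageI) simp
    from S[OF _ this, of "p \<odot> t *\<^sub>R v"] that show ?thesis by simp
  qed
  thus ?thesis by (meson not_le)
qed

text \<open>
  Right translation by \<open>exp (t v)\<close> is the flow of the left-invariant field
  \<open>v\<close>, and flows commute with their own field.
\<close>

lemma right_flow_derivative:
  assumes \<phi>: "Ck 1 \<phi>"
  shows "FD (\<lambda>t. \<phi> (p \<odot> t *\<^sub>R v)) t s = s *\<^sub>R FD (\<lambda>p. \<phi> (p \<odot> t *\<^sub>R v)) p (LD p 0 v)"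
proof -
  have 1: "RD (t *\<^sub>R v) p (LD p 0 v) = LD p (t *\<^sub>R v) v"
  proof -
    have "((\<lambda>s. p \<odot> s *\<^sub>R v \<odot> t *\<^sub>R v) has_vector_derivative RD (t *\<^sub>R v) (p \<odot> 0 *\<^sub>R v) (LD p (0 *\<^sub>R v) v)) (at 0)"
      by (rule has_vector_derivative_eq_rhs[OF has_vector_derivative_gmul[OF has_vector_derivative_gmul]])
         (auto intro!: derivative_eq_intros simp: RD_simps LD_simps)
    moreover have "((\<lambda>s. p \<odot> (s + t) *\<^sub>R v) has_vector_derivative LD p ((0 + t) *\<^sub>R v) v) (at 0)"
      by (rule has_vector_derivative_eq_rhs[OF has_vector_derivative_gmul])
         (auto intro!: derivative_eq_intros simp: RD_simps LD_simps)
    moreover have "p \<odot> s *\<^sub>R v \<odot> t *\<^sub>R v = p \<odot> (s + t) *\<^sub>R v" for s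
      by (simp add: gmul_assoc exponential_coordinates)
    ultimately show ?thesis using vector_derivative_unique_at by fastforce
  qed
  have "((\<lambda>t. p \<odot> t *\<^sub>R v) has_vector_derivative LD p (t *\<^sub>R v) v) (at t)"
    by (rule has_vector_derivative_eq_rhs[OF has_vector_derivative_gmul])
       (auto intro!: derivative_eq_intros simp: RD_simps)
  hence "((\<lambda>t. p \<odot> t *\<^sub>R v) has_derivative (\<lambda>s. s *\<^sub>R LD p (t *\<^sub>R v) v)) (at t)"
    by (simp add: has_vector_derivative_def)
  from FD_eq[OF has_derivative_compose[OF this Ck_1_deriv[OF \<phi>]]]
  have 2: "FD (\<lambda>t. \<phi> (p \<odot> t *\<^sub>R v)) t s = s *\<^sub>R FD \<phi> (p \<odot> t *\<^sub>R v) (LD p (t *\<^sub>R v) v)"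
    by (simp add: linear_scale[OF Ck_1_FD_linear[OF \<phi>]])
  have "FD (\<lambda>p. \<phi> (p \<odot> t *\<^sub>R v)) p = (\<lambda>w. FD \<phi> (p \<odot> t *\<^sub>R v) (RD (t *\<^sub>R v) p w))"
    by (rule FD_eq[OF has_derivative_compose[OF has_derivative_gmul_right Ck_1_deriv[OF \<phi>]]])
  thus ?thesis by (simp add: 2 1)
qed

lemma right_flow_integral_derivative:
  assumes \<phi>: "Ck 1 \<phi>" "bounded {p. \<phi> p \<noteq> (0::real)}" and f: "f \<in> borel_measurable borel" "\<And>y. \<bar>f y\<bar> \<le> 1"
  shows "((\<lambda>t. \<integral>p. f p * \<phi> (p \<odot> t *\<^sub>R v) \<partial>lborel) has_real_derivative
     (\<integral>p. f p * FD (\<lambda>p. \<phi> (p \<odot> t *\<^sub>R v)) p (LD p 0 v) \<partial>lborel)) (at t)"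
proof -
  have C: "Ck 1 (\<lambda>z. \<phi> (snd z \<odot> fst z *\<^sub>R v))"
    by (intro Ck_1_compose[OF \<phi>(1)] Ck_1_gmul Ck_1_scaleR Ck_1_const Ck_1_bounded_linear bounded_linear_fst bounded_linear_snd)
  have "((\<lambda>t. \<integral>p. f p * \<phi> (p \<odot> t *\<^sub>R v) \<partial>lborel) has_derivative
     (\<lambda>s. \<integral>p. f p * FD (\<lambda>t. \<phi> (p \<odot> t *\<^sub>R v)) t s \<partial>lborel)) (at t)"
    by (rule Ck_1_param_integral(1)[of "\<lambda>t p. \<phi> (p \<odot> t *\<^sub>R v)", OF C right_flow_support[OF \<phi>(2)] f])
  thus ?thesis unfolding right_flow_derivative[OF \<phi>(1)] has_field_derivative_def
    by (rule has_derivative_eq_rhs) (simp add: fun_eq_iff mult.left_commute mult.commute)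
qed

text \<open>
  The integral of \<open>\<phi> (p \<odot> t v)\<close> does not depend on \<open>t\<close>, by
  right invariance of Lebesgue measure.
\<close>

lemma integral_left_field_zero:
  assumes \<phi>: "Ck 1 \<phi>" "bounded {p. \<phi> p \<noteq> (0::real)}"
  shows "(\<integral>p. FD \<phi> p (LD p 0 v) \<partial>lborel) = 0"
proof -
  have "((\<lambda>t. \<integral>p. 1 * \<phi> (p \<odot> t *\<^sub>R v) \<partial>lborel) has_real_derivative
     (\<integral>p. 1 * FD (\<lambda>p. \<phi> (p \<odot> 0 *\<^sub>R v)) p (LD p 0 v) \<partial>lborel)) (at 0)"
    by (rule right_flow_integral_derivative[OF \<phi>]) auto
  moreover have "(\<integral>p. 1 * \<phi> (p \<odot> t *\<^sub>R v) \<partial>lborel) = (\<integral>p. \<phi> p \<partial>lborel)" for t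
    using integral_right[OF Ck_1_measurable[OF \<phi>(1)]] by simp
  ultimately have "((\<lambda>t. \<integral>p. \<phi> p \<partial>lborel) has_real_derivative (\<integral>p. FD \<phi> p (LD p 0 v) \<partial>lborel)) (at 0)" by simp
  thus ?thesis using DERIV_unique DERIV_const by blast
qed

lemma integral_hdiv_zero:
  assumes u: "Ck 1 u" "bounded {p. u p \<noteq> 0}"
  shows "(\<integral>p. hdiv u p \<partial>lborel) = 0"
proof -
  have b: "bounded {p. u p $ i \<noteq> 0}" for i by (rule bounded_subset[OF u(2)]) auto
  have int: "integrable lborel (\<lambda>p. FD (\<lambda>p. u p $ i) p (LD p 0 (axis i 1)))" for i
  proof -
    have c: "continuous_on UNIV (\<lambda>p. FD (\<lambda>p. u p $ i) p (LD p 0 (axis i 1)))"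
      by (intro Ck_1_FD_continuous[OF Ck_1_nth[OF u(1)]] continuous_on_LD continuous_intros)
    have "bounded {p. FD (\<lambda>p. u p $ i) p (LD p 0 (axis i 1)) \<noteq> 0}"
    proof (rule bounded_subset[OF bounded_closure[OF b[of i]]], rule subsetI, rule ccontr)
      fix p assume "p \<in> {p. FD (\<lambda>p. u p $ i) p (LD p 0 (axis i 1)) \<noteq> 0}" "p \<notin> closure {p. u p $ i \<noteq> 0}"
      thus False by (simp add: FD_zero_outside)
    qed
    from integrable_mult_bounded_support[of "\<lambda>_. 1", OF _ _ c this] show ?thesis by simp
  qed
  have "hdiv u p = (\<Sum>i\<in>UNIV. FD (\<lambda>p. u p $ i) p (LD p 0 (axis i 1)))" for p
    by (simp add: hdiv_def FD_nth[OF u(1)])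
  thus ?thesis
    using integral_left_field_zero[OF Ck_1_nth[OF u(1)] b] int by (simp add: Bochner_Integration.integral_sum)
qed

end

context sub_finsler_nilpotent_group
begin

section \<open>The perimeter as a bound on a pairing\<close>

definition pair :: "((real, 'n) vec \<Rightarrow> real) \<Rightarrow> ((real, 'n) vec \<Rightarrow> (real, 'n) vec) \<Rightarrow> real" where
  "pair f u = (\<integral>x. f x * hdiv u x \<partial>lborel)"

text \<open>
  Perimeters are handled through their upper bounds. This keeps all estimates in the reals, and
  \<open>perim_le B c\<close> states in particular that the perimeter is finite.
\<close>

definition perim_le :: "(real, 'n) vec set \<Rightarrow> real \<Rightarrow> bool" where
  "perim_le B c \<longleftrightarrow> (\<forall>u\<in>T. pair (indicator B) u \<le> c)"

lemma T_D: assumes "u \<in> T" shows "Ck 1 u" "bounded {p. u p \<noteq> 0}" "u p \<in> K"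
  using assms by (auto simp: T_def simp del: One_nat_def)

lemma T_I: "Ck 1 u \<Longrightarrow> bounded {p. u p \<noteq> 0} \<Longrightarrow> (\<And>p. u p \<in> K) \<Longrightarrow> u \<in> T"
  by (auto simp: T_def simp del: One_nat_def)

lemma zero_in_T: "(\<lambda>p. 0) \<in> T"
  by (rule T_I) (auto simp: zero_in_K)

lemma pair_integrable:
  assumes "u \<in> T" "f \<in> borel_measurable borel" "\<And>y. \<bar>f y\<bar> \<le> 1"
  shows "integrable lborel (\<lambda>x. f x * hdiv u x)"
  by (rule integrable_mult_bounded_support[OF assms(2,3) continuous_hdiv[OF T_D(1)[OF assms(1)]] bounded_support_hdiv[OF T_D(2)[OF assms(1)]]])

lemma T_convex_combination:
  assumes u: "u \<in> T" and w: "w \<in> T" and \<theta>: "Ck 1 \<theta>" "\<And>p. 0 \<le> \<theta> p" "\<And>p. \<theta> p \<le> 1"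
  shows "(\<lambda>p. \<theta> p *\<^sub>R u p + (1 - \<theta> p) *\<^sub>R w p) \<in> T"
proof (rule T_I)
  show "Ck 1 (\<lambda>p. \<theta> p *\<^sub>R u p + (1 - \<theta> p) *\<^sub>R w p)"
    by (intro Ck_1_add Ck_1_scaleR Ck_1_diff Ck_1_const \<theta> T_D[OF u] T_D[OF w])
  have "bounded ({p. u p \<noteq> 0} \<union> {p. w p \<noteq> 0})" using T_D(2)[OF u] T_D(2)[OF w] by simp
  thus "bounded {p. \<theta> p *\<^sub>R u p + (1 - \<theta> p) *\<^sub>R w p \<noteq> 0}" by (rule bounded_subset) auto
  show "\<theta> p *\<^sub>R u p + (1 - \<theta> p) *\<^sub>R w p \<in> K" for p
    using K_body(3) T_D(3)[OF u] T_D(3)[OF w] \<theta> by (intro convexD) auto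
qed

lemma hdiv_convex_combination:
  assumes u: "Ck 1 u" and w: "Ck 1 w" and \<theta>: "Ck 1 \<theta>"
  shows "hdiv (\<lambda>p. \<theta> p *\<^sub>R u p + (1 - \<theta> p) *\<^sub>R w p) p
    = \<theta> p * hdiv u p + (1 - \<theta> p) * hdiv w p + FD \<theta> p (LD p 0 (u p - w p))"
proof -
  have \<theta>': "Ck 1 (\<lambda>p. 1 - \<theta> p)" by (intro Ck_1_diff Ck_1_const \<theta>)
  have "FD (\<lambda>p. 1 - \<theta> p) p = (\<lambda>v. - FD \<theta> p v)"
    using FD_eq[OF has_derivative_diff[OF has_derivative_const[of 1] Ck_1_deriv[OF \<theta>]]] by simp
  thus ?thesis
    by (simp add: hdiv_add[OF Ck_1_scaleR[OF \<theta> u] Ck_1_scaleR[OF \<theta>' w]] hdiv_scaleR[OF \<theta> u] hdiv_scaleR[OF \<theta>' w]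
        LD_simps linear_diff[OF Ck_1_FD_linear[OF \<theta>]] del: One_nat_def)
qed

lemma T_left: "u \<in> T \<Longrightarrow> (\<lambda>p. u (h \<odot> p)) \<in> T"
  by (rule T_I) (auto intro: Ck_1_left bounded_support_left T_D simp del: One_nat_def)

lemma perim_le_nonneg: "perim_le B c \<Longrightarrow> 0 \<le> c"
  using zero_in_T unfolding perim_le_def pair_def by (force simp: hdiv_const)

lemma pair_left:
  assumes "u \<in> T" "f \<in> borel_measurable borel"
  shows "pair (\<lambda>x. f (h \<odot> x)) (\<lambda>p. u (h \<odot> p)) = pair f u"
  unfolding pair_def hdiv_left[OF T_D(1)[OF assms(1)]]
  by (rule integral_left) (use assms borel_measurable_continuous_onI[OF continuous_hdiv[OF T_D(1)[OF assms(1)]]] in measurable)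

lemma perim_le_left:
  assumes B: "B \<in> sets borel" and P: "perim_le B c"
  shows "perim_le {x. h \<odot> x \<in> B} c"
  unfolding perim_le_def
proof
  fix u assume u: "u \<in> T"
  have "pair (\<lambda>x. indicator B (h \<odot> x)) (\<lambda>p. u (- h \<odot> (h \<odot> p))) = pair (indicator B) (\<lambda>p. u (- h \<odot> p))"
    by (rule pair_left[OF T_left[OF u]]) (use B in simp)
  also have "\<dots> \<le> c" using P T_left[OF u] by (auto simp: perim_le_def)
  finally have "pair (\<lambda>x. indicator B (h \<odot> x)) u \<le> c" by simp
  moreover have "(\<lambda>x. indicator B (h \<odot> x)) = (indicator {x. h \<odot> x \<in> B} :: _ \<Rightarrow> real)"
    by (auto simp: indicator_def)
  ultimately show "pair (indicator {x. h \<odot> x \<in> B}) u \<le> c" by simp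
qed

lemma pair_scale_le:
  assumes P: "perim_le B c" and \<kappa>: "\<kappa> > 0" and u: "Ck 1 u" "bounded {p. u p \<noteq> 0}"
    and K: "\<And>p. (1 / \<kappa>) *\<^sub>R u p \<in> K"
  shows "pair (indicator B) u \<le> \<kappa> * c"
proof -
  have "(\<lambda>p. (1 / \<kappa>) *\<^sub>R u p) \<in> T"
    by (rule T_I) (use u K in \<open>auto intro: Ck_1_scaleR Ck_1_const simp del: One_nat_def elim: bounded_subset\<close>)
  hence "pair (indicator B) (\<lambda>p. (1 / \<kappa>) *\<^sub>R u p) \<le> c" using P by (auto simp: perim_le_def)
  moreover have "hdiv (\<lambda>p. (1 / \<kappa>) *\<^sub>R u p) p = (1 / \<kappa>) * hdiv u p" for p
    using hdiv_scaleR[OF Ck_1_const[of "1 / \<kappa>"] u(1)] FD_eq[OF has_derivative_const[of "1/\<kappa>" "at p"]] by simp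
  hence "pair (indicator B) (\<lambda>p. (1 / \<kappa>) *\<^sub>R u p) = (1 / \<kappa>) * pair (indicator B) u"
    by (simp add: pair_def)
  ultimately show ?thesis using \<kappa> by (simp add: field_simps)
qed

lemma horizontal_gauge_bound:
  obtains \<kappa> where "\<kappa> > 0" "\<And>x s. x \<in> X \<Longrightarrow> \<bar>s\<bar> \<le> 1 \<Longrightarrow> (1 / \<kappa>) *\<^sub>R (s *\<^sub>R x) \<in> K"
proof -
  obtain e where e: "e > 0" "\<And>w. w \<in> span X \<Longrightarrow> norm w \<le> e \<Longrightarrow> w \<in> K" using K_absorbing by blast
  have fin: "finite X" using independent_X by (rule independent_imp_finite)
  define M where "M = 1 + (\<Sum>x\<in>X. norm x)"
  have M: "M > 0" by (simp add: M_def add_pos_nonneg sum_nonneg)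
  have "(1 / (M / e)) *\<^sub>R (s *\<^sub>R x) \<in> K" if "x \<in> X" "\<bar>s\<bar> \<le> 1" for x s
  proof (rule e(2))
    show "(1 / (M / e)) *\<^sub>R (s *\<^sub>R x) \<in> span X" by (intro span_scale span_base that)
    have "norm x \<le> (\<Sum>x\<in>X. norm x)" using that fin by (intro member_le_sum) auto
    hence "\<bar>s\<bar> * norm x \<le> 1 * M" using that M by (intro mult_mono) (auto simp: M_def)
    hence "(\<bar>s\<bar> * norm x) * (e / M) \<le> M * (e / M)" using M e by (intro mult_right_mono) auto
    thus "norm ((1 / (M / e)) *\<^sub>R (s *\<^sub>R x)) \<le> e" using M e by (simp add: abs_mult field_simps)
  qed
  thus ?thesis using that[of "M / e"] M e by simp
qed

text \<open>
  The derivative in \<open>t\<close> of the first integral is the pairing of \<open>B\<close> with a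
  multiple of the test field \<open>\<psi> x\<close>, where \<open>\<psi>\<close> is a translate of
  \<open>\<phi>\<close>. Both signs of \<open>x\<close> are used because \<open>K\<close> need not
  be symmetric; \<open>\<kappa>\<close> is the factor by which \<open>K\<close> has to be dilated to
  contain both.
\<close>

lemma right_difference_bound:
  assumes \<kappa>: "\<kappa> > 0" "\<And>x s. x \<in> X \<Longrightarrow> \<bar>s\<bar> \<le> 1 \<Longrightarrow> (1 / \<kappa>) *\<^sub>R (s *\<^sub>R x) \<in> K"
    and x: "x \<in> X" and B: "B \<in> sets borel" "perim_le B c"
    and \<phi>: "Ck 1 \<phi>" "bounded {p. \<phi> p \<noteq> 0}" "\<And>p. \<bar>\<phi> p\<bar> \<le> (1::real)"
  shows "\<bar>(\<integral>p. indicator B p * \<phi> (p \<odot> t *\<^sub>R x) \<partial>lborel) - (\<integral>p. indicator B p * \<phi> p \<partial>lborel)\<bar> \<le> \<kappa> * c * \<bar>t\<bar>"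
proof -
  define F where "F t = (\<integral>p. indicator B p * \<phi> (p \<odot> t *\<^sub>R x) \<partial>lborel)" for t :: real
  define F' where "F' t = (\<integral>p. indicator B p * FD (\<lambda>p. \<phi> (p \<odot> t *\<^sub>R x)) p (LD p 0 x) \<partial>lborel)" for t :: real
  have F': "(F has_real_derivative F' t) (at t)" for t
    unfolding F_def F'_def by (rule right_flow_integral_derivative[OF \<phi>(1,2)]) (use B in \<open>auto simp: indicator_def\<close>)
  have bound: "\<bar>F' t\<bar> \<le> \<kappa> * c" for t
  proof -
    define \<psi> where "\<psi> p = \<phi> (p \<odot> t *\<^sub>R x)" for p
    have \<psi>: "Ck 1 \<psi>" unfolding \<psi>_def by (rule Ck_1_right[OF \<phi>(1)])
    obtain S where "\<And>s p. norm s \<le> \<bar>t\<bar> \<Longrightarrow> S < norm p \<Longrightarrow> \<phi> (p \<odot> s *\<^sub>R x) = 0"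
      using right_flow_support[OF \<phi>(2), of "\<bar>t\<bar>" x] by blast
    from this[of t] have "norm p \<le> S" if "\<psi> p \<noteq> 0" for p using that unfolding \<psi>_def by (force simp: not_le[symmetric])
    hence bd: "bounded {p. \<psi> p \<noteq> 0}" by (auto simp: bounded_iff)
    have eq: "F' t * s = pair (indicator B) (\<lambda>p. \<psi> p *\<^sub>R (s *\<^sub>R x))" for s
      unfolding pair_def hdiv_scaleR[OF \<psi> Ck_1_const] hdiv_const F'_def \<psi>_def[symmetric]
      by (simp add: LD_simps linear_scale[OF Ck_1_FD_linear[OF \<psi>]] mult_ac)
    have le: "F' t * s \<le> \<kappa> * c" if "\<bar>s\<bar> \<le> 1" for s
      unfolding eq
    proof (rule pair_scale_le[OF B(2) \<kappa>(1)])
      show "Ck 1 (\<lambda>p. \<psi> p *\<^sub>R (s *\<^sub>R x))" by (intro Ck_1_scaleR \<psi> Ck_1_const)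
      show "bounded {p. \<psi> p *\<^sub>R (s *\<^sub>R x) \<noteq> 0}" by (rule bounded_subset[OF bd]) auto
      have "\<bar>\<psi> p * s\<bar> \<le> 1" for p
        using mult_mono[OF \<phi>(3)[of "p \<odot> t *\<^sub>R x"] that] by (simp add: abs_mult \<psi>_def)
      from \<kappa>(2)[OF x this] show "(1 / \<kappa>) *\<^sub>R (\<psi> p *\<^sub>R (s *\<^sub>R x)) \<in> K" for p by simp
    qed
    show ?thesis using le[of 1] le[of "-1"] by simp
  qed
  have "norm (F t - F 0) \<le> \<kappa> * c * norm (t - 0)"
    by (rule field_differentiable_bound[of UNIV]) (use F' bound in auto)
  thus ?thesis by (simp add: F_def)
qed

end

section \<open>Approximation of sets of finite measure\<close>

lemma finite_measure_tail:
  fixes B :: "'a::euclidean_space set"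
  assumes B: "B \<in> sets borel" "emeasure lborel B < \<infinity>" and e: "e > 0"
  obtains n :: nat where "emeasure lborel (B - cball 0 (real n)) < ennreal e"
proof -
  have "(\<lambda>n. emeasure lborel (B - cball 0 (real n))) \<longlonglongrightarrow> emeasure lborel (\<Inter>n. B - cball 0 (real n))"
  proof (rule Lim_emeasure_decseq)
    show "range (\<lambda>n. B - cball 0 (real n)) \<subseteq> sets lborel" using B by auto
    show "decseq (\<lambda>n. B - cball 0 (real n))" by (auto simp: decseq_def)
    show "emeasure lborel (B - cball 0 (real n)) \<noteq> \<infinity>" for n
      using emeasure_mono[of "B - cball 0 (real n)" B lborel] B by (auto simp: top_unique less_top)
  qed
  moreover have "(\<Inter>n. B - cball 0 (real n)) = {}" using real_arch_simple by fastforce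
  ultimately have "(\<lambda>n. emeasure lborel (B - cball 0 (real n))) \<longlonglongrightarrow> 0" by (simp only: emeasure_empty)
  hence "\<forall>\<^sub>F n in sequentially. emeasure lborel (B - cball 0 (real n)) < ennreal e"
    using order_tendstoD(2)[of _ 0 sequentially "ennreal e"] e by simp
  thus ?thesis using that eventually_sequentially by auto
qed

lemma inner_compact:
  fixes B :: "'a::euclidean_space set"
  assumes B: "B \<in> sets borel" "emeasure lborel B < \<infinity>" and e: "e > 0"
  obtains C where "compact C" "C \<subseteq> B" "emeasure lborel (B - C) < ennreal e"
proof -
  obtain C where C: "closed C" "C \<subseteq> B" "emeasure lebesgue (B - C) < ennreal (e / 2)"
    by (rule sets_lebesgue_inner_closed[of B "e / 2"]) (use B e in auto)
  have C': "emeasure lborel (B - C) < ennreal (e / 2)" using C B by (simp add: borel_closed sets.Diff)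
  obtain n :: nat where n: "emeasure lborel (B - cball 0 (real n)) < ennreal (e / 2)"
    using finite_measure_tail[OF B, of "e / 2"] e by auto
  show ?thesis
  proof (rule that[of "C \<inter> cball 0 (real n)"])
    show "compact (C \<inter> cball 0 (real n))" using C by (simp add: closed_Int_compact)
    have "emeasure lborel (B - C \<inter> cball 0 (real n)) \<le> emeasure lborel ((B - C) \<union> (B - cball 0 (real n)))"
      using B C by (intro emeasure_mono) (auto simp: borel_closed)
    also have "\<dots> \<le> emeasure lborel (B - C) + emeasure lborel (B - cball 0 (real n))"
      using B C by (intro emeasure_subadditive) (auto simp: borel_closed)
    also have "\<dots> < ennreal (e / 2) + ennreal (e / 2)" using C' n by (rule add_strict_mono)
    also have "\<dots> = ennreal e" using e by (simp add: ennreal_plus[symmetric] del: ennreal_plus)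
    finally show "emeasure lborel (B - C \<inter> cball 0 (real n)) < ennreal e" .
  qed (use C in auto)
qed

context nilpotent_lie_group
begin

text \<open>
  Between a compact set inside \<open>B\<close> and an open set outside, the translation has no
  effect when it is small; the remainder has small measure.
\<close>

lemma left_translation_continuous:
  assumes B: "B \<in> sets borel" "emeasure lborel B < \<infinity>" and e: "e > 0"
  obtains d where "d > 0" "\<And>h. norm h < d \<Longrightarrow> emeasure lborel {x. (h \<odot> x \<in> B) \<noteq> (x \<in> B)} \<le> ennreal e"
proof -
  obtain C where C: "compact C" "C \<subseteq> B" "emeasure lborel (B - C) < ennreal (e / 4)"
    using inner_compact[OF B, of "e / 4"] e by auto
  obtain U where U: "open U" "B \<subseteq> U" "emeasure lborel (U - B) < ennreal (e / 4)"
    using outer_regular_lborel[OF B(1), of "e / 4"] e by auto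
  obtain s where s: "s > 0" "(\<Union>x\<in>C. ball x s) \<subseteq> U"
    using compact_subset_open_imp_ball_epsilon_subset[OF C(1) U(1)] C U by blast
  have "uniformly_continuous_on (cball 0 1 \<times> C) (\<lambda>z. - fst z \<odot> snd z)"
    by (intro compact_uniformly_continuous continuous_on_gmul continuous_intros compact_Times C) auto
  then obtain d where d: "d > 0" "\<And>z z'. z \<in> cball 0 1 \<times> C \<Longrightarrow> z' \<in> cball 0 1 \<times> C \<Longrightarrow> dist z' z < d \<Longrightarrow>
      dist (- fst z' \<odot> snd z') (- fst z \<odot> snd z) < s"
    using s(1) unfolding uniformly_continuous_on_def by blast
  have inU: "- h \<odot> c \<in> U" if h: "norm h < min d 1" and c: "c \<in> C" for h c
  proof -
    have a: "(0, c) \<in> cball 0 1 \<times> C" "(h, c) \<in> cball 0 1 \<times> C" "dist (h, c) (0, c) < d"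
      using h c by (auto simp: dist_Pair_Pair)
    from d(2)[OF a] have "dist (- h \<odot> c) c < s" by simp
    hence "- h \<odot> c \<in> ball c s" by (simp add: dist_commute)
    thus ?thesis using s c by blast
  qed
  have one: "emeasure lborel {x. h \<odot> x \<in> B \<and> x \<notin> B} \<le> ennreal (e / 2)" if h: "norm h < min d 1" for h
  proof -
    have [measurable]: "B \<in> sets borel" "U \<in> sets borel" "C \<in> sets borel"
      using B U C by (auto simp: borel_compact)
    have "{x. h \<odot> x \<in> B \<and> x \<notin> B} \<subseteq> {x. h \<odot> x \<in> B - C} \<union> (U - B)"
    proof
      fix x assume x: "x \<in> {x. h \<odot> x \<in> B \<and> x \<notin> B}"
      have "x \<in> U" if "h \<odot> x \<in> C" using inU[OF h that] by simp
      thus "x \<in> {x. h \<odot> x \<in> B - C} \<union> (U - B)" using x by blast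
    qed
    hence "emeasure lborel {x. h \<odot> x \<in> B \<and> x \<notin> B} \<le> emeasure lborel ({x. h \<odot> x \<in> B - C} \<union> (U - B))"
      by (intro emeasure_mono) measurable
    also have "\<dots> \<le> emeasure lborel {x. h \<odot> x \<in> B - C} + emeasure lborel (U - B)"
      by (intro emeasure_subadditive) measurable
    also have "\<dots> = emeasure lborel (B - C) + emeasure lborel (U - B)"
      by (subst emeasure_left) auto
    also have "\<dots> \<le> ennreal (e / 4) + ennreal (e / 4)" using C U by (intro add_mono) auto
    also have "\<dots> = ennreal (e / 2)" using e by (simp add: ennreal_plus[symmetric] del: ennreal_plus)
    finally show ?thesis .
  qed
  show ?thesis
  proof (rule that[of "min d 1"])
    show "min d 1 > 0" using d by simp
    fix h :: "(real, 'n) vec" assume h: "norm h < min d 1"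
    have [measurable]: "B \<in> sets borel" by (rule B)
    have "{x. (h \<odot> x \<in> B) \<noteq> (x \<in> B)} = {x. h \<odot> x \<in> B \<and> x \<notin> B} \<union> {x. h \<odot> x \<in> {y. - h \<odot> y \<in> B \<and> y \<notin> B}}" by auto
    hence "emeasure lborel {x. (h \<odot> x \<in> B) \<noteq> (x \<in> B)}
      \<le> emeasure lborel {x. h \<odot> x \<in> B \<and> x \<notin> B} + emeasure lborel {x. h \<odot> x \<in> {y. - h \<odot> y \<in> B \<and> y \<notin> B}}"
      by (simp only:) (intro emeasure_subadditive; measurable)
    also have "emeasure lborel {x. h \<odot> x \<in> {y. - h \<odot> y \<in> B \<and> y \<notin> B}} = emeasure lborel {y. - h \<odot> y \<in> B \<and> y \<notin> B}"
      by (intro emeasure_left) measurable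
    also have "emeasure lborel {x. h \<odot> x \<in> B \<and> x \<notin> B} + emeasure lborel {y. - h \<odot> y \<in> B \<and> y \<notin> B} \<le> ennreal (e / 2) + ennreal (e / 2)"
      using one[of h] one[of "- h"] h by (intro add_mono) auto
    also have "\<dots> = ennreal e" using e by (simp add: ennreal_plus[symmetric] del: ennreal_plus)
    finally show "emeasure lborel {x. (h \<odot> x \<in> B) \<noteq> (x \<in> B)} \<le> ennreal e" by simp
  qed
qed

section \<open>Mollification\<close>

text \<open>
  The convolution of \<open>\<rho>\<close> with the indicator of \<open>B\<close>. The variable
  \<open>x\<close> enters only through the \<open>C\<^sup>1\<close> function \<open>\<rho>\<close>,
  which gives regularity; after the substitution in \<open>moll_eq\<close> it becomes an average of
  left translates of \<open>B\<close>, which gives the perimeter bound.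
\<close>

definition moll :: "((real, 'n) vec \<Rightarrow> real) \<Rightarrow> (real, 'n) vec set \<Rightarrow> (real, 'n) vec \<Rightarrow> real" where
  "moll \<rho> B x = (\<integral>y. indicator B y * \<rho> (x \<odot> - y) \<partial>lborel)"

lemma moll_support:
  assumes "bounded {x. \<rho> x \<noteq> 0}"
  shows "\<exists>S. \<forall>x y. norm x \<le> R \<longrightarrow> S < norm y \<longrightarrow> \<rho> (x \<odot> - y) = (0::real)"
proof -
  have "bounded (uminus ` cball 0 R :: (real, 'n) vec set)"
    by (intro compact_imp_bounded compact_continuous_image continuous_intros) auto
  then obtain S where S: "\<And>a b. a \<in> uminus ` cball 0 R \<Longrightarrow> b \<in> {x. \<rho> x \<noteq> 0} \<Longrightarrow> norm (a \<odot> b) \<le> S"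
    using bounded_gmul[OF _ assms] by blast
  have "norm y \<le> S" if "norm x \<le> R" "\<rho> (x \<odot> - y) \<noteq> 0" for x y
  proof -
    have "- x \<in> uminus ` cball 0 R" using that by (intro imageI) simp
    from S[OF this, of "x \<odot> - y"] that show ?thesis by simp
  qed
  thus ?thesis by (meson not_le)
qed

lemma Ck_1_moll:
  assumes \<rho>: "Ck 1 \<rho>" "bounded {x. \<rho> x \<noteq> 0}" and B: "B \<in> sets borel"
  shows "Ck 1 (moll \<rho> B)"
  unfolding moll_def[abs_def]
proof (rule Ck_1_param_integral(2)[of "\<lambda>x y. \<rho> (x \<odot> - y)"])
  show "Ck 1 (\<lambda>z. \<rho> (fst z \<odot> - snd z))"
    by (intro Ck_1_compose[OF \<rho>(1)] Ck_1_gmul Ck_1_uminus Ck_1_bounded_linear bounded_linear_fst bounded_linear_snd)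
qed (use moll_support[OF \<rho>(2)] B in \<open>auto simp: indicator_def\<close>)

text \<open>
  The substitution \<open>y = h\<inverse> \<odot> x\<close> preserves Lebesgue measure, being
  composed of a translation and a reflection.
\<close>

lemma moll_eq:
  assumes \<rho>: "Ck 1 \<rho>" and B: "B \<in> sets borel"
  shows "moll \<rho> B x = (\<integral>h. \<rho> h * indicator B (- h \<odot> x) \<partial>lborel)"
proof -
  have [measurable]: "\<rho> \<in> borel_measurable borel" "B \<in> sets borel" using Ck_1_measurable[OF \<rho>] B by auto
  define F where "F y = indicator B y * \<rho> (x \<odot> - y)" for y
  have [measurable]: "F \<in> borel_measurable borel" unfolding F_def by measurable
  have "moll \<rho> B x = (\<integral>y. F (- y) \<partial>lborel)" unfolding moll_def F_def[symmetric] by (rule integral_minus[symmetric]) measurable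
  also have "\<dots> = (\<integral>y. F (- (- x \<odot> y)) \<partial>lborel)" by (rule integral_left[symmetric]) measurable
  also have "\<dots> = (\<integral>h. \<rho> h * indicator B (- h \<odot> x) \<partial>lborel)"
    unfolding F_def minus_gmul by (simp add: minus_gmul mult.commute)
  finally show ?thesis .
qed

lemma moll_bounds:
  assumes \<rho>: "Ck 1 \<rho>" "\<And>x. 0 \<le> \<rho> x" "integrable lborel \<rho>" "(\<integral>x. \<rho> x \<partial>lborel) = 1" and B: "B \<in> sets borel"
  shows "0 \<le> moll \<rho> B x" "moll \<rho> B x \<le> 1"
proof -
  have [measurable]: "\<rho> \<in> borel_measurable borel" "B \<in> sets borel" using Ck_1_measurable[OF \<rho>(1)] B by auto
  show "0 \<le> moll \<rho> B x" unfolding moll_def using \<rho>(2) by (intro integral_nonneg_AE) auto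
  have "moll \<rho> B x \<le> (\<integral>h. \<rho> h \<partial>lborel)" unfolding moll_eq[OF \<rho>(1) B]
  proof (rule integral_mono)
    show "integrable lborel (\<lambda>h. \<rho> h * indicator B (- h \<odot> x))"
      by (rule Bochner_Integration.integrable_bound[OF \<rho>(3)]) (use \<rho>(2) in \<open>auto simp: indicator_def\<close>)
  qed (use \<rho> in \<open>auto simp: indicator_def\<close>)
  thus "moll \<rho> B x \<le> 1" using \<rho>(4) by simp
qed

lemma moll_L1:
  assumes \<rho>: "Ck 1 \<rho>" "\<And>x. 0 \<le> \<rho> x" "integrable lborel \<rho>" "(\<integral>x. \<rho> x \<partial>lborel) = 1" and B: "B \<in> sets borel"
    and e: "e > 0" and d: "\<And>h. \<rho> h \<noteq> 0 \<Longrightarrow> emeasure lborel {x. (- h \<odot> x \<in> B) \<noteq> (x \<in> B)} \<le> ennreal e"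
  shows "(\<integral>\<^sup>+x. ennreal \<bar>moll \<rho> B x - indicator B x\<bar> \<partial>lborel) \<le> ennreal e"
proof -
  have [measurable]: "\<rho> \<in> borel_measurable borel" "B \<in> sets borel" using Ck_1_measurable[OF \<rho>(1)] B by auto
  define D :: "(real, 'n) vec \<Rightarrow> (real, 'n) vec \<Rightarrow> real" where "D h x = indicator {x. (- h \<odot> x \<in> B) \<noteq> (x \<in> B)} x" for h x
  have D: "\<bar>indicator B (- h \<odot> x) - indicator B x\<bar> = D h x" for h x by (auto simp: D_def indicator_def)
  have [measurable]: "case_prod D \<in> borel_measurable (lborel \<Otimes>\<^sub>M lborel)"
    unfolding D[symmetric] by measurable
  have pt: "ennreal \<bar>moll \<rho> B x - indicator B x\<bar> \<le> (\<integral>\<^sup>+h. ennreal (\<rho> h) * ennreal (D h x) \<partial>lborel)" for x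
  proof -
    have int: "integrable lborel (\<lambda>h. \<rho> h * indicator B (- h \<odot> x))"
      by (rule Bochner_Integration.integrable_bound[OF \<rho>(3)]) (use \<rho>(2) in \<open>auto simp: indicator_def\<close>)
    have "moll \<rho> B x - indicator B x = (\<integral>h. \<rho> h * indicator B (- h \<odot> x) \<partial>lborel) - (\<integral>h. \<rho> h * indicator B x \<partial>lborel)"
      using \<rho>(4) by (simp add: moll_eq[OF \<rho>(1) B])
    also have "\<dots> = (\<integral>h. \<rho> h * (indicator B (- h \<odot> x) - indicator B x) \<partial>lborel)"
      using int \<rho>(3) by (simp add: right_diff_distrib)
    finally have "ennreal \<bar>moll \<rho> B x - indicator B x\<bar> \<le> (\<integral>\<^sup>+h. ennreal (norm (\<rho> h * (indicator B (- h \<odot> x) - indicator B x))) \<partial>lborel)"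
      using integral_norm_bound_ennreal[of lborel "\<lambda>h. \<rho> h * (indicator B (- h \<odot> x) - indicator B x)"] int \<rho>(3)
      by (simp add: right_diff_distrib)
    also have "\<dots> = (\<integral>\<^sup>+h. ennreal (\<rho> h) * ennreal (D h x) \<partial>lborel)"
      using \<rho>(2) by (intro nn_integral_cong) (simp add: abs_mult D ennreal_mult')
    finally show ?thesis .
  qed
  have "(\<integral>\<^sup>+x. ennreal \<bar>moll \<rho> B x - indicator B x\<bar> \<partial>lborel) \<le> (\<integral>\<^sup>+x. (\<integral>\<^sup>+h. ennreal (\<rho> h) * ennreal (D h x) \<partial>lborel) \<partial>lborel)"
    by (intro nn_integral_mono pt)
  also have "\<dots> = (\<integral>\<^sup>+h. (\<integral>\<^sup>+x. ennreal (\<rho> h) * ennreal (D h x) \<partial>lborel) \<partial>lborel)"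
    by (rule lborel_pair.Fubini') measurable
  also have "\<dots> \<le> (\<integral>\<^sup>+h. ennreal (\<rho> h) * ennreal e \<partial>lborel)"
  proof (intro nn_integral_mono)
    fix h
    have Dm: "{x. (- h \<odot> x \<in> B) \<noteq> (x \<in> B)} \<in> sets lborel" by measurable
    have "(\<integral>\<^sup>+x. ennreal (D h x) \<partial>lborel) = emeasure lborel {x. (- h \<odot> x \<in> B) \<noteq> (x \<in> B)}"
      unfolding D_def ennreal_indicator using Dm by (rule nn_integral_indicator)
    moreover have "(\<integral>\<^sup>+x. ennreal (\<rho> h) * ennreal (D h x) \<partial>lborel) = ennreal (\<rho> h) * (\<integral>\<^sup>+x. ennreal (D h x) \<partial>lborel)"
      by (rule nn_integral_cmult) (unfold D_def, use Dm in measurable)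
    ultimately show "(\<integral>\<^sup>+x. ennreal (\<rho> h) * ennreal (D h x) \<partial>lborel) \<le> ennreal (\<rho> h) * ennreal e"
      using d[of h] by (cases "\<rho> h = 0") (auto intro!: mult_left_mono)
  qed
  also have "\<dots> = (\<integral>\<^sup>+h. ennreal (\<rho> h) \<partial>lborel) * ennreal e" by (rule nn_integral_multc) measurable
  also have "\<dots> = ennreal e" using \<rho> by (simp add: nn_integral_eq_integral)
  finally show ?thesis .
qed

end

context sub_finsler_nilpotent_group
begin

text \<open>
  By Fubini the pairing is the average, with weight \<open>\<rho>\<close>, of the pairings of left
  translates of \<open>B\<close>, and the perimeter is invariant under left translations.
\<close>

lemma pair_moll_le:
  assumes \<rho>: "Ck 1 \<rho>" "bounded {x. \<rho> x \<noteq> 0}" "\<And>x. 0 \<le> \<rho> x" "integrable lborel \<rho>" "(\<integral>x. \<rho> x \<partial>lborel) = 1"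
    and B: "B \<in> sets borel" "perim_le B c" and u: "u \<in> T"
  shows "pair (moll \<rho> B) u \<le> c"
proof -
  have [measurable]: "\<rho> \<in> borel_measurable borel" "B \<in> sets borel" "hdiv u \<in> borel_measurable borel"
    using Ck_1_measurable[OF \<rho>(1)] B borel_measurable_continuous_onI[OF continuous_hdiv[OF T_D(1)[OF u]]] by auto
  define F where "F x h = indicator B (- h \<odot> x) * (\<rho> h * hdiv u x)" for x h
  have "integrable (lborel \<Otimes>\<^sub>M lborel) (case_prod F)"
  proof -
    have "integrable lborel (\<lambda>z. indicator B (- snd z \<odot> fst z) * (\<rho> (snd z) * hdiv u (fst z)))"
    proof (rule integrable_mult_bounded_support)
      show "(\<lambda>z. indicator B (- snd z \<odot> fst z) :: real) \<in> borel_measurable borel"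
      proof -
        have "(\<lambda>z :: (real,'n) vec \<times> (real,'n) vec. - snd z \<odot> fst z) \<in> borel_measurable borel"
          by (intro borel_measurable_continuous_onI continuous_on_gmul continuous_intros)
        thus ?thesis using measurable_compose[of _ borel borel "indicator B"] by (simp add: borel_measurable_indicator)
      qed
      show "continuous_on UNIV (\<lambda>z. \<rho> (snd z) * hdiv u (fst z))"
        by (intro continuous_on_mult continuous_on_compose2[OF Ck_1_continuous[OF \<rho>(1), of UNIV]]
            continuous_on_compose2[OF continuous_hdiv[OF T_D(1)[OF u]]] continuous_intros) auto
      have "bounded ({x. hdiv u x \<noteq> 0} \<times> {x. \<rho> x \<noteq> 0})"
        by (intro bounded_Times \<rho>(2) bounded_support_hdiv T_D[OF u])
      thus "bounded {z. \<rho> (snd z) * hdiv u (fst z) \<noteq> 0}" by (rule bounded_subset) auto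
    qed (auto simp: indicator_def)
    thus ?thesis by (simp add: lborel_prod F_def case_prod_beta')
  qed
  note Fub = lborel_pair.Fubini_integral[OF this]
  have "pair (moll \<rho> B) u = (\<integral>x. (\<integral>h. F x h \<partial>lborel) \<partial>lborel)"
    unfolding pair_def moll_eq[OF \<rho>(1) B(1)] F_def by (simp add: mult_ac flip: integral_mult_left_zero integral_mult_right_zero)
  also have "\<dots> = (\<integral>h. (\<integral>x. F x h \<partial>lborel) \<partial>lborel)" using Fub by simp
  also have "\<dots> = (\<integral>h. \<rho> h * pair (indicator {x. - h \<odot> x \<in> B}) u \<partial>lborel)"
  proof (rule Bochner_Integration.integral_cong[OF refl])
    fix h
    have "(\<integral>x. F x h \<partial>lborel) = (\<integral>x. \<rho> h * (indicator {x. - h \<odot> x \<in> B} x * hdiv u x) \<partial>lborel)"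
      by (rule Bochner_Integration.integral_cong) (auto simp: F_def indicator_def)
    thus "(\<integral>x. F x h \<partial>lborel) = \<rho> h * pair (indicator {x. - h \<odot> x \<in> B}) u" by (simp add: pair_def)
  qed
  also have "\<dots> \<le> (\<integral>h. \<rho> h * c \<partial>lborel)"
  proof (rule integral_mono')
    show "integrable lborel (\<lambda>h. \<rho> h * c)" using \<rho>(4) by simp
    show "0 \<le> \<rho> h * c" for h using \<rho>(3) perim_le_nonneg[OF B(2)] by simp
    show "\<rho> h * pair (indicator {x. - h \<odot> x \<in> B}) u \<le> \<rho> h * c" for h
      using perim_le_left[OF B, of "- h"] u \<rho>(3) by (intro mult_left_mono) (auto simp: perim_le_def)
  qed
  also have "\<dots> = c" using \<rho>(5) by simp
  finally show ?thesis .
qed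

text \<open>
  One approximating function serves for all perimeter bounds simultaneously, and its support is
  bounded when \<open>B\<close> is bounded.
\<close>

lemma mollification:
  assumes B: "B \<in> sets borel" "emeasure lborel B < \<infinity>" and e: "e > 0"
  obtains m where "Ck 1 m" "\<And>x. 0 \<le> m x" "\<And>x. m x \<le> (1::real)" "\<And>c u. perim_le B c \<Longrightarrow> u \<in> T \<Longrightarrow> pair m u \<le> c"
    "integrable lborel (\<lambda>x. m x - indicator B x)" "(\<integral>x. \<bar>m x - indicator B x\<bar> \<partial>lborel) \<le> e"
    "bounded B \<Longrightarrow> bounded {x. m x \<noteq> 0}"
proof -
  obtain d where d: "d > 0" "\<And>h. norm h < d \<Longrightarrow> emeasure lborel {x. (h \<odot> x \<in> B) \<noteq> (x \<in> B)} \<le> ennreal e"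
    using left_translation_continuous[OF B e] by blast
  obtain \<rho> :: "(real, 'n) vec \<Rightarrow> real" where \<rho>: "Ck 1 \<rho>" "\<And>x. 0 \<le> \<rho> x" "\<And>x. d \<le> norm x \<Longrightarrow> \<rho> x = 0"
    "integrable lborel \<rho>" "(\<integral>x. \<rho> x \<partial>lborel) = 1" using bump_exists[OF d(1)] by metis
  have sup: "norm x < d" if "\<rho> x \<noteq> 0" for x using \<rho>(3)[of x] that by force
  hence bs: "bounded {x. \<rho> x \<noteq> 0}" by (auto simp: bounded_iff intro!: exI[of _ d] less_imp_le)
  have C: "Ck 1 (moll \<rho> B)" by (rule Ck_1_moll[OF \<rho>(1) bs B(1)])
  have L1: "(\<integral>\<^sup>+x. ennreal \<bar>moll \<rho> B x - indicator B x\<bar> \<partial>lborel) \<le> ennreal e"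
    using d(2) sup by (intro moll_L1[OF \<rho>(1,2,4,5) B(1) e]) auto
  have meas: "(\<lambda>x. moll \<rho> B x - indicator B x) \<in> borel_measurable borel"
    using Ck_1_measurable[OF C] B(1) by (intro borel_measurable_diff) auto
  have int: "integrable lborel (\<lambda>x. moll \<rho> B x - indicator B x)"
    using meas L1 by (intro integrableI_bounded) (auto intro: le_less_trans)
  show ?thesis
  proof (rule that[OF C moll_bounds[OF \<rho>(1,2,4,5) B(1)] _ int])
    show "pair (moll \<rho> B) u \<le> c" if "perim_le B c" "u \<in> T" for c u
      by (rule pair_moll_le[OF \<rho>(1) bs \<rho>(2,4,5) B(1) that])
    have "ennreal (\<integral>x. \<bar>moll \<rho> B x - indicator B x\<bar> \<partial>lborel) = (\<integral>\<^sup>+x. ennreal \<bar>moll \<rho> B x - indicator B x\<bar> \<partial>lborel)"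
      using int by (intro nn_integral_eq_integral[symmetric]) auto
    also note L1
    finally show "(\<integral>x. \<bar>moll \<rho> B x - indicator B x\<bar> \<partial>lborel) \<le> e" using e by (simp only: ennreal_le_iff less_imp_le)
    assume bB: "bounded B"
    obtain S where S: "\<And>a b. a \<in> {x. \<rho> x \<noteq> 0} \<Longrightarrow> b \<in> B \<Longrightarrow> norm (a \<odot> b) \<le> S" using bounded_gmul[OF bs bB] by blast
    have "norm x \<le> S" if "moll \<rho> B x \<noteq> 0" for x
    proof (rule ccontr)
      assume n: "\<not> norm x \<le> S"
      have "indicator B y * \<rho> (x \<odot> - y) = 0" for y
        using S[of "x \<odot> - y" y] n by (auto simp: indicator_def)
      hence "(\<lambda>y. indicator B y * \<rho> (x \<odot> - y)) = (\<lambda>_. 0)" by (rule ext)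
      thus False using that unfolding moll_def by simp
    qed
    thus "bounded {x. moll \<rho> B x \<noteq> 0}" by (auto simp: bounded_iff)
  qed
qed

section \<open>Submodularity of the perimeter\<close>

lemma pair_integration_by_parts:
  assumes f: "Ck 1 f" and u: "u \<in> T"
  shows "pair f u = - (\<integral>p. FD f p (LD p 0 (u p)) \<partial>lborel)"
    and "integrable lborel (\<lambda>p. FD f p (LD p 0 (u p)))"
proof -
  note u' = T_D[OF u]
  have bd: "bounded {p. f p *\<^sub>R u p \<noteq> 0}" by (rule bounded_subset[OF u'(2)]) auto
  have c: "continuous_on UNIV (\<lambda>p. FD f p (LD p 0 (u p)))"
    by (intro Ck_1_FD_continuous[OF f] continuous_on_LD continuous_intros Ck_1_continuous[OF u'(1)])
  have "bounded {p. FD f p (LD p 0 (u p)) \<noteq> 0}"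
    by (rule bounded_subset[OF u'(2)]) (auto simp: LD_simps linear_0[OF Ck_1_FD_linear[OF f]])
  from integrable_mult_bounded_support[of "\<lambda>_. 1", OF _ _ c this]
  show i1: "integrable lborel (\<lambda>p. FD f p (LD p 0 (u p)))" by simp
  have "continuous_on UNIV (\<lambda>p. f p * hdiv u p)"
    by (intro continuous_on_mult Ck_1_continuous[OF f] continuous_hdiv[OF u'(1)])
  moreover have "bounded {p. f p * hdiv u p \<noteq> 0}"
    by (rule bounded_subset[OF bounded_support_hdiv[OF u'(2)]]) auto
  ultimately have i2: "integrable lborel (\<lambda>p. f p * hdiv u p)"
    using integrable_mult_bounded_support[of "\<lambda>_. 1" "\<lambda>p. f p * hdiv u p"] by simp
  have "(\<integral>p. f p * hdiv u p + FD f p (LD p 0 (u p)) \<partial>lborel) = 0"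
    using integral_hdiv_zero[OF Ck_1_scaleR[OF f u'(1)] bd] by (simp only: hdiv_scaleR[OF f u'(1)])
  thus "pair f u = - (\<integral>p. FD f p (LD p 0 (u p)) \<partial>lborel)"
    unfolding pair_def using i1 i2 by simp
qed

lemma half_sum_identity:
  fixes a b t :: real
  shows "1/2 * (a + b + t * (a - b)) = 1/2 * (1 + t) * a + (1 - 1/2 * (1 + t)) * b"
    and half_diff_identity: "1/2 * (a + b - t * (a - b)) = (1 - 1/2 * (1 + t)) * a + 1/2 * (1 + t) * b"
  by (simp_all add: field_simps)

text \<open>
  \<open>M\<close> and \<open>N\<close> are smooth substitutes for the maximum and the minimum of
  \<open>m\<close> and \<open>n\<close>. With \<open>\<theta> = (1 + s / q) / 2\<close>, where
  \<open>s = m - n\<close> and \<open>q\<close> is the square root, their gradients are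
  \<open>\<theta> \<nabla>m + (1 - \<theta>) \<nabla>n\<close> and \<open>(1 - \<theta>) \<nabla>m +
  \<theta> \<nabla>n\<close>. Collecting the terms with \<open>\<nabla>m\<close> and those with
  \<open>\<nabla>n\<close> shows that testing \<open>M\<close> with \<open>u\<close> and
  \<open>N\<close> with \<open>w\<close> amounts to testing \<open>m\<close> and \<open>n\<close>
  with two convex combinations of \<open>u\<close> and \<open>w\<close>, which are again
  \<open>K\<close>-valued.
\<close>

lemma smooth_max_min_pair_le:
  assumes m: "Ck 1 m" and n: "Ck 1 n" and \<delta>: "\<delta> > 0"
    and mc: "\<And>u. u \<in> T \<Longrightarrow> pair m u \<le> c" and nc: "\<And>u. u \<in> T \<Longrightarrow> pair n u \<le> c'"
    and u: "u \<in> T" and w: "w \<in> T"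
  defines "M \<equiv> \<lambda>x. (m x + n x + sqrt ((m x - n x)\<^sup>2 + \<delta>\<^sup>2)) / 2"
    and "N \<equiv> \<lambda>x. (m x + n x - sqrt ((m x - n x)\<^sup>2 + \<delta>\<^sup>2)) / 2"
  shows "pair M u + pair N w \<le> c + c'" "Ck 1 M" "Ck 1 N"
proof -
  define s where "s x = m x - n x" for x
  define q where "q t = sqrt (t\<^sup>2 + \<delta>\<^sup>2)" for t
  have qpos: "t\<^sup>2 + \<delta>\<^sup>2 > 0" for t using \<delta> by (simp add: add_nonneg_pos)
  have q0: "q t > 0" for t using qpos[of t] by (simp add: q_def)
  have qd: "(q has_real_derivative (t / q t)) (at t)" for t
  proof -
    have "((\<lambda>t. t\<^sup>2 + \<delta>\<^sup>2) has_real_derivative 2 * t) (at t)" by (auto intro!: derivative_eq_intros)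
    hence "((\<lambda>t. sqrt (t\<^sup>2 + \<delta>\<^sup>2)) has_real_derivative inverse (sqrt (t\<^sup>2 + \<delta>\<^sup>2)) / 2 * (2 * t)) (at t)"
      by (rule DERIV_chain2[where g = "\<lambda>t. t\<^sup>2 + \<delta>\<^sup>2", OF DERIV_real_sqrt[OF qpos]])
    moreover have "q = (\<lambda>t. sqrt (t\<^sup>2 + \<delta>\<^sup>2))" by (rule ext) (rule q_def)
    ultimately show ?thesis by (simp add: field_simps)
  qed
  have q_ge: "\<bar>t\<bar> \<le> q t" for t
    unfolding q_def by (rule real_le_rsqrt) simp
  have qc: "continuous_on UNIV q" using DERIV_continuous_on[of UNIV q "\<lambda>t. t / q t"] qd by simp
  have Cq: "Ck 1 q"
    by (rule Ck_1_real[OF qd]) (use q0 qc in \<open>auto intro!: continuous_intros simp: less_imp_neq[symmetric]\<close>)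
  have Cs: "Ck 1 s" unfolding s_def by (intro Ck_1_diff m n)
  have Cqs: "Ck 1 (\<lambda>x. q (s x))" by (rule Ck_1_compose[OF Cq Cs])
  have M: "M = (\<lambda>x. (1/2) * (m x + n x + q (s x)))" and N: "N = (\<lambda>x. (1/2) * (m x + n x - q (s x)))"
    by (auto simp: M_def N_def q_def s_def)
  show CM: "Ck 1 M" unfolding M by (intro Ck_1_mult Ck_1_const Ck_1_add m n Cqs)
  show CN: "Ck 1 N" unfolding N by (intro Ck_1_mult Ck_1_const Ck_1_add Ck_1_diff m n Cqs)
  define \<theta> where "\<theta> x = (1/2) * (1 + s x / q (s x))" for x
  have rq: "((\<lambda>t. t / q t) has_real_derivative (q t - t * (t / q t)) / (q t)\<^sup>2) (at t)" for t
    by (rule derivative_eq_intros qd refl | use q0[of t] in \<open>simp add: power2_eq_square\<close>)+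
  have "Ck 1 (\<lambda>t. t / q t)"
    by (rule Ck_1_real[OF rq]) (use q0 qc in \<open>auto intro!: continuous_intros simp: less_imp_neq[symmetric]\<close>)
  hence "Ck 1 (\<lambda>x. s x / q (s x))" by (rule Ck_1_compose[OF _ Cs])
  hence C\<theta>: "Ck 1 \<theta>" unfolding \<theta>_def by (intro Ck_1_mult Ck_1_const Ck_1_add)
  have \<theta>01: "0 \<le> \<theta> x" "\<theta> x \<le> 1" for x
  proof -
    have "- q (s x) \<le> s x" "s x \<le> q (s x)" using q_ge[of "s x"] by (auto simp: abs_le_iff)
    hence "-1 \<le> s x / q (s x)" "s x / q (s x) \<le> 1" using q0[of "s x"] by (simp_all add: le_divide_eq divide_le_eq)
    thus "0 \<le> \<theta> x" "\<theta> x \<le> 1" by (auto simp: \<theta>_def)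
  qed
  have FDqs: "FD (\<lambda>x. q (s x)) p v = (s p / q (s p)) * (FD m p v - FD n p v)" for p v
  proof -
    have "(s has_derivative (\<lambda>v. FD m p v - FD n p v)) (at p)"
      unfolding s_def[abs_def] by (rule has_derivative_diff[OF Ck_1_deriv[OF m] Ck_1_deriv[OF n]])
    hence "((\<lambda>x. q (s x)) has_derivative (\<lambda>v. (s p / q (s p)) * (FD m p v - FD n p v))) (at p)"
      by (rule has_derivative_compose) (rule qd[unfolded has_field_derivative_def])
    from fun_cong[OF FD_eq[OF this]] show ?thesis .
  qed
  have FDM: "FD M p v = \<theta> p * FD m p v + (1 - \<theta> p) * FD n p v" for p v
  proof -
    have "(M has_derivative (\<lambda>v. (1/2) * (FD m p v + FD n p v + FD (\<lambda>x. q (s x)) p v))) (at p)"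
      unfolding M by (intro has_derivative_mult_right has_derivative_add Ck_1_deriv m n Cqs)
    note eq = fun_cong[OF FD_eq[OF this], of v, unfolded FDqs]
    show ?thesis unfolding eq \<theta>_def by (rule half_sum_identity)
  qed
  have FDN: "FD N p v = (1 - \<theta> p) * FD m p v + \<theta> p * FD n p v" for p v
  proof -
    have "(N has_derivative (\<lambda>v. (1/2) * (FD m p v + FD n p v - FD (\<lambda>x. q (s x)) p v))) (at p)"
      unfolding N by (intro has_derivative_mult_right has_derivative_add has_derivative_diff Ck_1_deriv m n Cqs)
    note eq = fun_cong[OF FD_eq[OF this], of v, unfolded FDqs]
    show ?thesis unfolding eq \<theta>_def by (rule half_diff_identity)
  qed
  define U where "U = (\<lambda>p. \<theta> p *\<^sub>R u p + (1 - \<theta> p) *\<^sub>R w p)"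
  define W where "W = (\<lambda>p. (1 - \<theta> p) *\<^sub>R u p + (1 - (1 - \<theta> p)) *\<^sub>R w p)"
  have U: "U \<in> T" unfolding U_def by (rule T_convex_combination[OF u w C\<theta> \<theta>01])
  have W: "W \<in> T" unfolding W_def
    by (rule T_convex_combination[OF u w]) (use \<theta>01 in \<open>auto intro!: Ck_1_diff Ck_1_const C\<theta> simp del: One_nat_def\<close>)
  \<comment> \<open>the weights pass from the gradients to the test fields\<close>
  have pt: "FD M p (LD p 0 (u p)) + FD N p (LD p 0 (w p)) = FD m p (LD p 0 (U p)) + FD n p (LD p 0 (W p))" for p
    unfolding FDM FDN U_def W_def
    by (simp add: LD_simps linear_add[OF Ck_1_FD_linear[OF m]] linear_scale[OF Ck_1_FD_linear[OF m]]
        linear_add[OF Ck_1_FD_linear[OF n]] linear_scale[OF Ck_1_FD_linear[OF n]])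
  have "pair M u + pair N w = - (\<integral>p. FD M p (LD p 0 (u p)) + FD N p (LD p 0 (w p)) \<partial>lborel)"
    using pair_integration_by_parts[OF CM u] pair_integration_by_parts[OF CN w] by simp
  also have "\<dots> = pair m U + pair n W"
    unfolding pt using pair_integration_by_parts[OF m U] pair_integration_by_parts[OF n W] by simp
  also have "\<dots> \<le> c + c'" using mc[OF U] nc[OF W] by simp
  finally show "pair M u + pair N w \<le> c + c'" .
qed

text \<open>
  The error allowed between \<open>k\<close> and \<open>f\<close> is the sum of a small uniform one,
  harmless on the bounded support of the test field, and one with small integral.
\<close>

lemma pair_close:
  assumes f: "f \<in> borel_measurable borel" "\<And>x. \<bar>f x\<bar> \<le> 1" and k: "k \<in> borel_measurable borel" "\<And>x. \<bar>k x\<bar> \<le> 1 + \<delta>"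
    and u: "u \<in> T" and A: "\<And>x. \<bar>hdiv u x\<bar> \<le> A * indicator (cball 0 S) x" and "A > 0" "\<delta> > 0"
    and d: "\<And>x. \<bar>k x - f x\<bar> \<le> d x + \<delta>" and int: "integrable lborel d"  "\<And>x. d x \<ge> 0" "(\<integral>x. d x \<partial>lborel) \<le> e"
  shows "\<bar>pair k u - pair f u\<bar> \<le> A * e + \<delta> * A * measure lborel (cball 0 S :: (real, 'n) vec set)"
proof -
  have ig: "integrable lborel (\<lambda>x. k x * hdiv u x)"
  proof -
    have "integrable lborel (\<lambda>x. (k x / (1 + \<delta>)) * hdiv u x)"
      by (rule pair_integrable[OF u]) (use k \<open>\<delta> > 0\<close> in \<open>auto simp: abs_divide\<close>)
    hence "integrable lborel (\<lambda>x. (1 + \<delta>) * ((k x / (1 + \<delta>)) * hdiv u x))" by (rule integrable_mult_right)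
    thus ?thesis using \<open>\<delta> > 0\<close> by simp
  qed
  have if': "integrable lborel (\<lambda>x. f x * hdiv u x)" by (rule pair_integrable[OF u f])
  have fin: "emeasure lborel (cball 0 S :: (real, 'n) vec set) < \<infinity>" using emeasure_lborel_cball_finite by blast
  have iS: "integrable lborel (\<lambda>x. \<delta> * A * indicator (cball (0 :: (real, 'n) vec) S) x)"
    using fin by (intro integrable_mult_right integrable_real_indicator) auto
  have "pair k u - pair f u = (\<integral>x. (k x - f x) * hdiv u x \<partial>lborel)"
    unfolding pair_def using ig if' by (simp add: left_diff_distrib)
  also have "\<bar>\<dots>\<bar> \<le> (\<integral>x. \<bar>(k x - f x) * hdiv u x\<bar> \<partial>lborel)" by (rule integral_abs_bound)
  also have "\<dots> \<le> (\<integral>x. A * d x + \<delta> * A * indicator (cball 0 S) x \<partial>lborel)"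
  proof (rule integral_mono)
    show "integrable lborel (\<lambda>x. \<bar>(k x - f x) * hdiv u x\<bar>)"
      using Bochner_Integration.integrable_diff[OF ig if'] by (simp add: left_diff_distrib)
    show "integrable lborel (\<lambda>x. A * d x + \<delta> * A * indicator (cball 0 S) x)"
      using int iS by simp
    fix x
    have "\<bar>(k x - f x) * hdiv u x\<bar> \<le> (d x + \<delta>) * (A * indicator (cball 0 S) x)"
      unfolding abs_mult using A d int(2)[of x] \<open>\<delta> > 0\<close> by (intro mult_mono) auto
    also have "\<dots> = A * (d x * indicator (cball 0 S) x) + \<delta> * A * indicator (cball 0 S) x" by (simp add: algebra_simps)
    also have "\<dots> \<le> A * d x + \<delta> * A * indicator (cball 0 S) x"
      using \<open>A > 0\<close> \<open>\<delta> > 0\<close> int(2)[of x] by (intro add_mono mult_left_mono) (auto simp: indicator_def)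
    finally show "\<bar>(k x - f x) * hdiv u x\<bar> \<le> A * d x + \<delta> * A * indicator (cball 0 S) x" .
  qed
  also have "\<dots> = A * (\<integral>x. d x \<partial>lborel) + \<delta> * A * measure lborel (cball 0 S :: (real, 'n) vec set)"
    using int iS by simp
  also have "\<dots> \<le> A * e + \<delta> * A * measure lborel (cball 0 S :: (real, 'n) vec set)"
    using int(3) \<open>A > 0\<close> by simp
  finally show ?thesis .
qed

text \<open>
  The smoothed maximum and minimum of mollified indicators converge in \<open>L\<^sup>1\<close> on
  bounded sets to the indicators of the union and the intersection. Keeping the two test fields
  independent makes the bound apply to the sum of the two perimeters.
\<close>

lemma perimeter_submodular:
  assumes E: "E \<in> sets borel" "emeasure lborel E < \<infinity>" "perim_le E c"
    and F: "F \<in> sets borel" "emeasure lborel F < \<infinity>" "perim_le F c'"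
    and u: "u \<in> T" and w: "w \<in> T"
  shows "pair (indicator (E \<union> F)) u + pair (indicator (E \<inter> F)) w \<le> c + c'"
proof -
  obtain A S where A: "A > 0" "\<And>x. \<bar>hdiv u x\<bar> \<le> A * indicator (cball 0 S) x"
    using continuous_bounded_support[OF continuous_hdiv[OF T_D(1)[OF u]] bounded_support_hdiv[OF T_D(2)[OF u]]] by blast
  obtain A' S' where A': "A' > 0" "\<And>x. \<bar>hdiv w x\<bar> \<le> A' * indicator (cball 0 S') x"
    using continuous_bounded_support[OF continuous_hdiv[OF T_D(1)[OF w]] bounded_support_hdiv[OF T_D(2)[OF w]]] by blast
  define Q where "Q = 2 * A + A * measure lborel (cball 0 S :: (real, 'n) vec set)
     + 2 * A' + A' * measure lborel (cball 0 S' :: (real, 'n) vec set)"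
  have Q: "Q > 0" unfolding Q_def using A A' by (intro add_pos_nonneg) auto
  have est: "pair (indicator (E \<union> F)) u + pair (indicator (E \<inter> F)) w \<le> c + c' + \<delta> * Q" if \<delta>: "\<delta> > 0" for \<delta>
  proof -
    obtain m where m: "Ck 1 m" "\<And>x. 0 \<le> m x" "\<And>x. m x \<le> (1::real)" "\<And>c u. perim_le E c \<Longrightarrow> u \<in> T \<Longrightarrow> pair m u \<le> c"
      "integrable lborel (\<lambda>x. m x - indicator E x)" "(\<integral>x. \<bar>m x - indicator E x\<bar> \<partial>lborel) \<le> \<delta>"
      "bounded E \<Longrightarrow> bounded {x. m x \<noteq> 0}"
      by (rule mollification[OF E(1,2) \<delta>]) (rule that; assumption)
    obtain n where n: "Ck 1 n" "\<And>x. 0 \<le> n x" "\<And>x. n x \<le> (1::real)" "\<And>c u. perim_le F c \<Longrightarrow> u \<in> T \<Longrightarrow> pair n u \<le> c"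
      "integrable lborel (\<lambda>x. n x - indicator F x)" "(\<integral>x. \<bar>n x - indicator F x\<bar> \<partial>lborel) \<le> \<delta>"
      "bounded F \<Longrightarrow> bounded {x. n x \<noteq> 0}"
      by (rule mollification[OF F(1,2) \<delta>]) (rule that; assumption)
    define M where "M x = (m x + n x + sqrt ((m x - n x)\<^sup>2 + \<delta>\<^sup>2)) / 2" for x
    define N where "N x = (m x + n x - sqrt ((m x - n x)\<^sup>2 + \<delta>\<^sup>2)) / 2" for x
    have MN: "pair M u + pair N w \<le> c + c'" "Ck 1 M" "Ck 1 N"
      unfolding M_def[abs_def] N_def[abs_def]
      using smooth_max_min_pair_le[OF m(1) n(1) \<delta> m(4)[OF E(3)] n(4)[OF F(3)] u w] by auto
    define d where "d x = \<bar>m x - indicator E x\<bar> + \<bar>n x - indicator F x\<bar>" for x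
    have d: "integrable lborel d" "\<And>x. d x \<ge> 0" "(\<integral>x. d x \<partial>lborel) \<le> 2 * \<delta>"
      unfolding d_def using m(5,6) n(5,6) by auto
    have sq: "\<bar>sqrt ((m x - n x)\<^sup>2 + \<delta>\<^sup>2) - \<bar>m x - n x\<bar>\<bar> \<le> \<delta>" for x
    proof -
      have "sqrt ((m x - n x)\<^sup>2 + \<delta>\<^sup>2) \<le> \<bar>m x - n x\<bar> + \<delta>"
        using sqrt_add_le_add_sqrt[of "(m x - n x)\<^sup>2" "\<delta>\<^sup>2"] \<delta> by simp
      moreover have "\<bar>m x - n x\<bar> \<le> sqrt ((m x - n x)\<^sup>2 + \<delta>\<^sup>2)" by (rule real_le_rsqrt) simp
      ultimately show ?thesis by simp
    qed
    have Mmax: "\<bar>M x - max (m x) (n x)\<bar> \<le> \<delta> / 2" and Nmin: "\<bar>N x - min (m x) (n x)\<bar> \<le> \<delta> / 2" for x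
      using sq[of x] by (auto simp: M_def N_def max_def min_def abs_if field_simps split: if_splits)
    have M1: "\<bar>M x - indicator (E \<union> F) x\<bar> \<le> d x + \<delta>" for x
    proof -
      have "indicator (E \<union> F) x = max (indicator E x) (indicator F x :: real)" by (auto simp: indicator_def)
      moreover have "\<bar>max (m x) (n x) - max (indicator E x) (indicator F x)\<bar> \<le> d x" by (auto simp: d_def max_def)
      ultimately show ?thesis using Mmax[of x] \<delta> by linarith
    qed
    have N1: "\<bar>N x - indicator (E \<inter> F) x\<bar> \<le> d x + \<delta>" for x
    proof -
      have "indicator (E \<inter> F) x = min (indicator E x) (indicator F x :: real)" by (auto simp: indicator_def)
      moreover have "\<bar>min (m x) (n x) - min (indicator E x) (indicator F x)\<bar> \<le> d x" by (auto simp: d_def min_def)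
      ultimately show ?thesis using Nmin[of x] \<delta> by linarith
    qed
    have "\<bar>pair M u - pair (indicator (E \<union> F)) u\<bar> \<le> A * (2 * \<delta>) + \<delta> * A * measure lborel (cball 0 S :: (real, 'n) vec set)"
    proof (rule pair_close[OF _ _ Ck_1_measurable[OF MN(2)] _ u A(2,1) \<delta> M1 d])
      show "\<bar>M x\<bar> \<le> 1 + \<delta>" for x
      proof -
        have "0 \<le> max (m x) (n x)" "max (m x) (n x) \<le> 1" using m(2,3)[of x] n(2,3)[of x] by (auto simp: max_def)
        thus ?thesis using Mmax[of x] \<delta> by linarith
      qed
    qed (use E F in \<open>auto simp: indicator_def\<close>)
    moreover have "\<bar>pair N w - pair (indicator (E \<inter> F)) w\<bar> \<le> A' * (2 * \<delta>) + \<delta> * A' * measure lborel (cball 0 S' :: (real, 'n) vec set)"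
    proof (rule pair_close[OF _ _ Ck_1_measurable[OF MN(3)] _ w A'(2,1) \<delta> N1 d])
      show "\<bar>N x\<bar> \<le> 1 + \<delta>" for x
      proof -
        have "0 \<le> min (m x) (n x)" "min (m x) (n x) \<le> 1" using m(2,3)[of x] n(2,3)[of x] by (auto simp: min_def)
        thus ?thesis using Nmin[of x] \<delta> by linarith
      qed
    qed (use E F in \<open>auto simp: indicator_def\<close>)
    moreover have "\<delta> * Q = A * (2 * \<delta>) + \<delta> * A * measure lborel (cball 0 S :: (real, 'n) vec set)
       + (A' * (2 * \<delta>) + \<delta> * A' * measure lborel (cball 0 S' :: (real, 'n) vec set))"
      unfolding Q_def by (simp add: algebra_simps)
    ultimately show ?thesis using MN(1) by linarith
  qed
  show ?thesis
  proof (rule field_le_epsilon)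
    fix e :: real assume e: "e > 0"
    show "pair (indicator (E \<union> F)) u + pair (indicator (E \<inter> F)) w \<le> c + c' + e"
      using est[of "e / Q"] e Q by simp
  qed
qed

text \<open>
  Testing with one of the fields equal to \<open>0\<close> shows that both suprema are finite; since
  the fields vary independently, the suprema add up to at most \<open>c\<close>.
\<close>

lemma pair_bdd_split:
  assumes "\<And>u w. u \<in> T \<Longrightarrow> w \<in> T \<Longrightarrow> pair (indicator A) u + pair (indicator B) w \<le> c"
  obtains a b where "perim_le A a" "perim_le B b" "a + b \<le> c"
proof -
  let ?a = "Sup (pair (indicator A) ` T)" and ?b = "Sup (pair (indicator B) ` T)"
  have ne: "T \<noteq> {}" using zero_in_T by blast
  have z: "pair f (\<lambda>p. 0) = 0" for f by (simp add: pair_def hdiv_const)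
  have bA: "bdd_above (pair (indicator A) ` T)"
    using assms[OF _ zero_in_T] z by (force intro!: bdd_aboveI[of _ c])
  have bB: "bdd_above (pair (indicator B) ` T)"
    using assms[OF zero_in_T] z by (force intro!: bdd_aboveI[of _ c])
  have 1: "?a \<le> c - pair (indicator B) w" if "w \<in> T" for w
    by (rule cSUP_least[OF ne]) (use assms that in \<open>force simp: le_diff_eq\<close>)
  have "?b \<le> c - ?a"
    by (rule cSUP_least[OF ne]) (use 1 in force)
  hence "?a + ?b \<le> c" by simp
  moreover have "perim_le A ?a" "perim_le B ?b"
    unfolding perim_le_def using cSUP_upper[OF _ bA] cSUP_upper[OF _ bB] by auto
  ultimately show ?thesis using that by blast
qed

lemma perimeter_union_inter:
  assumes E: "E \<in> sets borel" "emeasure lborel E < \<infinity>" "perim_le E c"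
    and F: "F \<in> sets borel" "emeasure lborel F < \<infinity>" "perim_le F c'"
  obtains a b where "perim_le (E \<union> F) a" "perim_le (E \<inter> F) b" "a + b \<le> c + c'"
  using pair_bdd_split perimeter_submodular[OF E F] by blast

section \<open>Cutting by a function\<close>

text \<open>
  Testing \<open>E\<close> with the convex combination \<open>\<eta> u + (1 - \<eta>) w\<close>
  tests the two weighted pieces separately, at the cost of the derivative of \<open>\<eta>\<close>.
\<close>

lemma pair_cut:
  assumes E: "E \<in> sets borel" "perim_le E c" and u: "u \<in> T" and w: "w \<in> T"
    and \<eta>: "Ck 1 \<eta>" "\<And>p. 0 \<le> \<eta> p" "\<And>p. \<eta> p \<le> 1"
  shows "pair (\<lambda>p. indicator E p * \<eta> p) u + pair (\<lambda>p. indicator E p * (1 - \<eta> p)) w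
     \<le> c - (\<integral>p. indicator E p * FD \<eta> p (LD p 0 (u p - w p)) \<partial>lborel)"
proof -
  let ?U = "\<lambda>p. \<eta> p *\<^sub>R u p + (1 - \<eta> p) *\<^sub>R w p"
  have U: "?U \<in> T" by (rule T_convex_combination[OF u w \<eta>])
  have m: "\<eta> \<in> borel_measurable borel" by (rule Ck_1_measurable[OF \<eta>(1)])
  have i1: "integrable lborel (\<lambda>p. (indicator E p * \<eta> p) * hdiv u p)"
    by (rule pair_integrable[OF u]) (use E m \<eta> in \<open>auto simp: indicator_def\<close>)
  have i2: "integrable lborel (\<lambda>p. (indicator E p * (1 - \<eta> p)) * hdiv w p)"
    by (rule pair_integrable[OF w]) (use E m \<eta> in \<open>auto simp: indicator_def\<close>)
  have c3: "continuous_on UNIV (\<lambda>p. FD \<eta> p (LD p 0 (u p - w p)))"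
    by (intro Ck_1_FD_continuous[OF \<eta>(1)] continuous_on_LD continuous_intros Ck_1_continuous T_D[OF u] T_D[OF w])
  have b3: "bounded {p. FD \<eta> p (LD p 0 (u p - w p)) \<noteq> 0}"
  proof (rule bounded_subset)
    show "bounded ({p. u p \<noteq> 0} \<union> {p. w p \<noteq> 0})" using T_D(2)[OF u] T_D(2)[OF w] by simp
  qed (auto simp: LD_simps linear_0[OF Ck_1_FD_linear[OF \<eta>(1)]])
  have i3: "integrable lborel (\<lambda>p. indicator E p * FD \<eta> p (LD p 0 (u p - w p)))"
    by (rule integrable_mult_bounded_support[OF _ _ c3 b3]) (use E in \<open>auto simp: indicator_def\<close>)
  have "pair (indicator E) ?U = (\<integral>p. (indicator E p * \<eta> p) * hdiv u p + (indicator E p * (1 - \<eta> p)) * hdiv w p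
      + indicator E p * FD \<eta> p (LD p 0 (u p - w p)) \<partial>lborel)"
    unfolding pair_def hdiv_convex_combination[OF T_D(1)[OF u] T_D(1)[OF w] \<eta>(1)] by (simp add: algebra_simps)
  also have "\<dots> = pair (\<lambda>p. indicator E p * \<eta> p) u + pair (\<lambda>p. indicator E p * (1 - \<eta> p)) w
      + (\<integral>p. indicator E p * FD \<eta> p (LD p 0 (u p - w p)) \<partial>lborel)"
    unfolding pair_def using i1 i2 i3 by simp
  finally show ?thesis using E(2) U by (auto simp: perim_le_def)
qed

section \<open>Right translations\<close>

text \<open>
  The volume of the points outside \<open>B\<close> that the right translation by \<open>h\<close>
  takes into \<open>B\<close>. It is subadditive in \<open>h\<close>, so products of short elements
  have small defect.
\<close>

definition defect :: "(real, 'n) vec set \<Rightarrow> (real, 'n) vec \<Rightarrow> ennreal" where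
  "defect B h = emeasure lborel {p. p \<odot> h \<in> B \<and> p \<notin> B}"

text \<open>
  The bound for test functions is applied to mollified indicators of bounded parts of the set that
  enters \<open>B\<close>; on this set the translated indicator exceeds the original one by
  \<open>1\<close>.
\<close>

lemma defect_horizontal:
  assumes \<kappa>: "\<kappa> > 0" "\<And>x s. x \<in> X \<Longrightarrow> \<bar>s\<bar> \<le> 1 \<Longrightarrow> (1 / \<kappa>) *\<^sub>R (s *\<^sub>R x) \<in> K"
    and x: "x \<in> X" and B: "B \<in> sets borel" "emeasure lborel B < \<infinity>" "perim_le B c"
  shows "defect B (t *\<^sub>R x) \<le> ennreal (\<kappa> * c * \<bar>t\<bar>)"
proof -
  have c: "c \<ge> 0" by (rule perim_le_nonneg[OF B(3)])
  define h where "h = t *\<^sub>R x"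
  have [measurable]: "B \<in> sets borel" by (rule B)
  define A where "A n = {p. p \<odot> h \<in> B \<and> p \<notin> B} \<inter> cball 0 (real n)" for n :: nat
  have Am [measurable]: "A n \<in> sets borel" for n unfolding A_def by measurable
  have Af: "emeasure lborel (A n) < \<infinity>" for n
  proof -
    have "emeasure lborel (A n) \<le> emeasure lborel (cball (0 :: (real, 'n) vec) (real n))"
      by (rule emeasure_mono) (auto simp: A_def)
    thus ?thesis using emeasure_lborel_cball_finite le_less_trans by blast
  qed
  have "measure lborel (A n) \<le> \<kappa> * c * \<bar>t\<bar>" for n
  proof (rule field_le_epsilon)
    fix e :: real assume e: "e > 0"
    obtain m where m: "Ck 1 m" "\<And>x. 0 \<le> m x" "\<And>x. m x \<le> (1::real)"
      "\<And>c u. perim_le (A n) c \<Longrightarrow> u \<in> T \<Longrightarrow> pair m u \<le> c" "integrable lborel (\<lambda>x. m x - indicator (A n) x)" "(\<integral>x. \<bar>m x - indicator (A n) x\<bar> \<partial>lborel) \<le> e"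
      "bounded (A n) \<Longrightarrow> bounded {x. m x \<noteq> 0}"
      by (rule mollification[OF Am Af e]) (rule that; assumption)
    have bA: "bounded (A n)" unfolding A_def by (rule bounded_subset[of "cball 0 (real n)"]) auto
    note bm = m(7)[OF bA]
    have [measurable]: "m \<in> borel_measurable borel" by (rule Ck_1_measurable[OF m(1)])
    have "\<bar>(\<integral>p. indicator B p * m (p \<odot> (- t) *\<^sub>R x) \<partial>lborel) - (\<integral>p. indicator B p * m p \<partial>lborel)\<bar> \<le> \<kappa> * c * \<bar>- t\<bar>"
      by (rule right_difference_bound[OF \<kappa> x B(1,3) m(1) bm]) (use m in auto)
    moreover have "(\<integral>p. indicator B p * m (p \<odot> (- t) *\<^sub>R x) \<partial>lborel) = (\<integral>p. indicator B (p \<odot> h) * m p \<partial>lborel)"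
      using integral_right[of "\<lambda>p. indicator B p * m (p \<odot> (- t) *\<^sub>R x)" h] by (simp add: h_def)
    ultimately have le: "(\<integral>p. indicator B (p \<odot> h) * m p \<partial>lborel) - (\<integral>p. indicator B p * m p \<partial>lborel) \<le> \<kappa> * c * \<bar>t\<bar>"
      by (simp add: abs_le_iff)
    have i1: "integrable lborel (\<lambda>p. indicator B (p \<odot> h) * m p)"
      by (rule integrable_mult_bounded_support[OF _ _ Ck_1_continuous[OF m(1)] bm]) (auto simp: indicator_def)
    have i2: "integrable lborel (\<lambda>p. indicator B p * m p)"
      by (rule integrable_mult_bounded_support[OF _ _ Ck_1_continuous[OF m(1)] bm]) (auto simp: indicator_def)
    have iA: "integrable lborel (indicator (A n) :: _ \<Rightarrow> real)" using Af by (intro integrable_real_indicator) auto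
    have "measure lborel (A n) - e \<le> (\<integral>p. indicator (A n) p \<partial>lborel) - (\<integral>x. \<bar>m x - indicator (A n) x\<bar> \<partial>lborel)"
      using m(6) by simp
    also have "\<dots> = (\<integral>p. indicator (A n) p - \<bar>m p - indicator (A n) p\<bar> \<partial>lborel)"
      by (rule Bochner_Integration.integral_diff[symmetric, OF iA]) (rule integrable_abs[OF m(5)])
    also have "\<dots> \<le> (\<integral>p. indicator B (p \<odot> h) * m p - indicator B p * m p \<partial>lborel)"
    proof (rule integral_mono)
      show "integrable lborel (\<lambda>p. indicator (A n) p - \<bar>m p - indicator (A n) p\<bar>)"
        by (rule Bochner_Integration.integrable_diff[OF iA integrable_abs[OF m(5)]])
      show "integrable lborel (\<lambda>p. indicator B (p \<odot> h) * m p - indicator B p * m p)"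
        by (rule Bochner_Integration.integrable_diff[OF i1 i2])
      show "indicator (A n) p - \<bar>m p - indicator (A n) p\<bar> \<le> indicator B (p \<odot> h) * m p - indicator B p * m p" for p
        using m(2,3)[of p] by (auto simp: A_def indicator_def)
    qed
    also have "\<dots> = (\<integral>p. indicator B (p \<odot> h) * m p \<partial>lborel) - (\<integral>p. indicator B p * m p \<partial>lborel)"
      by (rule Bochner_Integration.integral_diff[OF i1 i2])
    finally show "measure lborel (A n) \<le> \<kappa> * c * \<bar>t\<bar> + e" using le by linarith
  qed
  hence le: "emeasure lborel (A n) \<le> ennreal (\<kappa> * c * \<bar>t\<bar>)" for n
    using Af[of n] \<kappa>(1) c by (simp add: emeasure_eq_ennreal_measure top_unique ennreal_leI)
  have "(SUP n. emeasure lborel (A n)) = emeasure lborel (\<Union>n. A n)"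
    by (rule SUP_emeasure_incseq) (auto simp: A_def incseq_def)
  moreover have "(\<Union>n. A n) = {p. p \<odot> h \<in> B \<and> p \<notin> B}"
    by (auto simp: A_def real_arch_simple)
  ultimately have "defect B h = (SUP n. emeasure lborel (A n))" by (simp add: defect_def)
  thus ?thesis using SUP_least[of UNIV, OF le] by (simp add: h_def)
qed

lemma defect_gmul:
  assumes [measurable]: "B \<in> sets borel"
  shows "defect B (h \<odot> k) \<le> defect B h + defect B k"
proof -
  have "{p. p \<odot> (h \<odot> k) \<in> B \<and> p \<notin> B} \<subseteq> {p. p \<odot> h \<in> B \<and> p \<notin> B} \<union> {p. p \<odot> h \<in> {q. q \<odot> k \<in> B \<and> q \<notin> B}}"
    by (auto simp: gmul_assoc)
  hence "defect B (h \<odot> k) \<le> emeasure lborel ({p. p \<odot> h \<in> B \<and> p \<notin> B} \<union> {p. p \<odot> h \<in> {q. q \<odot> k \<in> B \<and> q \<notin> B}})"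
    unfolding defect_def by (intro emeasure_mono) measurable
  also have "\<dots> \<le> defect B h + emeasure lborel {p. p \<odot> h \<in> {q. q \<odot> k \<in> B \<and> q \<notin> B}}"
    unfolding defect_def by (intro emeasure_subadditive; measurable)
  also have "emeasure lborel {p. p \<odot> h \<in> {q. q \<odot> k \<in> B \<and> q \<notin> B}} = defect B k"
    unfolding defect_def by (intro emeasure_right) measurable
  finally show ?thesis .
qed

end

(* From here on the terms of the series are used as subspaces, not through their generators. *)
declare lower_central.simps(2) [simp del]

context nilpotent_lie_group
begin

section \<open>Generating the lower central series\<close>

text \<open>
  The case \<open>[\<gg>\<^sub>1, \<gg>\<^sub>k] \<subseteq> \<gg>\<^sub>k\<^sub>+\<^sub>2\<close>
  of the filtration property of the lower central series, where \<open>\<gg>\<^sub>1\<close> denotes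
  its term of index \<open>1\<close>, from the Jacobi identity.
\<close>

lemma bracket_commutator_lower_central:
  assumes y: "y \<in> lower_central gmul (Suc 0)" and z: "z \<in> lower_central gmul k"
  shows "bracket gmul y z \<in> lower_central gmul (Suc (Suc k))"
proof -
  have "y \<in> span {bracket gmul a b |a b. a \<in> UNIV \<and> b \<in> UNIV}"
    using y by (simp add: lower_central.simps(2) set_bracket_def)
  thus ?thesis
  proof (induction rule: span_induct)
    case (step x)
    then obtain a b where "x = bracket gmul a b" by blast
    thus ?case unfolding jacobi[of a b z, folded \<open>x = _\<close>] \<open>x = _\<close> jacobi
      using bracket_lower_central[OF bracket_lower_central[OF z]] subspace_diff[OF subspace_lower_central] by blast
  next
    case base
    show ?case unfolding subspace_def mem_Collect_eq bracket_simps
      using subspace_lower_central[of "Suc (Suc k)"] unfolding subspace_def by blast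
  qed
qed

primrec iterated_brackets :: "(real, 'n) vec set \<Rightarrow> nat \<Rightarrow> (real, 'n) vec set" where
  "iterated_brackets X 0 = X"
| "iterated_brackets X (Suc k) = {bracket gmul x v | x v. x \<in> X \<and> v \<in> iterated_brackets X k}"

lemma finite_iterated_brackets: "finite X \<Longrightarrow> finite (iterated_brackets X k)"
  by (induction k) (auto intro: finite_image_set2)

lemma iterated_brackets_lower_central: "v \<in> iterated_brackets X k \<Longrightarrow> v \<in> lower_central gmul k"
  by (induction k arbitrary: v) (auto simp: bracket_lower_central)

lemma bracket_span:
  assumes "a \<in> span A" "b \<in> span B"
  shows "bracket gmul a b \<in> span {bracket gmul x v |x v. x \<in> A \<and> v \<in> B}" (is "_ \<in> span ?S")
  using assms(1)
proof (induction rule: span_induct)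
  case (step x)
  show ?case using assms(2)
  proof (induction rule: span_induct)
    case step' : (step v)
    show ?case using step step' by (intro span_base) blast
  next
    case base
    show ?case unfolding subspace_def mem_Collect_eq bracket_simps
      using span_zero span_add span_scale by blast
  qed
next
  case base
  show ?case unfolding subspace_def mem_Collect_eq bracket_simps
    using span_zero span_add span_scale by blast
qed

text \<open>
  Brackets lie in the commutator ideal, so a bracket-generating \<open>X\<close> spans the Lie
  algebra modulo commutators.
\<close>

lemma bracket_layer_subset:
  "z \<in> bracket_layer gmul X m \<Longrightarrow> \<exists>a\<in>span X. z - a \<in> lower_central gmul (Suc 0)"
proof (induction m arbitrary: z)
  case 0
  thus ?case using subspace_0[OF subspace_lower_central] by (intro bexI[of _ z]) auto
next
  case (Suc m)
  then obtain a b where ab: "z = a + b" "a \<in> bracket_layer gmul X m"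
    "b \<in> set_bracket gmul (bracket_layer gmul X m) (span X)" by auto
  obtain a' where a': "a' \<in> span X" "a - a' \<in> lower_central gmul (Suc 0)" using Suc.IH[OF ab(2)] by blast
  have "b \<in> lower_central gmul (Suc 0)"
    using ab(3) span_mono[of "{bracket gmul a b |a b. a \<in> bracket_layer gmul X m \<and> b \<in> span X}" "{bracket gmul a b |a b. a \<in> UNIV \<and> b \<in> UNIV}"]
    unfolding set_bracket_def lower_central.simps by blast
  from subspace_add[OF subspace_lower_central a'(2) this] have "z - a' \<in> lower_central gmul (Suc 0)"
    by (simp add: ab(1) algebra_simps)
  thus ?case using a'(1) by blast
qed

text \<open>
  Modulo deeper terms both arguments of a bracket may be replaced: the first one by a combination of
  \<open>X\<close> and the second one by a combination of iterated brackets of \<open>X\<close>.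
\<close>

lemma lower_central_generated:
  assumes gen: "bracket_layer gmul X s = UNIV" and z: "z \<in> lower_central gmul k"
  shows "\<exists>a\<in>span (iterated_brackets X k). z - a \<in> lower_central gmul (Suc k)"
  using z
proof (induction k arbitrary: z)
  case 0
  show ?case using bracket_layer_subset[of z X s] gen by simp
next
  case (Suc k)
  let ?G = "iterated_brackets X (Suc k)" and ?L = "lower_central gmul (Suc (Suc k))"
  have sub: "subspace {z. \<exists>a\<in>span ?G. z - a \<in> ?L}"
    unfolding subspace_def
  proof (intro conjI ballI allI)
    show "0 \<in> {z. \<exists>a\<in>span ?G. z - a \<in> ?L}"
      by (intro CollectI bexI[of _ 0]) (auto simp: span_zero subspace_0[OF subspace_lower_central])
    fix y z assume "y \<in> {z. \<exists>a\<in>span ?G. z - a \<in> ?L}" "z \<in> {z. \<exists>a\<in>span ?G. z - a \<in> ?L}"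
    then obtain a b where ab: "a \<in> span ?G" "y - a \<in> ?L" "b \<in> span ?G" "z - b \<in> ?L" by blast
    have "y + z - (a + b) \<in> ?L" using subspace_add[OF subspace_lower_central ab(2,4)] by (simp add: algebra_simps)
    thus "y + z \<in> {z. \<exists>a\<in>span ?G. z - a \<in> ?L}" using span_add[OF ab(1,3)] by blast
  next
    fix c :: real and y assume "y \<in> {z. \<exists>a\<in>span ?G. z - a \<in> ?L}"
    then obtain a where a: "a \<in> span ?G" "y - a \<in> ?L" by blast
    have "c *\<^sub>R y - c *\<^sub>R a \<in> ?L" using subspace_scale[OF subspace_lower_central a(2), of c] by (simp add: algebra_simps)
    thus "c *\<^sub>R y \<in> {z. \<exists>a\<in>span ?G. z - a \<in> ?L}" using span_scale[OF a(1)] by blast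
  qed
  have gens: "{bracket gmul a b |a b. a \<in> UNIV \<and> b \<in> lower_central gmul k} \<subseteq> {z. \<exists>a\<in>span ?G. z - a \<in> ?L}"
  proof
    fix y assume "y \<in> {bracket gmul a b |a b. a \<in> UNIV \<and> b \<in> lower_central gmul k}"
    then obtain p b where y: "y = bracket gmul p b" and b: "b \<in> lower_central gmul k" by blast
    obtain a where a: "a \<in> span X" "p - a \<in> lower_central gmul (Suc 0)"
      using bracket_layer_subset[of p X s] gen by blast
    obtain b0 where b0: "b0 \<in> span (iterated_brackets X k)" "b - b0 \<in> lower_central gmul (Suc k)"
      using Suc.IH[OF b] by blast
    have "y - bracket gmul a b0 = bracket gmul (p - a) b + bracket gmul a (b - b0)"
      unfolding y bracket_simps by simp
    also have "\<dots> \<in> ?L"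
      by (rule subspace_add[OF subspace_lower_central bracket_commutator_lower_central[OF a(2) b] bracket_lower_central[OF b0(2)]])
    finally have "y - bracket gmul a b0 \<in> ?L" .
    moreover have "bracket gmul a b0 \<in> span ?G" using bracket_span[OF a(1) b0(1)] by simp
    ultimately show "y \<in> {z. \<exists>a\<in>span ?G. z - a \<in> ?L}" by blast
  qed
  have "z \<in> span {bracket gmul a b |a b. a \<in> UNIV \<and> b \<in> lower_central gmul k}"
    using Suc.prems by (simp add: lower_central.simps(2) set_bracket_def)
  thus ?case using span_minimal[OF gens sub] by blast
qed

text \<open>
  The multiplication vanishes at the origin and is Lipschitz on bounded sets.
\<close>

lemma norm_gmul_le:
  obtains C where "C > 0" "\<And>a b. norm a \<le> R \<Longrightarrow> norm b \<le> R \<Longrightarrow> norm (a \<odot> b) \<le> C * (norm a + norm b)"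
proof -
  define S :: "((real, 'n) vec \<times> (real, 'n) vec) set" where "S = cball 0 R \<times> cball 0 R"
  obtain C where C: "C > 0" "\<And>z w. z \<in> S \<Longrightarrow> norm (FD (\<lambda>z. fst z \<odot> snd z) z w) \<le> C * norm w"
  proof (rule linear_family_bounded[of S "FD (\<lambda>z. fst z \<odot> snd z)"])
    show "compact S" by (auto simp: S_def intro: compact_Times)
    show "linear (FD (\<lambda>z. fst z \<odot> snd z) p)" for p by (rule Ck_1_FD_linear[OF Ck_1_mult_pair])
    show "continuous_on S (\<lambda>p. FD (\<lambda>z. fst z \<odot> snd z) p b)" for b
      by (rule Ck_1_FD_continuous[OF Ck_1_mult_pair continuous_on_id continuous_on_const])
  qed blast
  have "norm (a \<odot> b) \<le> C * (norm a + norm b)" if ab: "norm a \<le> R" "norm b \<le> R" for a b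
  proof -
    have R: "R \<ge> 0" using ab(1) norm_ge_zero order_trans by blast
    have "norm ((\<lambda>z. fst z \<odot> snd z) (a, b) - (\<lambda>z. fst z \<odot> snd z) (0, 0)) \<le> C * norm ((a, b) - (0, 0))"
    proof (rule differentiable_bound[of S])
      show "convex S" by (auto simp: S_def intro: convex_Times)
      show "((\<lambda>z. fst z \<odot> snd z) has_derivative FD (\<lambda>z. fst z \<odot> snd z) z) (at z within S)" for z
        by (rule has_derivative_at_withinI[OF Ck_1_deriv[OF Ck_1_mult_pair]])
      show "onorm (FD (\<lambda>z. fst z \<odot> snd z) z) \<le> C" if "z \<in> S" for z
        using C that by (intro onorm_bound) auto
    qed (use ab R in \<open>auto simp: S_def\<close>)
    also have "\<dots> \<le> C * (norm a + norm b)"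
      using C(1) norm_Pair_le[of a b] by (intro mult_left_mono) auto
    finally show ?thesis by simp
  qed
  thus ?thesis using that C(1) by blast
qed

end

context sub_finsler_nilpotent_group
begin

section \<open>Products of horizontal segments\<close>

text \<open>
  \<open>h\<close> is a product of exponentials of multiples of elements of \<open>X\<close>. The
  number \<open>L\<close> bounds the total length; the factor \<open>2\<close> in the product rule
  anticipates the concatenation of two paths on \<open>{0..1}\<close>, each of which is run through
  at double speed. The number of factors in use is bounded, so it only affects constants.
\<close>

inductive reach :: "real \<Rightarrow> (real, 'n) vec \<Rightarrow> bool" where
  zero: "reach 0 0"
| horizontal: "x \<in> X \<Longrightarrow> reach \<bar>t\<bar> (t *\<^sub>R x)"
| product: "reach L h \<Longrightarrow> reach L' h' \<Longrightarrow> reach (2 * (L + L')) (h \<odot> h')"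

lemma reach_nonneg: "reach L h \<Longrightarrow> L \<ge> 0"
  by (induction rule: reach.induct) auto

lemma reach_minus: "reach L h \<Longrightarrow> reach L (- h)"
proof (induction rule: reach.induct)
  case zero show ?case using reach.zero by simp
next
  case (horizontal x t)
  thus ?case using reach.horizontal[of x "- t"] by simp
next
  case (product L h L' h')
  thus ?case using reach.product[OF product.IH(2,1)] by (simp add: minus_gmul add.commute)
qed

text \<open>
  A family of reachable points that follows \<open>t\<^sup>k\<^sup>+\<^sup>1 v\<close> modulo the
  next term of the lower central series, at a length that is linear in \<open>t\<close>.
\<close>

definition approximable :: "nat \<Rightarrow> (real, 'n) vec \<Rightarrow> bool" where
  "approximable k v \<longleftrightarrow> (\<exists>c A. A > 0 \<and> (\<forall>t. c t \<in> lower_central gmul k) \<and> (\<forall>t. c t - t ^ Suc k *\<^sub>R v \<in> lower_central gmul (Suc k)) \<and>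
     (\<forall>t\<in>{-1..1}. norm (c t) \<le> A * \<bar>t\<bar>) \<and> (\<forall>t. \<exists>L\<le>A * \<bar>t\<bar>. reach L (c t)))"

lemma approximable_horizontal:
  assumes "x \<in> X" shows "approximable 0 x"
  unfolding approximable_def
proof (rule exI[of _ "\<lambda>t. t *\<^sub>R x"], rule exI[of _ "1 + norm x"], intro conjI allI ballI)
  show "0 < 1 + norm x" by (simp add: add_pos_nonneg)
  show "norm (t *\<^sub>R x) \<le> (1 + norm x) * \<bar>t\<bar>" for t :: real by (simp add: algebra_simps)
  show "\<exists>L\<le>(1 + norm x) * \<bar>t\<bar>. reach L (t *\<^sub>R x)" for t :: real
    using reach.horizontal[OF assms, of t] by (intro exI[of _ "\<bar>t\<bar>"]) (auto simp: algebra_simps)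
qed (use subspace_0[OF subspace_lower_central, of "Suc 0"] in auto)

text \<open>
  The group commutator of \<open>exp (t x)\<close> with a family that follows
  \<open>t\<^sup>k\<^sup>+\<^sup>1 v\<close> follows \<open>t\<^sup>k\<^sup>+\<^sup>2 [x,
  v]\<close>: conjugation adds \<open>[t x, c t]\<close> to \<open>c t\<close> modulo the next term,
  and modulo this term the group law is additive in that direction.
\<close>

lemma approximable_bracket:
  assumes v: "approximable k v" and x: "x \<in> X"
  shows "approximable (Suc k) (bracket gmul x v)"
proof -
  let ?L1 = "lower_central gmul (Suc k)" and ?L2 = "lower_central gmul (Suc (Suc k))"
  obtain c A where A: "A > 0" and c: "\<And>t. c t \<in> lower_central gmul k" "\<And>t. c t - t ^ Suc k *\<^sub>R v \<in> ?L1"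
     "\<And>t. t \<in> {-1..1} \<Longrightarrow> norm (c t) \<le> A * \<bar>t\<bar>" "\<And>t. \<exists>L\<le>A * \<bar>t\<bar>. reach L (c t)"
    using v unfolding approximable_def by blast
  \<comment> \<open>the group commutator of \<open>t x\<close> and \<open>c t\<close>\<close>
  define c' where "c' t = Ad (t *\<^sub>R x) (c t) \<odot> - c t" for t
  have main: "c' t - t ^ Suc (Suc k) *\<^sub>R bracket gmul x v \<in> ?L2" for t
  proof -
    define w where "w = Ad (t *\<^sub>R x) (c t) - c t"
    have w: "w \<in> ?L1" unfolding w_def by (rule Ad_minus_in[OF ideal_pair_lower_central c(1)])
    have 1: "w - bracket gmul (t *\<^sub>R x) (c t) \<in> ?L2"
      unfolding w_def by (rule Ad_minus_bracket_in[OF ideal_pair_lower_central ideal_pair_lower_central c(1)])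
    have "(c t + w) \<odot> - c t - (c t \<odot> - c t + w) \<in> ?L2"
      by (rule gmul_add_left_in[OF ideal_pair_lower_central w])
    hence 2: "c' t - w \<in> ?L2" by (simp add: c'_def w_def)
    have 3: "bracket gmul (t *\<^sub>R x) (c t - t ^ Suc k *\<^sub>R v) \<in> ?L2" by (rule bracket_lower_central[OF c(2)])
    have eq: "c' t - t ^ Suc (Suc k) *\<^sub>R bracket gmul x v
       = (c' t - w) + (w - bracket gmul (t *\<^sub>R x) (c t)) + bracket gmul (t *\<^sub>R x) (c t - t ^ Suc k *\<^sub>R v)"
      by (simp add: bracket_simps)
    show ?thesis unfolding eq by (intro subspace_add[OF subspace_lower_central] 1 2 3)
  qed
  have v': "v \<in> lower_central gmul k"
  proof -
    have "c 1 - 1 ^ Suc k *\<^sub>R v \<in> lower_central gmul k"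
      using c(2)[of 1] lower_central_decreasing by blast
    from subspace_diff[OF subspace_lower_central c(1)[of 1] this] show ?thesis by simp
  qed
  have in1: "c' t \<in> ?L1" for t
  proof -
    have "t ^ Suc (Suc k) *\<^sub>R bracket gmul x v \<in> ?L1" by (rule subspace_scale[OF subspace_lower_central bracket_lower_central[OF v']])
    moreover have "c' t - t ^ Suc (Suc k) *\<^sub>R bracket gmul x v \<in> ?L1" using main lower_central_decreasing by blast
    ultimately have "(c' t - t ^ Suc (Suc k) *\<^sub>R bracket gmul x v) + t ^ Suc (Suc k) *\<^sub>R bracket gmul x v \<in> ?L1"
      by (intro subspace_add[OF subspace_lower_central])
    thus ?thesis by simp
  qed
  obtain CA where CA: "CA > 0" "\<And>s w. s \<in> {-1..1} \<Longrightarrow> norm (Ad (s *\<^sub>R x) w) \<le> CA * norm w"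
    using Ad_bounded_segment[of x] by blast
  obtain CG where CG: "CG > 0" "\<And>a b. norm a \<le> (CA + 1) * A \<Longrightarrow> norm b \<le> (CA + 1) * A \<Longrightarrow> norm (a \<odot> b) \<le> CG * (norm a + norm b)"
    using norm_gmul_le[of "(CA + 1) * A"] by blast
  have size: "norm (c' t) \<le> (CG * (CA + 1) * A) * \<bar>t\<bar>" if t: "t \<in> {-1..1}" for t
  proof -
    have ct: "norm (c t) \<le> A * \<bar>t\<bar>" by (rule c(3)[OF t])
    have "A * \<bar>t\<bar> \<le> A * 1" using A t by (intro mult_left_mono) auto
    hence ctA: "norm (c t) \<le> A" using ct by simp
    have Ac: "norm (Ad (t *\<^sub>R x) (c t)) \<le> CA * norm (c t)" by (rule CA(2)[OF t])
    have "CA * norm (c t) \<le> CA * A" using CA(1) ctA by (intro mult_left_mono) auto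
    hence b1: "norm (Ad (t *\<^sub>R x) (c t)) \<le> (CA + 1) * A" using Ac A by (simp add: algebra_simps)
    have b2: "norm (- c t) \<le> (CA + 1) * A" using ctA CA(1) A by (simp add: algebra_simps add_increasing2)
    have "norm (c' t) \<le> CG * (norm (Ad (t *\<^sub>R x) (c t)) + norm (- c t))"
      unfolding c'_def by (rule CG(2)[OF b1 b2])
    also have "\<dots> \<le> CG * (CA * (A * \<bar>t\<bar>) + A * \<bar>t\<bar>)"
      using CG(1) CA(1) ct Ac by (intro mult_left_mono add_mono order_trans[OF Ac] mult_left_mono) auto
    finally show ?thesis by (simp add: algebra_simps)
  qed
  have reach': "\<exists>L\<le>(16 * (A + 1)) * \<bar>t\<bar>. reach L (c' t)" for t
  proof -
    obtain L where L: "L \<le> A * \<bar>t\<bar>" "reach L (c t)" using c(4) by blast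
    have h: "reach \<bar>t\<bar> (t *\<^sub>R x)" "reach \<bar>t\<bar> (- (t *\<^sub>R x))" using reach.horizontal[OF x] reach_minus by blast+
    have "reach (2 * (2 * (2 * (\<bar>t\<bar> + L) + \<bar>t\<bar>) + L)) (c' t)"
      unfolding c'_def Ad_def by (intro reach.product h L(2) reach_minus[OF L(2)])
    moreover have "2 * (2 * (2 * (\<bar>t\<bar> + L) + \<bar>t\<bar>) + L) \<le> (16 * (A + 1)) * \<bar>t\<bar>"
    proof -
      define P where "P = A * \<bar>t\<bar>"
      have "(16 * (A + 1)) * \<bar>t\<bar> = 16 * P + 16 * \<bar>t\<bar>" "0 \<le> P" "L \<le> P" using A L(1) by (auto simp: algebra_simps P_def)
      thus ?thesis by simp
    qed
    ultimately show ?thesis by blast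
  qed
  define A' where "A' = CG * (CA + 1) * A + 16 * (A + 1)"
  have pos: "0 \<le> CG * (CA + 1) * A" "0 \<le> 16 * (A + 1)" "0 < A'" using A CA(1) CG(1) by (auto simp: A'_def intro!: add_nonneg_pos mult_nonneg_nonneg)
  show ?thesis unfolding approximable_def
  proof (rule exI[of _ c'], rule exI[of _ A'], intro conjI allI ballI in1 main pos(3))
    show "norm (c' t) \<le> A' * \<bar>t\<bar>" if "t \<in> {-1..1}" for t
      using size[OF that] pos mult_right_mono[of "CG * (CA + 1) * A" A' "\<bar>t\<bar>"] by (simp add: A'_def)
    show "\<exists>L\<le>A' * \<bar>t\<bar>. reach L (c' t)" for t
    proof -
      have "16 * (A + 1) * \<bar>t\<bar> \<le> A' * \<bar>t\<bar>" using pos by (intro mult_right_mono) (auto simp: A'_def)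
      thus ?thesis using reach'[of t] by (meson order_trans)
    qed
  qed
qed

lemma approximable_iterated_brackets: "v \<in> iterated_brackets X k \<Longrightarrow> approximable k v"
  by (induction k arbitrary: v) (auto simp: approximable_horizontal approximable_bracket)

text \<open>
  Points of \<open>W\<close> near \<open>0\<close> can be reached with a length that is bounded by a
  power of their norm. The exponent deteriorates in the induction below, and any positive exponent
  serves.
\<close>

definition reachable :: "(real, 'n) vec set \<Rightarrow> bool" where
  "reachable W \<longleftrightarrow> (\<exists>C>0. \<exists>\<beta>>0. \<exists>\<rho>>0. \<beta> \<le> 1 \<and> \<rho> \<le> 1 \<and>
     (\<forall>h\<in>W. norm h \<le> \<rho> \<longrightarrow> (\<exists>L\<le>C * norm h powr \<beta>. reach L h)))"

text \<open>
  To reach \<open>h = a v + w\<close> with \<open>w\<close> in \<open>W\<close>, first reach an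
  approximation of \<open>a v\<close>, choosing the parameter \<open>\<tau>\<close> as the root of
  \<open>\<bar>a\<bar>\<close> of order \<open>k + 1\<close>. What remains to be reached then lies
  in \<open>W\<close>, because \<open>W\<close> contains the next term of the lower central series.
  Its norm is only controlled by a root of the norm of \<open>h\<close>.
\<close>

lemma reachable_insert:
  assumes W: "subspace W" "lower_central gmul (Suc k) \<subseteq> W" "W \<subseteq> lower_central gmul k"
    and R: "reachable W" and v: "approximable k v"
  shows "reachable (span (insert v W))"
proof (cases "v \<in> W")
  case True
  hence "span (insert v W) = W" using W(1) by (simp add: insert_absorb)
  thus ?thesis using R by simp
next
  case False
  let ?L1 = "lower_central gmul (Suc k)"
  obtain c A where A: "A > 0" and c: "\<And>t. c t \<in> lower_central gmul k" "\<And>t. c t - t ^ Suc k *\<^sub>R v \<in> ?L1"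
     "\<And>t. t \<in> {-1..1} \<Longrightarrow> norm (c t) \<le> A * \<bar>t\<bar>" "\<And>t. \<exists>L\<le>A * \<bar>t\<bar>. reach L (c t)"
    using v unfolding approximable_def by blast
  obtain C \<beta> \<rho> where C: "C > 0" and \<beta>: "\<beta> > 0" "\<beta> \<le> 1" and \<rho>: "\<rho> > 0" "\<rho> \<le> 1"
    and RW: "\<And>h. h \<in> W \<Longrightarrow> norm h \<le> \<rho> \<Longrightarrow> \<exists>L\<le>C * norm h powr \<beta>. reach L h"
    using R unfolding reachable_def by blast
  \<comment> \<open>the coefficient of \<open>v\<close> is read off by pairing with the component \<open>y\<close> of \<open>v\<close> orthogonal to \<open>W\<close>\<close>
  obtain p y where y: "p \<in> span W" "\<And>w. w \<in> span W \<Longrightarrow> orthogonal y w" "v = p + y"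
    using orthogonal_subspace_decomp_exists[of W v] by blast
  have pW: "p \<in> W" using y(1) W(1) by (metis span_eq_iff)
  have y0: "y \<noteq> 0" using False pW y(3) by auto
  have yv: "y \<bullet> v = y \<bullet> y" using y(2)[OF y(1)] by (simp add: y(3) inner_add_right orthogonal_def)
  have yy: "y \<bullet> y > 0" using y0 by simp
  define M where "M = 1 + norm y / (y \<bullet> y)"
  have M: "M > 0" using yy by (simp add: M_def add_pos_nonneg)
  define \<gamma> where "\<gamma> = 1 / real (Suc k)"
  have \<gamma>: "\<gamma> > 0" "\<gamma> \<le> 1" by (auto simp: \<gamma>_def)
  obtain CG where CG: "CG > 0" "\<And>a b. norm a \<le> A + 1 \<Longrightarrow> norm b \<le> A + 1 \<Longrightarrow> norm (a \<odot> b) \<le> CG * (norm a + norm b)"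
    using norm_gmul_le[of "A + 1"] by blast
  define C2 where "C2 = CG * (A * M powr \<gamma> + 1)"
  have C2: "C2 > 0" using CG A M by (auto simp: C2_def intro!: mult_pos_pos add_nonneg_pos)
  define \<rho>2 where "\<rho>2 = min (min 1 (1 / M)) ((\<rho> / C2) powr (1 / \<gamma>))"
  have \<rho>2: "\<rho>2 > 0" "\<rho>2 \<le> 1" using M \<rho> C2 by (auto simp: \<rho>2_def)
  define C3 where "C3 = 2 * (A * M powr \<gamma> + C * C2 powr \<beta>)"
  have C3: "C3 > 0" using A M C C2 by (auto simp: C3_def intro!: add_nonneg_pos)
  have key: "\<exists>L\<le>C3 * norm h powr (\<gamma> * \<beta>). reach L h" if h: "h \<in> span (insert v W)" "norm h \<le> \<rho>2" for h
  proof -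
    obtain a where "h - a *\<^sub>R v \<in> span W" using h(1) by (auto simp: span_insert)
    moreover have "span W = W" using W(1) span_eq_iff by blast
    ultimately have a: "h - a *\<^sub>R v \<in> W" by (simp only:)
    have "y \<bullet> (h - a *\<^sub>R v) = 0" using y(2)[OF span_base[OF a]] by (simp add: orthogonal_def)
    hence "a * (y \<bullet> y) = y \<bullet> h" by (simp add: inner_diff_right yv)
    hence "\<bar>a\<bar> * (y \<bullet> y) = \<bar>y \<bullet> h\<bar>" using yy by (metis abs_mult abs_of_pos)
    also have "\<dots> \<le> norm y * norm h" by (rule Cauchy_Schwarz_ineq2)
    finally have "\<bar>a\<bar> \<le> (norm y / (y \<bullet> y)) * norm h" using yy by (simp add: field_simps)
    also have "\<dots> \<le> M * norm h" by (simp add: M_def distrib_right)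
    finally have aM: "\<bar>a\<bar> \<le> M * norm h" .
    define \<tau> where "\<tau> = \<bar>a\<bar> powr \<gamma>"
    have \<tau>k: "\<tau> ^ Suc k = \<bar>a\<bar>"
    proof (cases "a = 0")
      case True thus ?thesis by (simp add: \<tau>_def)
    next
      case False
      have "\<tau> ^ Suc k = \<tau> powr real (Suc k)" using False by (subst powr_realpow) (auto simp: \<tau>_def)
      also have "\<dots> = \<bar>a\<bar>" using False by (simp add: \<tau>_def powr_powr \<gamma>_def del: of_nat_Suc)
      finally show ?thesis .
    qed
    have \<tau>0: "\<tau> \<ge> 0" by (simp add: \<tau>_def)
    have \<tau>M: "\<tau> \<le> M powr \<gamma> * norm h powr \<gamma>"
      using powr_mono2[of \<gamma> "\<bar>a\<bar>" "M * norm h"] aM \<gamma> M by (simp add: \<tau>_def powr_mult)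
    have h1: "norm h \<le> 1" using h(2) \<rho>2 by simp
    have "M * norm h \<le> M * (1 / M)" using h(2) M by (intro mult_left_mono) (auto simp: \<rho>2_def)
    hence a1: "\<bar>a\<bar> \<le> 1" using aM M by simp
    hence "\<tau> \<le> 1" using powr_mono2[of \<gamma> "\<bar>a\<bar>" 1] \<gamma> by (simp add: \<tau>_def)
    hence \<tau>1: "\<tau> \<in> {-1..1}" using \<tau>0 by simp
    \<comment> \<open>inverting the approximating point takes care of a negative coefficient\<close>
    define c0 where "c0 = (if a \<ge> 0 then c \<tau> else - c \<tau>)"
    have c0a: "c0 - a *\<^sub>R v \<in> ?L1"
    proof (cases "a \<ge> 0")
      case True thus ?thesis using c(2)[of \<tau>] \<tau>k by (simp add: c0_def del: power_Suc)
    next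
      case False
      have "- (c \<tau> - \<tau> ^ Suc k *\<^sub>R v) \<in> ?L1" by (rule subspace_neg[OF subspace_lower_central c(2)])
      thus ?thesis using False \<tau>k by (simp add: c0_def del: power_Suc)
    qed
    have c0L: "- c0 \<in> lower_central gmul k"
      using c(1)[of \<tau>] subspace_neg[OF subspace_lower_central] by (auto simp: c0_def)
    have c0n: "norm c0 \<le> A * \<tau>" using c(3)[OF \<tau>1] \<tau>0 by (auto simp: c0_def)
    obtain L0 where L0: "L0 \<le> A * \<tau>" "reach L0 c0"
      using c(4)[of \<tau>] \<tau>0 reach_minus by (auto simp: c0_def)
    define h' where "h' = - c0 \<odot> h"
    have h'W: "h' \<in> W"
    proof -
      have "(0 + - c0) \<odot> h - (0 \<odot> h + - c0) \<in> ?L1"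
        by (rule gmul_add_left_in[OF ideal_pair_lower_central c0L])
      hence 1: "h' - (h - c0) \<in> W" using W(2) by (auto simp: h'_def)
      have 2: "c0 - a *\<^sub>R v \<in> W" using c0a W(2) by blast
      have "h' = (h' - (h - c0)) - (c0 - a *\<^sub>R v) + (h - a *\<^sub>R v)" by simp
      thus ?thesis using subspace_add[OF W(1) subspace_diff[OF W(1) 1 2] a] by simp
    qed
    have h\<gamma>: "norm h \<le> norm h powr \<gamma>" using powr_mono'[of \<gamma> 1 "norm h"] h1 \<gamma> by simp
    have h'n: "norm h' \<le> C2 * norm h powr \<gamma>"
    proof -
      have "A * \<tau> \<le> A * 1" using A \<tau>1 by (intro mult_left_mono) auto
      hence "norm c0 \<le> A + 1" using c0n by simp
      hence "norm h' \<le> CG * (norm (- c0) + norm h)"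
        unfolding h'_def using h1 A by (intro CG(2)) auto
      also have "\<dots> \<le> CG * (A * (M powr \<gamma> * norm h powr \<gamma>) + norm h powr \<gamma>)"
      proof -
        have "norm (- c0) \<le> A * (M powr \<gamma> * norm h powr \<gamma>)"
          using order_trans[OF c0n mult_left_mono[OF \<tau>M, of A]] A by simp
        thus ?thesis using CG(1) h\<gamma> by (intro mult_left_mono add_mono) (assumption | simp)+
      qed
      finally show ?thesis by (simp add: C2_def algebra_simps)
    qed
    also have "\<dots> \<le> C2 * ((\<rho> / C2) powr (1 / \<gamma>)) powr \<gamma>"
      using h(2) C2 \<gamma> by (intro mult_left_mono powr_mono2) (auto simp: \<rho>2_def)
    also have "\<dots> = \<rho>" using \<gamma> C2 \<rho> by (simp add: powr_powr)
    finally have "norm h' \<le> \<rho>" .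
    then obtain L' where L': "L' \<le> C * norm h' powr \<beta>" "reach L' h'" using RW[OF h'W] by blast
    have "norm h' powr \<beta> \<le> (C2 * norm h powr \<gamma>) powr \<beta>" using h'n \<beta> by (intro powr_mono2) auto
    also have "\<dots> = C2 powr \<beta> * norm h powr (\<gamma> * \<beta>)" using C2 by (simp add: powr_mult powr_powr)
    finally have L'b: "L' \<le> C * C2 powr \<beta> * norm h powr (\<gamma> * \<beta>)"
      using order_trans[OF L'(1) mult_left_mono[of _ _ C]] C by (simp add: mult.assoc)
    have L0b: "L0 \<le> A * M powr \<gamma> * norm h powr (\<gamma> * \<beta>)"
    proof -
      have "norm h powr \<gamma> \<le> norm h powr (\<gamma> * \<beta>)" using h1 \<gamma> \<beta> by (intro powr_mono') (auto simp: mult_left_le)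
      hence "M powr \<gamma> * norm h powr \<gamma> \<le> M powr \<gamma> * norm h powr (\<gamma> * \<beta>)" by (intro mult_left_mono) auto
      hence "\<tau> \<le> M powr \<gamma> * norm h powr (\<gamma> * \<beta>)" using \<tau>M by linarith
      hence "A * \<tau> \<le> A * (M powr \<gamma> * norm h powr (\<gamma> * \<beta>))" using A by (intro mult_left_mono) auto
      thus ?thesis using L0(1) by (simp add: mult.assoc)
    qed
    have "reach (2 * (L0 + L')) (c0 \<odot> h')" by (rule reach.product[OF L0(2) L'(2)])
    moreover have "c0 \<odot> h' = h" by (simp add: h'_def)
    moreover have "2 * (L0 + L') \<le> C3 * norm h powr (\<gamma> * \<beta>)"
      using L0b L'b by (simp add: C3_def algebra_simps)
    ultimately show ?thesis by auto
  qed
  have gb: "\<gamma> * \<beta> > 0" "\<gamma> * \<beta> \<le> 1" using \<gamma> \<beta> by (auto intro: mult_le_one)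
  show ?thesis unfolding reachable_def
    using C3 gb \<rho>2 key by blast
qed

text \<open>
  Descending induction: iterated brackets of \<open>X\<close>, of which there are finitely many,
  span each term modulo the next one.
\<close>

lemma reachable_lower_central: "k \<le> r \<Longrightarrow> reachable (lower_central gmul k)"
proof (induction k rule: inc_induct)
  case base
  have "reachable {0}" unfolding reachable_def
    by (intro exI[of _ 1] conjI) (auto intro: reach.zero)
  thus ?case using nilpotent(2) by simp
next
  case (step k)
  let ?L0 = "lower_central gmul k" and ?L1 = "lower_central gmul (Suc k)"
  obtain s where s: "bracket_layer gmul X s = UNIV" using bracket_generating by blast
  have fin: "finite (iterated_brackets X k)"
    using independent_X independent_imp_finite finite_iterated_brackets by blast
  have "reachable (span (G \<union> ?L1)) \<and> span (G \<union> ?L1) \<subseteq> ?L0" if "finite G" "G \<subseteq> iterated_brackets X k" for G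
    using that
  proof (induction G rule: finite_induct)
    case empty
    have "span ?L1 = ?L1" using subspace_lower_central span_eq_iff by blast
    thus ?case using step.IH lower_central_decreasing[of k] by (simp only: Un_empty_left simp_thms)
  next
    case (insert v G)
    let ?W = "span (G \<union> ?L1)"
    have IH: "reachable ?W" "?W \<subseteq> ?L0" using insert by auto
    have v: "v \<in> iterated_brackets X k" using insert by auto
    have "reachable (span (insert v ?W))"
      by (rule reachable_insert[OF subspace_span _ IH(2,1) approximable_iterated_brackets[OF v]]) (auto intro: span_base)
    moreover have "span (insert v ?W) = span (insert v G \<union> ?L1)"
    proof
      show "span (insert v ?W) \<subseteq> span (insert v G \<union> ?L1)"
      proof (rule span_minimal)
        show "insert v ?W \<subseteq> span (insert v G \<union> ?L1)"
          using span_mono[of "G \<union> ?L1" "insert v G \<union> ?L1"] by (auto intro: span_base)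
      qed (rule subspace_span)
      show "span (insert v G \<union> ?L1) \<subseteq> span (insert v ?W)"
        by (rule span_mono) (auto intro: span_base)
    qed
    moreover have "span (insert v G \<union> ?L1) \<subseteq> ?L0"
    proof (rule span_minimal[OF _ subspace_lower_central])
      show "insert v G \<union> ?L1 \<subseteq> ?L0"
        using iterated_brackets_lower_central insert.prems lower_central_decreasing by blast
    qed
    ultimately show ?case by simp
  qed
  from this[OF fin] have R: "reachable (span (iterated_brackets X k \<union> ?L1))" "span (iterated_brackets X k \<union> ?L1) \<subseteq> ?L0" by auto
  have "?L0 \<subseteq> span (iterated_brackets X k \<union> ?L1)"
  proof
    fix z assume "z \<in> ?L0"
    then obtain a where a: "a \<in> span (iterated_brackets X k)" "z - a \<in> ?L1" using lower_central_generated[OF s] by blast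
    have "a \<in> span (iterated_brackets X k \<union> ?L1)" using a(1) span_mono[of "iterated_brackets X k" "iterated_brackets X k \<union> ?L1"] by blast
    moreover have "z - a \<in> span (iterated_brackets X k \<union> ?L1)" using a(2) by (intro span_base) blast
    ultimately have "a + (z - a) \<in> span (iterated_brackets X k \<union> ?L1)" by (rule span_add)
    thus "z \<in> span (iterated_brackets X k \<union> ?L1)" by simp
  qed
  thus ?case using R by (metis subset_antisym)
qed

text \<open>
  A quantitative form of Chow's theorem at the identity.
\<close>

lemma chow:
  obtains C \<beta> \<rho> where "C > 0" "\<beta> > 0" "\<rho> > 0" "\<And>h. norm h \<le> \<rho> \<Longrightarrow> \<exists>L\<le>C * norm h powr \<beta>. reach L h"
  using reachable_lower_central[of 0] unfolding reachable_def by (auto simp: that)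

section \<open>The isoperimetric inequality for small volumes\<close>

lemma defect_reach:
  assumes \<kappa>: "\<kappa> > 0" "\<And>x s. x \<in> X \<Longrightarrow> \<bar>s\<bar> \<le> 1 \<Longrightarrow> (1 / \<kappa>) *\<^sub>R (s *\<^sub>R x) \<in> K"
    and B: "B \<in> sets borel" "emeasure lborel B < \<infinity>" "perim_le B c" and h: "reach L h"
  shows "defect B h \<le> ennreal (\<kappa> * c * L)"
  using h
proof (induction rule: reach.induct)
  case zero
  have "{p. p \<odot> 0 \<in> B \<and> p \<notin> B} = {}" by auto
  thus ?case by (simp add: defect_def)
next
  case (horizontal x t)
  show ?case by (rule defect_horizontal[OF \<kappa> horizontal B])
next
  case (product L h L' h')
  have c: "c \<ge> 0" by (rule perim_le_nonneg[OF B(3)])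
  have L: "L \<ge> 0" "L' \<ge> 0" using product.hyps reach_nonneg by auto
  have "defect B (h \<odot> h') \<le> ennreal (\<kappa> * c * L) + ennreal (\<kappa> * c * L')"
    using defect_gmul[OF B(1)] product.IH by (meson add_mono order_trans)
  also have "\<dots> = ennreal (\<kappa> * c * (L + L'))"
    using \<kappa>(1) c L by (simp add: ennreal_plus[symmetric] distrib_left del: ennreal_plus)
  also have "\<dots> \<le> ennreal (\<kappa> * c * (2 * (L + L')))"
    using \<kappa>(1) c L by (intro ennreal_leI mult_left_mono) auto
  finally show ?case .
qed

text \<open>
  Fubini: for a fixed point \<open>p\<close> of \<open>B\<close> the elements \<open>h\<close> with
  \<open>p \<odot> h \<in> B\<close> form a left translate of \<open>B\<close>.
\<close>

lemma average_intersection: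
  assumes B [measurable]: "B \<in> sets borel" and A [measurable]: "A \<in> sets borel"
  shows "(\<integral>\<^sup>+h. emeasure lborel {p. p \<odot> h \<in> B \<and> p \<in> B} * indicator A h \<partial>lborel) \<le> emeasure lborel B * emeasure lborel B"
proof -
  have "emeasure lborel {p. p \<odot> h \<in> B \<and> p \<in> B} * indicator A h
     = (\<integral>\<^sup>+p. indicator B (p \<odot> h) * indicator B p * indicator A h \<partial>lborel)" for h
  proof -
    have "emeasure lborel {p. p \<odot> h \<in> B \<and> p \<in> B} = (\<integral>\<^sup>+p. indicator {p. p \<odot> h \<in> B \<and> p \<in> B} p \<partial>lborel)"
      by (rule nn_integral_indicator[symmetric]) measurable
    also have "\<dots> = (\<integral>\<^sup>+p. indicator B (p \<odot> h) * indicator B p \<partial>lborel)"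
      by (rule nn_integral_cong) (auto simp: indicator_def)
    finally have e: "emeasure lborel {p. p \<odot> h \<in> B \<and> p \<in> B} = (\<integral>\<^sup>+p. indicator B (p \<odot> h) * indicator B p \<partial>lborel)" .
    show ?thesis unfolding e by (rule nn_integral_multc[symmetric]) measurable
  qed
  hence "(\<integral>\<^sup>+h. emeasure lborel {p. p \<odot> h \<in> B \<and> p \<in> B} * indicator A h \<partial>lborel)
     = (\<integral>\<^sup>+h. (\<integral>\<^sup>+p. indicator B (p \<odot> h) * indicator B p * indicator A h \<partial>lborel) \<partial>lborel)" by simp
  also have "\<dots> = (\<integral>\<^sup>+p. (\<integral>\<^sup>+h. indicator B (p \<odot> h) * indicator B p * indicator A h \<partial>lborel) \<partial>lborel)"
    by (rule lborel_pair.Fubini') measurable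
  also have "\<dots> \<le> (\<integral>\<^sup>+p. emeasure lborel B * indicator B p \<partial>lborel)"
  proof (rule nn_integral_mono)
    fix p
    have "(\<integral>\<^sup>+h. indicator B (p \<odot> h) * indicator B p * indicator A h \<partial>lborel) \<le> (\<integral>\<^sup>+h. indicator B (p \<odot> h) * indicator B p \<partial>lborel)"
      by (rule nn_integral_mono) (auto simp: indicator_def)
    also have "\<dots> = (\<integral>\<^sup>+h. indicator B (p \<odot> h) \<partial>lborel) * indicator B p" by (rule nn_integral_multc) measurable
    also have "(\<integral>\<^sup>+h. indicator B (p \<odot> h) \<partial>lborel) = emeasure lborel B"
      using nn_integral_left[of "indicator B" p] by simp
    finally show "(\<integral>\<^sup>+h. indicator B (p \<odot> h) * indicator B p * indicator A h \<partial>lborel) \<le> emeasure lborel B * indicator B p" .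
  qed
  also have "\<dots> = emeasure lborel B * emeasure lborel B" by (subst nn_integral_cmult) auto
  finally show ?thesis .
qed

text \<open>
  For \<open>h\<close> in a ball \<open>A\<close> of radius \<open>s\<close> the translate of
  \<open>B\<close> by \<open>h\<close> differs from \<open>B\<close> by a volume of at most a
  multiple of \<open>c s\<^sup>\<beta>\<close>. If \<open>A\<close> has twice the volume
  \<open>b\<close> of \<open>B\<close>, then on average over \<open>A\<close> at most half of
  \<open>B\<close> overlaps with its translate. Hence \<open>b / 2\<close> is at most that multiple,
  and \<open>s\<close> is a power of \<open>b\<close>.
\<close>

lemma isoperimetric_inequality:
  obtains C \<sigma> b0 where "C > 0" "\<sigma> > 0" "b0 > 0"
    "\<And>B c. B \<in> sets borel \<Longrightarrow> emeasure lborel B < \<infinity> \<Longrightarrow> perim_le B c \<Longrightarrow> measure lborel B \<le> b0 \<Longrightarrow>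
       measure lborel B \<le> C * c * measure lborel B powr \<sigma>"
proof -
  obtain \<kappa> where \<kappa>: "\<kappa> > 0" "\<And>x s. x \<in> X \<Longrightarrow> \<bar>s\<bar> \<le> 1 \<Longrightarrow> (1 / \<kappa>) *\<^sub>R (s *\<^sub>R x) \<in> K"
    using horizontal_gauge_bound by blast
  obtain C \<beta> \<rho> where C: "C > 0" and \<beta>: "\<beta> > 0" and \<rho>: "\<rho> > 0"
    and ch: "\<And>h. norm h \<le> \<rho> \<Longrightarrow> \<exists>L\<le>C * norm h powr \<beta>. reach L h" using chow by blast
  define d where "d = real DIM((real, 'n) vec)"
  have d: "d > 0" by (simp add: d_def)
  define \<omega> where "\<omega> = unit_ball_vol d"
  have \<omega>: "\<omega> > 0" using d by (simp add: \<omega>_def unit_ball_vol_pos)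
  have vol: "measure lborel (cball (0 :: (real, 'n) vec) s) = \<omega> * s powr d" if "s > 0" for s
    using that content_cball[of s "0 :: (real, 'n) vec"] by (simp add: \<omega>_def d_def powr_realpow)
  have step: "measure lborel B \<le> 2 * \<kappa> * C * c * s powr \<beta>"
    if B: "B \<in> sets borel" "emeasure lborel B < \<infinity>" "perim_le B c" and s: "0 < s" "s \<le> \<rho>"
      and le: "2 * measure lborel B \<le> \<omega> * s powr d" for B c s
  proof -
    have [measurable]: "B \<in> sets borel" by (rule B)
    have c: "c \<ge> 0" by (rule perim_le_nonneg[OF B(3)])
    define b where "b = measure lborel B"
    have b0: "b \<ge> 0" by (simp add: b_def)
    have eb: "emeasure lborel B = ennreal b" using B(2) by (simp add: b_def emeasure_eq_ennreal_measure top_unique less_top)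
    define A where "A = cball (0 :: (real, 'n) vec) s"
    have Am: "A \<in> sets lborel" by (simp add: A_def)
    define q where "q = \<omega> * s powr d"
    have q: "q > 0" using \<omega> s by (simp add: q_def)
    have eA: "emeasure lborel A = ennreal q"
      using vol[OF s(1)] emeasure_lborel_cball_finite[of "0 :: (real, 'n) vec" s]
      by (simp add: A_def q_def emeasure_eq_ennreal_measure top_unique less_top)
    define D where "D = \<kappa> * c * (C * s powr \<beta>)"
    have D0: "D \<ge> 0" using \<kappa>(1) c C by (simp add: D_def)
    have def_le: "defect B h \<le> ennreal D" if "h \<in> A" for h
    proof -
      have hs: "norm h \<le> s" using that by (simp add: A_def)
      then obtain L where L: "L \<le> C * norm h powr \<beta>" "reach L h" using ch[of h] s by auto
      have "norm h powr \<beta> \<le> s powr \<beta>" using hs \<beta> by (intro powr_mono2) auto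
      hence "C * norm h powr \<beta> \<le> C * s powr \<beta>" using C by (intro mult_left_mono) auto
      hence "L \<le> C * s powr \<beta>" using L(1) by linarith
      hence "\<kappa> * c * L \<le> D" unfolding D_def using \<kappa>(1) c by (intro mult_left_mono) auto
      thus ?thesis using defect_reach[OF \<kappa> B L(2)] ennreal_leI order_trans by blast
    qed
    have pt: "ennreal b * indicator A h \<le> emeasure lborel {p. p \<odot> h \<in> B \<and> p \<in> B} * indicator A h + ennreal D * indicator A h" for h
    proof (cases "h \<in> A")
      case True
      have "ennreal b = emeasure lborel {p. p \<odot> h \<in> B}" using emeasure_right[OF B(1), of h] eb by simp
      also have "{p. p \<odot> h \<in> B} = {p. p \<odot> h \<in> B \<and> p \<in> B} \<union> {p. p \<odot> h \<in> B \<and> p \<notin> B}" by auto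
      also have "emeasure lborel \<dots> \<le> emeasure lborel {p. p \<odot> h \<in> B \<and> p \<in> B} + defect B h"
        unfolding defect_def by (intro emeasure_subadditive; measurable)
      finally show ?thesis using def_le[OF True] True by (simp add: add_left_mono order_trans)
    qed simp
    have "ennreal b * ennreal q = (\<integral>\<^sup>+h. ennreal b * indicator A h \<partial>lborel)"
      by (simp only: nn_integral_cmult_indicator[OF Am] eA)
    also have "\<dots> \<le> (\<integral>\<^sup>+h. emeasure lborel {p. p \<odot> h \<in> B \<and> p \<in> B} * indicator A h + ennreal D * indicator A h \<partial>lborel)"
      by (intro nn_integral_mono pt)
    also have "\<dots> = (\<integral>\<^sup>+h. emeasure lborel {p. p \<odot> h \<in> B \<and> p \<in> B} * indicator A h \<partial>lborel) + (\<integral>\<^sup>+h. ennreal D * indicator A h \<partial>lborel)"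
    proof (rule nn_integral_add)
      have "(\<lambda>h. \<integral>\<^sup>+p. indicator B (p \<odot> h) * indicator B p \<partial>lborel) \<in> borel_measurable lborel"
        by measurable
      moreover have "(\<integral>\<^sup>+p. indicator B (p \<odot> h) * indicator B p \<partial>lborel) = emeasure lborel {p. p \<odot> h \<in> B \<and> p \<in> B}" for h
      proof -
        have "emeasure lborel {p. p \<odot> h \<in> B \<and> p \<in> B} = (\<integral>\<^sup>+p. indicator {p. p \<odot> h \<in> B \<and> p \<in> B} p \<partial>lborel)"
          by (rule nn_integral_indicator[symmetric]) measurable
        also have "\<dots> = (\<integral>\<^sup>+p. indicator B (p \<odot> h) * indicator B p \<partial>lborel)"
          by (rule nn_integral_cong) (auto simp: indicator_def)
        finally show ?thesis ..
      qed
      ultimately have [measurable]: "(\<lambda>h. emeasure lborel {p. p \<odot> h \<in> B \<and> p \<in> B}) \<in> borel_measurable lborel" by simp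
      have [measurable]: "A \<in> sets borel" by (simp add: A_def)
      show "(\<lambda>h. emeasure lborel {p. p \<odot> h \<in> B \<and> p \<in> B} * indicator A h) \<in> borel_measurable lborel" by measurable
      show "(\<lambda>h. ennreal D * indicator A h) \<in> borel_measurable lborel" by measurable
    qed
    also have "(\<integral>\<^sup>+h. ennreal D * indicator A h \<partial>lborel) = ennreal D * ennreal q"
      by (simp only: nn_integral_cmult_indicator[OF Am] eA)
    also have "(\<integral>\<^sup>+h. emeasure lborel {p. p \<odot> h \<in> B \<and> p \<in> B} * indicator A h \<partial>lborel) \<le> ennreal b * ennreal b"
      using average_intersection[OF B(1), of A] by (simp add: eb A_def)
    finally have "ennreal b * ennreal q \<le> ennreal b * ennreal b + ennreal D * ennreal q" by (simp add: add_right_mono)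
    hence "b * q \<le> b * b + D * q"
      using b0 q D0 by (simp add: ennreal_mult[symmetric] ennreal_plus[symmetric] del: ennreal_plus)
    moreover have "b * b \<le> b * (q / 2)" using le b0 by (intro mult_left_mono) (auto simp: b_def q_def)
    ultimately have "b * q \<le> 2 * D * q" by (simp add: algebra_simps)
    hence "b \<le> 2 * D" using q by simp
    thus ?thesis by (simp add: b_def D_def mult_ac)
  qed
  define b0 where "b0 = \<omega> * \<rho> powr d / 2"
  have b0: "b0 > 0" using \<omega> \<rho> by (simp add: b0_def)
  define C' where "C' = 2 * \<kappa> * C * (2 / \<omega>) powr (\<beta> / d)"
  have C': "C' > 0" using \<kappa>(1) C \<omega> by (simp add: C'_def)
  show ?thesis
  proof (rule that[OF C' _ b0, of "\<beta> / d"])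
    show "\<beta> / d > 0" using \<beta> d by simp
    fix B c assume B: "B \<in> sets borel" "emeasure lborel B < \<infinity>" "perim_le B c" "measure lborel B \<le> b0"
    define b where "b = measure lborel B"
    show "measure lborel B \<le> C' * c * measure lborel B powr (\<beta> / d)"
    proof (cases "b = 0")
      case True thus ?thesis by (simp add: b_def)
    next
      case False
      hence b: "b > 0" by (simp add: b_def zero_less_measure_iff)
      \<comment> \<open>the radius of a ball of volume \<open>2 b\<close>\<close>
      define s where "s = (2 * b / \<omega>) powr (1 / d)"
      have s0: "s > 0" using b \<omega> by (simp add: s_def)
      have sd: "s powr d = 2 * b / \<omega>" using b \<omega> d by (simp add: s_def powr_powr)
      have "2 * b / \<omega> \<le> \<rho> powr d" using B(4) \<omega> by (simp add: b_def b0_def field_simps)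
      hence "s \<le> (\<rho> powr d) powr (1 / d)" unfolding s_def using b \<omega> d by (intro powr_mono2) auto
      hence s\<rho>: "s \<le> \<rho>" using \<rho> d by (simp add: powr_powr)
      have "b \<le> 2 * \<kappa> * C * c * s powr \<beta>"
        unfolding b_def using sd \<omega> by (intro step[OF B(1-3) s0 s\<rho>]) (simp add: b_def)
      also have "s powr \<beta> = (2 / \<omega>) powr (\<beta> / d) * b powr (\<beta> / d)"
        using b \<omega> by (simp add: s_def powr_powr powr_mult[symmetric])
      finally show ?thesis by (simp add: b_def C'_def mult_ac)
    qed
  qed
qed

section \<open>Carnot--Caratheodory balls are neighbourhoods\<close>

text \<open>
  A horizontal path on \<open>{0..1}\<close> with speed at most \<open>L\<close> away from finitely
  many points. A bound on the speed is easier to carry through concatenations than the length.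
\<close>

definition speed_path :: "real \<Rightarrow> (real, 'n) vec \<Rightarrow> (real, 'n) vec \<Rightarrow> (real \<Rightarrow> (real, 'n) vec) \<Rightarrow> bool" where
  "speed_path L p q \<gamma> \<longleftrightarrow> valid_path \<gamma> \<and> pathstart \<gamma> = p \<and> pathfinish \<gamma> = q \<and>
     (\<exists>S. finite S \<and> (\<forall>t\<in>{0..1} - S. \<exists>w\<in>span X. (\<gamma> has_vector_derivative LD (\<gamma> t) 0 w) (at t) \<and>
        sqrt (\<Sum>x\<in>X. (representation X w x)\<^sup>2) \<le> L))"

lemma speed_path_join:
  assumes 1: "speed_path L p q \<gamma>" and 2: "speed_path L' q q' \<gamma>'" and L: "L \<ge> 0" "L' \<ge> 0"
  shows "speed_path (2 * (L + L')) p q' (\<gamma> +++ \<gamma>')"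
proof -
  obtain S where S: "finite S" "\<And>t. t \<in> {0..1} - S \<Longrightarrow> \<exists>w\<in>span X. (\<gamma> has_vector_derivative LD (\<gamma> t) 0 w) (at t) \<and>
        sqrt (\<Sum>x\<in>X. (representation X w x)\<^sup>2) \<le> L" using 1 unfolding speed_path_def by blast
  obtain S' where S': "finite S'" "\<And>t. t \<in> {0..1} - S' \<Longrightarrow> \<exists>w\<in>span X. (\<gamma>' has_vector_derivative LD (\<gamma>' t) 0 w) (at t) \<and>
        sqrt (\<Sum>x\<in>X. (representation X w x)\<^sup>2) \<le> L'" using 2 unfolding speed_path_def by blast
  have scale: "sqrt (\<Sum>x\<in>X. (representation X (2 *\<^sub>R w) x)\<^sup>2) \<le> 2 * (L + L')"
    if w: "w \<in> span X" "sqrt (\<Sum>x\<in>X. (representation X w x)\<^sup>2) \<le> L0" "L0 \<le> L + L'" for w L0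
  proof -
    have "(\<Sum>x\<in>X. (representation X (2 *\<^sub>R w) x)\<^sup>2) = 2\<^sup>2 * (\<Sum>x\<in>X. (representation X w x)\<^sup>2)"
      using representation_scale[OF independent_X w(1), of 2] by (simp add: power_mult_distrib sum_distrib_left)
    hence "sqrt (\<Sum>x\<in>X. (representation X (2 *\<^sub>R w) x)\<^sup>2) = 2 * sqrt (\<Sum>x\<in>X. (representation X w x)\<^sup>2)"
      by (simp add: real_sqrt_mult)
    thus ?thesis using w by simp
  qed
  \<comment> \<open>the exceptional points of both paths and the point where they are joined\<close>
  define S0 where "S0 = {1/2} \<union> (\<lambda>t. t / 2) ` S \<union> (\<lambda>t. (t + 1) / 2) ` S'"
  have "\<exists>w\<in>span X. ((\<gamma> +++ \<gamma>') has_vector_derivative LD ((\<gamma> +++ \<gamma>') t) 0 w) (at t) \<and>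
        sqrt (\<Sum>x\<in>X. (representation X w x)\<^sup>2) \<le> 2 * (L + L')" if t: "t \<in> {0..1} - S0" for t
  proof (cases "t < 1/2")
    case True
    have "2 * t \<in> {0..1} - S"
    proof -
      have "2 * t \<notin> S"
      proof
        assume "2 * t \<in> S"
        hence "(2 * t) / 2 \<in> S0" unfolding S0_def by blast
        thus False using t by simp
      qed
      thus ?thesis using t True by auto
    qed
    then obtain w where w: "w \<in> span X" "(\<gamma> has_vector_derivative LD (\<gamma> (2 * t)) 0 w) (at (2 * t))"
      "sqrt (\<Sum>x\<in>X. (representation X w x)\<^sup>2) \<le> L" using S(2) by blast
    have "((\<lambda>t. 2 * t) has_vector_derivative 2) (at t)" by (auto intro!: derivative_eq_intros simp: has_vector_derivative_def)
    from vector_diff_chain_at[OF this w(2)]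
    have "((\<lambda>t. \<gamma> (2 * t)) has_vector_derivative LD (\<gamma> (2 * t)) 0 (2 *\<^sub>R w)) (at t)" by (simp add: o_def LD_simps)
    hence "((\<gamma> +++ \<gamma>') has_vector_derivative LD (\<gamma> (2 * t)) 0 (2 *\<^sub>R w)) (at t)"
      by (rule has_vector_derivative_transform_within_open[where S = "{..<1/2}"]) (use True in \<open>auto simp: joinpaths_def\<close>)
    moreover have "(\<gamma> +++ \<gamma>') t = \<gamma> (2 * t)" using True by (simp add: joinpaths_def)
    ultimately show ?thesis using scale[OF w(1,3)] L span_scale[OF w(1), of 2] by auto
  next
    case False
    hence t2: "t > 1/2" using t by (auto simp: S0_def)
    have "2 * t - 1 \<in> {0..1} - S'"
    proof -
      have "2 * t - 1 \<notin> S'"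
      proof
        assume "2 * t - 1 \<in> S'"
        hence "((2 * t - 1) + 1) / 2 \<in> S0" unfolding S0_def by blast
        thus False using t by simp
      qed
      thus ?thesis using t t2 by auto
    qed
    then obtain w where w: "w \<in> span X" "(\<gamma>' has_vector_derivative LD (\<gamma>' (2 * t - 1)) 0 w) (at (2 * t - 1))"
      "sqrt (\<Sum>x\<in>X. (representation X w x)\<^sup>2) \<le> L'" using S'(2) by blast
    have "((\<lambda>t. 2 * t - 1) has_vector_derivative 2) (at t)" by (auto intro!: derivative_eq_intros simp: has_vector_derivative_def)
    from vector_diff_chain_at[OF this w(2)]
    have "((\<lambda>t. \<gamma>' (2 * t - 1)) has_vector_derivative LD (\<gamma>' (2 * t - 1)) 0 (2 *\<^sub>R w)) (at t)" by (simp add: o_def LD_simps)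
    hence "((\<gamma> +++ \<gamma>') has_vector_derivative LD (\<gamma>' (2 * t - 1)) 0 (2 *\<^sub>R w)) (at t)"
      by (rule has_vector_derivative_transform_within_open[where S = "{1/2<..}"]) (use t2 in \<open>auto simp: joinpaths_def\<close>)
    moreover have "(\<gamma> +++ \<gamma>') t = \<gamma>' (2 * t - 1)" using t2 by (simp add: joinpaths_def)
    ultimately show ?thesis using scale[OF w(1,3)] L span_scale[OF w(1), of 2] by auto
  qed
  moreover have "finite S0" using S(1) S'(1) by (simp add: S0_def)
  ultimately show ?thesis using 1 2 unfolding speed_path_def
    by (auto intro: valid_path_join)
qed

text \<open>
  Each factor of a product contributes the segment \<open>s \<mapsto> p \<odot> s t x\<close> of an
  integral curve of \<open>x\<close>.
\<close>

lemma speed_path_reach: "reach L h \<Longrightarrow> \<exists>\<gamma>. speed_path L p (p \<odot> h) \<gamma>"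
proof (induction arbitrary: p rule: reach.induct)
  case zero
  have "speed_path 0 p (p \<odot> 0) (\<lambda>_. p)"
    unfolding speed_path_def
    by (auto simp: pathstart_def pathfinish_def valid_path_def LD_simps representation_zero C1_differentiable_imp_piecewise
        intro!: exI[of _ "{}"] bexI[of _ 0] span_zero)
  thus ?case by blast
next
  case (horizontal x t)
  define \<gamma> where "\<gamma> s = p \<odot> s *\<^sub>R (t *\<^sub>R x)" for s :: real
  have flow: "LD p (s *\<^sub>R v) v = LD (p \<odot> s *\<^sub>R v) 0 v" for s v
  proof -
    have "((\<lambda>e. s *\<^sub>R v \<odot> e *\<^sub>R v) has_vector_derivative LD (s *\<^sub>R v) (0 *\<^sub>R v) v) (at 0)"
      by (rule has_vector_derivative_eq_rhs[OF has_vector_derivative_gmul]) (auto intro!: derivative_eq_intros simp: RD_simps)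
    moreover have "((\<lambda>e. (s + e) *\<^sub>R v) has_vector_derivative v) (at 0)" by (auto intro!: derivative_eq_intros)
    ultimately have "LD (s *\<^sub>R v) 0 v = v"
      using vector_derivative_unique_at unfolding exponential_coordinates by fastforce
    thus ?thesis using LD_LD[of p "s *\<^sub>R v" 0 v] by simp
  qed
  have d: "(\<gamma> has_vector_derivative LD (\<gamma> s) 0 (t *\<^sub>R x)) (at s)" for s
    unfolding \<gamma>_def flow[symmetric]
    by (rule has_vector_derivative_eq_rhs[OF has_vector_derivative_gmul]) (auto intro!: derivative_eq_intros simp: RD_simps)
  have "\<gamma> C1_differentiable_on {0..1}"
    unfolding C1_differentiable_on_def
  proof (intro exI conjI ballI)
    show "(\<gamma> has_vector_derivative LD (\<gamma> s) 0 (t *\<^sub>R x)) (at s)" for s by (rule d)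
    show "continuous_on {0..1} (\<lambda>s. LD (\<gamma> s) 0 (t *\<^sub>R x))"
      unfolding \<gamma>_def by (intro continuous_on_LD continuous_on_gmul continuous_intros)
  qed
  hence "valid_path \<gamma>" by (simp add: valid_path_def C1_differentiable_imp_piecewise)
  moreover have "sqrt (\<Sum>y\<in>X. (representation X (t *\<^sub>R x) y)\<^sup>2) = \<bar>t\<bar>"
  proof -
    have "(representation X (t *\<^sub>R x) y)\<^sup>2 = (if y = x then t\<^sup>2 else 0)" for y
      using representation_scale[OF independent_X span_base[OF horizontal], of t] representation_basis[OF independent_X horizontal]
      by (auto simp: power_mult_distrib)
    thus ?thesis using horizontal independent_imp_finite[OF independent_X] by simp
  qed
  ultimately have "speed_path \<bar>t\<bar> p (p \<odot> t *\<^sub>R x) \<gamma>"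
    unfolding speed_path_def using d span_scale[OF span_base[OF horizontal], of t]
    by (auto simp: pathstart_def pathfinish_def \<gamma>_def intro!: exI[of _ "{}"] bexI[of _ "t *\<^sub>R x"])
  thus ?case by blast
next
  case (product L h L' h')
  obtain \<gamma> where \<gamma>: "speed_path L p (p \<odot> h) \<gamma>" using product.IH(1) by blast
  obtain \<gamma>' where \<gamma>': "speed_path L' (p \<odot> h) (p \<odot> h \<odot> h') \<gamma>'" using product.IH(2) by blast
  from speed_path_join[OF \<gamma> \<gamma>' reach_nonneg[OF product.hyps(1)] reach_nonneg[OF product.hyps(2)]]
  show ?case by (auto simp: gmul_assoc)
qed

lemma cc_dist_le_of_speed_path:
  assumes "speed_path L p q \<gamma>"
  shows "cc_dist gmul ginv X p q \<le> ennreal L"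
proof -
  obtain S where S: "finite S" "\<And>t. t \<in> {0..1} - S \<Longrightarrow> \<exists>w\<in>span X. (\<gamma> has_vector_derivative LD (\<gamma> t) 0 w) (at t) \<and>
        sqrt (\<Sum>x\<in>X. (representation X w x)\<^sup>2) \<le> L" using assms unfolding speed_path_def by blast
  have A: "\<gamma> differentiable (at t) \<and> vector_derivative \<gamma> (at t) \<in> horizontal_at gmul X (\<gamma> t) \<and>
      sr_norm_at gmul ginv X (\<gamma> t) (vector_derivative \<gamma> (at t)) \<le> L" if "t \<in> {0..1} - S" for t
  proof -
    obtain w where w: "w \<in> span X" "(\<gamma> has_vector_derivative LD (\<gamma> t) 0 w) (at t)"
      "sqrt (\<Sum>x\<in>X. (representation X w x)\<^sup>2) \<le> L" using S(2) \<open>t \<in> {0..1} - S\<close> by blast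
    have v: "vector_derivative \<gamma> (at t) = LD (\<gamma> t) 0 w" by (rule vector_derivative_at[OF w(2)])
    have "\<gamma> differentiable (at t)" using w(2) differentiableI_vector by blast
    thus ?thesis using w unfolding v sr_norm_at_def horizontal_at_def left_field_eq pull_back_eq by auto
  qed
  have hp: "horizontal_path gmul X \<gamma>"
    using assms A S(1) unfolding horizontal_path_def speed_path_def by blast
  have "cc_length gmul ginv X \<gamma> \<le> (\<integral>\<^sup>+t. ennreal L * indicator {0..1} (t :: real) \<partial>lborel)"
    unfolding cc_length_def
  proof (rule nn_integral_mono_AE)
    have "AE t in lborel. t \<notin> S" using S(1) by (intro AE_not_in) (simp add: finite_imp_null_set_lborel)
    thus "AE t in lborel. ennreal (sr_norm_at gmul ginv X (\<gamma> t) (vector_derivative \<gamma> (at t))) * indicator {0..1} t \<le> ennreal L * indicator {0..1} t"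
      by eventually_elim (use A in \<open>auto simp: indicator_def intro: ennreal_leI\<close>)
  qed
  also have "\<dots> = ennreal L" by (subst nn_integral_cmult) auto
  finally have "cc_length gmul ginv X \<gamma> \<le> ennreal L" .
  moreover have "cc_dist gmul ginv X p q \<le> cc_length gmul ginv X \<gamma>"
    unfolding cc_dist_def using hp assms by (intro Inf_lower) (auto simp: speed_path_def)
  ultimately show ?thesis by (rule order_trans[rotated])
qed

lemma cc_ball_neighbourhood:
  assumes "\<rho> > 0"
  obtains d where "d > 0" "\<And>p h. norm h < d \<Longrightarrow> p \<odot> h \<in> cc_ball gmul ginv X p \<rho>"
proof -
  obtain C \<beta> \<rho>0 where C: "C > 0" and \<beta>: "\<beta> > 0" and \<rho>0: "\<rho>0 > 0"
    and ch: "\<And>h. norm h \<le> \<rho>0 \<Longrightarrow> \<exists>L\<le>C * norm h powr \<beta>. reach L h" using chow by blast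
  define d where "d = min \<rho>0 ((\<rho> / C) powr (1 / \<beta>))"
  have "p \<odot> h \<in> cc_ball gmul ginv X p \<rho>" if h: "norm h < d" for p h
  proof -
    obtain L where L: "L \<le> C * norm h powr \<beta>" "reach L h" using ch[of h] h by (auto simp: d_def)
    obtain \<gamma> where "speed_path L p (p \<odot> h) \<gamma>" using speed_path_reach[OF L(2)] by blast
    hence "cc_dist gmul ginv X p (p \<odot> h) \<le> ennreal L" by (rule cc_dist_le_of_speed_path)
    moreover have "norm h powr \<beta> < ((\<rho> / C) powr (1 / \<beta>)) powr \<beta>"
      using h \<beta> by (intro powr_less_mono2) (auto simp: d_def)
    hence "norm h powr \<beta> < \<rho> / C" using \<beta> C assms by (simp add: powr_powr)
    hence "L < \<rho>" using L(1) C by (simp add: field_simps)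
    hence "ennreal L < ennreal \<rho>" using assms by (simp add: ennreal_less_iff reach_nonneg[OF L(2)])
    ultimately show ?thesis by (simp add: cc_ball_def)
  qed
  moreover have "d > 0" using \<rho>0 C assms by (simp add: d_def)
  ultimately show ?thesis using that by blast
qed

section \<open>Midpoint concavity of the isoperimetric profile\<close>

text \<open>
  The pairs formed by a volume and an upper bound for the perimeter of some set of this volume. The
  isoperimetric profile is \<open>w \<mapsto> Inf {c. admissible w c}\<close>.
\<close>

definition admissible :: "real \<Rightarrow> real \<Rightarrow> bool" where
  "admissible w c \<longleftrightarrow> (\<exists>B\<in>sets borel. emeasure lborel B = ennreal w \<and> perim_le B c)"

text \<open>
  Along a segment from \<open>0\<close> to an element \<open>h0\<close> that moves most of
  \<open>B\<close> off itself, the volume outside \<open>B\<close> of the translate varies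
  continuously from \<open>0\<close> to almost \<open>u\<close>.
\<close>

lemma translate_with_overlap:
  assumes B: "B \<in> sets borel" "emeasure lborel B = ennreal u" and w: "0 \<le> w" "w < u"
  obtains h where "emeasure lborel {x. h \<odot> x \<in> B \<and> x \<notin> B} = ennreal w"
proof -
  have [measurable]: "B \<in> sets borel" by (rule B)
  have fin: "emeasure lborel B < \<infinity>" using B by simp
  define f where "f h = measure lborel {x. h \<odot> x \<in> B \<and> x \<notin> B}" for h
  have fm: "{x. h \<odot> x \<in> B \<and> x \<notin> B} \<in> fmeasurable lborel" for h
  proof (rule fmeasurableI)
    have "emeasure lborel {x. h \<odot> x \<in> B \<and> x \<notin> B} \<le> emeasure lborel {x. h \<odot> x \<in> B}"
      by (rule emeasure_mono) (auto, measurable)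
    thus "emeasure lborel {x. h \<odot> x \<in> B \<and> x \<notin> B} < \<infinity>" using emeasure_left[OF B(1), of h] fin by simp
  qed measurable
  have ef: "emeasure lborel {x. h \<odot> x \<in> B \<and> x \<notin> B} = ennreal (f h)" for h
    unfolding f_def using fm[of h] by (rule emeasure_eq_measure2)
  have f_diff: "ennreal (f h) \<le> ennreal (f k) + emeasure lborel {x. ((h \<odot> - k) \<odot> x \<in> B) \<noteq> (x \<in> B)}" for h k
  proof -
    have "{x. h \<odot> x \<in> B \<and> x \<notin> B} \<subseteq> {x. k \<odot> x \<in> B \<and> x \<notin> B} \<union> {x. k \<odot> x \<in> {y. ((h \<odot> - k) \<odot> y \<in> B) \<noteq> (y \<in> B)}}"
      by (auto simp: gmul_assoc)
    hence "emeasure lborel {x. h \<odot> x \<in> B \<and> x \<notin> B}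
      \<le> emeasure lborel ({x. k \<odot> x \<in> B \<and> x \<notin> B} \<union> {x. k \<odot> x \<in> {y. ((h \<odot> - k) \<odot> y \<in> B) \<noteq> (y \<in> B)}})"
      by (rule emeasure_mono) measurable
    also have "\<dots> \<le> emeasure lborel {x. k \<odot> x \<in> B \<and> x \<notin> B} + emeasure lborel {x. k \<odot> x \<in> {y. ((h \<odot> - k) \<odot> y \<in> B) \<noteq> (y \<in> B)}}"
      by (rule emeasure_subadditive; measurable)
    also have "emeasure lborel {x. k \<odot> x \<in> {y. ((h \<odot> - k) \<odot> y \<in> B) \<noteq> (y \<in> B)}} = emeasure lborel {y. ((h \<odot> - k) \<odot> y \<in> B) \<noteq> (y \<in> B)}"
      by (rule emeasure_left) measurable
    finally show ?thesis unfolding ef .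
  qed
  obtain C where C: "compact C" "C \<subseteq> B" "emeasure lborel (B - C) < ennreal ((u - w) / 4)"
    using inner_compact[OF B(1) fin, of "(u - w) / 4"] w by auto
  have [measurable]: "C \<in> sets borel" using C(1) by (rule borel_compact)
  have "bounded (uminus ` C)" using C(1) by (intro compact_imp_bounded compact_continuous_image continuous_intros) auto
  then obtain S where S: "\<And>a b. a \<in> C \<Longrightarrow> b \<in> uminus ` C \<Longrightarrow> norm (a \<odot> b) \<le> S"
    using bounded_gmul[OF compact_imp_bounded[OF C(1)]] by blast
  \<comment> \<open>longer than every quotient of two points of \<open>C\<close>, so that it moves \<open>C\<close> off itself\<close>
  define h0 :: "(real, 'n) vec" where "h0 = (\<bar>S\<bar> + 1) *\<^sub>R axis (SOME i. True) 1"
  have h0: "norm h0 > S" by (simp add: h0_def)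
  have disj: "\<not> (h0 \<odot> x \<in> C \<and> x \<in> C)" for x
  proof
    assume "h0 \<odot> x \<in> C \<and> x \<in> C"
    hence "norm ((h0 \<odot> x) \<odot> - x) \<le> S" by (intro S) auto
    thus False using h0 by simp
  qed
  have "ennreal u = emeasure lborel {x. h0 \<odot> x \<in> B}" using emeasure_left[OF B(1)] B(2) by simp
  also have "\<dots> \<le> emeasure lborel ({x. h0 \<odot> x \<in> B \<and> x \<notin> B} \<union> ({x. h0 \<odot> x \<in> B - C} \<union> (B - C)))"
    by (rule emeasure_mono) (use disj in \<open>auto, measurable\<close>)
  also have "\<dots> \<le> emeasure lborel {x. h0 \<odot> x \<in> B \<and> x \<notin> B} + emeasure lborel ({x. h0 \<odot> x \<in> B - C} \<union> (B - C))"
    by (rule emeasure_subadditive; measurable)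
  also have "\<dots> \<le> emeasure lborel {x. h0 \<odot> x \<in> B \<and> x \<notin> B} + (emeasure lborel {x. h0 \<odot> x \<in> B - C} + emeasure lborel (B - C))"
    by (intro add_left_mono emeasure_subadditive; measurable)
  also have "emeasure lborel {x. h0 \<odot> x \<in> B - C} = emeasure lborel (B - C)" by (rule emeasure_left) measurable
  also have "emeasure lborel {x. h0 \<odot> x \<in> B \<and> x \<notin> B} + (emeasure lborel (B - C) + emeasure lborel (B - C))
     \<le> ennreal (f h0) + (ennreal ((u - w) / 4) + ennreal ((u - w) / 4))"
    unfolding ef using C(3) by (intro add_left_mono add_mono) auto
  also have "\<dots> = ennreal (f h0 + (u - w) / 2)"
    using w by (simp add: f_def ennreal_plus[symmetric] del: ennreal_plus)
  finally have "u \<le> f h0 + (u - w) / 2" using w by (subst (asm) ennreal_le_iff) (auto simp: f_def)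
  hence big: "w < f h0" using w by (simp add: field_simps)
  have cont: "continuous_on {0..1} (\<lambda>t. f (t *\<^sub>R h0))"
    unfolding continuous_on_iff
  proof (intro ballI allI impI)
    fix t e :: real assume e: "e > 0"
    obtain d where d: "d > 0" "\<And>h. norm h < d \<Longrightarrow> emeasure lborel {x. (h \<odot> x \<in> B) \<noteq> (x \<in> B)} \<le> ennreal (e / 2)"
      using left_translation_continuous[OF B(1) fin, of "e / 2"] e by auto
    have h0n: "norm h0 > 0" by (simp add: h0_def)
    have close: "f (s *\<^sub>R h0) \<le> f (t' *\<^sub>R h0) + e / 2" if "\<bar>s - t'\<bar> < d / norm h0" for s t'
    proof -
      have "s *\<^sub>R h0 \<odot> - (t' *\<^sub>R h0) = (s - t') *\<^sub>R h0"
        using exponential_coordinates[of s h0 "- t'"] by simp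
      moreover have "norm ((s - t') *\<^sub>R h0) < d" using that h0n by (simp add: pos_less_divide_eq)
      ultimately have "norm (s *\<^sub>R h0 \<odot> - (t' *\<^sub>R h0)) < d" by simp
      from d(2)[OF this] have "ennreal (f (s *\<^sub>R h0)) \<le> ennreal (f (t' *\<^sub>R h0)) + ennreal (e / 2)"
        by (rule order_trans[OF f_diff add_left_mono])
      thus ?thesis using e by (simp add: f_def ennreal_plus[symmetric] ennreal_le_iff del: ennreal_plus)
    qed
    show "\<exists>d>0. \<forall>s\<in>{0..1}. dist s t < d \<longrightarrow> dist (f (s *\<^sub>R h0)) (f (t *\<^sub>R h0)) < e"
    proof (intro exI[of _ "d / norm h0"] conjI ballI impI)
      show "d / norm h0 > 0" using d h0n by simp
      fix s assume "dist s t < d / norm h0"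
      thus "dist (f (s *\<^sub>R h0)) (f (t *\<^sub>R h0)) < e"
        using close[of s t] close[of t s] e by (auto simp: dist_real_def abs_minus_commute)
    qed
  qed
  have f0: "f (0 *\<^sub>R h0) = 0"
  proof -
    have "{x. 0 \<odot> x \<in> B \<and> x \<notin> B} = {}" by auto
    thus ?thesis by (simp add: f_def)
  qed
  obtain t where "f (t *\<^sub>R h0) = w"
    using IVT'[of "\<lambda>t. f (t *\<^sub>R h0)" 0 w 1] f0 big w cont by auto
  thus ?thesis using that[of "t *\<^sub>R h0"] ef by simp
qed

text \<open>
  The union and the intersection of \<open>B\<close> with a translate that leaves \<open>B\<close>
  in the volume \<open>w\<close> have the volumes \<open>u + w\<close> and \<open>u - w\<close>.
\<close>

lemma midpoint_concavity:
  assumes c: "admissible u c" and w: "0 \<le> w" "w < u"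
  obtains a b where "admissible (u + w) a" "admissible (u - w) b" "a + b \<le> 2 * c"
proof -
  obtain B where B: "B \<in> sets borel" "emeasure lborel B = ennreal u" "perim_le B c"
    using c unfolding admissible_def by blast
  have [measurable]: "B \<in> sets borel" by (rule B)
  obtain h where h: "emeasure lborel {x. h \<odot> x \<in> B \<and> x \<notin> B} = ennreal w"
    using translate_with_overlap[OF B(1,2) w] by blast
  define F where "F = {x. h \<odot> x \<in> B}"
  have F: "F \<in> sets borel" "emeasure lborel F = ennreal u" "perim_le F c"
    using B(2) emeasure_left[OF B(1), of h] perim_le_left[OF B(1,3), of h] by (auto simp: F_def)
  have [measurable]: "F \<in> sets borel" by (rule F)
  obtain a b where ab: "perim_le (B \<union> F) a" "perim_le (B \<inter> F) b" "a + b \<le> c + c"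
    using perimeter_union_inter[OF B(1) _ B(3) F(1) _ F(3)] B(2) F(2) by auto
  have hF: "emeasure lborel (F - B) = ennreal w"
  proof -
    have "F - B = {x. h \<odot> x \<in> B \<and> x \<notin> B}" by (auto simp: F_def)
    thus ?thesis using h by simp
  qed
  have "emeasure lborel (B \<union> F) = emeasure lborel B + emeasure lborel (F - B)"
    by (subst plus_emeasure) (auto intro: arg_cong[of _ _ "emeasure lborel"])
  hence e1: "emeasure lborel (B \<union> F) = ennreal (u + w)" using B(2) hF w by (simp add: ennreal_plus[symmetric] del: ennreal_plus)
  have "emeasure lborel F = emeasure lborel (B \<inter> F) + emeasure lborel (F - B)"
    by (subst plus_emeasure) (auto intro: arg_cong[of _ _ "emeasure lborel"])
  hence "emeasure lborel (B \<inter> F) + ennreal w = ennreal u" using F(2) hF by simp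
  hence "emeasure lborel (B \<inter> F) = ennreal u - ennreal w" by (metis ennreal_add_diff_cancel_right ennreal_neq_top)
  hence e2: "emeasure lborel (B \<inter> F) = ennreal (u - w)" using w by (simp add: ennreal_minus)
  show ?thesis
  proof (rule that[of a b])
    show "admissible (u + w) a" unfolding admissible_def using ab e1 by (intro bexI[of _ "B \<union> F"]) auto
    show "admissible (u - w) b" unfolding admissible_def using ab e2 by (intro bexI[of _ "B \<inter> F"]) auto
  qed (use ab in simp)
qed

text \<open>
  By concavity the decrease \<open>\<Delta> j\<close> of the profile from \<open>v - j m\<close> to
  \<open>v - (j + 1) m\<close> grows with \<open>j\<close>. There are \<open>n \<ge> v / (2
  m)\<close> such steps down to a volume that is still positive, and they add up to at most
  \<open>c0\<close>, so the first of them is at most \<open>c0 / n\<close>.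
\<close>

lemma profile_increment:
  assumes c0: "admissible v c0" and min: "\<And>c. admissible v c \<Longrightarrow> c0 \<le> c"
    and m: "0 < m" "2 * m \<le> v" and a: "admissible (v - m) a"
  shows "c0 \<le> a + 2 * m * c0 / v"
proof -
  define F where "F u = Inf {c. admissible u c}" for u
  have nn: "admissible u c \<Longrightarrow> 0 \<le> c" for u c unfolding admissible_def using perim_le_nonneg by blast
  have bdd: "bdd_below {c. admissible u c}" for u using nn by (intro bdd_belowI[of _ 0]) auto
  have F_le: "admissible u c \<Longrightarrow> F u \<le> c" for u c unfolding F_def by (intro cInf_lower bdd) auto
  have ne: "\<exists>c. admissible (v - w) c" if "0 \<le> w" "w < v" for w using midpoint_concavity[OF c0 that] by blast
  have F0: "0 \<le> F (v - w)" if "0 \<le> w" "w < v" for w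
    unfolding F_def using ne[OF that] nn by (intro cInf_greatest) auto
  have Fv: "F v = c0" unfolding F_def using c0 min by (intro cInf_eq_minimum) auto
  have mid: "F (u + m) + F (u - m) \<le> 2 * F u" if mu: "m < u" and ex: "\<exists>c. admissible u c" for u
  proof -
    have "(F (u + m) + F (u - m)) / 2 \<le> F u"
      unfolding F_def[of u]
    proof (rule cInf_greatest)
      show "{c. admissible u c} \<noteq> {}" using ex by blast
      fix c assume "c \<in> {c. admissible u c}"
      hence "admissible u c" by simp
      then obtain a b where "admissible (u + m) a" "admissible (u - m) b" "a + b \<le> 2 * c"
        using midpoint_concavity[OF _ less_imp_le[OF m(1)] mu] by blast
      thus "(F (u + m) + F (u - m)) / 2 \<le> c" using F_le[of "u + m" a] F_le[of "u - m" b] by simp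
    qed
    thus ?thesis by simp
  qed
  define \<Delta> where "\<Delta> j = F (v - real j * m) - F (v - real (Suc j) * m)" for j
  have step: "\<Delta> j \<le> \<Delta> (Suc j)" if "real (Suc (Suc j)) * m < v" for j
  proof -
    have "F ((v - real (Suc j) * m) + m) + F ((v - real (Suc j) * m) - m) \<le> 2 * F (v - real (Suc j) * m)"
    proof (rule mid)
      show "m < v - real (Suc j) * m" using that by (simp add: algebra_simps)
      show "\<exists>c. admissible (v - real (Suc j) * m) c"
        using that m by (intro ne) (auto simp: algebra_simps)
    qed
    moreover have "(v - real (Suc j) * m) + m = v - real j * m" "(v - real (Suc j) * m) - m = v - real (Suc (Suc j)) * m"
      by (auto simp: algebra_simps)
    ultimately show ?thesis by (simp only: \<Delta>_def)
  qed
  have mono: "\<Delta> 0 \<le> \<Delta> j" if "real (Suc j) * m < v" for j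
    using that
  proof (induction j)
    case (Suc j)
    have "real (Suc j) * m < v" using Suc.prems m by (simp add: algebra_simps)
    thus ?case using Suc.IH step[OF Suc.prems] by linarith
  qed simp
  have tele: "(\<Sum>j<n. \<Delta> j) = F v - F (v - real n * m)" for n
    by (induction n) (auto simp: \<Delta>_def)
  \<comment> \<open>the largest number of steps of size \<open>m\<close> that leaves a positive volume\<close>
  define n where "n = nat (\<lceil>v / m\<rceil> - 1)"
  have vm: "v / m \<ge> 2" using m by (simp add: le_divide_eq)
  have n_real: "real n = real_of_int \<lceil>v / m\<rceil> - 1"
  proof -
    have "0 \<le> \<lceil>v / m\<rceil> - 1" using vm by linarith
    hence "real_of_int (int n) = real_of_int (\<lceil>v / m\<rceil> - 1)" unfolding n_def by (simp only: nat_0_le)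
    thus ?thesis by simp
  qed
  have n1: "real n * m < v"
  proof -
    have "real n < v / m" unfolding n_real by linarith
    thus ?thesis using m by (simp add: pos_less_divide_eq)
  qed
  have n2: "v / (2 * m) \<le> real n"
  proof -
    have "v / m - 1 \<le> real n" unfolding n_real by linarith
    moreover have "v / (2 * m) = v / m / 2" by simp
    ultimately show ?thesis using vm by linarith
  qed
  have "real n * \<Delta> 0 = (\<Sum>j<n. \<Delta> 0)" by simp
  also have "\<dots> \<le> (\<Sum>j<n. \<Delta> j)"
  proof (rule sum_mono)
    fix j assume "j \<in> {..<n}"
    hence "real (Suc j) * m \<le> real n * m" using m by (intro mult_right_mono) auto
    thus "\<Delta> 0 \<le> \<Delta> j" using n1 by (intro mono) simp
  qed
  also have "\<dots> \<le> c0" unfolding tele using F0[of "real n * m"] n1 m by (simp add: Fv)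
  finally have nD: "real n * \<Delta> 0 \<le> c0" .
  have "\<Delta> 0 \<le> 2 * m * c0 / v"
  proof (cases "\<Delta> 0 \<le> 0")
    case True
    have "0 \<le> 2 * m * c0 / v" using nn[OF c0] m by (intro divide_nonneg_nonneg mult_nonneg_nonneg) auto
    thus ?thesis using True by linarith
  next
    case False
    have "v / (2 * m) * \<Delta> 0 \<le> real n * \<Delta> 0" using n2 False by (intro mult_right_mono) auto
    hence "v / (2 * m) * \<Delta> 0 \<le> c0" using nD by linarith
    thus ?thesis using m by (simp add: field_simps)
  qed
  thus ?thesis using F_le[OF a] by (simp add: \<Delta>_def Fv)
qed

end

section \<open>Mean slopes and superlinear decay\<close>

text \<open>
  In each bisection one of the two halves has mean slope at most \<open>\<sigma>\<close>. For a
  monotone \<open>m\<close> the limit point would be a point where the derivative, if it exists, is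
  at most \<open>\<sigma>\<close>; the statement with shrinking intervals serves the same purpose
  without differentiability almost everywhere.
\<close>

lemma slope_bisection:
  fixes m :: "real \<Rightarrow> real"
  assumes "a < b"
  defines "\<sigma> \<equiv> (m b - m a) / (b - a)"
  obtains s f g where "a \<le> s" "s \<le> b" "\<And>n. a \<le> f n" "\<And>n. g n \<le> b" "\<And>n. f n < g n" "\<And>n. f n \<le> s" "\<And>n. s \<le> g n"
    "(\<lambda>n. g n - f n) \<longlonglongrightarrow> 0" "\<And>n. m (g n) - m (f n) \<le> \<sigma> * (g n - f n)"
proof -
  define good where "good p \<longleftrightarrow> a \<le> fst p \<and> snd p \<le> b \<and> fst p < snd p \<and> m (snd p) - m (fst p) \<le> \<sigma> * (snd p - fst p)" for p :: "real \<times> real"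
  have init: "good (a, b)" using assms by (simp add: good_def \<sigma>_def)
  have step: "\<exists>q. good q \<and> fst p \<le> fst q \<and> snd q \<le> snd p \<and> snd q - fst q = (snd p - fst p) / 2" if p: "good p" for p
  proof -
    define c where "c = (fst p + snd p) / 2"
    have c: "fst p < c" "c < snd p" "c - fst p = (snd p - fst p) / 2" "snd p - c = (snd p - fst p) / 2"
      using p by (auto simp: good_def c_def field_simps)
    have "\<sigma> * (snd p - fst p) = \<sigma> * (c - fst p) + \<sigma> * (snd p - c)" by (simp add: algebra_simps)
    hence "m c - m (fst p) \<le> \<sigma> * (c - fst p) \<or> m (snd p) - m c \<le> \<sigma> * (snd p - c)"
      using p unfolding good_def by linarith
    thus ?thesis
    proof
      assume "m c - m (fst p) \<le> \<sigma> * (c - fst p)"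
      hence "good (fst p, c)" using p c(1,2) by (simp add: good_def)
      thus ?thesis using c by (intro exI[of _ "(fst p, c)"]) simp
    next
      assume "m (snd p) - m c \<le> \<sigma> * (snd p - c)"
      hence "good (c, snd p)" using p c(1,2) by (simp add: good_def)
      thus ?thesis using c by (intro exI[of _ "(c, snd p)"]) simp
    qed
  qed
  obtain P where P0: "P 0 = (a, b)" and P: "\<And>n. good (P n)"
    "\<And>n. fst (P n) \<le> fst (P (Suc n)) \<and> snd (P (Suc n)) \<le> snd (P n) \<and> snd (P (Suc n)) - fst (P (Suc n)) = (snd (P n) - fst (P n)) / 2"
  proof -
    obtain P where "P 0 = (a, b) \<and> (\<forall>n. good (P n) \<and> (fst (P n) \<le> fst (P (Suc n)) \<and> snd (P (Suc n)) \<le> snd (P n) \<and> snd (P (Suc n)) - fst (P (Suc n)) = (snd (P n) - fst (P n)) / 2))"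
    proof -
      define nx where "nx p = (SOME q. good q \<and> fst p \<le> fst q \<and> snd q \<le> snd p \<and> snd q - fst q = (snd p - fst p) / 2)" for p
      have nx: "good (nx p) \<and> fst p \<le> fst (nx p) \<and> snd (nx p) \<le> snd p \<and> snd (nx p) - fst (nx p) = (snd p - fst p) / 2" if "good p" for p
        unfolding nx_def using someI_ex[OF step[OF that]] .
      define P where "P n = (nx ^^ n) (a, b)" for n
      have g: "good (P n)" for n by (induction n) (auto simp: P_def init nx)
      show ?thesis
        by (rule that[of P]) (use g nx[OF g] in \<open>auto simp: P_def\<close>)
    qed
    thus ?thesis using that by blast
  qed
  have len: "snd (P n) - fst (P n) = (b - a) * (1/2) ^ n" for n
    by (induction n) (use P(2) P0 in auto)
  have lim: "(\<lambda>n. snd (P n) - fst (P n)) \<longlonglongrightarrow> 0"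
    unfolding len by (intro tendsto_mult_right_zero LIMSEQ_realpow_zero) auto
  have lim': "(\<lambda>n. fst (P n) - snd (P n)) \<longlonglongrightarrow> 0" using tendsto_minus[OF lim] by simp
  obtain s where s: "\<And>n. fst (P n) \<le> s" "\<And>n. s \<le> snd (P n)"
    using nested_sequence_unique[of "\<lambda>n. fst (P n)" "\<lambda>n. snd (P n)"] P lim' by (auto simp: good_def less_imp_le)
  show ?thesis
  proof (rule that[of s "\<lambda>n. fst (P n)" "\<lambda>n. snd (P n)"])
    show "a \<le> s" "s \<le> b" using s[of 0] P0 by auto
  qed (use P(1) s lim in \<open>auto simp: good_def\<close>)
qed

text \<open>
  The recursion preserves \<open>m k \<le> \<epsilon> q\<^sup>k\<close> when \<open>q\<^sup>e = 1 /
  2\<close> cancels the factor \<open>2\<^sup>k\<close> and \<open>\<epsilon>\<close> is such that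
  \<open>Q \<epsilon>\<^sup>e = q\<close>.
\<close>

lemma de_giorgi_iteration:
  fixes Q e :: real
  assumes Q: "Q > 0" and e: "e > 0"
  obtains \<epsilon> where "\<epsilon> > 0" "\<And>m. (\<And>k. 0 \<le> m k) \<Longrightarrow> m 0 \<le> \<epsilon> \<Longrightarrow>
     (\<And>k::nat. m k \<le> \<epsilon> \<Longrightarrow> m (Suc k) \<le> Q * 2 ^ k * m k powr (1 + e)) \<Longrightarrow> m \<longlonglongrightarrow> 0"
proof -
  define q where "q = (1/2) powr (1 / e)"
  have q: "0 < q" "q < 1" using powr_less_mono2[of "1 / e" "1 / 2" 1] e by (auto simp: q_def)
  have qe: "q powr e = 1/2" using e by (simp add: q_def powr_powr)
  define \<epsilon> where "\<epsilon> = (q / Q) powr (1 / e)"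
  have \<epsilon>: "\<epsilon> > 0" using q Q by (simp add: \<epsilon>_def)
  have \<epsilon>e: "Q * \<epsilon> powr e = q" using q Q e by (simp add: \<epsilon>_def powr_powr)
  show ?thesis
  proof (rule that[OF \<epsilon>])
    fix m :: "nat \<Rightarrow> real"
    assume nn: "\<And>k. 0 \<le> m k" and m0: "m 0 \<le> \<epsilon>"
      and step: "\<And>k::nat. m k \<le> \<epsilon> \<Longrightarrow> m (Suc k) \<le> Q * 2 ^ k * m k powr (1 + e)"
    have bound: "m k \<le> \<epsilon> * q ^ k" for k
    proof (induction k)
      case (Suc k)
      have "\<epsilon> * q ^ k \<le> \<epsilon> * 1" using \<epsilon> q by (intro mult_left_mono power_le_one) auto
      hence "m k \<le> \<epsilon>" using Suc.IH by simp
      hence "m (Suc k) \<le> Q * 2 ^ k * m k powr (1 + e)" by (rule step)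
      also have "\<dots> \<le> Q * 2 ^ k * (\<epsilon> * q ^ k) powr (1 + e)"
        using Suc.IH nn Q e by (intro mult_left_mono powr_mono2) auto
      also have "(\<epsilon> * q ^ k) powr (1 + e) = (\<epsilon> * q ^ k) * (\<epsilon> powr e * (q ^ k) powr e)"
        using \<epsilon> q by (simp add: powr_add powr_mult)
      also have "(q ^ k) powr e = (1/2) ^ k"
      proof -
        have "(q ^ k) powr e = (q powr e) powr real k" using q by (simp add: powr_realpow[symmetric] powr_powr mult.commute)
        thus ?thesis by (simp add: qe powr_realpow)
      qed
      also have "Q * 2 ^ k * (\<epsilon> * q ^ k * (\<epsilon> powr e * (1/2) ^ k)) = (Q * \<epsilon> powr e) * (\<epsilon> * q ^ k) * (2 ^ k * (1/2) ^ k)"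
        by (simp only: mult_ac)
      also have "\<dots> = \<epsilon> * q ^ Suc k" unfolding \<epsilon>e power_mult_distrib[symmetric] by simp
      finally show ?case .
    qed (use m0 in simp)
    have "(\<lambda>k. \<epsilon> * q ^ k) \<longlonglongrightarrow> 0" using q by (intro tendsto_mult_right_zero LIMSEQ_realpow_zero) auto
    thus "m \<longlonglongrightarrow> 0"
      by (rule tendsto_sandwich[OF always_eventually always_eventually tendsto_const, rotated 2]) (use nn bound in auto)
  qed
qed

lemma ramp'_support: obtains M where "M > 0" "\<And>s. \<bar>ramp' s\<bar> \<le> M * indicator {0<..1} s"
proof -
  obtain M where M: "M > 0" "\<And>s. \<bar>ramp' s\<bar> \<le> M * indicator {0..1} s" using ramp'_bound by blast
  have 0: "ramp' 0 = 0" by (simp add: ramp'_def square_plus_def)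
  have "\<bar>ramp' s\<bar> \<le> M * indicator {0<..1} s" for s
    using M(2)[of s] 0 by (cases "s = 0") (auto simp: indicator_def split: if_splits)
  thus ?thesis using that M(1) by blast
qed

context sub_finsler_nilpotent_group
begin

section \<open>Cutting by balls\<close>

text \<open>
  The left translate to \<open>x\<close> of the closed Euclidean ball of radius \<open>sqrt
  s\<close>. Parametrizing by the square of the radius keeps the defining function differentiable,
  and left translation makes all constants independent of \<open>x\<close>.
\<close>

definition gball :: "(real, 'n) vec \<Rightarrow> real \<Rightarrow> (real, 'n) vec set" where
  "gball x s = {p. (- x \<odot> p) \<bullet> (- x \<odot> p) \<le> s}"

lemma gball_measurable [measurable]: "gball x s \<in> sets borel"
proof -
  have "closed (gball x s)" unfolding gball_def
    by (intro closed_Collect_le continuous_on_inner continuous_on_gmul continuous_intros)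
  thus ?thesis by (rule borel_closed)
qed

lemma gball_mono: "s \<le> t \<Longrightarrow> gball x s \<subseteq> gball x t"
  by (auto simp: gball_def)

text \<open>
  A cutoff between two concentric balls. Its left-invariant derivatives at \<open>p\<close> are
  those at \<open>- x \<odot> p\<close> of a cutoff between balls at the origin, so they are bounded
  uniformly in \<open>x\<close>.
\<close>

lemma ball_cut_function:
  obtains D where "D > 0" "\<And>x a b. 0 \<le> a \<Longrightarrow> a < b \<Longrightarrow> b \<le> 1 \<Longrightarrow>
     \<exists>\<eta>. Ck 1 \<eta> \<and> (\<forall>p. 0 \<le> \<eta> p \<and> \<eta> p \<le> 1) \<and> (\<forall>p\<in>gball x a. \<eta> p = 1) \<and> (\<forall>p. p \<notin> gball x b \<longrightarrow> \<eta> p = 0) \<and>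
       (\<forall>p. \<forall>v\<in>K. \<forall>w\<in>K. \<bar>FD \<eta> p (LD p 0 (v - w))\<bar> \<le> D / (b - a) * indicator (gball x b - gball x a) p)"
proof -
  obtain M where M: "M > 0" "\<And>s. \<bar>ramp' s\<bar> \<le> M * indicator {0<..1} s" using ramp'_support by blast
  obtain R where R: "\<And>v. v \<in> K \<Longrightarrow> norm v \<le> R" using compact_imp_bounded[OF K_body(2)] by (auto simp: bounded_iff)
  have R0: "R \<ge> 0" using R[OF zero_in_K] by simp
  obtain C where C: "C > 0" "\<And>y w. y \<in> cball 0 1 \<Longrightarrow> norm (LD y 0 w) \<le> C * norm w"
  proof (rule linear_family_bounded[of "cball 0 1" "\<lambda>y. LD y 0"])
    show "continuous_on (cball 0 1) (\<lambda>y. LD y 0 b)" for b by (intro continuous_on_LD continuous_intros)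
  qed (auto intro: linear_LD)
  \<comment> \<open>\<open>R\<close> bounds \<open>K\<close>, so \<open>2 R + 1\<close> bounds differences of its elements; \<open>2\<close> comes from the squared norm\<close>
  define D where "D = M * (2 * (C * (2 * R + 1)))"
  have D: "D > 0" using M C R0 by (simp add: D_def)
  show ?thesis
  proof (rule that[OF D])
    fix x a b assume ab: "0 \<le> a" "a < b" "b \<le> (1::real)"
    define \<psi> where "\<psi> p = ((- x \<odot> p) \<bullet> (- x \<odot> p) - a) * (1 / (b - a))" for p
    have C\<psi>: "Ck 1 \<psi>" unfolding \<psi>_def
      by (intro Ck_1_mult Ck_1_diff Ck_1_const Ck_1_compose[OF Ck_1_norm_square] Ck_1_gmul Ck_1_id)
    define \<eta> where "\<eta> p = ramp (\<psi> p)" for p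
    have C\<eta>: "Ck 1 \<eta>" unfolding \<eta>_def by (rule Ck_1_compose[OF Ck_1_ramp C\<psi>])
    have FD\<psi>: "FD \<psi> p (LD p 0 w) = 2 * ((- x \<odot> p) \<bullet> LD (- x \<odot> p) 0 w) * (1 / (b - a))" for p w
    proof -
      have "((\<lambda>p. (- x \<odot> p) \<bullet> (- x \<odot> p) - a) has_derivative (\<lambda>w. (- x \<odot> p) \<bullet> LD (- x) p w + LD (- x) p w \<bullet> (- x \<odot> p) - 0)) (at p)"
        by (intro has_derivative_diff has_derivative_inner has_derivative_gmul_left has_derivative_const)
      from FD_eq[OF has_derivative_mult_left[OF this, of "1 / (b - a)"]]
      have "FD \<psi> p = (\<lambda>w. ((- x \<odot> p) \<bullet> LD (- x) p w + LD (- x) p w \<bullet> (- x \<odot> p) - 0) * (1 / (b - a)))"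
        unfolding \<psi>_def[abs_def] by simp
      thus ?thesis using LD_LD[of "- x" p 0 w] by (simp add: inner_commute)
    qed
    have FD\<eta>: "FD \<eta> p v = FD \<psi> p v * ramp' (\<psi> p)" for p v
    proof -
      have "((\<lambda>p. ramp (\<psi> p)) has_derivative (\<lambda>v. ramp' (\<psi> p) * FD \<psi> p v)) (at p)"
        by (rule has_derivative_compose[OF Ck_1_deriv[OF C\<psi>]]) (rule ramp_deriv[unfolded has_field_derivative_def])
      from fun_cong[OF FD_eq[OF this], of v] show ?thesis by (simp add: \<eta>_def[abs_def] mult.commute)
    qed
    have le0: "\<psi> p \<le> 0 \<longleftrightarrow> p \<in> gball x a" for p using ab by (simp add: \<psi>_def gball_def divide_le_eq)
    have le1: "\<psi> p \<le> 1 \<longleftrightarrow> p \<in> gball x b" for p using ab by (simp add: \<psi>_def gball_def divide_le_eq)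
    have der: "\<bar>FD \<eta> p (LD p 0 (v - w))\<bar> \<le> D / (b - a) * indicator (gball x b - gball x a) p"
      if vw: "v \<in> K" "w \<in> K" for p v w
    proof (cases "p \<in> gball x b - gball x a")
      case True
      define y where "y = - x \<odot> p"
      have "y \<bullet> y \<le> 1" using True ab by (simp add: gball_def y_def)
      hence y1: "norm y \<le> 1" by (simp add: norm_eq_sqrt_inner)
      have "norm (v - w) \<le> 2 * R + 1" using norm_triangle_ineq4[of v w] R[OF vw(1)] R[OF vw(2)] by simp
      hence "C * norm (v - w) \<le> C * (2 * R + 1)" using C(1) by (intro mult_left_mono) auto
      hence "norm (LD y 0 (v - w)) \<le> C * (2 * R + 1)" using C(2)[of y "v - w"] y1 by simp
      moreover have "\<bar>y \<bullet> LD y 0 (v - w)\<bar> \<le> 1 * norm (LD y 0 (v - w))"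
        using Cauchy_Schwarz_ineq2[of y "LD y 0 (v - w)"] mult_right_mono[OF y1, of "norm (LD y 0 (v - w))"] by simp
      ultimately have y2: "\<bar>y \<bullet> LD y 0 (v - w)\<bar> \<le> C * (2 * R + 1)" by simp
      have "\<bar>ramp' (\<psi> p)\<bar> \<le> M"
        by (rule order_trans[OF M(2)]) (use M(1) in \<open>simp add: indicator_def\<close>)
      hence "\<bar>ramp' (\<psi> p)\<bar> * (2 * \<bar>y \<bullet> LD y 0 (v - w)\<bar>) \<le> M * (2 * (C * (2 * R + 1)))"
        using y2 M(1) by (intro mult_mono) auto
      hence "(\<bar>ramp' (\<psi> p)\<bar> * (2 * \<bar>y \<bullet> LD y 0 (v - w)\<bar>)) / (b - a) \<le> D / (b - a)"
        using ab by (intro divide_right_mono) (auto simp: D_def)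
      thus ?thesis using True ab by (simp add: FD\<eta> FD\<psi> y_def[symmetric] abs_mult mult_ac)
    next
      case False
      hence "\<psi> p \<notin> {0<..1}" using le0[of p] le1[of p] by auto
      hence "ramp' (\<psi> p) = 0" using M(2)[of "\<psi> p"] by simp
      thus ?thesis using False by (simp add: FD\<eta>)
    qed
    show "\<exists>\<eta>. Ck 1 \<eta> \<and> (\<forall>p. 0 \<le> \<eta> p \<and> \<eta> p \<le> 1) \<and> (\<forall>p\<in>gball x a. \<eta> p = 1) \<and> (\<forall>p. p \<notin> gball x b \<longrightarrow> \<eta> p = 0) \<and>
       (\<forall>p. \<forall>v\<in>K. \<forall>w\<in>K. \<bar>FD \<eta> p (LD p 0 (v - w))\<bar> \<le> D / (b - a) * indicator (gball x b - gball x a) p)"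
    proof (rule exI[of _ \<eta>], intro conjI allI ballI impI)
      show "\<eta> p = 1" if "p \<in> gball x a" for p using that le0[of p] by (simp add: \<eta>_def ramp_eq_1)
      show "\<eta> p = 0" if "p \<notin> gball x b" for p using that le1[of p] by (simp add: \<eta>_def ramp_eq_0)
    qed (use C\<eta> der in \<open>auto simp: \<eta>_def ramp_bounds simp del: One_nat_def\<close>)
  qed
qed

text \<open>
  On an interval of radii with small mean slope of \<open>s \<mapsto> \<bar>B \<inter> gball x
  s\<bar>\<close> a cutoff function splits the perimeter at the cost of \<open>D\<close> times this
  slope. Shrinking the interval around \<open>s\<close> turns the cutoff into the indicator of a
  ball.
\<close>

lemma cut_by_ball:
  obtains D where "D > 0" "\<And>B c x a b. B \<in> sets borel \<Longrightarrow> emeasure lborel B < \<infinity> \<Longrightarrow> perim_le B c \<Longrightarrow> 0 \<le> a \<Longrightarrow> a < b \<Longrightarrow> b \<le> 1 \<Longrightarrow>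
     \<exists>s\<in>{a..b}. \<exists>c1 c2. perim_le (B \<inter> gball x s) c1 \<and> perim_le (B - gball x s) c2 \<and>
       c1 + c2 \<le> c + D * ((measure lborel (B \<inter> gball x b) - measure lborel (B \<inter> gball x a)) / (b - a))"
proof -
  obtain D where D: "D > 0" and cutf: "\<And>x a b. 0 \<le> a \<Longrightarrow> a < b \<Longrightarrow> b \<le> 1 \<Longrightarrow>
     \<exists>\<eta>. Ck 1 \<eta> \<and> (\<forall>p. 0 \<le> \<eta> p \<and> \<eta> p \<le> 1) \<and> (\<forall>p\<in>gball x a. \<eta> p = 1) \<and> (\<forall>p. p \<notin> gball x b \<longrightarrow> \<eta> p = 0) \<and>
       (\<forall>p. \<forall>v\<in>K. \<forall>w\<in>K. \<bar>FD \<eta> p (LD p 0 (v - w))\<bar> \<le> D / (b - a) * indicator (gball x b - gball x a) p)"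
    using ball_cut_function by blast
  show ?thesis
  proof (rule that[OF D])
    fix B c x a b
    assume B: "B \<in> sets borel" "emeasure lborel B < \<infinity>" "perim_le B c" and ab: "0 \<le> a" "a < b" "b \<le> (1::real)"
    have [measurable]: "B \<in> sets borel" by (rule B)
    define m where "m s = measure lborel (B \<inter> gball x s)" for s
    have fm: "B \<inter> A \<in> fmeasurable lborel" if "A \<in> sets borel" for A
      using emeasure_mono[of "B \<inter> A" B lborel] B that by (intro fmeasurableI) (auto intro: le_less_trans)
    have m_diff: "measure lborel (B \<inter> (gball x t - gball x s)) = m t - m s" if "s \<le> t" for s t
    proof -
      have "B \<inter> gball x t - B \<inter> gball x s = B \<inter> (gball x t - gball x s)" by auto
      thus ?thesis using measurable_measure_Diff[of "B \<inter> gball x t" lborel "B \<inter> gball x s"] fm gball_mono[OF that, of x]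
        by (auto simp: m_def fmeasurableD)
    qed
    define \<sigma> where "\<sigma> = (m b - m a) / (b - a)"
    obtain s lo hi where s: "a \<le> s" "s \<le> b" "\<And>n. a \<le> lo n" "\<And>n. hi n \<le> b" "\<And>n. lo n < hi n" "\<And>n. lo n \<le> s" "\<And>n. s \<le> hi n"
      "(\<lambda>n. hi n - lo n) \<longlonglongrightarrow> 0" "\<And>n. m (hi n) - m (lo n) \<le> (m b - m a) / (b - a) * (hi n - lo n)"
      by (rule slope_bisection[OF ab(2), of m]) (rule that; assumption)
    have main: "pair (indicator (B \<inter> gball x s)) u + pair (indicator (B - gball x s)) w \<le> c + D * \<sigma>"
      if u: "u \<in> T" and w: "w \<in> T" for u w
    proof -
      obtain A S where A: "A > 0" "\<And>x. \<bar>hdiv u x\<bar> \<le> A * indicator (cball 0 S) x"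
        using continuous_bounded_support[OF continuous_hdiv[OF T_D(1)[OF u]] bounded_support_hdiv[OF T_D(2)[OF u]]] by blast
      obtain A' S' where A': "A' > 0" "\<And>x. \<bar>hdiv w x\<bar> \<le> A' * indicator (cball 0 S') x"
        using continuous_bounded_support[OF continuous_hdiv[OF T_D(1)[OF w]] bounded_support_hdiv[OF T_D(2)[OF w]]] by blast
      \<comment> \<open>collects the errors of both cuts, which are linear in the length of the interval\<close>
      define Q where "Q = (A * \<sigma> + A * measure lborel (cball 0 S :: (real, 'n) vec set))
         + (A' * \<sigma> + A' * measure lborel (cball 0 S' :: (real, 'n) vec set))"
      have est: "pair (indicator (B \<inter> gball x s)) u + pair (indicator (B - gball x s)) w \<le> c + D * \<sigma> + Q * (hi n - lo n)" for n
      proof -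
        define \<delta> where "\<delta> = hi n - lo n"
        have \<delta>: "\<delta> > 0" using s(5) by (simp add: \<delta>_def)
        obtain \<eta> where \<eta>: "Ck 1 \<eta>" "\<And>p. 0 \<le> \<eta> p" "\<And>p. \<eta> p \<le> 1" "\<And>p. p \<in> gball x (lo n) \<Longrightarrow> \<eta> p = 1"
          "\<And>p. p \<notin> gball x (hi n) \<Longrightarrow> \<eta> p = 0"
          "\<And>p v w. v \<in> K \<Longrightarrow> w \<in> K \<Longrightarrow> \<bar>FD \<eta> p (LD p 0 (v - w))\<bar> \<le> D / \<delta> * indicator (gball x (hi n) - gball x (lo n)) p"
        proof -
          have "0 \<le> lo n" "lo n < hi n" "hi n \<le> 1" using s(3)[of n] s(4)[of n] s(5)[of n] ab by auto
          from cutf[OF this, of x] show ?thesis using that unfolding \<delta>_def by blast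
        qed
        have [measurable]: "\<eta> \<in> borel_measurable borel" by (rule Ck_1_measurable[OF \<eta>(1)])
        define d where "d = (indicator (B \<inter> (gball x (hi n) - gball x (lo n))) :: _ \<Rightarrow> real)"
        have dint: "integrable lborel d" "\<And>p. d p \<ge> 0" "(\<integral>p. d p \<partial>lborel) = m (hi n) - m (lo n)"
        proof -
          have "B \<inter> (gball x (hi n) - gball x (lo n)) \<in> fmeasurable lborel" by (intro fm) measurable
          thus "integrable lborel d" unfolding d_def by (intro integrable_real_indicator) (auto simp: fmeasurable_def)
          show "(\<integral>p. d p \<partial>lborel) = m (hi n) - m (lo n)"
            unfolding d_def using m_diff[of "lo n" "hi n"] s(5)[of n] by simp
        qed (simp add: d_def)
        have le\<sigma>: "m (hi n) - m (lo n) \<le> \<sigma> * \<delta>" using s(9) by (simp add: \<delta>_def \<sigma>_def)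
        have gf: "gball x (lo n) \<subseteq> gball x s" "gball x s \<subseteq> gball x (hi n)"
          by (rule gball_mono, rule s)+
        have c1: "\<bar>pair (\<lambda>p. indicator B p * \<eta> p) u - pair (indicator (B \<inter> gball x s)) u\<bar>
            \<le> A * (\<sigma> * \<delta>) + \<delta> * A * measure lborel (cball 0 S :: (real, 'n) vec set)"
        proof (rule pair_close[OF _ _ _ _ u A(2,1) \<delta> _ dint(1,2)])
          show "\<bar>indicator B p * \<eta> p - indicator (B \<inter> gball x s) p\<bar> \<le> d p + \<delta>" for p
          proof -
            have "\<bar>indicator B p * \<eta> p - indicator (B \<inter> gball x s) p\<bar> \<le> d p"
              using \<eta>(2-5)[of p] gf by (auto simp: d_def indicator_def)
            thus ?thesis using \<delta> by simp
          qed
          show "\<bar>indicator B p * \<eta> p\<bar> \<le> 1 + \<delta>" for p using \<eta>(2,3)[of p] \<delta> by (auto simp: indicator_def)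
          show "(\<integral>p. d p \<partial>lborel) \<le> \<sigma> * \<delta>" using le\<sigma> dint(3) by simp
        qed (auto simp: indicator_def)
        have c2: "\<bar>pair (\<lambda>p. indicator B p * (1 - \<eta> p)) w - pair (indicator (B - gball x s)) w\<bar>
            \<le> A' * (\<sigma> * \<delta>) + \<delta> * A' * measure lborel (cball 0 S' :: (real, 'n) vec set)"
        proof (rule pair_close[OF _ _ _ _ w A'(2,1) \<delta> _ dint(1,2)])
          show "\<bar>indicator B p * (1 - \<eta> p) - indicator (B - gball x s) p\<bar> \<le> d p + \<delta>" for p
          proof -
            have "\<bar>indicator B p * (1 - \<eta> p) - indicator (B - gball x s) p\<bar> \<le> d p"
              using \<eta>(2-5)[of p] gf by (auto simp: d_def indicator_def)
            thus ?thesis using \<delta> by simp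
          qed
          show "\<bar>indicator B p * (1 - \<eta> p)\<bar> \<le> 1 + \<delta>" for p using \<eta>(2,3)[of p] \<delta> by (auto simp: indicator_def)
          show "(\<integral>p. d p \<partial>lborel) \<le> \<sigma> * \<delta>" using le\<sigma> dint(3) by simp
        qed (auto simp: indicator_def)
        have c3: "- (\<integral>p. indicator B p * FD \<eta> p (LD p 0 (u p - w p)) \<partial>lborel) \<le> D * \<sigma>"
        proof -
          have "\<bar>indicator B p * FD \<eta> p (LD p 0 (u p - w p))\<bar> \<le> (D / \<delta>) * d p" for p
            using \<eta>(6)[OF T_D(3)[OF u] T_D(3)[OF w], of p p p] by (auto simp: d_def indicator_def split: if_splits)
          hence pt: "- (indicator B p * FD \<eta> p (LD p 0 (u p - w p))) \<le> (D / \<delta>) * d p" for p by (simp add: abs_le_iff)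
          have "(\<integral>p. - (indicator B p * FD \<eta> p (LD p 0 (u p - w p))) \<partial>lborel) \<le> (\<integral>p. (D / \<delta>) * d p \<partial>lborel)"
            by (rule integral_mono') (use pt dint D \<delta> in auto)
          also have "\<dots> = (D / \<delta>) * (m (hi n) - m (lo n))" using dint(3) by simp
          also have "\<dots> \<le> (D / \<delta>) * (\<sigma> * \<delta>)" using le\<sigma> D \<delta> by (intro mult_left_mono) auto
          also have "\<dots> = D * \<sigma>" using \<delta> by simp
          finally show ?thesis by simp
        qed
        have "pair (\<lambda>p. indicator B p * \<eta> p) u + pair (\<lambda>p. indicator B p * (1 - \<eta> p)) w \<le> c + D * \<sigma>"
          using pair_cut[OF B(1,3) u w \<eta>(1-3)] c3 by linarith
        moreover have "Q * (hi n - lo n) = (A * (\<sigma> * \<delta>) + \<delta> * A * measure lborel (cball 0 S :: (real, 'n) vec set))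
          + (A' * (\<sigma> * \<delta>) + \<delta> * A' * measure lborel (cball 0 S' :: (real, 'n) vec set))"
          by (simp add: Q_def \<delta>_def algebra_simps)
        ultimately show ?thesis using c1 c2 by linarith
      qed
      have "(\<lambda>n. c + D * \<sigma> + Q * (hi n - lo n)) \<longlonglongrightarrow> c + D * \<sigma> + Q * 0" by (intro tendsto_intros s(8))
      hence "pair (indicator (B \<inter> gball x s)) u + pair (indicator (B - gball x s)) w \<le> c + D * \<sigma> + Q * 0"
        by (rule LIMSEQ_le_const) (use est in blast)
      thus ?thesis by simp
    qed
    obtain c1 c2 where "perim_le (B \<inter> gball x s) c1" "perim_le (B - gball x s) c2" "c1 + c2 \<le> c + D * \<sigma>"
      using pair_bdd_split[OF main] by blast
    thus "\<exists>s\<in>{a..b}. \<exists>c1 c2. perim_le (B \<inter> gball x s) c1 \<and> perim_le (B - gball x s) c2 \<and>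
       c1 + c2 \<le> c + D * ((measure lborel (B \<inter> gball x b) - measure lborel (B \<inter> gball x a)) / (b - a))"
      using s(1,2) unfolding \<sigma>_def m_def by (intro bexI[of _ s]) auto
  qed
qed

section \<open>Density of isoperimetric sets\<close>

text \<open>
  Along the radii \<open>(1 + 2\<^sup>-\<^sup>k) / 2\<close> let \<open>m k\<close> be the volume of
  \<open>B\<close> in the corresponding ball. A cut at a parameter between two consecutive ones
  produces an inner piece of volume \<open>\<mu>\<close> and perimeter \<open>c1\<close>, and an
  outer piece that competes with \<open>B\<close> up to the volume \<open>\<mu>\<close>. Minimality
  together with \<open>profile_increment\<close> gives \<open>c1 \<le> 4 D 2\<^sup>k m k + 2 \<mu>
  c0 / v\<close>. In the isoperimetric inequality for the inner piece the second term is absorbed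
  when \<open>\<mu>\<close> is small, leaving \<open>m (k + 1) \<le> Q 2\<^sup>k (m
  k)\<^sup>1\<^sup>+\<^sup>e\<close>.
\<close>

lemma density_estimate:
  assumes B: "B \<in> sets borel" "emeasure lborel B = ennreal v" "perim_le B c0" and v: "v > 0"
    and min: "\<And>c. admissible v c \<Longrightarrow> c0 \<le> c"
  obtains \<epsilon> where "\<epsilon> > 0" "\<And>x. measure lborel (B \<inter> gball x 1) \<le> \<epsilon> \<Longrightarrow> measure lborel (B \<inter> gball x (1/2)) = 0"
proof -
  have [measurable]: "B \<in> sets borel" by (rule B)
  have fin: "emeasure lborel B < \<infinity>" using B by simp
  have adm: "admissible v c0" unfolding admissible_def using B by blast
  have c0: "c0 \<ge> 0" by (rule perim_le_nonneg[OF B(3)])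
  obtain C e b0 where C: "C > 0" and e: "e > 0" and b0: "b0 > 0" and iso:
    "\<And>B c. B \<in> sets borel \<Longrightarrow> emeasure lborel B < \<infinity> \<Longrightarrow> perim_le B c \<Longrightarrow> measure lborel B \<le> b0 \<Longrightarrow>
       measure lborel B \<le> C * c * measure lborel B powr e" using isoperimetric_inequality by blast
  obtain D where D: "D > 0" and cut: "\<And>x a b. 0 \<le> a \<Longrightarrow> a < b \<Longrightarrow> b \<le> 1 \<Longrightarrow>
     \<exists>s\<in>{a..b}. \<exists>c1 c2. perim_le (B \<inter> gball x s) c1 \<and> perim_le (B - gball x s) c2 \<and>
       c1 + c2 \<le> c0 + D * ((measure lborel (B \<inter> gball x b) - measure lborel (B \<inter> gball x a)) / (b - a))"
    using cut_by_ball B(1,3) fin by (metis (no_types, lifting))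
  define Q where "Q = 8 * C * D"
  have Q: "Q > 0" using C D by (simp add: Q_def)
  obtain \<epsilon>1 where \<epsilon>1: "\<epsilon>1 > 0" "\<And>m. (\<And>k. 0 \<le> m k) \<Longrightarrow> m 0 \<le> \<epsilon>1 \<Longrightarrow>
     (\<And>k::nat. m k \<le> \<epsilon>1 \<Longrightarrow> m (Suc k) \<le> Q * 2 ^ k * m k powr (1 + e)) \<Longrightarrow> m \<longlonglongrightarrow> 0"
    using de_giorgi_iteration[OF Q e] by blast
  \<comment> \<open>below this volume the term \<open>2 \<mu> c0 / v\<close> accounts for at most half of \<open>\<mu>\<close>; the summand \<open>1\<close> covers \<open>c0 = 0\<close>\<close>
  define \<mu>1 where "\<mu>1 = (v / (4 * C * (c0 + 1))) powr (1 / e)"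
  have \<mu>1: "\<mu>1 > 0" using v C c0 by (simp add: \<mu>1_def)
  have \<mu>1e: "C * (2 * c0 / v) * \<mu>1 powr e \<le> 1/2"
  proof -
    have "\<mu>1 powr e = v / (4 * C * (c0 + 1))" using v C c0 e by (simp add: \<mu>1_def powr_powr)
    moreover have "c0 + 1 \<noteq> 0" using c0 by simp
    ultimately have "C * (2 * c0 / v) * \<mu>1 powr e = c0 / (2 * (c0 + 1))"
      using v C by (simp add: divide_simps) (simp add: algebra_simps)
    also have "\<dots> \<le> 1/2" using c0 by (simp add: field_simps)
    finally show ?thesis .
  qed
  define \<epsilon> where "\<epsilon> = min (min \<epsilon>1 b0) (min \<mu>1 (v / 2))"
  have \<epsilon>: "\<epsilon> > 0" "\<epsilon> \<le> \<epsilon>1" "\<epsilon> \<le> b0" "\<epsilon> \<le> \<mu>1" "\<epsilon> \<le> v / 2" using \<epsilon>1 b0 \<mu>1 v by (auto simp: \<epsilon>_def)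
  show ?thesis
  proof (rule that[OF \<epsilon>(1)])
    fix x assume small: "measure lborel (B \<inter> gball x 1) \<le> \<epsilon>"
    have fm: "B \<inter> A \<in> fmeasurable lborel" if "A \<in> sets borel" for A
      using emeasure_mono[of "B \<inter> A" B lborel] B(1) fin that by (intro fmeasurableI) (auto intro: le_less_trans)
    define M where "M s = measure lborel (B \<inter> gball x s)" for s
    have M_mono: "M s \<le> M t" if "s \<le> t" for s t
      unfolding M_def using gball_mono[OF that, of x] fm[OF gball_measurable] by (intro measure_mono_fmeasurable) (auto simp: fmeasurableD)
    have M0: "M s \<ge> 0" for s by (simp add: M_def)
    define s :: "nat \<Rightarrow> real" where "s k = (1 + (1/2) ^ k) / 2" for k :: nat
    have s: "0 \<le> s (Suc k)" "s (Suc k) < s k" "s k \<le> 1" "s k - s (Suc k) = (1/2) ^ k / 4" for k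
      by (auto simp: s_def power_le_one field_simps add_pos_nonneg intro!: divide_nonneg_pos)
    define m where "m k = M (s k)" for k
    have m_le: "m k \<le> \<epsilon>" for k
      using M_mono[OF s(3)[of k]] small by (simp add: m_def M_def)
    have "m \<longlonglongrightarrow> 0"
    proof (rule \<epsilon>1(2))
      show "0 \<le> m k" for k by (simp add: m_def M0)
      show "m 0 \<le> \<epsilon>1" using m_le[of 0] \<epsilon>(2) by simp
      fix k
      obtain t c1 c2 where t: "s (Suc k) \<le> t" "t \<le> s k" and P1: "perim_le (B \<inter> gball x t) c1" and P2: "perim_le (B - gball x t) c2"
        and c12: "c1 + c2 \<le> c0 + D * ((m k - m (Suc k)) / (s k - s (Suc k)))"
        using cut[OF s(1)[of k] s(2)[of k] s(3)[of k], of x] by (auto simp: m_def M_def)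
      define \<mu> where "\<mu> = M t"
      have \<mu>: "m (Suc k) \<le> \<mu>" "\<mu> \<le> m k" "0 \<le> \<mu>" using M_mono t by (auto simp: \<mu>_def m_def M0)
      have \<mu>\<epsilon>: "\<mu> \<le> \<epsilon>" using \<mu>(2) m_le[of k] by simp
      show "m (Suc k) \<le> Q * 2 ^ k * m k powr (1 + e)"
      proof (cases "\<mu> = 0")
        case True
        thus ?thesis using \<mu>(1) Q by (simp add: order_trans[OF _ mult_nonneg_nonneg])
      next
        case False
        hence \<mu>0: "\<mu> > 0" using \<mu>(3) by simp
        have eO: "emeasure lborel (B - gball x t) = ennreal (v - \<mu>)"
        proof -
          have "emeasure lborel (B - B \<inter> gball x t) = emeasure lborel B - emeasure lborel (B \<inter> gball x t)"
            using fm[OF gball_measurable[of x t]] by (intro emeasure_Diff) (auto simp: fmeasurable_def less_top)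
          moreover have "emeasure lborel (B \<inter> gball x t) = ennreal \<mu>"
            unfolding \<mu>_def M_def using fm[OF gball_measurable[of x t]] by (rule emeasure_eq_measure2)
          moreover have "B - B \<inter> gball x t = B - gball x t" by auto
          ultimately show ?thesis using B(2) \<mu>0 by (simp add: ennreal_minus)
        qed
        have "admissible (v - \<mu>) c2" unfolding admissible_def using eO P2 by (intro bexI[of _ "B - gball x t"]) auto
        hence prof: "c0 \<le> c2 + 2 * \<mu> * c0 / v"
          using \<mu>\<epsilon> \<epsilon>(5) by (intro profile_increment[OF adm min \<mu>0]) auto
        define L where "L = (m k - m (Suc k)) / (s k - s (Suc k))"
        have L: "L \<le> 4 * 2 ^ k * m k"
        proof -
          have "L = 4 * 2 ^ k * (m k - m (Suc k))" unfolding L_def s(4) by (simp add: power_one_over field_simps)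
          also have "\<dots> \<le> 4 * 2 ^ k * m k" using M0 by (intro mult_left_mono) (auto simp: m_def)
          finally show ?thesis .
        qed
        have c1: "c1 \<le> D * L + 2 * \<mu> * c0 / v" using c12 prof by (simp add: L_def)
        have "\<mu> \<le> C * c1 * \<mu> powr e"
          unfolding \<mu>_def M_def
        proof (rule iso[OF _ _ P1])
          show "measure lborel (B \<inter> gball x t) \<le> b0" using \<mu>\<epsilon> \<epsilon>(3) by (simp add: \<mu>_def M_def)
          show "emeasure lborel (B \<inter> gball x t) < \<infinity>" using fm[OF gball_measurable[of x t]] by (auto simp: fmeasurable_def)
        qed measurable
        also have "\<dots> \<le> C * (D * L + 2 * \<mu> * c0 / v) * \<mu> powr e"
          using c1 C by (intro mult_right_mono mult_left_mono) auto
        also have "\<dots> = C * D * L * \<mu> powr e + (C * (2 * c0 / v) * \<mu> powr e) * \<mu>" by (simp add: algebra_simps)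
        also have "\<dots> \<le> C * D * L * \<mu> powr e + (1/2) * \<mu>"
        proof -
          have "\<mu> powr e \<le> \<mu>1 powr e" using \<mu>\<epsilon> \<epsilon>(4) \<mu>0 e by (intro powr_mono2) auto
          hence "C * (2 * c0 / v) * \<mu> powr e \<le> C * (2 * c0 / v) * \<mu>1 powr e" using C c0 v by (intro mult_left_mono) auto
          hence "C * (2 * c0 / v) * \<mu> powr e \<le> 1/2" using \<mu>1e by linarith
          thus ?thesis using \<mu>0 by (intro add_left_mono mult_right_mono) auto
        qed
        finally have "\<mu> \<le> 2 * (C * D * L * \<mu> powr e)" by simp
        also have "\<dots> \<le> 2 * (C * D * (4 * 2 ^ k * m k) * m k powr e)"
        proof -
          have "C * D * L \<le> C * D * (4 * 2 ^ k * m k)" using L C D by (intro mult_left_mono) auto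
          moreover have "\<mu> powr e \<le> m k powr e" using \<mu> e by (intro powr_mono2) auto
          moreover have "0 \<le> C * D * (4 * 2 ^ k * m k)" using C D \<mu> by (intro mult_nonneg_nonneg) auto
          ultimately have "(C * D * L) * \<mu> powr e \<le> (C * D * (4 * 2 ^ k * m k)) * m k powr e" by (rule mult_mono) simp
          thus ?thesis by linarith
        qed
        also have "\<dots> = Q * 2 ^ k * m k powr (1 + e)"
          using \<mu>0 \<mu>(2) by (simp add: Q_def powr_add)
        finally show ?thesis using \<mu>(1) by simp
      qed
    qed
    moreover have "M (1/2) \<le> m k" for k
      unfolding m_def by (rule M_mono) (simp add: s_def)
    ultimately have "M (1/2) \<le> 0" by (intro LIMSEQ_le_const[of m]) auto
    thus "measure lborel (B \<inter> gball x (1/2)) = 0" using M0[of "1/2"] unfolding M_def by (rule antisym)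
  qed
qed

section \<open>Passage to Borel sets\<close>

lemma borel_representative:
  assumes "E \<in> sets lebesgue"
  obtains B where "B \<in> sets borel" "AE p in lebesgue. p \<in> E \<longleftrightarrow> p \<in> B"
proof -
  obtain N where B: "main_part lborel E \<in> sets lborel" "E = main_part lborel E \<union> null_part lborel E" and N: "N \<in> null_sets lborel" "null_part lborel E \<subseteq> N"
    using main_part_sets[OF assms] main_part_null_part_Un[OF assms] null_part[OF assms] by metis
  have "AE p in lebesgue. p \<notin> N" using N by (intro AE_not_in) (simp add: null_sets_completionI)
  hence "AE p in lebesgue. p \<in> E \<longleftrightarrow> p \<in> main_part lborel E"
    by eventually_elim (use B(2) N(2) in blast)
  thus ?thesis using that B by auto
qed

lemma lebesgue_integral_hdiv_eq_pair:
  assumes B: "B \<in> sets borel" and E: "E \<in> sets lebesgue" and ae: "AE p in lebesgue. p \<in> E \<longleftrightarrow> p \<in> B" and u: "u \<in> T"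
  shows "(LINT p:E|lebesgue. hdiv u p) = pair (indicator B) u"
proof -
  have m: "hdiv u \<in> borel_measurable borel" by (rule borel_measurable_continuous_onI[OF continuous_hdiv[OF T_D(1)[OF u]]])
  have mb: "(\<lambda>p. indicator B p * hdiv u p) \<in> borel_measurable lborel" using m B by simp
  have mL: "hdiv u \<in> borel_measurable lebesgue" using m by (simp add: measurable_completion)
  have "(LINT p:E|lebesgue. hdiv u p) = (\<integral>p. indicator B p * hdiv u p \<partial>lebesgue)"
    unfolding set_lebesgue_integral_def
  proof (rule integral_cong_AE)
    show "(\<lambda>p. indicator E p *\<^sub>R hdiv u p) \<in> borel_measurable lebesgue" using mL E by simp
    show "(\<lambda>p. indicator B p * hdiv u p) \<in> borel_measurable lebesgue" using mb by (rule measurable_completion)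
    show "AE p in lebesgue. indicator E p *\<^sub>R hdiv u p = indicator B p * hdiv u p"
      using ae by eventually_elim (auto simp: indicator_def)
  qed
  also have "\<dots> = (\<integral>p. indicator B p * hdiv u p \<partial>lborel)" using mb by (rule integral_completion)
  finally show ?thesis by (simp add: pair_def)
qed

lemma perimeter_le_iff:
  assumes "B \<in> sets borel" "E \<in> sets lebesgue" "AE p in lebesgue. p \<in> E \<longleftrightarrow> p \<in> B"
  shows "perimeter gmul ginv X g K E \<le> ereal c \<longleftrightarrow> perim_le B c"
  unfolding perimeter_eq_hdiv perim_le_def SUP_le_iff
  using lebesgue_integral_hdiv_eq_pair[OF assms] by auto

lemma perimeter_nonneg: "0 \<le> perimeter gmul ginv X g K E"
proof -
  have "ereal (LINT p:E|lebesgue. hdiv (\<lambda>p. 0) p) = 0" by (simp add: hdiv_const set_lebesgue_integral_def)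
  thus ?thesis unfolding perimeter_eq_hdiv using SUP_upper[OF zero_in_T, of "\<lambda>u. ereal (LINT p:E|lebesgue. hdiv u p)"] by metis
qed

lemma emeasure_AE_eq:
  assumes B: "B \<in> sets borel" and E: "E \<in> sets lebesgue" and ae: "AE p in lebesgue. p \<in> E \<longleftrightarrow> p \<in> B"
  shows "emeasure lebesgue E = emeasure lborel B"
proof -
  have "emeasure lebesgue E = emeasure lebesgue B" using ae E B by (intro emeasure_eq_AE) auto
  thus ?thesis using B by simp
qed

section \<open>Boundedness of isoperimetric regions\<close>

text \<open>
  Every point of \<open>E\<close> has density at least \<open>\<epsilon>\<close> in its ball:
  otherwise \<open>B\<close> would be negligible in a smaller ball, while \<open>E\<close> has full
  measure near the point. Balls around points that are far apart are disjoint, so an unbounded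
  \<open>E\<close> would have infinite volume.
\<close>

lemma isoperimetric_region_bounded:
  assumes v: "0 < v" and iso: "isoperimetric_region gmul ginv X g K v E" and E1: "E = measure_interior gmul ginv X E"
  shows "bounded E"
proof (rule ccontr)
  assume unb: "\<not> bounded E"
  have E: "E \<in> sets lebesgue" "perimeter gmul ginv X g K E < \<infinity>" "emeasure lebesgue E = ennreal v"
    "perimeter gmul ginv X g K E = isoperimetric_profile gmul ginv X g K v"
    using iso by (auto simp: isoperimetric_region_def finite_perimeter_def)
  obtain B where B: "B \<in> sets borel" and ae: "AE p in lebesgue. p \<in> E \<longleftrightarrow> p \<in> B" using borel_representative[OF E(1)] by blast
  have [measurable]: "B \<in> sets borel" by (rule B)
  have eB: "emeasure lborel B = ennreal v" using emeasure_AE_eq[OF B E(1) ae] E(3) by simp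
  obtain c0 where c0: "perimeter gmul ginv X g K E = ereal c0"
    using E(2) perimeter_nonneg[of E] by (cases "perimeter gmul ginv X g K E") auto
  have PB: "perim_le B c0" using perimeter_le_iff[OF B E(1) ae, of c0] c0 by simp
  have min: "c0 \<le> c" if adm: "admissible v c" for c
  proof -
    obtain F where F: "F \<in> sets borel" "emeasure lborel F = ennreal v" "perim_le F c" using adm unfolding admissible_def by blast
    have FL: "F \<in> sets lebesgue" using F(1) by simp
    have PF: "perimeter gmul ginv X g K F \<le> ereal c" using perimeter_le_iff[OF F(1) FL, of c] F(3) by simp
    have "finite_perimeter gmul ginv X g K F" unfolding finite_perimeter_def using FL PF by (auto intro: le_less_trans)
    hence "isoperimetric_profile gmul ginv X g K v \<le> perimeter gmul ginv X g K F"
      unfolding isoperimetric_profile_def using F by (intro Inf_lower) auto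
    hence "ereal c0 \<le> ereal c" using PF E(4) c0 by (metis order_trans)
    thus ?thesis by simp
  qed
  obtain \<epsilon> where \<epsilon>: "\<epsilon> > 0" "\<And>x. measure lborel (B \<inter> gball x 1) \<le> \<epsilon> \<Longrightarrow> measure lborel (B \<inter> gball x (1/2)) = 0"
    using density_estimate[OF B eB PB v min] by blast
  have fm: "B \<inter> A \<in> fmeasurable lborel" if "A \<in> sets borel" for A
    using emeasure_mono[of "B \<inter> A" B lborel] B eB that by (intro fmeasurableI) (auto intro: le_less_trans)
  have dens: "measure lborel (B \<inter> gball x 1) > \<epsilon>" if x: "x \<in> E" for x
  proof (rule ccontr)
    assume "\<not> ?thesis"
    hence z: "measure lborel (B \<inter> gball x (1/2)) = 0" using \<epsilon>(2) by simp
    have zn: "B \<inter> gball x (1/2) \<in> null_sets lborel"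
      using emeasure_eq_measure2[OF fm[OF gball_measurable[of x "1/2"]]] z by (auto simp: null_sets_def)
    obtain \<rho> where \<rho>: "\<rho> > 0" "cc_ball gmul ginv X x \<rho> - E \<in> null_sets lebesgue"
      using x E1 by (auto simp: measure_interior_def)
    obtain d where d: "d > 0" "\<And>p h. norm h < d \<Longrightarrow> p \<odot> h \<in> cc_ball gmul ginv X p \<rho>" using cc_ball_neighbourhood[OF \<rho>(1)] by blast
    define A where "A = {p. - x \<odot> p \<in> ball 0 (min d (1/2))}"
    have "AE p in lebesgue. p \<notin> A"
    proof -
      have "AE p in lebesgue. p \<notin> cc_ball gmul ginv X x \<rho> - E" using \<rho>(2) by (rule AE_not_in)
      moreover have "AE p in lebesgue. p \<notin> B \<inter> gball x (1/2)"
        using zn by (intro AE_not_in) (simp add: null_sets_completionI)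
      ultimately show ?thesis using ae
      proof eventually_elim
        case (elim p)
        show ?case
        proof
          assume p: "p \<in> A"
          have n: "norm (- x \<odot> p) < d" "norm (- x \<odot> p) < 1/2" using p by (auto simp: A_def)
          from d(2)[OF n(1), of x] have "p \<in> cc_ball gmul ginv X x \<rho>" by simp
          moreover have "p \<in> gball x (1/2)"
          proof -
            have "(norm (- x \<odot> p))\<^sup>2 \<le> (1/2)\<^sup>2" using n(2) by (intro power_mono) auto
            thus ?thesis by (simp add: gball_def power2_norm_eq_inner[symmetric] power2_eq_square)
          qed
          ultimately show False using elim by blast
        qed
      qed
    qed
    moreover have Am: "A \<in> sets borel" 
    proof -
      have "open A" unfolding A_def ball_def mem_Collect_eq
        by (intro open_Collect_less continuous_intros continuous_on_dist continuous_on_gmul)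
      thus ?thesis by (rule borel_open)
    qed
    ultimately have "A \<in> null_sets lebesgue" using AE_iff_null_sets[of A lebesgue] by simp
    hence "emeasure lborel A = 0" using Am by (auto simp: null_sets_def)
    moreover have "emeasure lborel A = emeasure lborel (ball (0 :: (real, 'n) vec) (min d (1/2)))"
      unfolding A_def by (rule emeasure_left) simp
    moreover have "measure lborel (ball (0 :: (real, 'n) vec) (min d (1/2))) > 0"
      using d(1) by (intro content_ball_pos) auto
    ultimately show False by (simp add: measure_def)
  qed
  have pack: "\<exists>F\<subseteq>E. finite F \<and> card F = n \<and> disjoint_family_on (\<lambda>x. gball x 1) F" for n
  proof (induction n)
    case 0
    show ?case by (intro exI[of _ "{}"]) (auto simp: disjoint_family_on_def)
  next
    case (Suc n)
    obtain F where F: "F \<subseteq> E" "finite F" "card F = n" "disjoint_family_on (\<lambda>x. gball x 1) F" using Suc.IH by blast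
    \<comment> \<open>balls around \<open>y\<close> and \<open>x\<close> can only meet if \<open>x\<close> lies in \<open>y \<odot> Y \<odot> - Y\<close>, a bounded set\<close>
    define Y where "Y = {y :: (real, 'n) vec. y \<bullet> y \<le> 1}"
    have Yb: "bounded Y" by (auto simp: Y_def bounded_iff norm_eq_sqrt_inner intro!: exI[of _ 1])
    have "bounded (uminus ` Y)" using Yb by simp
    then obtain S where S: "\<And>a b. a \<in> Y \<Longrightarrow> b \<in> uminus ` Y \<Longrightarrow> norm (a \<odot> b) \<le> S" using bounded_gmul[OF Yb] by blast
    obtain S' where S': "\<And>a b. a \<in> F \<Longrightarrow> b \<in> cball 0 S \<Longrightarrow> norm (a \<odot> b) \<le> S'"
      using bounded_gmul[OF finite_imp_bounded[OF F(2)], of "cball 0 S"] by auto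
    obtain x where x: "x \<in> E" "norm x > S'" using unb unfolding bounded_iff by (meson not_le)
    have disj: "gball y 1 \<inter> gball x 1 = {}" if y: "y \<in> F" for y
    proof (rule ccontr)
      assume "gball y 1 \<inter> gball x 1 \<noteq> {}"
      then obtain p where p: "p \<in> gball y 1" "p \<in> gball x 1" by blast
      have "(- y \<odot> p) \<odot> - (- x \<odot> p) \<in> cball 0 S" using S[of "- y \<odot> p" "- (- x \<odot> p)"] p by (auto simp: Y_def gball_def)
      hence "norm (y \<odot> ((- y \<odot> p) \<odot> - (- x \<odot> p))) \<le> S'" by (rule S'[OF y])
      moreover have "y \<odot> ((- y \<odot> p) \<odot> - (- x \<odot> p)) = x"
        by (simp add: minus_gmul gmul_assoc)
      ultimately show False using x(2) by simp
    qed
    have "x \<notin> F"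
    proof
      assume "x \<in> F"
      hence "gball x 1 = {}" using disj by blast
      moreover have "x \<in> gball x 1" by (simp add: gball_def)
      ultimately show False by blast
    qed
    hence "card (insert x F) = Suc n" using F by simp
    moreover have "disjoint_family_on (\<lambda>x. gball x 1) (insert x F)"
      using F(4) disj unfolding disjoint_family_on_def by blast
    ultimately show ?case using F x by (intro exI[of _ "insert x F"]) auto
  qed
  obtain n :: nat where n: "v / \<epsilon> < real n" using reals_Archimedean2 by blast
  obtain F where F: "F \<subseteq> E" "finite F" "card F = n" "disjoint_family_on (\<lambda>x. gball x 1) F" using pack by blast
  have "real n * \<epsilon> = (\<Sum>x\<in>F. \<epsilon>)" using F(3) by simp
  also have "\<dots> \<le> (\<Sum>x\<in>F. measure lborel (B \<inter> gball x 1))" using dens F(1) by (intro sum_mono) (auto intro: less_imp_le)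
  also have "\<dots> = measure lborel (\<Union>x\<in>F. B \<inter> gball x 1)"
    using F fm[OF gball_measurable]
    by (intro measure_finite_Union[symmetric]) (auto simp: disjoint_family_on_def fmeasurable_def top_unique less_top)
  also have "\<dots> \<le> measure lborel B"
  proof (rule measure_mono_fmeasurable)
    show "B \<in> fmeasurable lborel" using B eB by (intro fmeasurableI) auto
    show "(\<Union>x\<in>F. B \<inter> gball x 1) \<in> sets lborel" using F(2) by (intro sets.finite_UN) auto
  qed auto
  also have "\<dots> = v" using eB v by (simp add: measure_def)
  finally have "real n * \<epsilon> \<le> v" .
  moreover have "v < real n * \<epsilon>" using n \<epsilon>(1) by (simp add: pos_divide_less_eq)
  ultimately show False by simp
qed

end

theorem theorem3p11:
  fixes gmul :: "real ^ 'n::{finite,linorder} \<Rightarrow> real ^ 'n::{finite,linorder} \<Rightarrow> real ^ 'n::{finite,linorder}"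
    and ginv :: "real ^ 'n::{finite,linorder} \<Rightarrow> real ^ 'n::{finite,linorder}"
    and r :: nat
    and X :: "(real ^ 'n::{finite,linorder}) set"
    and g :: "real ^ 'n::{finite,linorder} \<Rightarrow> real ^ 'n::{finite,linorder} \<Rightarrow> real"
    and V :: "(real ^ 'n::{finite,linorder}) set"
    and K :: "(real ^ 'n::{finite,linorder}) set"
    and v :: real
    and E :: "(real ^ 'n::{finite,linorder}) set"
  assumes "sub_finsler_nilpotent_group gmul ginv r X g V K"
    and "0 < v"
    and "isoperimetric_region gmul ginv X g K v E"
    and "E = measure_interior gmul ginv X E"
  shows "bounded E"
  using sub_finsler_nilpotent_group.isoperimetric_region_bounded[OF assms] .

end
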